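(* Let $\Lambda=kQ/\langle\rho\rangle$ be a quotient of a path algebra, where $k$ is a field, $Q$ is a quiver, and $\rho$ is a minimal set of relations in $kQ$ generating an admissible ideal $\langle\rho\rangle$. Choose some vertices in $Q$ where no relations start, and let $a$ be the sum of all vertices except these. Then the functor $\operatorname{mod}\Lambda\to\operatorname{mod}a\Lambda a$, $M\mapsto aM$, induces a singular equivalence between $\Lambda$ and $a\Lambda a$: $$\mathsf D_{\mathsf{sg}}(a-)\colon\mathsf D_{\mathsf{sg}}(\operatorname{mod}\Lambda)\xrightarrow{\ \simeq\ }\mathsf D_{\mathsf{sg}}(\operatorname{mod}a\Lambda a).$$
   Context: $Q$ is a finite quiver; modules are finitely generated left modules and paths are composed from right to left, so that the indecomposable projective module at a vertex $v$ is $\Lambda e_v$, spanned by classes of paths starting at $v$. Vertices are identified with the corresponding trivial-path idempotents, so $a$ is an idempotent of $\Lambda$. A relation is a linear combination of paths with a common start vertex and a common end vertex; a relation starts (ends) at that common start (end) vertex, and "no relations start in $v$" means no element of $\rho$ starts at $v$. Minimal means that no proper subset of $\rho$ generates $\langle\rho\rangle$. The singularity category is the Verdier quotient $\mathsf D_{\mathsf{sg}}(\operatorname{mod}\Lambda)=\mathsf D^{\mathsf b}(\operatorname{mod}\Lambda)/\mathsf K^{\mathsf b}(\operatorname{proj}\Lambda)$. An exact functor induces a singular equivalence if its derived functor sends bounded complexes of projectives to objects isomorphic to bounded complexes of projectives and the induced functor between singularity categories is a triangle equivalence. *)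

theory Defs
  imports
    "HOL-Algebra.QuotRing"
    "HOL-Algebra.Module"
    "HOL-Algebra.Ideal_Product"
    "HOL-Library.Nat_Bijection"
    "Graph_Theory.Arc_Walk"
begin

section \<open>Path algebras and admissible relations\<close>

text \<open>A finite quiver is a \<^locale>\<open>fin_digraph\<close>; loops and parallel arrows are allowed.
  A path is its start vertex together with its arrows in the order in which they are
  traversed; \<open>(v, [])\<close> is the trivial path at \<open>v\<close>.\<close>

type_synonym ('v, 'e) qpath = "'v \<times> 'e list"

definition path_end :: "('v, 'e) pre_digraph \<Rightarrow> ('v, 'e) qpath \<Rightarrow> 'v" where
  "path_end Q p = pre_digraph.awlast Q (fst p) (snd p)"

definition paths :: "('v, 'e) pre_digraph \<Rightarrow> ('v, 'e) qpath set" where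
  "paths Q = {p. pre_digraph.awalk Q (fst p) (snd p) (path_end Q p)}"

text \<open>Paths compose from right to left, so the coefficient of a path \<open>p\<close> in \<open>x y\<close> is the
  sum, over all ways to cut \<open>p\<close> in two, of the coefficient in \<open>y\<close> of the piece that is
  traversed first times the coefficient in \<open>x\<close> of the piece that is traversed second.\<close>

definition path_algebra :: "('v, 'e) pre_digraph \<Rightarrow> (('v, 'e) qpath \<Rightarrow> 'k::field) ring" where
  "path_algebra Q =
    \<lparr>carrier = {x. finite {p. x p \<noteq> 0} \<and> {p. x p \<noteq> 0} \<subseteq> paths Q},
     mult = (\<lambda>x y (u, es). \<Sum>i\<le>length es.
       x (path_end Q (u, take i es), drop i es) * y (u, take i es)),
     one = (\<lambda>(u, es). if u \<in> verts Q \<and> es = [] then 1 else 0),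
     zero = (\<lambda>_. 0),
     add = (\<lambda>x y p. x p + y p)\<rparr>"

definition single_path :: "('v, 'e) qpath \<Rightarrow> ('v, 'e) qpath \<Rightarrow> 'k::field" where
  "single_path p = (\<lambda>q. if q = p then 1 else 0)"

definition relation_from_to ::
  "('v, 'e) pre_digraph \<Rightarrow> 'v \<Rightarrow> 'v \<Rightarrow> (('v, 'e) qpath \<Rightarrow> 'k::field) \<Rightarrow> bool" where
  "relation_from_to Q u v x \<longleftrightarrow> x \<in> carrier (path_algebra Q) \<and> u \<in> verts Q \<and> v \<in> verts Q \<and>
    (\<forall>p. x p \<noteq> 0 \<longrightarrow> fst p = u \<and> path_end Q p = v)"

definition is_relation ::
  "('v, 'e) pre_digraph \<Rightarrow> (('v, 'e) qpath \<Rightarrow> 'k::field) \<Rightarrow> bool" where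
  "is_relation Q x \<longleftrightarrow> (\<exists>u v. relation_from_to Q u v x)"

text \<open>The zero element starts at every vertex under this definition, but it never belongs
  to a minimal generating set.\<close>

definition starts_at ::
  "('v, 'e) pre_digraph \<Rightarrow> (('v, 'e) qpath \<Rightarrow> 'k::field) \<Rightarrow> 'v \<Rightarrow> bool" where
  "starts_at Q x u \<longleftrightarrow> (\<exists>v. relation_from_to Q u v x)"

definition minimal_relations ::
  "('v, 'e) pre_digraph \<Rightarrow> (('v, 'e) qpath \<Rightarrow> 'k::field) set \<Rightarrow> bool" where
  "minimal_relations Q \<rho> \<longleftrightarrow> (\<forall>x\<in>\<rho>. is_relation Q x) \<and>
    (\<forall>\<sigma>. \<sigma> \<subset> \<rho> \<longrightarrow> genideal (path_algebra Q) \<sigma> \<noteq> genideal (path_algebra Q) \<rho>)"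

definition arrow_ideal :: "('v, 'e) pre_digraph \<Rightarrow> (('v, 'e) qpath \<Rightarrow> 'k::field) set" where
  "arrow_ideal Q = genideal (path_algebra Q) ((\<lambda>e. single_path (tail Q e, [e])) ` arcs Q)"

definition admissible ::
  "('v, 'e) pre_digraph \<Rightarrow> (('v, 'e) qpath \<Rightarrow> 'k::field) set \<Rightarrow> bool" where
  "admissible Q I \<longleftrightarrow> ideal I (path_algebra Q) \<and>
    I \<subseteq> arrow_ideal Q [^]\<^bsub>ideals_set (path_algebra Q)\<^esub> (2::nat) \<and>
    (\<exists>m::nat\<ge>2. arrow_ideal Q [^]\<^bsub>ideals_set (path_algebra Q)\<^esub> m \<subseteq> I)"

definition bound_quiver_algebra ::
  "('v, 'e) pre_digraph \<Rightarrow> (('v, 'e) qpath \<Rightarrow> 'k::field) set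
    \<Rightarrow> (('v, 'e) qpath \<Rightarrow> 'k) set ring" where
  "bound_quiver_algebra Q \<rho> = path_algebra Q Quot genideal (path_algebra Q) \<rho>"

definition vertex_sum ::
  "('v, 'e) pre_digraph \<Rightarrow> (('v, 'e) qpath \<Rightarrow> 'k::field) set \<Rightarrow> 'v set
    \<Rightarrow> (('v, 'e) qpath \<Rightarrow> 'k) set" where
  "vertex_sum Q \<rho> V = (\<Oplus>\<^bsub>bound_quiver_algebra Q \<rho>\<^esub> v\<in>V.
     genideal (path_algebra Q) \<rho> +>\<^bsub>path_algebra Q\<^esub> single_path (v, []))"

definition corner_ring :: "'r ring \<Rightarrow> 'r \<Rightarrow> 'r ring" where
  "corner_ring R a = R\<lparr>carrier := (\<lambda>x. a \<otimes>\<^bsub>R\<^esub> x \<otimes>\<^bsub>R\<^esub> a) ` carrier R, one := a\<rparr>"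


section \<open>Categories with shift and triangles, as raw data\<close>

text \<open>Hom-sets need not be disjoint: composition takes its three objects as arguments, and
  \<open>Comp C X Y Z g f\<close> is \<open>g \<circ> f\<close> for \<open>f : X \<rightarrow> Y\<close> and \<open>g : Y \<rightarrow> Z\<close>. The additive structure
  is not recorded, because it is determined by the underlying category.\<close>

record ('o, 'm) category =
  Ob :: "'o set"
  Hom :: "'o \<Rightarrow> 'o \<Rightarrow> 'm set"
  Ident :: "'o \<Rightarrow> 'm"
  Comp :: "'o \<Rightarrow> 'o \<Rightarrow> 'o \<Rightarrow> 'm \<Rightarrow> 'm \<Rightarrow> 'm"

record ('o, 'm) shift_category = "('o, 'm) category" +
  Shift :: "'o \<Rightarrow> 'o"
  ShiftMor :: "'o \<Rightarrow> 'o \<Rightarrow> 'm \<Rightarrow> 'm"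

type_synonym ('o, 'm) tri = "'o \<times> 'o \<times> 'o \<times> 'm \<times> 'm \<times> 'm"

record ('o, 'm) tri_category = "('o, 'm) shift_category" +
  Dist :: "('o, 'm) tri set"

definition is_iso :: "('o, 'm, 'z) category_scheme \<Rightarrow> 'o \<Rightarrow> 'o \<Rightarrow> 'm \<Rightarrow> bool" where
  "is_iso C X Y f \<longleftrightarrow> f \<in> Hom C X Y \<and>
    (\<exists>g\<in>Hom C Y X. Comp C X Y X g f = Ident C X \<and> Comp C Y X Y f g = Ident C Y)"

definition is_triangle :: "('o, 'm, 'z) shift_category_scheme \<Rightarrow> ('o, 'm) tri \<Rightarrow> bool" where
  "is_triangle C = (\<lambda>(X, Y, Z, u, v, w). X \<in> Ob C \<and> Y \<in> Ob C \<and> Z \<in> Ob C \<and>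
    u \<in> Hom C X Y \<and> v \<in> Hom C Y Z \<and> w \<in> Hom C Z (Shift C X))"

definition triangle_iso ::
  "('o, 'm, 'z) shift_category_scheme \<Rightarrow> ('o, 'm) tri \<Rightarrow> ('o, 'm) tri \<Rightarrow> bool" where
  "triangle_iso C = (\<lambda>(X, Y, Z, u, v, w) (X', Y', Z', u', v', w').
    \<exists>\<alpha> \<beta> \<gamma>. is_iso C X X' \<alpha> \<and> is_iso C Y Y' \<beta> \<and> is_iso C Z Z' \<gamma> \<and>
      Comp C X Y Y' \<beta> u = Comp C X X' Y' u' \<alpha> \<and>
      Comp C Y Z Z' \<gamma> v = Comp C Y Y' Z' v' \<beta> \<and>
      Comp C Z (Shift C X) (Shift C X') (ShiftMor C X X' \<alpha>) w =
        Comp C Z Z' (Shift C X') w' \<gamma>)"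

text \<open>The distinguished triangles are all triangles isomorphic to one of the given ones.\<close>

definition with_triangles ::
  "('o, 'm) shift_category \<Rightarrow> ('o, 'm) tri set \<Rightarrow> ('o, 'm) tri_category" where
  "with_triangles C \<T> =
    \<lparr>Ob = Ob C, Hom = Hom C, Ident = Ident C, Comp = Comp C,
     Shift = Shift C, ShiftMor = ShiftMor C,
     Dist = {t. is_triangle C t \<and> (\<exists>t'\<in>\<T>. triangle_iso C t t')}\<rparr>"

record ('o, 'm, 'p, 'n) func =
  on_ob :: "'o \<Rightarrow> 'p"
  on_mor :: "'o \<Rightarrow> 'o \<Rightarrow> 'm \<Rightarrow> 'n"

definition is_functor ::
  "('o, 'm, 'y) category_scheme \<Rightarrow> ('p, 'n, 'z) category_scheme
    \<Rightarrow> ('o, 'm, 'p, 'n) func \<Rightarrow> bool" where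
  "is_functor C D F \<longleftrightarrow>
    (\<forall>X\<in>Ob C. on_ob F X \<in> Ob D) \<and>
    (\<forall>X\<in>Ob C. \<forall>Y\<in>Ob C. \<forall>f\<in>Hom C X Y. on_mor F X Y f \<in> Hom D (on_ob F X) (on_ob F Y)) \<and>
    (\<forall>X\<in>Ob C. on_mor F X X (Ident C X) = Ident D (on_ob F X)) \<and>
    (\<forall>X\<in>Ob C. \<forall>Y\<in>Ob C. \<forall>Z\<in>Ob C. \<forall>f\<in>Hom C X Y. \<forall>g\<in>Hom C Y Z.
      on_mor F X Z (Comp C X Y Z g f) =
      Comp D (on_ob F X) (on_ob F Y) (on_ob F Z) (on_mor F Y Z g) (on_mor F X Y f))"

definition id_func :: "('o, 'm, 'o, 'm) func" where
  "id_func = \<lparr>on_ob = (\<lambda>X. X), on_mor = (\<lambda>_ _ f. f)\<rparr>"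

definition comp_func ::
  "('p, 'n, 'q, 'l) func \<Rightarrow> ('o, 'm, 'p, 'n) func \<Rightarrow> ('o, 'm, 'q, 'l) func" where
  "comp_func G F = \<lparr>on_ob = (\<lambda>X. on_ob G (on_ob F X)),
     on_mor = (\<lambda>X Y f. on_mor G (on_ob F X) (on_ob F Y) (on_mor F X Y f))\<rparr>"

definition is_nat_iso ::
  "('o, 'm, 'y) category_scheme \<Rightarrow> ('p, 'n, 'z) category_scheme
    \<Rightarrow> ('o, 'm, 'p, 'n) func \<Rightarrow> ('o, 'm, 'p, 'n) func \<Rightarrow> ('o \<Rightarrow> 'n) \<Rightarrow> bool" where
  "is_nat_iso C D F G \<theta> \<longleftrightarrow>
    (\<forall>X\<in>Ob C. is_iso D (on_ob F X) (on_ob G X) (\<theta> X)) \<and>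
    (\<forall>X\<in>Ob C. \<forall>Y\<in>Ob C. \<forall>f\<in>Hom C X Y.
      Comp D (on_ob F X) (on_ob F Y) (on_ob G Y) (\<theta> Y) (on_mor F X Y f) =
      Comp D (on_ob F X) (on_ob G X) (on_ob G Y) (on_mor G X Y f) (\<theta> X))"

definition is_equivalence ::
  "('o, 'm, 'y) category_scheme \<Rightarrow> ('p, 'n, 'z) category_scheme
    \<Rightarrow> ('o, 'm, 'p, 'n) func \<Rightarrow> bool" where
  "is_equivalence C D F \<longleftrightarrow> is_functor C D F \<and>
    (\<exists>G. is_functor D C G \<and>
      (\<exists>\<theta>. is_nat_iso C C (comp_func G F) id_func \<theta>) \<and>
      (\<exists>\<theta>. is_nat_iso D D (comp_func F G) id_func \<theta>))"

definition shift_func :: "('o, 'm, 'z) shift_category_scheme \<Rightarrow> ('o, 'm, 'o, 'm) func" where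
  "shift_func C = \<lparr>on_ob = Shift C, on_mor = ShiftMor C\<rparr>"

text \<open>\<open>\<eta>\<close> is the natural isomorphism \<open>F(X[1]) \<cong> (F X)[1]\<close> that is part of a triangle functor.\<close>

definition is_triangle_functor ::
  "('o, 'm) tri_category \<Rightarrow> ('p, 'n) tri_category
    \<Rightarrow> ('o, 'm, 'p, 'n) func \<Rightarrow> ('o \<Rightarrow> 'n) \<Rightarrow> bool" where
  "is_triangle_functor S T F \<eta> \<longleftrightarrow> is_functor S T F \<and>
    is_nat_iso S T (comp_func F (shift_func S)) (comp_func (shift_func T) F) \<eta> \<and>
    (\<forall>(X, Y, Z, u, v, w) \<in> Dist S.
      (on_ob F X, on_ob F Y, on_ob F Z, on_mor F X Y u, on_mor F Y Z v,
       Comp T (on_ob F Z) (on_ob F (Shift S X)) (Shift T (on_ob F X))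
         (\<eta> X) (on_mor F Z (Shift S X) w)) \<in> Dist T)"

definition is_triangle_equivalence ::
  "('o, 'm) tri_category \<Rightarrow> ('p, 'n) tri_category
    \<Rightarrow> ('o, 'm, 'p, 'n) func \<Rightarrow> ('o \<Rightarrow> 'n) \<Rightarrow> bool" where
  "is_triangle_equivalence S T F \<eta> \<longleftrightarrow> is_triangle_functor S T F \<eta> \<and> is_equivalence S T F"


section \<open>Verdier quotients\<close>

text \<open>The denominators are the morphisms whose cone is isomorphic to an object of \<open>N\<close>. As
  distinguished triangles are closed under isomorphism, \<open>N\<close> itself need not be: the
  quotient is by the closure of \<open>N\<close> under isomorphism.\<close>

definition denominators :: "('o, 'm) tri_category \<Rightarrow> 'o set \<Rightarrow> 'o \<Rightarrow> 'o \<Rightarrow> 'm set" where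
  "denominators T N X Y = {s. \<exists>Z\<in>N. \<exists>v w. (X, Y, Z, s, v, w) \<in> Dist T}"

text \<open>\<open>(Z, s, f)\<close> stands for the fraction \<open>f s\<^sup>-\<^sup>1\<close>, i.e. the roof \<open>X \<leftarrow> Z \<rightarrow> Y\<close> with denominator
  \<open>s : Z \<rightarrow> X\<close> and numerator \<open>f : Z \<rightarrow> Y\<close>.\<close>

type_synonym ('o, 'm) fraction = "'o \<times> 'm \<times> 'm"

definition roofs ::
  "('o, 'm) tri_category \<Rightarrow> 'o set \<Rightarrow> 'o \<Rightarrow> 'o \<Rightarrow> ('o, 'm) fraction set" where
  "roofs T N X Y = {(Z, s, f). Z \<in> Ob T \<and> s \<in> denominators T N Z X \<and> f \<in> Hom T Z Y}"

definition roof_equiv ::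
  "('o, 'm) tri_category \<Rightarrow> 'o set \<Rightarrow> 'o \<Rightarrow> 'o
    \<Rightarrow> ('o, 'm) fraction \<Rightarrow> ('o, 'm) fraction \<Rightarrow> bool" where
  "roof_equiv T N X Y = (\<lambda>(Z, s, f) (Z', s', f').
    \<exists>W\<in>Ob T. \<exists>p\<in>Hom T W Z. \<exists>q\<in>Hom T W Z'.
      Comp T W Z X s p = Comp T W Z' X s' q \<and>
      Comp T W Z X s p \<in> denominators T N W X \<and>
      Comp T W Z Y f p = Comp T W Z' Y f' q)"

definition roof_class ::
  "('o, 'm) tri_category \<Rightarrow> 'o set \<Rightarrow> 'o \<Rightarrow> 'o
    \<Rightarrow> ('o, 'm) fraction \<Rightarrow> ('o, 'm) fraction set" where
  "roof_class T N X Y r = {r' \<in> roofs T N X Y. roof_equiv T N X Y r r'}"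

text \<open>\<open>roof_comp T N X Y Z r r' t\<close>: the roof \<open>t\<close> from \<open>X\<close> to \<open>Z\<close> is a composite of the roof \<open>r\<close>
  from \<open>X\<close> to \<open>Y\<close> with the roof \<open>r'\<close> from \<open>Y\<close> to \<open>Z\<close>, formed by completing the middle
  of the zigzag to a commutative square.\<close>

definition roof_comp ::
  "('o, 'm) tri_category \<Rightarrow> 'o set \<Rightarrow> 'o \<Rightarrow> 'o \<Rightarrow> 'o
    \<Rightarrow> ('o, 'm) fraction \<Rightarrow> ('o, 'm) fraction \<Rightarrow> ('o, 'm) fraction \<Rightarrow> bool" where
  "roof_comp T N X Y Z = (\<lambda>(U, s, f) (V, t, g) (W, s'', g'').
    W \<in> Ob T \<and>
    (\<exists>t' \<in> denominators T N W U. \<exists>f' \<in> Hom T W V.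
      Comp T W U Y f t' = Comp T W V Y t f' \<and>
      s'' = Comp T W U X s t' \<and> g'' = Comp T W V Z g f'))"

definition verdier_base ::
  "('o, 'm) tri_category \<Rightarrow> 'o set \<Rightarrow> ('o, ('o, 'm) fraction set) shift_category" where
  "verdier_base T N =
    \<lparr>Ob = Ob T,
     Hom = (\<lambda>X Y. roof_class T N X Y ` roofs T N X Y),
     Ident = (\<lambda>X. roof_class T N X X (X, Ident T X, Ident T X)),
     Comp = (\<lambda>X Y Z c' c. {t' \<in> roofs T N X Z.
       \<exists>r\<in>c. \<exists>r'\<in>c'. \<exists>t. roof_comp T N X Y Z r r' t \<and> roof_equiv T N X Z t t'}),
     Shift = Shift T,
     ShiftMor = (\<lambda>X Y c. {r' \<in> roofs T N (Shift T X) (Shift T Y).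
       \<exists>(Z, s, f) \<in> c. roof_equiv T N (Shift T X) (Shift T Y)
         (Shift T Z, ShiftMor T Z X s, ShiftMor T Z Y f) r'})\<rparr>"

definition quotient_mor ::
  "('o, 'm) tri_category \<Rightarrow> 'o set \<Rightarrow> 'o \<Rightarrow> 'o \<Rightarrow> 'm \<Rightarrow> ('o, 'm) fraction set" where
  "quotient_mor T N X Y f = roof_class T N X Y (X, Ident T X, f)"

definition verdier_quotient ::
  "('o, 'm) tri_category \<Rightarrow> 'o set \<Rightarrow> ('o, ('o, 'm) fraction set) tri_category" where
  "verdier_quotient T N = with_triangles (verdier_base T N)
    {(X, Y, Z, quotient_mor T N X Y u, quotient_mor T N Y Z v,
      quotient_mor T N Z (Shift T X) w) | X Y Z u v w. (X, Y, Z, u, v, w) \<in> Dist T}"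

text \<open>Here \<open>T\<close> and \<open>N\<close> belong to the target of \<open>F\<close>. The class of a roof is sent to the class of
  the roof that consists of the images of its two legs.\<close>

definition verdier_func ::
  "('p, 'n) tri_category \<Rightarrow> 'p set \<Rightarrow> ('o, 'm, 'p, 'n) func
    \<Rightarrow> ('o, ('o, 'm) fraction set, 'p, ('p, 'n) fraction set) func" where
  "verdier_func T N F =
    \<lparr>on_ob = on_ob F,
     on_mor = (\<lambda>X Y c. {r' \<in> roofs T N (on_ob F X) (on_ob F Y).
       \<exists>(Z, s, f) \<in> c. roof_equiv T N (on_ob F X) (on_ob F Y)
         (on_ob F Z, on_mor F Z X s, on_mor F Z Y f) r'})\<rparr>"


section \<open>Finitely generated left modules\<close>

text \<open>The library's locale \<^locale>\<open>module\<close> insists on a commutative ring.\<close>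

locale left_module = R?: ring R + M?: abelian_group M
  for R (structure) and M (structure) +
  assumes smult_closed: "\<lbrakk>a \<in> carrier R; x \<in> carrier M\<rbrakk> \<Longrightarrow> a \<odot>\<^bsub>M\<^esub> x \<in> carrier M"
    and smult_l_distr: "\<lbrakk>a \<in> carrier R; b \<in> carrier R; x \<in> carrier M\<rbrakk> \<Longrightarrow>
      (a \<oplus> b) \<odot>\<^bsub>M\<^esub> x = a \<odot>\<^bsub>M\<^esub> x \<oplus>\<^bsub>M\<^esub> b \<odot>\<^bsub>M\<^esub> x"
    and smult_r_distr: "\<lbrakk>a \<in> carrier R; x \<in> carrier M; y \<in> carrier M\<rbrakk> \<Longrightarrow>
      a \<odot>\<^bsub>M\<^esub> (x \<oplus>\<^bsub>M\<^esub> y) = a \<odot>\<^bsub>M\<^esub> x \<oplus>\<^bsub>M\<^esub> a \<odot>\<^bsub>M\<^esub> y"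
    and smult_assoc1: "\<lbrakk>a \<in> carrier R; b \<in> carrier R; x \<in> carrier M\<rbrakk> \<Longrightarrow>
      (a \<otimes> b) \<odot>\<^bsub>M\<^esub> x = a \<odot>\<^bsub>M\<^esub> (b \<odot>\<^bsub>M\<^esub> x)"
    and smult_one: "x \<in> carrier M \<Longrightarrow> \<one> \<odot>\<^bsub>M\<^esub> x = x"

definition fin_gen :: "'r ring \<Rightarrow> ('r, 'm) module \<Rightarrow> bool" where
  "fin_gen R M \<longleftrightarrow> (\<exists>S. finite S \<and> S \<subseteq> carrier M \<and>
    (\<forall>N. submodule N R M \<and> S \<subseteq> N \<longrightarrow> N = carrier M))"

text \<open>The objects of \<open>mod R\<close> are the finitely generated modules whose carrier is a set of
  sequences in the element type of \<open>R\<close>. No module is lost up to isomorphism: a finitely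
  generated module is a quotient of some \<open>R\<^sup>n\<close>, so picking a preimage of each element
  identifies it with a set of such sequences.\<close>

type_synonym 'r fgmod = "('r, nat \<Rightarrow> 'r) module"
type_synonym 'r modmap = "(nat \<Rightarrow> 'r) \<Rightarrow> (nat \<Rightarrow> 'r)"

definition mod_hom :: "'r ring \<Rightarrow> 'r fgmod \<Rightarrow> 'r fgmod \<Rightarrow> 'r modmap set" where
  "mod_hom R M N = {f \<in> carrier M \<rightarrow>\<^sub>E carrier N.
    (\<forall>x\<in>carrier M. \<forall>y\<in>carrier M. f (x \<oplus>\<^bsub>M\<^esub> y) = f x \<oplus>\<^bsub>N\<^esub> f y) \<and>
    (\<forall>r\<in>carrier R. \<forall>x\<in>carrier M. f (r \<odot>\<^bsub>M\<^esub> x) = r \<odot>\<^bsub>N\<^esub> f x)}"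

definition mod_cat :: "'r ring \<Rightarrow> ('r fgmod, 'r modmap) category" where
  "mod_cat R =
    \<lparr>Ob = {M. left_module R M \<and> fin_gen R M},
     Hom = mod_hom R,
     Ident = (\<lambda>M. \<lambda>x\<in>carrier M. x),
     Comp = (\<lambda>M N P g f. compose (carrier M) g f)\<rparr>"

definition short_exact ::
  "'r ring \<Rightarrow> 'r fgmod \<Rightarrow> 'r fgmod \<Rightarrow> 'r fgmod \<Rightarrow> 'r modmap \<Rightarrow> 'r modmap \<Rightarrow> bool" where
  "short_exact R L M N f g \<longleftrightarrow> f \<in> mod_hom R L M \<and> g \<in> mod_hom R M N \<and>
    inj_on f (carrier L) \<and> f ` carrier L = {x \<in> carrier M. g x = \<zero>\<^bsub>N\<^esub>} \<and>
    g ` carrier M = carrier N"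

type_synonym 'r mod_func = "('r fgmod, 'r modmap, 'r fgmod, 'r modmap) func"

definition exact_functor :: "'r ring \<Rightarrow> 'r ring \<Rightarrow> 'r mod_func \<Rightarrow> bool" where
  "exact_functor R S F \<longleftrightarrow> is_functor (mod_cat R) (mod_cat S) F \<and>
    (\<forall>M\<in>Ob (mod_cat R). \<forall>N\<in>Ob (mod_cat R). \<forall>f\<in>mod_hom R M N. \<forall>g\<in>mod_hom R M N.
      on_mor F M N (\<lambda>x\<in>carrier M. f x \<oplus>\<^bsub>N\<^esub> g x) =
      (\<lambda>x\<in>carrier (on_ob F M). on_mor F M N f x \<oplus>\<^bsub>on_ob F N\<^esub> on_mor F M N g x)) \<and>
    (\<forall>L\<in>Ob (mod_cat R). \<forall>M\<in>Ob (mod_cat R). \<forall>N\<in>Ob (mod_cat R). \<forall>f g.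
      short_exact R L M N f g \<longrightarrow>
      short_exact S (on_ob F L) (on_ob F M) (on_ob F N) (on_mor F L M f) (on_mor F M N g))"

definition is_projective :: "'r ring \<Rightarrow> 'r fgmod \<Rightarrow> bool" where
  "is_projective R P \<longleftrightarrow> P \<in> Ob (mod_cat R) \<and>
    (\<forall>M\<in>Ob (mod_cat R). \<forall>N\<in>Ob (mod_cat R). \<forall>g\<in>mod_hom R M N. \<forall>f\<in>mod_hom R P N.
      g ` carrier M = carrier N \<longrightarrow> (\<exists>h\<in>mod_hom R P M. compose (carrier P) g h = f))"

text \<open>Two sequences are interleaved into one, so that the direct sum of two modules again has
  a set of sequences as its carrier.\<close>

definition pair_seq :: "(nat \<Rightarrow> 'b) \<Rightarrow> (nat \<Rightarrow> 'b) \<Rightarrow> nat \<Rightarrow> 'b" where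
  "pair_seq x y = case_sum x y \<circ> sum_decode"

definition fst_seq :: "(nat \<Rightarrow> 'b) \<Rightarrow> nat \<Rightarrow> 'b" where
  "fst_seq z = z \<circ> sum_encode \<circ> Inl"

definition snd_seq :: "(nat \<Rightarrow> 'b) \<Rightarrow> nat \<Rightarrow> 'b" where
  "snd_seq z = z \<circ> sum_encode \<circ> Inr"

text \<open>The record type \<^typ>\<open>('r, 'm) module\<close> inherits the fields \<^const>\<open>mult\<close> and
  \<^const>\<open>one\<close> from rings; they play no role for modules.\<close>

definition direct_sum :: "'r fgmod \<Rightarrow> 'r fgmod \<Rightarrow> 'r fgmod" where
  "direct_sum M N =
    \<lparr>carrier = {pair_seq x y | x y. x \<in> carrier M \<and> y \<in> carrier N},
     mult = undefined, one = undefined,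
     zero = pair_seq \<zero>\<^bsub>M\<^esub> \<zero>\<^bsub>N\<^esub>,
     add = (\<lambda>z w. pair_seq (fst_seq z \<oplus>\<^bsub>M\<^esub> fst_seq w) (snd_seq z \<oplus>\<^bsub>N\<^esub> snd_seq w)),
     smult = (\<lambda>r z. pair_seq (r \<odot>\<^bsub>M\<^esub> fst_seq z) (r \<odot>\<^bsub>N\<^esub> snd_seq z))\<rparr>"


section \<open>The bounded homotopy, derived and singularity categories\<close>

text \<open>Complexes are graded cohomologically: \<open>cdiff X n\<close> goes from degree \<open>n\<close> to \<open>n + 1\<close>.\<close>

record 'r cochain =
  cobj :: "int \<Rightarrow> 'r fgmod"
  cdiff :: "int \<Rightarrow> 'r modmap"

type_synonym 'r chainmap = "int \<Rightarrow> 'r modmap"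

definition bounded_complex :: "'r ring \<Rightarrow> 'r cochain \<Rightarrow> bool" where
  "bounded_complex R X \<longleftrightarrow>
    (\<forall>n. cobj X n \<in> Ob (mod_cat R)) \<and>
    (\<forall>n. cdiff X n \<in> mod_hom R (cobj X n) (cobj X (n + 1))) \<and>
    (\<forall>n. \<forall>x\<in>carrier (cobj X n). cdiff X (n + 1) (cdiff X n x) = \<zero>\<^bsub>cobj X (n + 1 + 1)\<^esub>) \<and>
    finite {n. carrier (cobj X n) \<noteq> {\<zero>\<^bsub>cobj X n\<^esub>}}"

definition chain_maps :: "'r ring \<Rightarrow> 'r cochain \<Rightarrow> 'r cochain \<Rightarrow> 'r chainmap set" where
  "chain_maps R X Y = {f. (\<forall>n. f n \<in> mod_hom R (cobj X n) (cobj Y n)) \<and>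
    (\<forall>n. \<forall>x\<in>carrier (cobj X n). f (n + 1) (cdiff X n x) = cdiff Y n (f n x))}"

definition homotopic ::
  "'r ring \<Rightarrow> 'r cochain \<Rightarrow> 'r cochain \<Rightarrow> 'r chainmap \<Rightarrow> 'r chainmap \<Rightarrow> bool" where
  "homotopic R X Y f g \<longleftrightarrow> (\<exists>h. (\<forall>n. h n \<in> mod_hom R (cobj X n) (cobj Y (n - 1))) \<and>
    (\<forall>n. \<forall>x\<in>carrier (cobj X n).
      f n x = g n x \<oplus>\<^bsub>cobj Y n\<^esub> (cdiff Y (n - 1) (h n x) \<oplus>\<^bsub>cobj Y n\<^esub> h (n + 1) (cdiff X n x))))"

definition homotopy_class ::
  "'r ring \<Rightarrow> 'r cochain \<Rightarrow> 'r cochain \<Rightarrow> 'r chainmap \<Rightarrow> 'r chainmap set" where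
  "homotopy_class R X Y f = {g \<in> chain_maps R X Y. homotopic R X Y f g}"

definition shift_complex :: "'r cochain \<Rightarrow> 'r cochain" where
  "shift_complex X =
    \<lparr>cobj = (\<lambda>n. cobj X (n + 1)),
     cdiff = (\<lambda>n. \<lambda>x\<in>carrier (cobj X (n + 1)).
       \<ominus>\<^bsub>cobj X (n + 1 + 1)\<^esub> cdiff X (n + 1) x)\<rparr>"

definition mapping_cone :: "'r cochain \<Rightarrow> 'r cochain \<Rightarrow> 'r chainmap \<Rightarrow> 'r cochain" where
  "mapping_cone X Y f =
    \<lparr>cobj = (\<lambda>n. direct_sum (cobj X (n + 1)) (cobj Y n)),
     cdiff = (\<lambda>n. \<lambda>z\<in>carrier (direct_sum (cobj X (n + 1)) (cobj Y n)).
       pair_seq (\<ominus>\<^bsub>cobj X (n + 1 + 1)\<^esub> cdiff X (n + 1) (fst_seq z))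
                (f (n + 1) (fst_seq z) \<oplus>\<^bsub>cobj Y (n + 1)\<^esub> cdiff Y n (snd_seq z)))\<rparr>"

definition cone_inclusion :: "'r cochain \<Rightarrow> 'r cochain \<Rightarrow> 'r chainmap" where
  "cone_inclusion X Y = (\<lambda>n. \<lambda>y\<in>carrier (cobj Y n). pair_seq \<zero>\<^bsub>cobj X (n + 1)\<^esub> y)"

definition cone_projection :: "'r cochain \<Rightarrow> 'r cochain \<Rightarrow> 'r chainmap" where
  "cone_projection X Y =
    (\<lambda>n. \<lambda>z\<in>carrier (direct_sum (cobj X (n + 1)) (cobj Y n)). fst_seq z)"

definition Kb_base :: "'r ring \<Rightarrow> ('r cochain, 'r chainmap set) shift_category" where
  "Kb_base R =
    \<lparr>Ob = {X. bounded_complex R X},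
     Hom = (\<lambda>X Y. homotopy_class R X Y ` chain_maps R X Y),
     Ident = (\<lambda>X. homotopy_class R X X (\<lambda>n. \<lambda>x\<in>carrier (cobj X n). x)),
     Comp = (\<lambda>X Y Z c' c. {h \<in> chain_maps R X Z. \<exists>f\<in>c. \<exists>g\<in>c'.
       homotopic R X Z (\<lambda>n. compose (carrier (cobj X n)) (g n) (f n)) h}),
     Shift = shift_complex,
     ShiftMor = (\<lambda>X Y c. {g \<in> chain_maps R (shift_complex X) (shift_complex Y). \<exists>f\<in>c.
       homotopic R (shift_complex X) (shift_complex Y) (\<lambda>n. f (n + 1)) g})\<rparr>"

definition Kb :: "'r ring \<Rightarrow> ('r cochain, 'r chainmap set) tri_category" where
  "Kb R = with_triangles (Kb_base R)
    {(X, Y, mapping_cone X Y f, homotopy_class R X Y f,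
      homotopy_class R Y (mapping_cone X Y f) (cone_inclusion X Y),
      homotopy_class R (mapping_cone X Y f) (shift_complex X) (cone_projection X Y)) | X Y f.
      bounded_complex R X \<and> bounded_complex R Y \<and> f \<in> chain_maps R X Y}"

definition acyclic_complexes :: "'r ring \<Rightarrow> 'r cochain set" where
  "acyclic_complexes R = {X. bounded_complex R X \<and>
    (\<forall>n. cdiff X n ` carrier (cobj X n) =
      {x \<in> carrier (cobj X (n + 1)). cdiff X (n + 1) x = \<zero>\<^bsub>cobj X (n + 1 + 1)\<^esub>})}"

definition projective_complexes :: "'r ring \<Rightarrow> 'r cochain set" where
  "projective_complexes R = {X. bounded_complex R X \<and> (\<forall>n. is_projective R (cobj X n))}"

type_synonym 'r Db_mor = "('r cochain, 'r chainmap set) fraction set"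
type_synonym 'r Dsg_mor = "('r cochain, 'r Db_mor) fraction set"

definition Db :: "'r ring \<Rightarrow> ('r cochain, 'r Db_mor) tri_category" where
  "Db R = verdier_quotient (Kb R) (acyclic_complexes R)"

definition Dsg :: "'r ring \<Rightarrow> ('r cochain, 'r Dsg_mor) tri_category" where
  "Dsg R = verdier_quotient (Db R) (projective_complexes R)"


section \<open>Singular equivalences\<close>

definition complex_image :: "'r mod_func \<Rightarrow> 'r cochain \<Rightarrow> 'r cochain" where
  "complex_image F X =
    \<lparr>cobj = (\<lambda>n. on_ob F (cobj X n)),
     cdiff = (\<lambda>n. on_mor F (cobj X n) (cobj X (n + 1)) (cdiff X n))\<rparr>"

definition Kb_func ::
  "'r ring \<Rightarrow> 'r mod_func \<Rightarrow> ('r cochain, 'r chainmap set, 'r cochain, 'r chainmap set) func"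
  where
  "Kb_func S F =
    \<lparr>on_ob = complex_image F,
     on_mor = (\<lambda>X Y c. {g \<in> chain_maps S (complex_image F X) (complex_image F Y). \<exists>f\<in>c.
       homotopic S (complex_image F X) (complex_image F Y)
         (\<lambda>n. on_mor F (cobj X n) (cobj Y n) (f n)) g})\<rparr>"

definition Db_func ::
  "'r ring \<Rightarrow> 'r mod_func \<Rightarrow> ('r cochain, 'r Db_mor, 'r cochain, 'r Db_mor) func" where
  "Db_func S F = verdier_func (Kb S) (acyclic_complexes S) (Kb_func S F)"

definition Dsg_func ::
  "'r ring \<Rightarrow> 'r mod_func \<Rightarrow> ('r cochain, 'r Dsg_mor, 'r cochain, 'r Dsg_mor) func" where
  "Dsg_func S F = verdier_func (Db S) (projective_complexes S) (Db_func S F)"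

text \<open>For additive \<open>F\<close> the complexes \<open>F(X[1])\<close> and \<open>(F X)[1]\<close> are equal, so the connecting
  isomorphism of the induced triangle functor is the identity.\<close>

definition induces_singular_equivalence :: "'r ring \<Rightarrow> 'r ring \<Rightarrow> 'r mod_func \<Rightarrow> bool" where
  "induces_singular_equivalence R S F \<longleftrightarrow>
    exact_functor R S F \<and>
    (\<forall>P\<in>projective_complexes R. \<exists>P'\<in>projective_complexes S. \<exists>f.
      is_iso (Db S) (on_ob (Db_func S F) P) P' f) \<and>
    is_triangle_equivalence (Dsg R) (Dsg S) (Dsg_func S F)
      (\<lambda>X. Ident (Dsg S) (Shift (Dsg S) (on_ob (Dsg_func S F) X)))"

definition corner_functor :: "'r \<Rightarrow> 'r mod_func" where
  "corner_functor a =
    \<lparr>on_ob = (\<lambda>M. M\<lparr>carrier := (\<lambda>x. a \<odot>\<^bsub>M\<^esub> x) ` carrier M\<rparr>),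
     on_mor = (\<lambda>M N f. restrict f ((\<lambda>x. a \<odot>\<^bsub>M\<^esub> x) ` carrier M))\<rparr>"

end

theory Submission
  imports Defs
begin

text \<open>The functor \<open>F = a-\<close> has the left adjoint \<open>\<Lambda>a \<otimes> -\<close>, and the unit of the adjunction is an
  isomorphism. Since no relation starts in a vertex \<open>v \<in> V\<^sub>0\<close>, stripping the first arrow is well-defined
  on the radical of \<open>\<Lambda>v\<close>, so this radical is projective and the simple module at \<open>v\<close> has a projective
  resolution of length one. Hence a complex whose image under \<open>F\<close> is acyclic is perfect: its cohomology
  modules are iterated extensions of such simple modules, and they can be killed from the top downwards
  by cones of maps from complexes of projectives of length one. So \<open>F\<close> preserves and reflects the morphisms
  with perfect cone, and the universal arrows of the adjoint make the functor between the categories of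
  fractions fully faithful and dense. It preserves perfect complexes because \<open>a\<Lambda>\<close> is projective over
  \<open>a\<Lambda>a\<close>; a dual basis is obtained by cutting paths where they leave \<open>V\<^sub>0\<close>. Both localizations, at the
  quasi-isomorphisms and at the perfect complexes, are treated as a single localization of the homotopy
  category.\<close>

\<comment> \<open>The left adjoint need not be exact, so it does not act on derived categories
  degreewise. It is therefore used only on the homotopy category, through universal arrows: because
  \<open>F\<close> reflects the morphisms with perfect cone, transposing a fraction along a
  universal arrow keeps its denominator a denominator. The other obstacle is the target itself:
  morphisms of \<open>Dsg\<close> are classes of roofs whose legs are again classes of roofs. They
  become computable once the derived morphisms with perfect cone are identified as the roofs with a
  quasi-isomorphism as one leg and a chain map with perfect cone as the other; then a single
  denominator from the homotopy category clears both layers. The nilpotency of the arrow ideal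
  enters twice. It filters every finitely generated module by simple or zero quotients, which yields
  both noetherianity and the resolutions. It also bounds the paths that stay inside the chosen
  vertices: stripping arrows shows that these are nonzero, so they cannot be long, and cutting paths
  where they leave stops after finitely many steps.\<close>
syntax
  "_index_sub" :: "logic => index" ("(\<open>unbreakable\<close>\<^sub>_)" [1000] 1000)
  "_index_obj" :: "logic => logic => index" ("(\<open>unbreakable\<close>\<^sub>_\<^sup>_)" [1000,1000] 1000)
translations
  (index) "\<^sub>M" => (index) "\<^bsub>M\<^esub>"
  (index) "\<^sub>X\<^sup>n" => (index) "\<^bsub>CONST cobj X n\<^esub>"

abbreviation "el \<equiv> carrier"
abbreviation "cel X n \<equiv> carrier (cobj X n)"
abbreviation "cone \<equiv> mapping_cone"
abbreviation "shift \<equiv> shift_complex"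
abbreviation "lmod \<equiv> left_module"
abbreviation "ob \<equiv> on_ob"
abbreviation "mor \<equiv> on_mor"

section \<open>Categories of fractions\<close>

locale cat =
 fixes C :: "('o, 'm, 'z) category_scheme"
 assumes ident_in [simp]: "X:Ob C ==> Ident C X:Hom C X X"
  and comp_in [simp]: "[|f:Hom C X Y; g:Hom C Y Z; X:Ob C; Y:Ob C; Z:Ob C|]
   ==> Comp C X Y Z g f:Hom C X Z"
  and comp_idl [simp]: "[|f:Hom C X Y; X:Ob C; Y:Ob C|] ==> Comp C X Y Y (Ident C Y) f = f"
  and comp_idr [simp]: "[|f:Hom C X Y; X:Ob C; Y:Ob C|] ==> Comp C X X Y f (Ident C X) = f"
  and comp_assoc: "[|f:Hom C X Y; g:Hom C Y Z; h:Hom C Z W;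
    X:Ob C; Y:Ob C; Z:Ob C; W:Ob C|]
   ==> Comp C X Y W (Comp C Y Z W h g) f = Comp C X Z W h (Comp C X Y Z g f)"
begin

lemma comp_ext:
 assumes "Comp C W Z X s p = Comp C W Z' X s' q" "r:Hom C V W" "p:Hom C W Z" "q:Hom C W Z'"
  "s:Hom C Z X" "s':Hom C Z' X" "V:Ob C" "W:Ob C" "Z:Ob C" "Z':Ob C" "X:Ob C"
 shows "Comp C V Z X s (Comp C V W Z p r) = Comp C V Z' X s' (Comp C V W Z' q r)" by (metis assms comp_assoc)

lemma comp_inv_ext:
 assumes "Comp C Y X Y f f' = Ident C Y" "f:Hom C X Y" "f':Hom C Y X" "h:Hom C W Y"
  "X:Ob C" "Y:Ob C" "W:Ob C"
 shows "Comp C W X Y f (Comp C W Y X f' h) = h" by (metis assms comp_assoc comp_idl)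

lemma iso_comp:
 assumes "is_iso C X Y f" "is_iso C Y Z g" "X:Ob C" "Y:Ob C" "Z:Ob C"
 shows "is_iso C X Z (Comp C X Y Z g f)"
proof -
 obtain f' g' where h: "f:Hom C X Y" "f':Hom C Y X" "g:Hom C Y Z" "g':Hom C Z Y"
  "Comp C X Y X f' f = Ident C X" "Comp C Y X Y f f' = Ident C Y"
  "Comp C Y Z Y g' g = Ident C Y" "Comp C Z Y Z g g' = Ident C Z" using assms unfolding is_iso_def by blast
 have "Comp C X Z Y g' (Comp C X Y Z g f) = f" "Comp C Z X Y f (Comp C Z Y X f' g') = g'" using comp_inv_ext h assms by blast+
 then show ?thesis unfolding is_iso_def using h assms by (auto intro!: bexI[of _ "Comp C Z Y X f' g'"] simp: comp_assoc)
qed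

lemma iso_ident: "X:Ob C ==> is_iso C X X (Ident C X)" unfolding is_iso_def by auto

lemma iso_inv:
 assumes "is_iso C X Y f"
 obtains g where "is_iso C Y X g" "Comp C X Y X g f = Ident C X" "Comp C Y X Y f g = Ident C Y"
  "f:Hom C X Y" "g:Hom C Y X" using assms unfolding is_iso_def by blast

lemma iso_cancel:
 assumes "is_iso C X Y f" "g:Hom C Y Z" "h:Hom C Y Z" "Comp C X Y Z g f = Comp C X Y Z h f"
  "X:Ob C" "Y:Ob C" "Z:Ob C"
 shows "g = h"
proof -
 obtain f' where f': "f':Hom C Y X" "Comp C Y X Y f f' = Ident C Y" "f:Hom C X Y" using assms unfolding is_iso_def by blast
 have "g = Comp C Y X Z (Comp C X Y Z g f) f'" "h = Comp C Y X Z (Comp C X Y Z h f) f'"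
  using assms(2,3,5-7) f' by (simp_all add: comp_assoc)
 then show ?thesis using assms(4) by metis
qed

end

lemma functor_ob: "[|is_functor C D F; X:Ob C|] ==> ob F X:Ob D" unfolding is_functor_def by blast

lemma functor_mor: "[|is_functor C D F; f:Hom C X Y; X:Ob C; Y:Ob C|]
  ==> mor F X Y f:Hom D (ob F X) (ob F Y)" unfolding is_functor_def by blast

lemma functor_ident: "[|is_functor C D F; X:Ob C|]
  ==> mor F X X (Ident C X) = Ident D (ob F X)" unfolding is_functor_def by blast

lemma functor_comp: "[|is_functor C D F; f:Hom C X Y; g:Hom C Y Z; X:Ob C; Y:Ob C; Z:Ob C|]
  ==> mor F X Z (Comp C X Y Z g f) =
   Comp D (ob F X) (ob F Y) (ob F Z) (mor F Y Z g) (mor F X Y f)" unfolding is_functor_def by blast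

lemma functor_iso:
 assumes "is_functor C D F" "is_iso C X Y f" "X:Ob C" "Y:Ob C"
 shows "is_iso D (ob F X) (ob F Y) (mor F X Y f)" using assms unfolding is_iso_def is_functor_def by metis

text \<open>A one-sided calculus of fractions for roofs X <- Z -> Y. \<open>den_ore\<close> moves a
  denominator past a morphism, and \<open>den_cancel\<close> trades a denominator that identifies
  two morphisms after them for one that identifies them before. These are the axioms behind
  well-definedness and associativity of composition in \<open>verdier_base\<close>.\<close>

locale ore = cat T for T :: "('o, 'm) tri_category" +
 fixes N :: "'o set"
 assumes den_sub: "s:denominators T N X Y ==> X:Ob T&Y:Ob T&s:Hom T X Y"
  and den_id: "X:Ob T ==> Ident T X:denominators T N X X"
  and den_comp: "[|s:denominators T N X Y; t:denominators T N Y Z|]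
   ==> Comp T X Y Z t s:denominators T N X Z"
  and den_ore: "[|f:Hom T U Y; t:denominators T N V Y; U:Ob T|] ==>
   \<exists>W\<in>Ob T. \<exists>t'\<in>denominators T N W U. \<exists>f'\<in>Hom T W V. Comp T W U Y f t' = Comp T W V Y t f'"
  and den_cancel: "[|f:Hom T X Y; g:Hom T X Y; X:Ob T; s:denominators T N Y Z;
   Comp T X Y Z s f = Comp T X Y Z s g|] ==>
   \<exists>W\<in>Ob T. \<exists>t\<in>denominators T N W X. Comp T W X Y f t = Comp T W X Y g t"
begin

abbreviation "S\<equiv>denominators T N"
abbreviation "VB\<equiv>verdier_base T N"
abbreviation "cls\<equiv>roof_class T N"
abbreviation "qm\<equiv>quotient_mor T N"

lemma den_hom [simp]: "s:S X Y ==> s:Hom T X Y" using den_sub by blast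

lemma roof_equivI:
 assumes "W:Ob T" "p:Hom T W Z" "q:Hom T W Z'" "Comp T W Z X s p = Comp T W Z' X s' q"
  "Comp T W Z X s p:S W X" "Comp T W Z Y f p = Comp T W Z' Y f' q"
 shows "roof_equiv T N X Y (Z, s, f) (Z', s', f')" unfolding roof_equiv_def using assms by blast

lemma roofsD:
 assumes "(Z, s, f):roofs T N X Y"
 shows "Z:Ob T" "s:S Z X" "s:Hom T Z X" "f:Hom T Z Y" "X:Ob T" using assms den_sub[of s Z X] unfolding roofs_def by auto

lemma roofsI: "[|s:S Z X; f:Hom T Z Y|] ==> (Z, s, f):roofs T N X Y" using den_sub[of s Z X] unfolding roofs_def by auto

lemma roof_refl:
 assumes "r:roofs T N X Y" "Y:Ob T"
 shows "roof_equiv T N X Y r r"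
proof -
 obtain Z s f where r: "r = (Z, s, f)" by (cases r)
 show ?thesis using roofsD[of Z s f X Y] assms unfolding r by (intro roof_equivI[of Z "Ident T Z" _ "Ident T Z"]) auto
qed

lemma roof_sym: "roof_equiv T N X Y r r' ==> roof_equiv T N X Y r' r" unfolding roof_equiv_def by (cases r, cases r') (auto, metis)

text \<open>The two given refinements W and W' are joined by an Ore square over X. It commutes only
  after composition with the middle denominator \<open>s'\<close>; \<open>den_cancel\<close>
  supplies a further denominator after which the two maps to Z' agree.\<close>

lemma roof_trans:
 assumes e: "roof_equiv T N X Y r r'" "roof_equiv T N X Y r' r''"
  and r: "r:roofs T N X Y" "r':roofs T N X Y" "r'':roofs T N X Y" and Y: "Y:Ob T"
 shows "roof_equiv T N X Y r r''"
proof -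
 obtain Z s f where r1: "r = (Z, s, f)" by (cases r)
 obtain Z' s' f' where r2: "r' = (Z', s', f')" by (cases r')
 obtain Z'' s'' f'' where r3: "r'' = (Z'', s'', f'')" by (cases r'')
 note rd = roofsD[OF r(1)[unfolded r1]] roofsD[OF r(2)[unfolded r2]] roofsD[OF r(3)[unfolded r3]]
 obtain W p q where w: "W:Ob T" "p:Hom T W Z" "q:Hom T W Z'"
   "Comp T W Z X s p = Comp T W Z' X s' q" "Comp T W Z X s p:S W X"
   "Comp T W Z Y f p = Comp T W Z' Y f' q" using e(1) unfolding r1 r2 roof_equiv_def by auto
 obtain W' p' q' where w': "W':Ob T" "p':Hom T W' Z'" "q':Hom T W' Z''"
   "Comp T W' Z' X s' p' = Comp T W' Z'' X s'' q'" "Comp T W' Z' X s' p':S W' X"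
   "Comp T W' Z' Y f' p' = Comp T W' Z'' Y f'' q'" using e(2) unfolding r2 r3 roof_equiv_def by auto
 have "Comp T W Z' X s' q:Hom T W X" using w rd by simp
 from den_ore[OF this w'(5) w(1)] obtain V a b where v: "V:Ob T" "a:S V W" "b:Hom T V W'"
  "Comp T V W X (Comp T W Z' X s' q) a = Comp T V W' X (Comp T W' Z' X s' p') b" by auto
 have "Comp T V Z' X s' (Comp T V W Z' q a) = Comp T V Z' X s' (Comp T V W' Z' p' b)" using v w(1-3) w'(1-3) rd by (simp add: comp_assoc)
 from den_cancel[OF _ _ v(1) rd(7) this] obtain V' c where
  c: "V':Ob T" "c:S V' V"
   "Comp T V' V Z' (Comp T V W Z' q a) c = Comp T V' V Z' (Comp T V W' Z' p' b) c" using v w w' rd by auto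
 have c': "Comp T V' W Z' q (Comp T V' V W a c) = Comp T V' W' Z' p' (Comp T V' V W' b c)"
  using c v(1-3) w(1-3) w'(1-3) rd by (simp add: comp_assoc)
 define a' where "a' = Comp T V' V W a c"
 define b' where "b' = Comp T V' V W' b c"
 have ab: "a':S V' W" "b':Hom T V' W'" "a':Hom T V' W" unfolding a'_def b'_def using c v w w' den_comp by auto
 note cc = c'[folded a'_def b'_def]
 have 1: "Comp T V' Z X s (Comp T V' W Z p a') = Comp T V' Z' X s' (Comp T V' W Z' q a')" using w rd ab c by (intro comp_ext) auto
 have 2: "Comp T V' Z' X s' (Comp T V' W' Z' p' b') = Comp T V' Z'' X s'' (Comp T V' W' Z'' q' b')"
  using w' rd ab c by (intro comp_ext) auto
 have 3: "Comp T V' Z Y f (Comp T V' W Z p a') = Comp T V' Z' Y f' (Comp T V' W Z' q a')" using w rd ab c Y by (intro comp_ext) auto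
 have 4: "Comp T V' Z' Y f' (Comp T V' W' Z' p' b') = Comp T V' Z'' Y f'' (Comp T V' W' Z'' q' b')"
  using w' rd ab c Y by (intro comp_ext) auto
 have 5: "Comp T V' Z X s (Comp T V' W Z p a'):S V' X" using den_comp[OF ab(1) w(5)] w(1-3) rd ab c(1,2) by (simp add: comp_assoc)
 show ?thesis unfolding r1 r3 by (rule roof_equivI[of V' "Comp T V' W Z p a'" _ "Comp T V' W' Z'' q' b'"])
    (use 1 2 3 4 5 w w' rd ab c Y cc in auto)
qed

lemma cls_eq_iff:
 assumes "r:roofs T N X Y" "r':roofs T N X Y" "Y:Ob T"
 shows "cls X Y r = cls X Y r'\<longleftrightarrow>roof_equiv T N X Y r r'"
 using assms roof_refl roof_sym roof_trans unfolding roof_class_def by blast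

lemma mem_cls: "[|r:roofs T N X Y; Y:Ob T|] ==> r:cls X Y r" unfolding roof_class_def using roof_refl by blast

text \<open>Two kinds of choice are handled at once: the square completing the zigzag, and a
  refinement \<open>p\<close> of the apex of the first roof. \<open>roof_comp_cong\<close> applies
  this twice against one common third composite.\<close>

lemma roof_comp_key:
 assumes r: "(U, s, f):roofs T N X Y" "(V, t, g):roofs T N Y Z" "Z:Ob T"
  and 1: "t1:S W1 U" "f1:Hom T W1 V" "Comp T W1 U Y f t1 = Comp T W1 V Y t f1"
  and p: "p:Hom T U' U" "Comp T U' U X s p:S U' X"
  and 2: "t2:S W2 U'" "f2:Hom T W2 V"
   "Comp T W2 U Y f (Comp T W2 U' U p t2) = Comp T W2 V Y t f2"
 shows "roof_equiv T N X Z (W1, Comp T W1 U X s t1, Comp T W1 V Z g f1)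
  (W2, Comp T W2 U' X (Comp T U' U X s p) t2, Comp T W2 V Z g f2)"
proof -
 note rd = roofsD[OF r(1)] roofsD[OF r(2)] r(3)
 have ob: "W1:Ob T" "W2:Ob T" "U':Ob T" using den_sub 1 2 by auto
 have "Comp T W2 U' U p t2:Hom T W2 U" using p 2 rd ob by simp
 from den_ore[OF this 1(1) ob(2)] obtain W3 a b where
  w: "W3:Ob T" "a:S W3 W2" "b:Hom T W3 W1"
   "Comp T W3 W2 U (Comp T W2 U' U p t2) a = Comp T W3 W1 U t1 b" by auto
 have "Comp T W3 V Y t (Comp T W3 W1 V f1 b) = Comp T W3 U Y f (Comp T W3 W1 U t1 b)"
  by (rule comp_ext[OF 1(3)[symmetric]]) (use 1 w rd ob in auto)
 also have "\<dots> = Comp T W3 U Y f (Comp T W3 W2 U (Comp T W2 U' U p t2) a)" using w by simp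
 also have "\<dots> = Comp T W3 V Y t (Comp T W3 W2 V f2 a)" by (rule comp_ext[OF 2(3)]) (use 2 p w rd ob in auto)
 finally have "Comp T W3 V Y t (Comp T W3 W1 V f1 b) = Comp T W3 V Y t (Comp T W3 W2 V f2 a)" .
 from den_cancel[OF _ _ w(1) rd(7) this] obtain W c where
  c: "W:Ob T" "c:S W W3"
   "Comp T W W3 V (Comp T W3 W1 V f1 b) c = Comp T W W3 V (Comp T W3 W2 V f2 a) c" using 1 2 w rd ob by auto
 have ac: "Comp T W W3 W2 a c:S W W2" using w c den_comp by blast
 have 3: "Comp T W W1 U t1 (Comp T W W3 W1 b c) = Comp T W U' U p (Comp T W W2 U' t2 (Comp T W W3 W2 a c))"
 proof -
  have "Comp T W W1 U t1 (Comp T W W3 W1 b c) = Comp T W W3 U (Comp T W3 W1 U t1 b) c" using 1 w c rd ob by (simp add: comp_assoc)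
  also have "\<dots> = Comp T W U' U p (Comp T W W2 U' t2 (Comp T W W3 W2 a c))"
   using w(4)[symmetric] p 2 w(1-3) c rd ob by (simp add: comp_assoc)
  finally show ?thesis .
 qed
 have 4: "Comp T W W2 X (Comp T W2 U' X (Comp T U' U X s p) t2) (Comp T W W3 W2 a c):S W X" using den_comp[OF ac den_comp[OF 2(1) p(2)]] .
 have 5: "Comp T W W1 X (Comp T W1 U X s t1) (Comp T W W3 W1 b c) =
  Comp T W W2 X (Comp T W2 U' X (Comp T U' U X s p) t2) (Comp T W W3 W2 a c)" using 3 1 2 p w c rd ob by (simp add: comp_assoc)
 have 6: "Comp T W W1 Z (Comp T W1 V Z g f1) (Comp T W W3 W1 b c) =
   Comp T W W2 Z (Comp T W2 V Z g f2) (Comp T W W3 W2 a c)" using c(3) 1 2 p w c(1,2) rd ob by (simp add: comp_assoc)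
 show ?thesis by (rule roof_equivI[of W "Comp T W W3 W1 b c" _ "Comp T W W3 W2 a c"])
    (use 4 5 6 1 2 p w c rd ob in auto)
qed

lemma roof_compD:
 assumes "roof_comp T N X Y Z (U, s, f) (V, t, g) (W, s'', g'')"
 obtains t' f' where "W:Ob T" "t':S W U" "f':Hom T W V"
  "Comp T W U Y f t' = Comp T W V Y t f'" "s'' = Comp T W U X s t'" "g'' = Comp T W V Z g f'" using assms unfolding roof_comp_def by auto

lemma roof_compI:
 assumes "t':S W U" "f':Hom T W V" "Comp T W U Y f t' = Comp T W V Y t f'"
 shows "roof_comp T N X Y Z (U, s, f) (V, t, g) (W, Comp T W U X s t', Comp T W V Z g f')"
 using assms den_sub[of t'] unfolding roof_comp_def by auto

lemma roof_comp_roof: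
 assumes "r:roofs T N X Y" "r':roofs T N Y Z" "Z:Ob T" "roof_comp T N X Y Z r r' t"
 shows "t:roofs T N X Z" using assms by (cases r, cases r', cases t) (auto simp: roofs_def roof_comp_def den_comp den_sub)

text \<open>Both composites are compared with a third one. It lives over a square K between the
  common refinement W of the first pair of roofs and the common refinement W' of the second
  pair.\<close>

lemma roof_comp_cong:
 assumes r: "r1:roofs T N X Y" "r2:roofs T N X Y" "r1':roofs T N Y Z" "r2':roofs T N Y Z"
  and Z: "Z:Ob T"
  and e: "roof_equiv T N X Y r1 r2" "roof_equiv T N Y Z r1' r2'"
  and c: "roof_comp T N X Y Z r1 r1' t1" "roof_comp T N X Y Z r2 r2' t2"
 shows "roof_equiv T N X Z t1 t2"
proof -
 obtain U1 s1 f1 where r1: "r1 = (U1, s1, f1)" by (cases r1)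
 obtain U2 s2 f2 where r2: "r2 = (U2, s2, f2)" by (cases r2)
 obtain V1 u1 g1 where r1': "r1' = (V1, u1, g1)" by (cases r1')
 obtain V2 u2 g2 where r2': "r2' = (V2, u2, g2)" by (cases r2')
 obtain W1 w1 h1 where t1: "t1 = (W1, w1, h1)" by (cases t1)
 obtain W2 w2 h2 where t2: "t2 = (W2, w2, h2)" by (cases t2)
 note rd = roofsD[OF r(1)[unfolded r1]] roofsD[OF r(2)[unfolded r2]]
   roofsD[OF r(3)[unfolded r1']] roofsD[OF r(4)[unfolded r2']]
 obtain W p q where w: "W:Ob T" "p:Hom T W U1" "q:Hom T W U2"
   "Comp T W U1 X s1 p = Comp T W U2 X s2 q" "Comp T W U1 X s1 p:S W X"
   "Comp T W U1 Y f1 p = Comp T W U2 Y f2 q" using e(1) unfolding r1 r2 roof_equiv_def by auto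
 obtain W' p' q' where w': "W':Ob T" "p':Hom T W' V1" "q':Hom T W' V2"
   "Comp T W' V1 Y u1 p' = Comp T W' V2 Y u2 q'" "Comp T W' V1 Y u1 p':S W' Y"
   "Comp T W' V1 Z g1 p' = Comp T W' V2 Z g2 q'" using e(2) unfolding r1' r2' roof_equiv_def by auto
 have "Comp T W U1 Y f1 p:Hom T W Y" using w rd by simp
 from den_ore[OF this w'(5) w(1)] obtain K a b where k: "K:Ob T" "a:S K W" "b:Hom T K W'"
  "Comp T K W Y (Comp T W U1 Y f1 p) a = Comp T K W' Y (Comp T W' V1 Y u1 p') b" by auto
 have k1: "Comp T K U1 Y f1 (Comp T K W U1 p a) = Comp T K V1 Y u1 (Comp T K W' V1 p' b)"
  using k w(1-3) w'(1-3) rd by (simp add: comp_assoc)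
 have k2: "Comp T K U2 Y f2 (Comp T K W U2 q a) = Comp T K V2 Y u2 (Comp T K W' V2 q' b)"
  using k(4) unfolding w(6) w'(4) using k(1-3) w(1-3) w'(1-3) rd by (simp add: comp_assoc)
 have b: "Comp T K W' V1 p' b:Hom T K V1" "Comp T K W' V2 q' b:Hom T K V2" using k w' rd by auto
 obtain a1 b1 where 1: "a1:S W1 U1" "b1:Hom T W1 V1" "Comp T W1 U1 Y f1 a1 = Comp T W1 V1 Y u1 b1"
  and t1': "w1 = Comp T W1 U1 X s1 a1" "h1 = Comp T W1 V1 Z g1 b1" using c(1) unfolding r1 r1' t1 by (rule roof_compD)
 obtain a2 b2 where 2: "a2:S W2 U2" "b2:Hom T W2 V2" "Comp T W2 U2 Y f2 a2 = Comp T W2 V2 Y u2 b2"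
  and t2': "w2 = Comp T W2 U2 X s2 a2" "h2 = Comp T W2 V2 Z g2 b2" using c(2) unfolding r2 r2' t2 by (rule roof_compD)
 have e1: "roof_equiv T N X Z t1 (K, Comp T K W X (Comp T W U1 X s1 p) a, Comp T K V1 Z g1 (Comp T K W' V1 p' b))" unfolding t1 t1'
  by (rule roof_comp_key[OF r(1)[unfolded r1] r(3)[unfolded r1'] Z 1 w(2,5) k(2) b(1) k1])
 have e2: "roof_equiv T N X Z t2 (K, Comp T K W X (Comp T W U2 X s2 q) a, Comp T K V2 Z g2 (Comp T K W' V2 q' b))" unfolding t2 t2'
  by (rule roof_comp_key[OF r(2)[unfolded r2] r(4)[unfolded r2'] Z 2 w(3) _ k(2) b(2) k2])
    (use w in simp)
 have "Comp T K V1 Z g1 (Comp T K W' V1 p' b) = Comp T K V2 Z g2 (Comp T K W' V2 q' b)" by (rule comp_ext[OF w'(6)]) (use k w' rd Z in auto)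
 then have e2': "roof_equiv T N X Z t2 (K, Comp T K W X (Comp T W U1 X s1 p) a, Comp T K V1 Z g1 (Comp T K W' V1 p' b))"
  using e2 w(4) by simp
 have m: "(K, Comp T K W X (Comp T W U1 X s1 p) a, Comp T K V1 Z g1 (Comp T K W' V1 p' b)):roofs T N X Z"
  using roofsI den_comp[OF k(2) w(5)] b rd Z k(1) by (auto intro!: roofsI)
 show ?thesis using roof_trans[OF e1 roof_sym[OF e2']] m roof_comp_roof r c Z by blast
qed

lemma vb_sel [simp]: "Ob VB = Ob T" "Hom VB X Y = cls X Y ` roofs T N X Y"
 "Ident VB X = cls X X (X, Ident T X, Ident T X)" "Shift VB = Shift T" unfolding verdier_base_def by auto

lemma vb_Comp: "Comp VB X Y Z c' c = {t'\<in>roofs T N X Z.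
    \<exists>r\<in>c. \<exists>r'\<in>c'. \<exists>t. roof_comp T N X Y Z r r' t&roof_equiv T N X Z t t'}"
 unfolding verdier_base_def by simp

lemma vb_comp:
 assumes "r:roofs T N X Y" "r':roofs T N Y Z" "Z:Ob T" "roof_comp T N X Y Z r r' t"
 shows "Comp VB X Y Z (cls Y Z r') (cls X Y r) = cls X Z t"
proof -
 have Y: "Y:Ob T" using assms(2) by (cases r') (auto dest: roofsD)
 have t: "t:roofs T N X Z" using roof_comp_roof assms by blast
 have sub: "cls X Y r<=roofs T N X Y" "cls Y Z r'<=roofs T N Y Z" unfolding roof_class_def by auto
 have "roof_equiv T N X Z t t'" if "r1:cls X Y r" "r1':cls Y Z r'" "roof_comp T N X Y Z r1 r1' t1"
  "roof_equiv T N X Z t1 t'" "t':roofs T N X Z" for r1 r1' t1 t'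
 proof -
  have e: "roof_equiv T N X Y r r1" "roof_equiv T N Y Z r' r1'" using that unfolding roof_class_def by auto
  have m: "r1:roofs T N X Y" "r1':roofs T N Y Z" using that sub by auto
  have "roof_equiv T N X Z t t1" by (rule roof_comp_cong[OF assms(1) m(1) assms(2) m(2) assms(3) e assms(4) that(3)])
  then show ?thesis using roof_trans[OF _ that(4) t _ that(5) assms(3)] roof_comp_roof[OF m assms(3) that(3)] by blast
 qed
 moreover have "r:cls X Y r" "r':cls Y Z r'" using mem_cls assms Y by auto
 ultimately show ?thesis using assms(4) unfolding vb_Comp roof_class_def[of T N X Z] by blast
qed

lemma cls_refine:
 assumes "(Z, s, f):roofs T N X Y" "p:Hom T W Z" "Comp T W Z X s p:S W X" "Y:Ob T"
 shows "cls X Y (Z, s, f) = cls X Y (W, Comp T W Z X s p, Comp T W Z Y f p)"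
proof -
 note rd = roofsD[OF assms(1)]
 have W: "W:Ob T" using den_sub assms(3) by blast
 have 1: "(W, Comp T W Z X s p, Comp T W Z Y f p):roofs T N X Y" using rd assms W by (intro roofsI) auto
 have "roof_equiv T N X Y (Z, s, f) (W, Comp T W Z X s p, Comp T W Z Y f p)"
  by (rule roof_equivI[of W p _ "Ident T W"]) (use rd assms W in auto)
 then show ?thesis using cls_eq_iff 1 assms by blast
qed

text \<open>When the first numerator already factors through the second denominator, the completing
  square can be taken with an identity leg. All later computations with composites go through this
  case.\<close>

lemma frac_comp:
 assumes "s:S U X" "f':Hom T U V" "(V, t, g):roofs T N Y Z" "Z:Ob T"
 shows "Comp VB X Y Z (cls Y Z (V, t, g)) (cls X Y (U, s, Comp T U V Y t f')) =
  cls X Z (U, s, Comp T U V Z g f')"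
proof -
 note rd = roofsD[OF assms(3)] den_sub[OF assms(1)]
 have "roof_comp T N X Y Z (U, s, Comp T U V Y t f') (V, t, g)
   (U, Comp T U U X s (Ident T U), Comp T U V Z g f')" by (rule roof_compI) (use rd assms den_id in auto)
 then show ?thesis using rd assms by (intro vb_comp) (auto intro!: roofsI)
qed

lemma hom_vbE:
 assumes "c:Hom VB X Y"
 obtains Z s f where "(Z, s, f):roofs T N X Y" "c = cls X Y (Z, s, f)" using assms by auto

lemma cls_hom: "(Z, s, f):roofs T N X Y ==> cls X Y (Z, s, f):Hom VB X Y" by auto

text \<open>The Ore square is absorbed into the representative of the first morphism, which is
  chosen to fit the denominator of the morphism that follows it; \<open>frac_comp\<close> then
  applies.\<close>

lemma comp_normal:
 assumes "c:Hom VB X Y" "t:S V Y"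
 obtains U s f where "s:S U X" "f:Hom T U V" "c = cls X Y (U, s, Comp T U V Y t f)"
proof -
 obtain Z s f where c: "(Z, s, f):roofs T N X Y" "c = cls X Y (Z, s, f)" using assms(1) by (rule hom_vbE)
 note rd = roofsD[OF c(1)] den_sub[OF assms(2)]
 obtain W t' f' where w: "W:Ob T" "t':S W Z" "f':Hom T W V"
  "Comp T W Z Y f t' = Comp T W V Y t f'" using den_ore[OF rd(4) assms(2) rd(1)] by auto
 have "c = cls X Y (W, Comp T W Z X s t', Comp T W V Y t f')" unfolding c(2) w(4)[symmetric]
  by (rule cls_refine) (use c rd w den_comp in auto)
 then show ?thesis using that den_comp[OF w(2) rd(2)] w(3) by blast
qed

lemma qm_cls: "qm X Y f = cls X Y (X, Ident T X, f)" unfolding quotient_mor_def ..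

lemma qm_hom: "[|f:Hom T X Y; X:Ob T|] ==> qm X Y f:Hom VB X Y" unfolding qm_cls by (intro cls_hom roofsI den_id)

lemma qm_comp_cls:
 assumes "(Z, s, f):roofs T N X Y" "g:Hom T Y Y'" "Y:Ob T" "Y':Ob T"
 shows "Comp VB X Y Y' (qm Y Y' g) (cls X Y (Z, s, f)) = cls X Y' (Z, s, Comp T Z Y Y' g f)"
 using frac_comp[of s Z X f Y "Ident T Y" g Y Y'] roofsD[OF assms(1)] assms unfolding qm_cls by (auto intro: roofsI den_id)

lemma cls_dup:
 assumes "s:S Z X"
 shows "cls X X (Z, s, s) = Ident VB X"
proof -
 have X: "X:Ob T" "Z:Ob T" "s:Hom T Z X" using den_sub assms by auto
 show ?thesis using cls_refine[of X "Ident T X" "Ident T X" X X s Z] X assms by (simp add: roofsI den_id)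
qed

lemma vb_cat: "cat VB"
proof
 fix X assume "X:Ob VB"
 then show "Ident VB X:Hom VB X X" by (auto intro!: roofsI den_id imageI)
next
 fix X Y Z f g assume *: "f:Hom VB X Y" "g:Hom VB Y Z" "X:Ob VB" "Y:Ob VB" "Z:Ob VB"
 obtain V t h where g: "(V, t, h):roofs T N Y Z" "g = cls Y Z (V, t, h)" using *(2) by (rule hom_vbE)
 obtain U s f' where f: "s:S U X" "f':Hom T U V" "f = cls X Y (U, s, Comp T U V Y t f')" using comp_normal[OF *(1) roofsD(2)[OF g(1)]] .
 show "Comp VB X Y Z g f:Hom VB X Z" unfolding f g using frac_comp[OF f(1,2) g(1)] f g * den_sub[OF f(1)] roofsD[OF g(1)]
  by (auto intro!: imageI roofsI)
next
 fix X Y f assume *: "f:Hom VB X Y" "X:Ob VB" "Y:Ob VB"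
 obtain U s f' where f: "(U, s, f'):roofs T N X Y" "f = cls X Y (U, s, f')" using *(1) by (rule hom_vbE)
 note rd = roofsD[OF f(1)]
 show "Comp VB X Y Y (Ident VB Y) f = f" using qm_comp_cls[OF f(1), of "Ident T Y" Y] rd * unfolding f qm_cls by simp
 show "Comp VB X X Y f (Ident VB X) = f" using frac_comp[of s U X "Ident T U" U s f' X Y for s]
   frac_comp[of s U X "Ident T U" U s f' X Y] rd * f unfolding cls_dup[OF rd(2), symmetric] by simp
next
 fix X Y Z W f g h
 assume *: "f:Hom VB X Y" "g:Hom VB Y Z" "h:Hom VB Z W"
  "X:Ob VB" "Y:Ob VB" "Z:Ob VB" "W:Ob VB"
 obtain A u k where h: "(A, u, k):roofs T N Z W" "h = cls Z W (A, u, k)" using *(3) by (rule hom_vbE)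
 note rh = roofsD[OF h(1)]
 obtain V t g' where g: "t:S V Y" "g':Hom T V A" "g = cls Y Z (V, t, Comp T V A Z u g')" using comp_normal[OF *(2) rh(2)] .
 obtain U s f' where f: "s:S U X" "f':Hom T U V" "f = cls X Y (U, s, Comp T U V Y t f')" using comp_normal[OF *(1) g(1)] .
 note ob = den_sub[OF f(1)] den_sub[OF g(1)] *(4-7)[simplified]
 have 1: "Comp VB X Y Z g f = cls X Z (U, s, Comp T U A Z u (Comp T U V A g' f'))"
  unfolding f g using f g ob rh by (subst frac_comp) (auto simp: comp_assoc intro: roofsI)
 have 2: "Comp VB Y Z W h g = cls Y W (V, t, Comp T V A W k g')" unfolding h g using f g h ob rh by (subst frac_comp) (auto)
 show "Comp VB X Y W (Comp VB Y Z W h g) f = Comp VB X Z W h (Comp VB X Y Z g f)"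
  unfolding 1 2 unfolding f(3) h(2) using f(1,2) g(1,2) h(1) ob rh by (subst (1 2) frac_comp) (auto simp: comp_assoc intro: roofsI)
qed

lemma qm_comp:
 assumes "f:Hom T X Y" "g:Hom T Y Z" "X:Ob T" "Y:Ob T" "Z:Ob T"
 shows "qm X Z (Comp T X Y Z g f) = Comp VB X Y Z (qm Y Z g) (qm X Y f)"
 using qm_comp_cls[of X "Ident T X" f X Y g Z] assms unfolding qm_cls by (simp add: roofsI den_id)

lemma cls_split:
 assumes "(Z, s, f):roofs T N X Y" "Y:Ob T"
 shows "cls X Y (Z, s, f) = Comp VB X Z Y (qm Z Y f) (cls X Z (Z, s, Ident T Z))"
 using qm_comp_cls[of Z s "Ident T Z" X Z f Y] roofsD[OF assms(1)] assms by (simp add: roofsI)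

lemma qm_inv:
 assumes "s:S Z X"
 shows "cls X Z (Z, s, Ident T Z):Hom VB X Z"
  "Comp VB Z X Z (cls X Z (Z, s, Ident T Z)) (qm Z X s) = Ident VB Z"
  "Comp VB X Z X (qm Z X s) (cls X Z (Z, s, Ident T Z)) = Ident VB X"
  "is_iso VB Z X (qm Z X s)" "is_iso VB X Z (cls X Z (Z, s, Ident T Z))"
proof -
 have ob: "X:Ob T" "Z:Ob T" "s:Hom T Z X" using den_sub assms by auto
 show 1: "cls X Z (Z, s, Ident T Z):Hom VB X Z" using ob assms by (intro cls_hom roofsI) auto
 show 2: "Comp VB Z X Z (cls X Z (Z, s, Ident T Z)) (qm Z X s) = Ident VB Z"
  using frac_comp[of "Ident T Z" Z Z "Ident T Z" Z s "Ident T Z" X Z] ob assms unfolding qm_cls by (simp add: roofsI den_id)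
 show 3: "Comp VB X Z X (qm Z X s) (cls X Z (Z, s, Ident T Z)) = Ident VB X"
  using cls_split[of Z s s X X] ob assms cls_dup[OF assms] by (simp add: roofsI)
 show "is_iso VB Z X (qm Z X s)" "is_iso VB X Z (cls X Z (Z, s, Ident T Z))" unfolding is_iso_def using 1 2 3 qm_hom[OF ob(3,2)] by blast+
qed

lemma qm_eq_iff:
 assumes "f:Hom T X Y" "g:Hom T X Y" "X:Ob T" "Y:Ob T"
 shows "qm X Y f = qm X Y g\<longleftrightarrow>(\<exists>W. \<exists>t\<in>S W X. Comp T W X Y f t = Comp T W X Y g t)"
proof -
 have 1: "qm X Y f = qm X Y g\<longleftrightarrow>roof_equiv T N X Y (X, Ident T X, f) (X, Ident T X, g)"
  unfolding qm_cls using assms by (intro cls_eq_iff roofsI den_id) auto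
 show ?thesis unfolding 1
 proof
  assume "roof_equiv T N X Y (X, Ident T X, f) (X, Ident T X, g)"
  then show "\<exists>W. \<exists>t\<in>S W X. Comp T W X Y f t = Comp T W X Y g t" using assms unfolding roof_equiv_def by auto
 next
  assume "\<exists>W. \<exists>t\<in>S W X. Comp T W X Y f t = Comp T W X Y g t"
  then obtain W t where "t:S W X" "Comp T W X Y f t = Comp T W X Y g t" by blast
  then show "roof_equiv T N X Y (X, Ident T X, f) (X, Ident T X, g)" using den_sub[of t W X] assms by (intro roof_equivI[of W t _ t]) auto
 qed
qed

lemma cls_qm_den:
 assumes "(W, w, h):roofs T N X Y" "Y:Ob T"
 shows "Comp VB W X Y (cls X Y (W, w, h)) (qm W X w) = qm W Y h"
 using frac_comp[of "Ident T W" W W "Ident T W" W w h X Y] roofsD[OF assms(1)] assms unfolding qm_cls by (simp add: den_id)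

text \<open>An Ore square over the common source X. Only the leg \<open>p\<close> has to be a
  denominator, since the composite \<open>w\<close> through the other leg \<open>q\<close> is the
  same map.\<close>

lemma common_den:
 assumes "(Z, s, f):roofs T N X Y" "(Z', s', f'):roofs T N X Y'" "Y:Ob T" "Y':Ob T"
 obtains W p q w where "w:S W X" "p:S W Z" "q:Hom T W Z'"
  "w = Comp T W Z X s p" "w = Comp T W Z' X s' q"
  "cls X Y (Z, s, f) = cls X Y (W, w, Comp T W Z Y f p)"
  "cls X Y' (Z', s', f') = cls X Y' (W, w, Comp T W Z' Y' f' q)"
proof -
 note rd = roofsD[OF assms(1)] roofsD[OF assms(2)]
 obtain W p q where w: "W:Ob T" "p:S W Z" "q:Hom T W Z'"
  "Comp T W Z X s p = Comp T W Z' X s' q" using den_ore[OF rd(3) rd(7) rd(1)] by auto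
 have d: "Comp T W Z X s p:S W X" using den_comp[OF w(2) rd(2)] .
 show ?thesis using that[OF d w(2,3) refl w(4) cls_refine[OF assms(1) _ d] ] cls_refine[OF assms(2) w(3)] d w assms by simp
qed

end

section \<open>Functors induced on categories of fractions\<close>

locale den_functor = A: ore T N + B: ore T' N' for T :: "('o, 'm) tri_category" and N and T' :: "('p, 'n) tri_category" and N' +
 fixes F :: "('o, 'm, 'p, 'n) func"
 assumes F: "is_functor T T' F"
  and F_den: "s:denominators T N X Y ==> mor F X Y s:denominators T' N' (ob F X) (ob F Y)"
begin

abbreviation "VF\<equiv>verdier_func T' N' F"

lemma F_roof: "(Z, s, f):roofs T N X Y ==> Y:Ob T ==>
 (ob F Z, mor F Z X s, mor F Z Y f):roofs T' N' (ob F X) (ob F Y)"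
 using A.roofsD[of Z s f X Y] by (intro B.roofsI F_den functor_mor[OF F]) auto

lemma F_roof_equiv:
 assumes "(Z, s, f):roofs T N X Y" "(Z', s', f'):roofs T N X Y" "Y:Ob T"
  "roof_equiv T N X Y (Z, s, f) (Z', s', f')"
 shows "roof_equiv T' N' (ob F X) (ob F Y)
  (ob F Z, mor F Z X s, mor F Z Y f) (ob F Z', mor F Z' X s', mor F Z' Y f')"
proof -
 note rd = A.roofsD[OF assms(1)] A.roofsD[OF assms(2)]
 obtain W p q where w: "W:Ob T" "p:Hom T W Z" "q:Hom T W Z'"
   "Comp T W Z X s p = Comp T W Z' X s' q" "Comp T W Z X s p:A.S W X"
   "Comp T W Z Y f p = Comp T W Z' Y f' q" using assms(4) unfolding roof_equiv_def by auto
 note fc = functor_comp[OF F, symmetric]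
 show ?thesis by (rule B.roof_equivI[of "ob F W" "mor F W Z p" _ "mor F W Z' q"])
    (use w rd assms F_den[OF w(5)] in \<open>simp_all add: fc functor_mor[OF F] functor_ob[OF F]\<close>)
qed

lemma vf_cls:
 assumes "(Z, s, f):roofs T N X Y" "Y:Ob T"
 shows "mor VF X Y (A.cls X Y (Z, s, f)) =
  B.cls (ob F X) (ob F Y) (ob F Z, mor F Z X s, mor F Z Y f)"
proof -
 have FY: "ob F Y:Ob T'" using functor_ob[OF F assms(2)] .
 have "roof_equiv T' N' (ob F X) (ob F Y)
   (ob F Z, mor F Z X s, mor F Z Y f) r'" if "(Z', s', f'):A.cls X Y (Z, s, f)" "r':roofs T' N' (ob F X) (ob F Y)"
   "roof_equiv T' N' (ob F X) (ob F Y) (ob F Z', mor F Z' X s', mor F Z' Y f') r'" for Z' s' f' r'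
 proof -
  have m: "(Z', s', f'):roofs T N X Y" "roof_equiv T N X Y (Z, s, f) (Z', s', f')" using that(1) unfolding roof_class_def by auto
  show ?thesis using B.roof_trans[OF F_roof_equiv[OF assms(1) m(1) assms(2) m(2)] that(3)]
    F_roof assms m that(2) FY by blast
 qed
 moreover have "(Z, s, f):A.cls X Y (Z, s, f)" using A.mem_cls assms by blast
 ultimately show ?thesis unfolding verdier_func_def roof_class_def[of T'] by auto
qed

lemma vf_ob: "ob VF X = ob F X" unfolding verdier_func_def by simp

lemma vf_qm:
 assumes "f:Hom T X Y" "X:Ob T" "Y:Ob T"
 shows "mor VF X Y (A.qm X Y f) = B.qm (ob F X) (ob F Y) (mor F X Y f)" unfolding A.qm_cls B.qm_cls using assms
 by (subst vf_cls) (auto intro!: A.roofsI A.den_id simp: functor_ident[OF F])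

lemma vf_functor: "is_functor A.VB B.VB VF" unfolding is_functor_def
proof (intro conjI ballI)
 fix X assume "X:Ob A.VB"
 then show "ob VF X:Ob B.VB" using functor_ob[OF F] by (simp add: vf_ob)
next
 fix X assume "X:Ob A.VB"
 then have X: "X:Ob T" by simp
 show "mor VF X X (Ident A.VB X) = Ident B.VB (ob VF X)" using vf_qm[of "Ident T X" X X] X
  by (simp add: A.qm_cls B.qm_cls functor_ident[OF F] vf_ob)
next
 fix X Y f assume *: "X:Ob A.VB" "Y:Ob A.VB" "f:Hom A.VB X Y"
 obtain Z s g where g: "(Z, s, g):roofs T N X Y" "f = A.cls X Y (Z, s, g)" using *(3) by (rule A.hom_vbE)
 show "mor VF X Y f:Hom B.VB (ob VF X) (ob VF Y)" unfolding g vf_ob using vf_cls[OF g(1)] F_roof[OF g(1)] * by simp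
next
 fix X Y Z f g
 assume *: "X:Ob A.VB" "Y:Ob A.VB" "Z:Ob A.VB" "f:Hom A.VB X Y" "g:Hom A.VB Y Z"
 obtain V t h where g: "(V, t, h):roofs T N Y Z" "g = A.cls Y Z (V, t, h)" using *(5) by (rule A.hom_vbE)
 note rg = A.roofsD[OF g(1)]
 \<comment> \<open>The first factor is put in normal form with respect to the second, so that the
   composite and its image are both read off from \<open>frac_comp\<close>.\<close>
 obtain U s k where f: "s:A.S U X" "k:Hom T U V" "f = A.cls X Y (U, s, Comp T U V Y t k)" using A.comp_normal[OF *(4) rg(2)] .
 have ob: "U:Ob T" "X:Ob T" "Y:Ob T" "Z:Ob T" using A.den_sub[OF f(1)] * by auto
 have 1: "Comp A.VB X Y Z g f = A.cls X Z (U, s, Comp T U V Z h k)" unfolding f g using A.frac_comp[OF f(1,2) g(1) ob(4)] .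
 have 2: "mor VF X Y f = B.cls (ob F X) (ob F Y) (ob F U, mor F U X s,
   Comp T' (ob F U) (ob F V) (ob F Y) (mor F V Y t) (mor F U V k))" unfolding f using vf_cls[of U s "Comp T U V Y t k" X Y] f rg ob
  by (simp add: A.roofsI functor_comp[OF F])
 have 3: "mor VF X Z (Comp A.VB X Y Z g f) = B.cls (ob F X) (ob F Z) (ob F U, mor F U X s,
   Comp T' (ob F U) (ob F V) (ob F Z) (mor F V Z h) (mor F U V k))" unfolding 1 using vf_cls[of U s "Comp T U V Z h k" X Z] f rg ob
  by (simp add: A.roofsI functor_comp[OF F])
 show "mor VF X Z (Comp A.VB X Y Z g f) =
   Comp B.VB (ob VF X) (ob VF Y) (ob VF Z) (mor VF Y Z g) (mor VF X Y f)"
  unfolding 2 3 vf_ob using vf_cls[OF g(1) ob(4), folded g(2)] F_roof[OF g(1) ob(4)] F_den[OF f(1)]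
   functor_mor[OF F f(2)] functor_ob[OF F] ob rg by (simp add: B.frac_comp)
qed

end

lemma wt_sel [simp]: "Ob (with_triangles C \<T>) = Ob C" "Hom (with_triangles C \<T>) = Hom C"
 "Ident (with_triangles C \<T>) = Ident C" "Comp (with_triangles C \<T>) = Comp C"
 "Shift (with_triangles C \<T>) = Shift C" "ShiftMor (with_triangles C \<T>) = ShiftMor C" unfolding with_triangles_def by simp_all

lemma is_triangle_wt [simp]: "is_triangle (with_triangles C \<T>) = is_triangle C" unfolding is_triangle_def by (intro ext) auto

lemma is_iso_wt [simp]: "is_iso (with_triangles C \<T>) = is_iso C" unfolding is_iso_def by (intro ext) auto

lemma Dist_wt: "Dist (with_triangles C \<T>) = {t. is_triangle C t&(\<exists>t'\<in>\<T>. triangle_iso C t t')}"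
 unfolding with_triangles_def by simp

lemma cat_wt [simp]: "cat (with_triangles C \<T>) = cat C" unfolding cat_def by simp

lemma is_functor_wt_dom [simp]: "is_functor (with_triangles C \<T>) D F = is_functor C D F" unfolding is_functor_def by simp

lemma is_functor_wt_cod [simp]: "is_functor C (with_triangles D \<T>) F = is_functor C D F" unfolding is_functor_def by simp

lemma shift_func_wt [simp]: "shift_func (with_triangles C \<T>) = shift_func C" unfolding shift_func_def by simp

text \<open>Equality on the nose instead of a natural isomorphism, because the connecting
  isomorphism in the goal is an identity.\<close>

definition strict_shift ::
 "('o, 'm, 'y) shift_category_scheme=>('p, 'n, 'z) shift_category_scheme=>('o, 'm, 'p, 'n) func=>bool" where
 "strict_shift C D F\<longleftrightarrow>(\<forall>X\<in>Ob C. ob F (Shift C X) = Shift D (ob F X))&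
  (\<forall>X\<in>Ob C. \<forall>Y\<in>Ob C. \<forall>f\<in>Hom C X Y.
   mor F (Shift C X) (Shift C Y) (ShiftMor C X Y f) = ShiftMor D (ob F X) (ob F Y) (mor F X Y f))"

text \<open>Distinguished triangles are by definition those isomorphic to a generating one, and a
  functor carries an isomorphism of triangles to one, the strict shift taking care of the third
  square. So only the generating triangles have to be checked.\<close>

lemma Dist_image:
 assumes F: "is_functor C D F" and sh: "strict_shift C D F" and Cs: "is_functor C C (shift_func C)"
  and tri: "!!t. t:\<T> ==> is_triangle C t"
  and im: "!!X Y Z u v w. (X, Y, Z, u, v, w):\<T> ==>
   (ob F X, ob F Y, ob F Z, mor F X Y u, mor F Y Z v, mor F Z (Shift C X) w):\<T>'"
  and t: "(X, Y, Z, u, v, w):Dist (with_triangles C \<T>)"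
 shows "(ob F X, ob F Y, ob F Z, mor F X Y u, mor F Y Z v, mor F Z (Shift C X) w)
 :Dist (with_triangles D \<T>')"
proof -
 obtain X' Y' Z' u' v' w' where t': "(X', Y', Z', u', v', w'):\<T>"
  "triangle_iso C (X, Y, Z, u, v, w) (X', Y', Z', u', v', w')" using t unfolding Dist_wt by auto
 have "is_triangle C (X, Y, Z, u, v, w)" using t unfolding Dist_wt by auto
 then have m: "X:Ob C" "Y:Ob C" "Z:Ob C" "u:Hom C X Y" "v:Hom C Y Z" "w:Hom C Z (Shift C X)" unfolding is_triangle_def by auto
 have m': "X':Ob C" "Y':Ob C" "Z':Ob C" "u':Hom C X' Y'" "v':Hom C Y' Z'" "w':Hom C Z' (Shift C X')"
  using tri[OF t'(1)] unfolding is_triangle_def by auto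
 obtain a b c where abc: "is_iso C X X' a" "is_iso C Y Y' b" "is_iso C Z Z' c"
   "Comp C X Y Y' b u = Comp C X X' Y' u' a" "Comp C Y Z Z' c v = Comp C Y Y' Z' v' b"
   "Comp C Z (Shift C X) (Shift C X') (ShiftMor C X X' a) w = Comp C Z Z' (Shift C X') w' c" using t'(2) unfolding triangle_iso_def by auto
 have h: "a:Hom C X X'" "b:Hom C Y Y'" "c:Hom C Z Z'" using abc unfolding is_iso_def by auto
 have S: "Shift C A:Ob C" if "A:Ob C" for A using functor_ob[OF Cs that] by (simp add: shift_func_def)
 have Sm: "ShiftMor C A B f:Hom C (Shift C A) (Shift C B)" if "f:Hom C A B" "A:Ob C" "B:Ob C" for A B f
  using functor_mor[OF Cs that] by (simp add: shift_func_def)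
 note fc = functor_comp[OF F, symmetric]
 have FS: "ob F (Shift C X) = Shift D (ob F X)" "ob F (Shift C X') = Shift D (ob F X')"
  "mor F (Shift C X) (Shift C X') (ShiftMor C X X' a) = ShiftMor D (ob F X) (ob F X') (mor F X X' a)"
  using sh m m' h unfolding strict_shift_def by blast+
 have 3: "Comp D (ob F Z) (Shift D (ob F X)) (Shift D (ob F X'))
   (ShiftMor D (ob F X) (ob F X') (mor F X X' a)) (mor F Z (Shift C X) w) =
  Comp D (ob F Z) (ob F Z') (Shift D (ob F X')) (mor F Z' (Shift C X') w') (mor F Z Z' c)"
  unfolding FS[symmetric] using m m' h S Sm by (simp add: fc abc(6))
 have "is_triangle D (ob F X, ob F Y, ob F Z, mor F X Y u, mor F Y Z v, mor F Z (Shift C X) w)"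
  unfolding is_triangle_def using functor_mor[OF F m(6,3)] S m FS by (auto intro: functor_ob[OF F] functor_mor[OF F])
 moreover have "triangle_iso D (ob F X, ob F Y, ob F Z, mor F X Y u, mor F Y Z v, mor F Z (Shift C X) w)
   (ob F X', ob F Y', ob F Z', mor F X' Y' u', mor F Y' Z' v', mor F Z' (Shift C X') w')" unfolding triangle_iso_def using abc m m' h 3
  by (auto intro!: exI functor_iso[OF F] simp: fc)
 ultimately show ?thesis unfolding Dist_wt using im[OF t'(1)] by blast
qed

lemma strict_triangle_functor:
 assumes "cat T" "cat T'" "is_functor T T (shift_func T)" "is_functor T' T' (shift_func T')"
  and F: "is_functor T T' F" "strict_shift T T' F"
  and tri: "!!t. t:Dist T ==> is_triangle T t"
  and D: "!!X Y Z u v w. (X, Y, Z, u, v, w):Dist T ==>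
   (ob F X, ob F Y, ob F Z, mor F X Y u, mor F Y Z v, mor F Z (Shift T X) w):Dist T'"
 shows "is_triangle_functor T T' F (\<lambda>X. Ident T' (Shift T' (ob F X)))"
proof -
 interpret A: cat T by fact
 interpret B: cat T' by fact
 have S: "Shift T X:Ob T" if "X:Ob T" for X using functor_ob[OF assms(3) that] by (simp add: shift_func_def)
 have S': "Shift T' X:Ob T'" if "X:Ob T'" for X using functor_ob[OF assms(4) that] by (simp add: shift_func_def)
 have Sm': "ShiftMor T' X Y f:Hom T' (Shift T' X) (Shift T' Y)" if "f:Hom T' X Y" "X:Ob T'" "Y:Ob T'" for X Y f
  using functor_mor[OF assms(4) that] by (simp add: shift_func_def)
 have FS: "X:Ob T ==> ob F (Shift T X) = Shift T' (ob F X)" for X using F(2) unfolding strict_shift_def by blast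
 have FSm: "[|X:Ob T; Y:Ob T; f:Hom T X Y|] ==> mor F (Shift T X) (Shift T Y) (ShiftMor T X Y f)
   = ShiftMor T' (ob F X) (ob F Y) (mor F X Y f)" for X Y f using F(2) unfolding strict_shift_def by blast
 have "is_nat_iso T T' (comp_func F (shift_func T)) (comp_func (shift_func T') F)
   (\<lambda>X. Ident T' (Shift T' (ob F X)))" unfolding is_nat_iso_def comp_func_def shift_func_def
  using FS FSm functor_ob[OF F(1)] S' functor_mor[OF F(1)] Sm' B.iso_ident by auto
 moreover have "Comp T' (ob F Z) (ob F (Shift T X)) (Shift T' (ob F X))
     (Ident T' (Shift T' (ob F X))) (mor F Z (Shift T X) w) = mor F Z (Shift T X) w" if "(X, Y, Z, u, v, w):Dist T" for X Y Z u v w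
 proof -
  have m: "X:Ob T" "Z:Ob T" "w:Hom T Z (Shift T X)" using tri[OF that] unfolding is_triangle_def by auto
  then show ?thesis using functor_mor[OF F(1) m(3,2) S[OF m(1)]] FS[OF m(1)] functor_ob[OF F(1)] S' by auto
 qed
 ultimately show ?thesis unfolding is_triangle_functor_def using F(1) D by auto
qed

text \<open>\<open>is_equivalence\<close> asks for an explicit quasi-inverse. On objects it is a
  chosen preimage \<open>g Y\<close> with an isomorphism \<open>e Y\<close>; on morphisms it is the
  preimage under \<open>F\<close> of the conjugate \<open>k\<close> by these isomorphisms.
  Faithfulness turns every law for \<open>G\<close> into one in the target.\<close>

lemma ff_ess_equivalence:
 assumes "cat C" "cat D" and F: "is_functor C D F"
  and full: "!!X Y g. [|X:Ob C; Y:Ob C; g:Hom D (ob F X) (ob F Y)|] ==>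
   \<exists>f\<in>Hom C X Y. mor F X Y f = g"
  and faithful: "!!X Y f g. [|X:Ob C; Y:Ob C; f:Hom C X Y; g:Hom C X Y;
   mor F X Y f = mor F X Y g|] ==> f = g"
  and ess: "!!Y. Y:Ob D ==> \<exists>X\<in>Ob C. \<exists>e. is_iso D (ob F X) Y e"
 shows "is_equivalence C D F"
proof -
 interpret C: cat C by fact
 interpret D: cat D by fact
 have "\<forall>Y\<in>Ob D. \<exists>X e e'. X:Ob C&e:Hom D (ob F X) Y&e':Hom D Y (ob F X)&
   Comp D (ob F X) Y (ob F X) e' e = Ident D (ob F X)&Comp D Y (ob F X) Y e e' = Ident D Y" using ess unfolding is_iso_def by meson
 then obtain g e e' where
  gO: "!!Y. Y:Ob D ==> g Y:Ob C" and e: "!!Y. Y:Ob D ==> e Y:Hom D (ob F (g Y)) Y"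
  and e': "!!Y. Y:Ob D ==> e' Y:Hom D Y (ob F (g Y))"
  and e'e: "!!Y. Y:Ob D ==> Comp D (ob F (g Y)) Y (ob F (g Y)) (e' Y) (e Y) = Ident D (ob F (g Y))"
  and ee': "!!Y. Y:Ob D ==> Comp D Y (ob F (g Y)) Y (e Y) (e' Y) = Ident D Y" by metis
 note FO = functor_ob[OF F]
 note FM = functor_mor[OF F]
 note FC = functor_comp[OF F]
 define p where "p X Y h = (SOME f. f:Hom C X Y&mor F X Y f = h)" for X Y h
 have p: "p X Y h:Hom C X Y" "mor F X Y (p X Y h) = h" if "X:Ob C" "Y:Ob C" "h:Hom D (ob F X) (ob F Y)" for X Y h
  using someI_ex[of "\<lambda>f. f:Hom C X Y&mor F X Y f = h"] full[OF that] unfolding p_def by blast+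
 define k where "k Y Y' h = Comp D (ob F (g Y)) Y (ob F (g Y')) (Comp D Y Y' (ob F (g Y')) (e' Y') h) (e Y)" for Y Y' h
 have k: "k Y Y' h:Hom D (ob F (g Y)) (ob F (g Y'))" if "Y:Ob D" "Y':Ob D" "h:Hom D Y Y'" for Y Y' h
  unfolding k_def using that e e' FO gO by simp
 have ek: "Comp D (ob F (g Y)) (ob F (g Y')) Y' (e Y') (k Y Y' h) = Comp D (ob F (g Y)) Y Y' h (e Y)"
  if "Y:Ob D" "Y':Ob D" "h:Hom D Y Y'" for Y Y' h
  unfolding k_def using that e e' FO gO D.comp_inv_ext[OF ee'[OF that(2)]] by (simp add: D.comp_assoc)
 have ecancel: "x = y" if "Comp D A (ob F (g Y)) Y (e Y) x = Comp D A (ob F (g Y)) Y (e Y) y"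
  "x:Hom D A (ob F (g Y))" "y:Hom D A (ob F (g Y))" "Y:Ob D" "A:Ob D" for A Y x y
  using D.comp_inv_ext[OF e'e[OF that(4)] e'[OF that(4)] e[OF that(4)]] that FO gO by metis
 define G where "G = \<lparr>on_ob = g, on_mor = (\<lambda>Y Y' h. p (g Y) (g Y') (k Y Y' h))\<rparr>"
 have G: "ob G = g" "mor G Y Y' h = p (g Y) (g Y') (k Y Y' h)" for Y Y' h unfolding G_def by auto
 have Gm: "mor G Y Y' h:Hom C (g Y) (g Y')" "mor F (g Y) (g Y') (mor G Y Y' h) = k Y Y' h" if "Y:Ob D" "Y':Ob D" "h:Hom D Y Y'" for Y Y' h
  unfolding G using p k that gO by auto
 have GF: "is_functor D C G" unfolding is_functor_def
 proof (intro conjI ballI)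
  fix X assume X: "X:Ob D"
  then show "ob G X:Ob C" using gO G by simp
  have "k X X (Ident D X) = Ident D (ob F (g X))" unfolding k_def using X e e' gO FO e'e by simp
  then show "mor G X X (Ident D X) = Ident C (ob G X)" using X gO Gm[OF X X D.ident_in[OF X]] unfolding G(1)
   by (intro faithful[of "g X" "g X"]) (simp_all add: functor_ident[OF F])
 next
  fix X Y f assume "X:Ob D" "Y:Ob D" "f:Hom D X Y"
  then show "mor G X Y f:Hom C (ob G X) (ob G Y)" using Gm by (simp add: G)
 next
  fix X Y Z f h assume *: "X:Ob D" "Y:Ob D" "Z:Ob D" "f:Hom D X Y" "h:Hom D Y Z"
  \<comment> \<open>Functoriality of \<open>k\<close> is checked after composing with the
    isomorphism \<open>e Z\<close>, where \<open>ek\<close> slides \<open>e\<close> past each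
    conjugate; \<open>ecancel\<close> then removes it.\<close>
  have "Comp D (ob F (g X)) (ob F (g Z)) Z (e Z) (k X Z (Comp D X Y Z h f)) =
    Comp D (ob F (g X)) (ob F (g Z)) Z (e Z)
     (Comp D (ob F (g X)) (ob F (g Y)) (ob F (g Z)) (k Y Z h) (k X Y f))"
  proof -
   have "Comp D (ob F (g X)) (ob F (g Z)) Z (e Z)
     (Comp D (ob F (g X)) (ob F (g Y)) (ob F (g Z)) (k Y Z h) (k X Y f)) =
     Comp D (ob F (g X)) (ob F (g Y)) Z (Comp D (ob F (g Y)) (ob F (g Z)) Z (e Z) (k Y Z h)) (k X Y f)"
    using * k e FO gO by (simp add: D.comp_assoc)
   also have "\<dots> = Comp D (ob F (g X)) Y Z h (Comp D (ob F (g X)) (ob F (g Y)) Y (e Y) (k X Y f))"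
    using * k[OF *(1,2,4)] e FO gO by (simp add: ek D.comp_assoc del: ek[OF *(1,2,4)])
   also have "\<dots> = Comp D (ob F (g X)) (ob F (g Z)) Z (e Z) (k X Z (Comp D X Y Z h f))" using * e FO gO by (simp add: ek D.comp_assoc)
   finally show ?thesis ..
  qed
  then have "k X Z (Comp D X Y Z h f) =
    Comp D (ob F (g X)) (ob F (g Y)) (ob F (g Z)) (k Y Z h) (k X Y f)" by (rule ecancel) (use * k gO FO in auto)
  then show "mor G X Z (Comp D X Y Z h f) =
    Comp C (ob G X) (ob G Y) (ob G Z) (mor G Y Z h) (mor G X Y f)"
   using * Gm gO unfolding G(1) by (intro faithful[of "g X" "g Z"]) (auto simp: FC)
 qed
 have "is_iso D (ob F (g Y)) Y (e Y)" if "Y:Ob D" for Y unfolding is_iso_def using e e' e'e ee' that by blast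
 then have 1: "is_nat_iso D D (comp_func F G) id_func e" unfolding is_nat_iso_def comp_func_def id_func_def using ek Gm by (auto simp: G(1))
 define t where "t X = p (g (ob F X)) X (e (ob F X))" for X
 have t: "t X:Hom C (g (ob F X)) X" "mor F (g (ob F X)) X (t X) = e (ob F X)" if "X:Ob C" for X unfolding t_def using p that gO FO e by auto
 have ti: "is_iso C (g (ob F X)) X (t X)" if X: "X:Ob C" for X
 proof -
  obtain s where s: "s:Hom C X (g (ob F X))" "mor F X (g (ob F X)) s = e' (ob F X)"
   using full[of X "g (ob F X)" "e' (ob F X)"] X gO FO e' by blast
  have "Comp C (g (ob F X)) X (g (ob F X)) s (t X) = Ident C (g (ob F X))"
   using X gO FO t s e'e by (intro faithful[of "g (ob F X)" "g (ob F X)"]) (auto simp: FC functor_ident[OF F])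
  moreover have "Comp C X (g (ob F X)) X (t X) s = Ident C X"
   using X gO FO t s ee' by (intro faithful[of X X]) (auto simp: FC functor_ident[OF F])
  ultimately show ?thesis unfolding is_iso_def using s t X by blast
 qed
 have "Comp C (g (ob F X)) (g (ob F Y)) Y (t Y) (mor G (ob F X) (ob F Y) (mor F X Y f)) =
   Comp C (g (ob F X)) X Y f (t X)" if "X:Ob C" "Y:Ob C" "f:Hom C X Y" for X Y f
  using that gO FO FM t Gm ek by (intro faithful[of "g (ob F X)" Y]) (auto simp: FC)
 then have 2: "is_nat_iso C C (comp_func G F) id_func t" unfolding is_nat_iso_def comp_func_def id_func_def using ti by (auto simp: G(1))
 show ?thesis unfolding is_equivalence_def using F GF 1 2 by blast
qed


text \<open>\<open>N\<close> is the null system of the first localization, \<open>N'\<close> that of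
  the composite, and \<open>N\<^sub>2\<close> the class of objects killed in the second step.
  \<open>den2\<close> says that the denominators of the second step are exactly the fractions f s^-1
  with s in the small and f in the large class. \<open>den_left\<close> is the part of
  two-out-of-three that keeps a leg of an Ore square in the large class.\<close>

locale two_step = A: ore T N + B: ore T N' for T :: "('o, 'm) tri_category" and N N' +
 fixes N\<^sub>2 :: "'o set"
 assumes den_mono: "denominators T N X Y<=denominators T N' X Y"
  and den_left: "[|s:denominators T N V Y; f:Hom T X V; X:Ob T;
   Comp T X V Y s f:denominators T N' X Y|] ==> f:denominators T N' X V"
  and den2: "denominators (verdier_quotient T N) N\<^sub>2 X Y = roof_class T N X Y `
   {(Z, s, f). s:denominators T N Z X&f:denominators T N' Z Y}"
  and shift: "is_functor T T (shift_func T)"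
  and shift_den: "s:denominators T N X Y ==> ShiftMor T X Y s:denominators T N (Shift T X) (Shift T Y)"
  and shift_den': "s:denominators T N' X Y ==> ShiftMor T X Y s:denominators T N' (Shift T X) (Shift T Y)"
  and dist_tri: "t:Dist T ==> is_triangle T t"
begin

abbreviation "VQ\<equiv>verdier_quotient T N"
abbreviation "VQ2\<equiv>verdier_quotient VQ N\<^sub>2"

lemma den2E:
 assumes "\<sigma>:denominators VQ N\<^sub>2 X Y"
 obtains Z s f where "s:A.S Z X" "f:B.S Z Y" "(Z, s, f):roofs T N X Y" "\<sigma> = A.cls X Y (Z, s, f)"
 using assms A.roofsI B.den_hom unfolding den2 by auto

lemma den2I: "s:A.S Z X ==> f:B.S Z Y ==> A.cls X Y (Z, s, f):denominators VQ N\<^sub>2 X Y" unfolding den2 by auto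

lemma den2_qm: "f:B.S X Y ==> A.qm X Y f:denominators VQ N\<^sub>2 X Y"
 unfolding A.qm_cls using B.den_sub[of f X Y] by (auto intro!: den2I A.den_id)

lemma VQ_sel [simp]: "Ob VQ = Ob T" "Hom VQ = Hom A.VB" "Comp VQ = Comp A.VB" "Ident VQ = Ident A.VB"
 "Shift VQ = Shift T" unfolding verdier_quotient_def by simp_all

text \<open>Each axiom for the second localization is reduced to \<open>T\<close> by clearing
  denominators of the first: numerators are then honest morphisms, to which the Ore axioms of
  \<open>N\<close> or \<open>N'\<close> apply, and the resulting maps are pushed back by
  \<open>den2_qm\<close>.\<close>

lemma ore2: "ore VQ N\<^sub>2"
proof (rule ore.intro)
 show "cat VQ" unfolding verdier_quotient_def using A.vb_cat by simp
 show "ore_axioms VQ N\<^sub>2"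
 proof
  fix s X Y assume "s:denominators VQ N\<^sub>2 X Y"
  then obtain Z r f where *: "r:A.S Z X" "f:B.S Z Y" "(Z, r, f):roofs T N X Y" "s = A.cls X Y (Z, r, f)" by (rule den2E)
  then show "X:Ob VQ&Y:Ob VQ&s:Hom VQ X Y" using A.den_sub B.den_sub by auto
 next
  fix X assume "X:Ob VQ"
  then show "Ident VQ X:denominators VQ N\<^sub>2 X X" using den2I[OF A.den_id B.den_id] by simp
 next
  fix s t X Y Z assume "s:denominators VQ N\<^sub>2 X Y" "t:denominators VQ N\<^sub>2 Y Z"
  then obtain U r f U' r' f' where 1: "r:A.S U X" "f:B.S U Y" "s = A.cls X Y (U, r, f)"
   "(U, r, f):roofs T N X Y"
   and 2: "r':A.S U' Y" "f':B.S U' Z" "t = A.cls Y Z (U', r', f')"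
   "(U', r', f'):roofs T N Y Z" by (elim den2E) auto
  have ob: "X:Ob T" "Y:Ob T" "Z:Ob T" "U:Ob T" "U':Ob T" using A.den_sub 1 2 B.den_sub by auto
  obtain K a g where k: "a:A.S K U" "g:Hom T K U'" "Comp T K U Y f a = Comp T K U' Y r' g" "K:Ob T"
   using A.den_ore[OF B.den_hom[OF 1(2)] 2(1) ob(4)] by auto
  have fa: "Comp T K U Y f a:B.S K Y" using B.den_comp 1 k den_mono by blast
  \<comment> \<open>The composite of \<open>g\<close> with \<open>r'\<close> equals f a, which lies
    in the large class, and \<open>r'\<close> is a denominator of the first step.\<close>
  have g: "g:B.S K U'" using den_left[OF 2(1) k(2)] k fa by simp
  have d: "Comp T K U X r a:A.S K X" using A.den_comp 1 k by blast
  have s: "s = A.cls X Y (K, Comp T K U X r a, Comp T K U' Y r' g)"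
   unfolding 1(3) k(3)[symmetric] using A.cls_refine[OF 1(4) _ d] k ob by simp
  have "Comp A.VB X Y Z t s = A.cls X Z (K, Comp T K U X r a, Comp T K U' Z f' g)"
   unfolding s 2(3) using A.frac_comp[OF d k(2) 2(4) ob(3)] .
  then show "Comp VQ X Y Z t s:denominators VQ N\<^sub>2 X Z" using den2I[OF d B.den_comp[OF g 2(2)]] by simp
 next
  fix \<phi> \<tau> U V Y assume *: "\<phi>:Hom VQ U Y" "\<tau>:denominators VQ N\<^sub>2 V Y" "U:Ob VQ"
  obtain V' r t where 1: "r:A.S V' V" "t:B.S V' Y" "(V', r, t):roofs T N V Y" "\<tau> = A.cls V Y (V', r, t)" using *(2) by (rule den2E)
  obtain U' s f where 2: "(U', s, f):roofs T N U Y" "\<phi> = A.cls U Y (U', s, f)" using *(1) A.hom_vbE by auto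
  note rd = A.roofsD[OF 1(3)] A.roofsD[OF 2(1)]
  have ob: "V:Ob T" "Y:Ob T" using rd B.den_sub 1 by auto
  obtain W t' f' where w: "W:Ob T" "t':B.S W U'" "f':Hom T W V'"
   "Comp T W U' Y f t' = Comp T W V' Y t f'" using B.den_ore[OF rd(9) 1(2) rd(6)] by auto
  have d: "Comp T W U' U s t':B.S W U" using B.den_comp w(2) rd(7) den_mono by blast
  have h: "Comp T W V' V r f':Hom T W V" using w rd by simp
  have "Comp A.VB W U Y \<phi> (A.qm W U (Comp T W U' U s t')) = A.qm W Y (Comp T W U' Y f t')"
   unfolding 2(2) A.qm_cls using w ob by (intro A.frac_comp 2 A.den_id) auto
  moreover have "Comp A.VB W V Y \<tau> (A.qm W V (Comp T W V' V r f')) = A.qm W Y (Comp T W V' Y t f')"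
   unfolding 1(4) A.qm_cls using w ob by (intro A.frac_comp 1 A.den_id) auto
  ultimately show "\<exists>W\<in>Ob VQ. \<exists>t'\<in>denominators VQ N\<^sub>2 W U. \<exists>f'\<in>Hom VQ W V.
    Comp VQ W U Y \<phi> t' = Comp VQ W V Y \<tau> f'" using w den2_qm[OF d] A.qm_hom[OF h w(1)] unfolding VQ_sel by metis
 next
  fix f g \<sigma> X Y Z assume *: "f:Hom VQ X Y" "g:Hom VQ X Y" "X:Ob VQ"
   "\<sigma>:denominators VQ N\<^sub>2 Y Z" "Comp VQ X Y Z \<sigma> f = Comp VQ X Y Z \<sigma> g"
  obtain Y' r t where 1: "r:A.S Y' Y" "t:B.S Y' Z" "(Y', r, t):roofs T N Y Z" "\<sigma> = A.cls Y Z (Y', r, t)" using *(4) by (rule den2E)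
  note r1 = A.roofsD[OF 1(3)]
  have ob: "X:Ob T" "Y:Ob T" "Z:Ob T" using r1 B.den_sub 1 * by auto
  obtain U1 s1 f1 where f: "s1:A.S U1 X" "f1:Hom T U1 Y'" "f = A.cls X Y (U1, s1, Comp T U1 Y' Y r f1)"
   using A.comp_normal *(1) 1(1) unfolding VQ_sel by blast
  obtain U2 s2 g1 where g: "s2:A.S U2 X" "g1:Hom T U2 Y'" "g = A.cls X Y (U2, s2, Comp T U2 Y' Y r g1)"
   using A.comp_normal *(2) 1(1) unfolding VQ_sel by blast
  have ob2: "U1:Ob T" "U2:Ob T" using A.den_sub f g by auto
  have fr: "(U1, s1, Comp T U1 Y' Y r f1):roofs T N X Y" "(U2, s2, Comp T U2 Y' Y r g1):roofs T N X Y"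
   using f g r1 ob ob2 by (auto intro!: A.roofsI)
  obtain W p q w where w: "w:A.S W X" "p:A.S W U1" "q:Hom T W U2"
   "f = A.cls X Y (W, w, Comp T W U1 Y (Comp T U1 Y' Y r f1) p)"
   "g = A.cls X Y (W, w, Comp T W U2 Y (Comp T U2 Y' Y r g1) q)" using A.common_den[OF fr ob(2,2)] f(3) g(3) by metis
  have W: "W:Ob T" using A.den_sub w(1) by blast
  \<comment> \<open>Over the common denominator \<open>w\<close> both morphisms have numerators that
    factor through \<open>r\<close>, the denominator of \<open>\<sigma>\<close>. Composing with
    \<open>\<sigma>\<close> cancels \<open>r\<close> and leaves an equation between t f2 and t g2,
    which can be tested in \<open>T\<close>.\<close>
  define f2 g2 where "f2 = Comp T W U1 Y' f1 p" and "g2 = Comp T W U2 Y' g1 q"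
  have f2: "f2:Hom T W Y'" "f = A.cls X Y (W, w, Comp T W Y' Y r f2)"
   and g2: "g2:Hom T W Y'" "g = A.cls X Y (W, w, Comp T W Y' Y r g2)"
   using f(2) g(2) w W r1 ob ob2 unfolding f2_def g2_def by (auto simp: A.comp_assoc)
  have "A.cls X Z (W, w, Comp T W Y' Z t f2) = A.cls X Z (W, w, Comp T W Y' Z t g2)"
   using A.frac_comp[OF w(1) f2(1) 1(3) ob(3)] A.frac_comp[OF w(1) g2(1) 1(3) ob(3)] *(5) unfolding f2 g2 1(4) by simp
  then have "A.qm W Z (Comp T W Y' Z t f2) = A.qm W Z (Comp T W Y' Z t g2)"
   using A.cls_qm_den[of W w _ X Z] f2 g2 w W r1 ob by (metis A.comp_in A.roofsI)
  then obtain K b where k: "b:A.S K W" "Comp T K W Z (Comp T W Y' Z t f2) b = Comp T K W Z (Comp T W Y' Z t g2) b"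
   using A.qm_eq_iff f2 g2 W r1 ob by (metis A.comp_in)
  have K: "K:Ob T" using A.den_sub k by blast
  have "Comp T K Y' Z t (Comp T K W Y' f2 b) = Comp T K Y' Z t (Comp T K W Y' g2 b)" using k K f2 g2 W r1 ob by (simp add: A.comp_assoc)
  from B.den_cancel[OF _ _ K 1(2) this] obtain L c where
   l: "L:Ob T" "c:B.S L K" "Comp T L K Y' (Comp T K W Y' f2 b) c = Comp T L K Y' (Comp T K W Y' g2 b) c" using f2 g2 k K W r1 by auto
  define d where "d = Comp T L K W b c"
  have d: "d:B.S L W" unfolding d_def using B.den_comp l k den_mono by blast
  have eq: "Comp T L W Y' f2 d = Comp T L W Y' g2 d" unfolding d_def using l k(1) K f2(1) g2(1) W r1 by (simp add: A.comp_assoc)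
  have wd: "Comp T L W X w d:B.S L X" using B.den_comp[OF d] w(1) den_mono by blast
  have "Comp A.VB L X Y (A.cls X Y (W, w, Comp T W Y' Y r h)) (A.qm L X (Comp T L W X w d)) =
    A.qm L Y (Comp T L Y' Y r (Comp T L W Y' h d))" if "h:Hom T W Y'" for h
   unfolding A.qm_cls using A.frac_comp[of "Ident T L" L L d W w "Comp T W Y' Y r h" X Y] that w(1) d l W r1 ob
   by (simp add: A.den_id A.roofsI A.comp_assoc)
  then show "\<exists>W\<in>Ob VQ. \<exists>t\<in>denominators VQ N\<^sub>2 W X. Comp VQ W X Y f t = Comp VQ W X Y g t"
   using den2_qm[OF wd] l(1) f2 g2 eq unfolding VQ_sel by metis
 qed
qed

sublocale V: ore VQ N\<^sub>2 by (rule ore2)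

abbreviation Q where "Q X Y f\<equiv>quotient_mor VQ N\<^sub>2 X Y (A.qm X Y f)"

lemma VQ2_sel [simp]: "Ob VQ2 = Ob T" "Hom VQ2 = Hom V.VB" "Comp VQ2 = Comp V.VB" "Ident VQ2 = Ident V.VB"
 "Shift VQ2 = Shift T" unfolding verdier_quotient_def[of VQ] by simp_all

lemma qmV: "[|f:Hom T X Y; X:Ob T|] ==> A.qm X Y f:Hom VQ X Y" using A.qm_hom by simp

lemma Q_hom: "[|f:Hom T X Y; X:Ob T|] ==> Q X Y f:Hom V.VB X Y" by (intro V.qm_hom qmV) auto

lemma Q_comp:
 assumes "f:Hom T X Y" "g:Hom T Y Z" "X:Ob T" "Y:Ob T" "Z:Ob T"
 shows "Q X Z (Comp T X Y Z g f) = Comp V.VB X Y Z (Q Y Z g) (Q X Y f)"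
 using V.qm_comp[of "A.qm X Y f" X Y "A.qm Y Z g" Z] qmV assms A.qm_comp[OF assms] by simp

lemma Q_iso: "w:B.S Z X ==> is_iso V.VB Z X (Q Z X w)" using V.qm_inv(4)[OF den2_qm] .

sublocale VV: cat V.VB by (rule V.vb_cat)

text \<open>The denominator of the outer fraction is itself a fraction by \<open>den2\<close>.
  Bringing it and the numerator to a common inner denominator \<open>u\<close> clears both layers
  with the single map \<open>w'\<close> of the large class.\<close>

lemma Q_gen:
 assumes "c:Hom V.VB X Y" "Y:Ob T"
 obtains Z w f where "w:B.S Z X" "f:Hom T Z Y" "Comp V.VB Z X Y c (Q Z X w) = Q Z Y f"
proof -
 obtain Z \<sigma> \<phi> where c: "(Z, \<sigma>, \<phi>):roofs VQ N\<^sub>2 X Y" "c = V.cls X Y (Z, \<sigma>, \<phi>)"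
  using assms(1) by (rule V.hom_vbE)
 note rd = V.roofsD[OF c(1), unfolded VQ_sel(1)]
 obtain Z1 s1 f1 where 1: "s1:A.S Z1 Z" "f1:B.S Z1 X" "(Z1, s1, f1):roofs T N Z X" "\<sigma> = A.cls Z X (Z1, s1, f1)"
  using rd(2) by (rule den2E)
 obtain Z2 s2 f2 where 2: "(Z2, s2, f2):roofs T N Z Y" "\<phi> = A.cls Z Y (Z2, s2, f2)" using rd(4)[unfolded VQ_sel(2)] by (rule A.hom_vbE)
 obtain W p q u where w: "u:A.S W Z" "p:A.S W Z1" "q:Hom T W Z2"
   "\<sigma> = A.cls Z X (W, u, Comp T W Z1 X f1 p)" "\<phi> = A.cls Z Y (W, u, Comp T W Z2 Y f2 q)"
  using A.common_den[OF 1(3) 2(1) rd(5) assms(2)] 1(4) 2(2) by metis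
 have W: "W:Ob T" using A.den_sub w(1) by blast
 define w' where "w' = Comp T W Z1 X f1 p"
 define f where "f = Comp T W Z2 Y f2 q"
 have w': "w':B.S W X" unfolding w'_def using B.den_comp w(2) 1(2) den_mono by blast
 have f: "f:Hom T W Y" unfolding f_def using w A.roofsD[OF 2(1)] assms W by auto
 have r: "(W, u, w'):roofs T N Z X" "(W, u, f):roofs T N Z Y" using w w' f by (auto intro!: A.roofsI)
 have e: "A.qm W X w' = Comp VQ W Z X \<sigma> (A.qm W Z u)" "A.qm W Y f = Comp VQ W Z Y \<phi> (A.qm W Z u)"
  using A.cls_qm_den[OF r(1) rd(5)] A.cls_qm_den[OF r(2) assms(2)] unfolding w(4,5) w'_def f_def by simp_all
 have qu: "A.qm W Z u:Hom VQ W Z" using w(1) W by (intro qmV) auto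
 have V2: "V.qm Z X \<sigma>:Hom V.VB Z X" "V.qm W Z (A.qm W Z u):Hom V.VB W Z"
  using V.qm_hom[OF V.den_hom[OF rd(2)]] V.qm_hom[OF qu] rd(1) W unfolding VQ_sel(1) by blast+
 have 3: "Comp V.VB Z X Y c (V.qm Z X \<sigma>) = V.qm Z Y \<phi>" unfolding c(2) using V.cls_qm_den[OF c(1)] assms(2) by simp
 have 5: "V.qm W X (Comp VQ W Z X \<sigma> (A.qm W Z u)) = Comp V.VB W Z X (V.qm Z X \<sigma>) (Q W Z u)"
  using V.qm_comp[OF qu V.den_hom[OF rd(2)]] rd(1,5) W unfolding VQ_sel(1) by blast
 have 6: "V.qm W Y (Comp VQ W Z Y \<phi> (A.qm W Z u)) = Comp V.VB W Z Y (V.qm Z Y \<phi>) (Q W Z u)"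
  using V.qm_comp[OF qu rd(4)] rd(1) W assms(2) unfolding VQ_sel(1) by blast
 have "Comp V.VB W X Y c (Q W X w') = Comp V.VB W Z Y (Comp V.VB Z X Y c (V.qm Z X \<sigma>)) (Q W Z u)"
  unfolding e 5 using V2 assms rd W by (subst VV.comp_assoc) auto
 also have "\<dots> = Q W Y f" unfolding 3 e 6 ..
 finally show ?thesis using that w' f by blast
qed

text \<open>Together with \<open>Q_gen\<close> this is all that is used of the double quotient: it
  behaves as the localization of \<open>T\<close> at the large class.\<close>

lemma Q_eq_iff:
 assumes "f:Hom T X Y" "g:Hom T X Y" "X:Ob T" "Y:Ob T"
 shows "Q X Y f = Q X Y g\<longleftrightarrow>(\<exists>W. \<exists>t\<in>B.S W X. Comp T W X Y f t = Comp T W X Y g t)"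
proof
 assume "Q X Y f = Q X Y g"
 then obtain W \<tau> where t: "\<tau>:denominators VQ N\<^sub>2 W X"
  "Comp VQ W X Y (A.qm X Y f) \<tau> = Comp VQ W X Y (A.qm X Y g) \<tau>"
  using V.qm_eq_iff[of "A.qm X Y f" X Y "A.qm X Y g"] assms qmV by auto
 obtain Z r t where 1: "r:A.S Z W" "t:B.S Z X" "(Z, r, t):roofs T N W X" "\<tau> = A.cls W X (Z, r, t)" using t(1) by (rule den2E)
 note rd = A.roofsD[OF 1(3)]
 have "A.cls W Y (Z, r, Comp T Z X Y f t) = A.cls W Y (Z, r, Comp T Z X Y g t)" using t(2) A.qm_comp_cls[OF 1(3)] assms 1(4) by simp
 then have "A.qm Z Y (Comp T Z X Y f t) = A.qm Z Y (Comp T Z X Y g t)"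
  using A.cls_qm_den[of Z r _ W Y] rd assms by (metis A.comp_in A.roofsI)
 then obtain K b where k: "b:A.S K Z" "Comp T K Z Y (Comp T Z X Y f t) b = Comp T K Z Y (Comp T Z X Y g t) b"
  using A.qm_eq_iff assms rd by (metis A.comp_in)
 have "K:Ob T" using A.den_sub k by blast
 then have "Comp T K X Y f (Comp T K Z X t b) = Comp T K X Y g (Comp T K Z X t b)" using k assms rd by (simp add: A.comp_assoc)
 moreover have "Comp T K Z X t b:B.S K X" using B.den_comp k(1) 1(2) den_mono by blast
 ultimately show "\<exists>W. \<exists>t\<in>B.S W X. Comp T W X Y f t = Comp T W X Y g t" by blast
next
 assume "\<exists>W. \<exists>t\<in>B.S W X. Comp T W X Y f t = Comp T W X Y g t"
 then obtain W t where t: "t:B.S W X" "Comp T W X Y f t = Comp T W X Y g t" by blast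
 have W: "W:Ob T" using B.den_sub t by blast
 show "Q X Y f = Q X Y g" using VV.iso_cancel[OF Q_iso[OF t(1)] Q_hom[OF assms(1,3)] Q_hom[OF assms(2,3)]]
   Q_comp[OF B.den_hom[OF t(1)] assms(1) W assms(3,4)] Q_comp[OF B.den_hom[OF t(1)] assms(2) W assms(3,4)]
   t(2) assms(3,4) W by simp
qed

lemma shiftA: "den_functor T N T N (shift_func T)" by unfold_locales (rule shift, simp add: shift_func_def shift_den)

lemma shift_func_VB: "shift_func A.VB = verdier_func T N (shift_func T)" unfolding shift_func_def verdier_func_def verdier_base_def by simp

lemma shift_VQ: "is_functor VQ VQ (shift_func VQ)"
 using den_functor.vf_functor[OF shiftA] unfolding verdier_quotient_def by (simp add: shift_func_VB)

lemma shift_den2: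
 assumes "s:denominators VQ N\<^sub>2 X Y"
 shows "ShiftMor VQ X Y s:denominators VQ N\<^sub>2 (Shift VQ X) (Shift VQ Y)"
proof -
 interpret SF: den_functor T N T N "shift_func T" by (rule shiftA)
 obtain Z r t where 1: "r:A.S Z X" "t:B.S Z Y" "(Z, r, t):roofs T N X Y" "s = A.cls X Y (Z, r, t)" using assms by (rule den2E)
 have "ShiftMor VQ X Y s = mor (shift_func A.VB) X Y s" unfolding verdier_quotient_def shift_func_def by simp
 also have "\<dots> = A.cls (Shift T X) (Shift T Y) (Shift T Z, ShiftMor T Z X r, ShiftMor T Z Y t)"
  unfolding shift_func_VB 1(4) using SF.vf_cls[OF 1(3)] B.den_sub[OF 1(2)] by (simp add: shift_func_def)
 finally show ?thesis using den2I shift_den[OF 1(1)] shift_den'[OF 1(2)] by simp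
qed

lemma shiftV: "den_functor VQ N\<^sub>2 VQ N\<^sub>2 (shift_func VQ)"
 by unfold_locales (rule shift_VQ, simp add: shift_func_def shift_den2 del: VQ_sel)

lemma shift_VQ2: "is_functor VQ2 VQ2 (shift_func VQ2)"
proof -
 have "shift_func V.VB = verdier_func VQ N\<^sub>2 (shift_func VQ)"
  unfolding shift_func_def verdier_func_def verdier_base_def[of VQ] by simp
 then show ?thesis using den_functor.vf_functor[OF shiftV] unfolding verdier_quotient_def[of VQ] by simp
qed

lemma dist_tri_VQ: "t:Dist VQ ==> is_triangle VQ t" unfolding verdier_quotient_def Dist_wt by simp

lemma dist_tri_VQ2: "t:Dist VQ2 ==> is_triangle VQ2 t" unfolding verdier_quotient_def[of VQ] Dist_wt by simp

end

lemma strict_shift_wt [simp]: "strict_shift (with_triangles C \<T>) D F = strict_shift C D F" unfolding strict_shift_def by simp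

lemma strict_shift_wt' [simp]: "strict_shift C (with_triangles D \<T>) F = strict_shift C D F" unfolding strict_shift_def by simp

text \<open>The shift on a category of fractions is itself induced by the shift functor of the base.
  Both sides are therefore images of one roof under composites of induced functors, and
  \<open>vf_cls\<close> computes them.\<close>

lemma (in den_functor) vf_strict_shift:
 assumes T: "den_functor T N T N (shift_func T)" and T': "den_functor T' N' T' N' (shift_func T')"
  and sh: "strict_shift T T' F"
 shows "strict_shift A.VB B.VB VF"
proof -
 interpret S: den_functor T N T N "shift_func T" by (rule T)
 interpret S': den_functor T' N' T' N' "shift_func T'" by (rule T')
 have e: "ShiftMor A.VB = mor (verdier_func T N (shift_func T))"
  "ShiftMor B.VB = mor (verdier_func T' N' (shift_func T'))" unfolding verdier_func_def verdier_base_def shift_func_def by simp_all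
 show ?thesis unfolding strict_shift_def
 proof (intro conjI ballI)
  fix X assume "X:Ob A.VB"
  then show "ob VF (Shift A.VB X) = Shift B.VB (ob VF X)" using sh unfolding strict_shift_def by (simp add: vf_ob)
 next
  fix X Y c assume *: "X:Ob A.VB" "Y:Ob A.VB" "c:Hom A.VB X Y"
  obtain Z s f where c: "(Z, s, f):roofs T N X Y" "c = A.cls X Y (Z, s, f)" using *(3) by (rule A.hom_vbE)
  note rd = A.roofsD[OF c(1)]
  have Y: "Y:Ob T" "ob F Y:Ob T'" using * functor_ob[OF F] by auto
  have S: "(Shift T Z, ShiftMor T Z X s, ShiftMor T Z Y f):roofs T N (Shift T X) (Shift T Y)"
   using S.F_roof[OF c(1) Y(1)] by (simp add: shift_func_def)
  have YS: "Shift T Y:Ob T" using functor_ob[OF S.F Y(1)] by (simp add: shift_func_def)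
  have F: "(ob F Z, mor F Z X s, mor F Z Y f):roofs T' N' (ob F X) (ob F Y)" using F_roof[OF c(1) Y(1)] .
  have "mor VF (Shift T X) (Shift T Y) (ShiftMor A.VB X Y c) =
    ShiftMor B.VB (ob F X) (ob F Y) (mor VF X Y c)"
   unfolding e c(2) using S.vf_cls[OF c(1) Y(1)] vf_cls[OF c(1) Y(1)] S'.vf_cls[OF F Y(2)] vf_cls[OF S YS]
    sh rd Y unfolding strict_shift_def by (simp add: shift_func_def)
  then show "mor VF (Shift A.VB X) (Shift A.VB Y) (ShiftMor A.VB X Y c) =
    ShiftMor B.VB (ob VF X) (ob VF Y) (mor VF X Y c)" by (simp add: vf_ob)
 qed
qed

lemma (in den_functor) vf_Dist:
 assumes T: "den_functor T N T N (shift_func T)" and T': "den_functor T' N' T' N' (shift_func T')"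
  and sh: "strict_shift T T' F" and tri: "!!t. t:Dist T ==> is_triangle T t"
  and D: "!!X Y Z u v w. (X, Y, Z, u, v, w):Dist T ==>
   (ob F X, ob F Y, ob F Z, mor F X Y u, mor F Y Z v, mor F Z (Shift T X) w):Dist T'"
  and t: "(X, Y, Z, u, v, w):Dist (verdier_quotient T N)"
 shows "(ob VF X, ob VF Y, ob VF Z, mor VF X Y u, mor VF Y Z v, mor VF Z (Shift T X) w)
 :Dist (verdier_quotient T' N')"
proof -
 interpret S: den_functor T N T N "shift_func T" by (rule T)
 have sf: "shift_func A.VB = verdier_func T N (shift_func T)" unfolding verdier_func_def verdier_base_def shift_func_def by simp
 have S: "Shift T A:Ob T" if "A:Ob T" for A using functor_ob[OF S.F that] by (simp add: shift_func_def)
 have q: "is_triangle A.VB (X, Y, Z, A.qm X Y u, A.qm Y Z v, A.qm Z (Shift T X) w)" if "(X, Y, Z, u, v, w):Dist T" for X Y Z u v w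
  using tri[OF that] unfolding is_triangle_def by (auto intro: A.qm_hom simp del: A.vb_sel(2))
 have im: "(ob VF X, ob VF Y, ob VF Z, mor VF X Y (A.qm X Y u), mor VF Y Z (A.qm Y Z v),
   mor VF Z (Shift T X) (A.qm Z (Shift T X) w)):
  {(X, Y, Z, B.qm X Y u, B.qm Y Z v, B.qm Z (Shift T' X) w) | X Y Z u v w. (X, Y, Z, u, v, w):Dist T'}"
  if d: "(X, Y, Z, u, v, w):Dist T" for X Y Z u v w
 proof -
  have m: "X:Ob T" "Y:Ob T" "Z:Ob T" "u:Hom T X Y" "v:Hom T Y Z" "w:Hom T Z (Shift T X)" using tri[OF d] unfolding is_triangle_def by auto
  have "ob F (Shift T X) = Shift T' (ob F X)" using sh m unfolding strict_shift_def by blast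
  then show ?thesis using m S D[OF d] by (auto simp: vf_qm vf_ob)
 qed
 have "(ob VF X, ob VF Y, ob VF Z, mor VF X Y u, mor VF Y Z v, mor VF Z (Shift A.VB X) w)
 :Dist (with_triangles B.VB {(X, Y, Z, B.qm X Y u, B.qm Y Z v, B.qm Z (Shift T' X) w) | X Y Z u v w. (X, Y, Z, u, v, w):Dist T'})"
  by (rule Dist_image[OF vf_functor vf_strict_shift[OF T T' sh] _ _ _ t[unfolded verdier_quotient_def]])
   (use q im S.vf_functor sf in auto)
 then show ?thesis unfolding verdier_quotient_def by simp
qed

section \<open>The induced functor between double quotients\<close>

locale two_step_functor = R: two_step T N N' N\<^sub>2 + S: two_step U M M' M\<^sub>2
 for T :: "('o, 'm) tri_category" and N N' N\<^sub>2 and U :: "('p, 'n) tri_category" and M M' M\<^sub>2 +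
 fixes F :: "('o, 'm, 'p, 'n) func"
 assumes F: "is_functor T U F"
  and F_den: "s:denominators T N X Y ==> mor F X Y s:denominators U M (ob F X) (ob F Y)"
  and F_den': "s:denominators T N' X Y ==> mor F X Y s:denominators U M' (ob F X) (ob F Y)"
  and F_shift: "strict_shift T U F"
  and F_dist: "(X, Y, Z, u, v, w):Dist T ==>
   (ob F X, ob F Y, ob F Z, mor F X Y u, mor F Y Z v, mor F Z (Shift T X) w):Dist U"
begin

sublocale F0: den_functor T N U M F by unfold_locales (auto intro: F F_den)

lemma F0_den2:
 assumes "s:denominators R.VQ N\<^sub>2 X Y"
 shows "mor F0.VF X Y s:denominators S.VQ M\<^sub>2 (ob F0.VF X) (ob F0.VF Y)"
proof -
 obtain Z r f where 1: "r:R.A.S Z X" "f:R.B.S Z Y" "(Z, r, f):roofs T N X Y" "s = R.A.cls X Y (Z, r, f)" using assms by (rule R.den2E)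
 then show ?thesis using F0.vf_cls[OF 1(3)] R.B.den_sub[OF 1(2)] by (simp add: F0.vf_ob S.den2I F_den F_den')
qed

sublocale F1: den_functor R.VQ N\<^sub>2 S.VQ M\<^sub>2 F0.VF
proof
 show "is_functor R.VQ S.VQ F0.VF" using F0.vf_functor unfolding verdier_quotient_def by simp
qed (rule F0_den2)

abbreviation "F2\<equiv>F1.VF"

lemma F2_ob: "ob F2 X = ob F X" by (simp add: F1.vf_ob F0.vf_ob)

lemma F2_Q:
 assumes "f:Hom T X Y" "X:Ob T" "Y:Ob T"
 shows "mor F2 X Y (R.Q X Y f) = S.Q (ob F X) (ob F Y) (mor F X Y f)"
 using F1.vf_qm[of "R.A.qm X Y f" X Y] R.qmV assms by (simp add: F0.vf_qm F0.vf_ob)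

lemma F2_functor: "is_functor R.V.VB S.V.VB F2" by (rule F1.vf_functor)

lemma F2_triangle_functor:
 "is_triangle_functor R.VQ2 S.VQ2 F2 (\<lambda>X. Ident S.VQ2 (Shift S.VQ2 (ob F2 X)))"
proof (rule strict_triangle_functor)
 show "cat R.VQ2" "cat S.VQ2" using R.V.vb_cat S.V.vb_cat unfolding verdier_quotient_def[of R.VQ] verdier_quotient_def[of S.VQ] by auto
 show "is_functor R.VQ2 R.VQ2 (shift_func R.VQ2)" "is_functor S.VQ2 S.VQ2 (shift_func S.VQ2)" by (rule R.shift_VQ2 S.shift_VQ2)+
 show "is_functor R.VQ2 S.VQ2 F2" using F2_functor unfolding verdier_quotient_def[of R.VQ] verdier_quotient_def[of S.VQ] by simp
 have sh1: "strict_shift R.VQ S.VQ F0.VF" using F0.vf_strict_shift[OF R.shiftA S.shiftA F_shift] unfolding verdier_quotient_def by simp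
 show "strict_shift R.VQ2 S.VQ2 F2" using F1.vf_strict_shift[OF R.shiftV S.shiftV sh1]
  unfolding verdier_quotient_def[of R.VQ] verdier_quotient_def[of S.VQ] by simp
 show "is_triangle R.VQ2 t" if "t:Dist R.VQ2" for t using R.dist_tri_VQ2[OF that] .
 have d1: "(ob F0.VF X, ob F0.VF Y, ob F0.VF Z, mor F0.VF X Y u, mor F0.VF Y Z v,
   mor F0.VF Z (Shift R.VQ X) w):Dist S.VQ" if "(X, Y, Z, u, v, w):Dist R.VQ" for X Y Z u v w
  using F0.vf_Dist[OF R.shiftA S.shiftA F_shift R.dist_tri F_dist that] by simp
 show "(ob F2 X, ob F2 Y, ob F2 Z, mor F2 X Y u, mor F2 Y Z v,
   mor F2 Z (Shift R.VQ2 X) w):Dist S.VQ2" if "(X, Y, Z, u, v, w):Dist R.VQ2" for X Y Z u v w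
  using F1.vf_Dist[OF R.shiftV S.shiftV sh1 R.dist_tri_VQ d1 that] by simp
qed

text \<open>No functor in the other direction is needed: an object \<open>G\<close> representing \<open>X \<mapsto> Hom(Y, F X)\<close>
 with invertible universal arrow is enough to lift fractions, because \<open>F\<close> reflects denominators.\<close>

theorem F2_triangle_equivalence:
 assumes adj: "!!Y. Y:Ob U ==> \<exists>G\<in>Ob T. \<exists>\<eta>. is_iso U Y (ob F G) \<eta>&
   (\<forall>X\<in>Ob T. (\<forall>v\<in>Hom U Y (ob F X). \<exists>u\<in>Hom T G X. Comp U Y (ob F G) (ob F X) (mor F G X u) \<eta> = v)&
    (\<forall>u\<in>Hom T G X. \<forall>u'\<in>Hom T G X. Comp U Y (ob F G) (ob F X) (mor F G X u) \<eta> =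
     Comp U Y (ob F G) (ob F X) (mor F G X u') \<eta>-->u = u'))"
  and reflect: "!!X Y u. [|X:Ob T; Y:Ob T; u:Hom T X Y;
   mor F X Y u:denominators U M' (ob F X) (ob F Y)|] ==> u:denominators T N' X Y"
  and iso_den: "!!X Y u. [|X:Ob U; Y:Ob U; is_iso U X Y u|] ==> u:denominators U M' X Y"
 shows "is_triangle_equivalence R.VQ2 S.VQ2 F2 (\<lambda>X. Ident S.VQ2 (Shift S.VQ2 (ob F2 X)))"
proof -
 note FO = functor_ob[OF F]
 note FM = functor_mor[OF F]
 note FC = functor_comp[OF F]
 note F2M = functor_mor[OF F2_functor, unfolded F2_ob]
 note F2C = functor_comp[OF F2_functor, unfolded F2_ob]
 \<comment> \<open>The transpose \<open>u\<close> of a denominator \<open>v\<close> is a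
   denominator: F u is \<open>v\<close> composed with the inverse of the universal arrow, hence lies
   in the large class, and \<open>F\<close> reflects this.\<close>
 have lift: "u:denominators T N' G X" if asm: "is_iso U Y (ob F G) \<eta>" "v:denominators U M' Y (ob F X)" "u:Hom T G X" "G:Ob T" "X:Ob T"
   "Comp U Y (ob F G) (ob F X) (mor F G X u) \<eta> = v" for Y G \<eta> X u v
 proof -
  have Y: "Y:Ob U" "v:Hom U Y (ob F X)" using S.B.den_sub asm(2) by auto
  obtain \<zeta> where z: "is_iso U (ob F G) Y \<zeta>" "Comp U (ob F G) Y (ob F G) \<eta> \<zeta> = Ident U (ob F G)"
    "\<eta>:Hom U Y (ob F G)" "\<zeta>:Hom U (ob F G) Y" using S.A.iso_inv[OF asm(1)] by metis
  have "mor F G X u = Comp U (ob F G) Y (ob F X) v \<zeta>"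
   unfolding asm(6)[symmetric] using z asm(3-5) FM[OF asm(3-5)] FO Y by (simp add: S.A.comp_assoc)
  also have "\<dots>:denominators U M' (ob F G) (ob F X)" using S.B.den_comp[OF iso_den[OF _ Y(1) z(1)] asm(2)] FO asm by simp
  finally show ?thesis using reflect asm by blast
 qed
 have "is_equivalence R.V.VB S.V.VB F2"
 proof (rule ff_ess_equivalence)
  show "cat R.V.VB" "cat S.V.VB" by (rule R.V.vb_cat S.V.vb_cat)+
  show "is_functor R.V.VB S.V.VB F2" by (rule F2_functor)
 next
  fix X Y g assume *: "X:Ob R.V.VB" "Y:Ob R.V.VB" "g:Hom S.V.VB (ob F2 X) (ob F2 Y)"
  have ob: "X:Ob T" "Y:Ob T" "ob F X:Ob U" "ob F Y:Ob U" using * FO by auto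
  \<comment> \<open>Fullness. The morphism \<open>g\<close> is the fraction h v^-1 out of F X.
    Transposing its legs along the universal arrow at Z gives \<open>u\<close> into X and
    \<open>k\<close> into Y, and k u^-1 is the preimage.\<close>
  obtain Z v h where z: "v:denominators U M' Z (ob F X)" "h:Hom U Z (ob F Y)"
   "Comp S.V.VB Z (ob F X) (ob F Y) g (S.Q Z (ob F X) v) = S.Q Z (ob F Y) h" using S.Q_gen *(3) ob unfolding F2_ob by metis
  have Z: "Z:Ob U" "v:Hom U Z (ob F X)" using S.B.den_sub z by auto
  obtain G \<eta> where G: "G:Ob T" "is_iso U Z (ob F G) \<eta>"
   "!!X v. X:Ob T ==> v:Hom U Z (ob F X) ==>
     \<exists>u\<in>Hom T G X. Comp U Z (ob F G) (ob F X) (mor F G X u) \<eta> = v" using adj[OF Z(1)] by metis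
  obtain u where u: "u:Hom T G X" "Comp U Z (ob F G) (ob F X) (mor F G X u) \<eta> = v" using G(3)[OF ob(1) Z(2)] by blast
  obtain k where k: "k:Hom T G Y" "Comp U Z (ob F G) (ob F Y) (mor F G Y k) \<eta> = h" using G(3)[OF ob(2) z(2)] by blast
  have eta: "\<eta>:Hom U Z (ob F G)" using G unfolding is_iso_def by blast
  have ud: "u:denominators T N' G X" using lift[OF G(2) z(1) u(1) G(1) ob(1) u(2)] .
  obtain i where i: "i:Hom R.V.VB X G" "Comp R.V.VB G X G i (R.Q G X u) = Ident R.V.VB G" using R.Q_iso[OF ud] unfolding is_iso_def by blast
  define c where "c = Comp R.V.VB X G Y (R.Q G Y k) i"
  have Qk: "R.Q G Y k:Hom R.V.VB G Y" "R.Q G X u:Hom R.V.VB G X" using R.Q_hom G k u by blast+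
  have c: "c:Hom R.V.VB X Y" unfolding c_def using R.VV.comp_in[OF i(1) Qk(1)] ob G by simp
  have cu: "Comp R.V.VB G X Y c (R.Q G X u) = R.Q G Y k"
   unfolding c_def using R.VV.comp_assoc[OF Qk(2) i(1) Qk(1)] R.VV.comp_idr[OF Qk(1)] ob G i(2) by simp
  have "Comp S.V.VB (ob F G) (ob F X) (ob F Y) (mor F2 X Y c) (S.Q (ob F G) (ob F X) (mor F G X u))
    = S.Q (ob F G) (ob F Y) (mor F G Y k)" using F2C[OF Qk(2) c] cu ob G F2_Q[OF u(1)] F2_Q[OF k(1)] by simp
  then have "Comp S.V.VB Z (ob F X) (ob F Y) (mor F2 X Y c) (S.Q Z (ob F X) v) = S.Q Z (ob F Y) h"
   using S.Q_comp[OF eta FM[OF u(1)]] S.Q_comp[OF eta FM[OF k(1)]] u(2) k(2) ob G(1) Z FO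
    S.VV.comp_assoc[OF S.Q_hom[OF eta] S.Q_hom[OF FM[OF u(1)]] F2M[OF c]] by simp
  then have "mor F2 X Y c = g" using S.VV.iso_cancel[OF S.Q_iso[OF z(1)] F2M[OF c] *(3)[unfolded F2_ob]] z(3) ob Z by simp
  then show "\<exists>f\<in>Hom R.V.VB X Y. mor F2 X Y f = g" using c by blast
 next
  fix X Y c d assume *: "X:Ob R.V.VB" "Y:Ob R.V.VB" "c:Hom R.V.VB X Y" "d:Hom R.V.VB X Y"
   "mor F2 X Y c = mor F2 X Y d"
  have ob: "X:Ob T" "Y:Ob T" using * by auto
  obtain Z1 w1 f1 where c: "w1:denominators T N' Z1 X" "f1:Hom T Z1 Y"
   "Comp R.V.VB Z1 X Y c (R.Q Z1 X w1) = R.Q Z1 Y f1" using R.Q_gen[OF *(3) ob(2)] by metis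
  obtain Z2 w2 f2 where d: "w2:denominators T N' Z2 X" "f2:Hom T Z2 Y"
   "Comp R.V.VB Z2 X Y d (R.Q Z2 X w2) = R.Q Z2 Y f2" using R.Q_gen[OF *(4) ob(2)] by metis
  have Z12: "Z1:Ob T" "w1:Hom T Z1 X" "Z2:Ob T" "w2:Hom T Z2 X" using R.B.den_sub c(1) d(1) by auto
  obtain Z p q where z: "Z:Ob T" "p:denominators T N' Z Z1" "q:Hom T Z Z2"
   "Comp T Z Z1 X w1 p = Comp T Z Z2 X w2 q" using R.B.den_ore[OF Z12(2) d(1) Z12(1)] by auto
  define w where "w = Comp T Z Z1 X w1 p"
  have w: "w:denominators T N' Z X" unfolding w_def using R.B.den_comp z c by blast
  have p: "p:Hom T Z Z1" using R.B.den_sub z(2) by blast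
  define f g where "f = Comp T Z Z1 Y f1 p" and "g = Comp T Z Z2 Y f2 q"
  have fg: "f:Hom T Z Y" "g:Hom T Z Y" unfolding f_def g_def using c d p z Z12 ob by auto
  have cw: "Comp R.V.VB Z X Y c (R.Q Z X w) = R.Q Z Y f" unfolding w_def f_def
   using R.Q_comp[OF p Z12(2)] R.Q_comp[OF p c(2)] c(3) z(1) Z12 ob
    R.VV.comp_assoc[OF R.Q_hom[OF p] R.Q_hom[OF Z12(2)] *(3)] by simp
  have dw: "Comp R.V.VB Z X Y d (R.Q Z X w) = R.Q Z Y g" unfolding w_def g_def z(4)
   using R.Q_comp[OF z(3) Z12(4)] R.Q_comp[OF z(3) d(2)] d(3) z(1) Z12 ob
    R.VV.comp_assoc[OF R.Q_hom[OF z(3)] R.Q_hom[OF Z12(4)] *(4)] by simp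
  have Qw: "R.Q Z X w:Hom R.V.VB Z X" using R.Q_hom[OF R.B.den_hom[OF w] z(1)] .
  have "mor F2 Z Y (R.Q Z Y f) = mor F2 Z Y (R.Q Z Y g)"
   unfolding cw[symmetric] dw[symmetric] using F2C[OF Qw *(3)] F2C[OF Qw *(4)] *(5) z(1) ob by simp
  then have "S.Q (ob F Z) (ob F Y) (mor F Z Y f) = S.Q (ob F Z) (ob F Y) (mor F Z Y g)" using F2_Q fg z(1) ob by simp
  \<comment> \<open>Faithfulness. Equality of the images means that a denominator \<open>v\<close>
    into F Z equalizes F f and F g. Its transpose \<open>u\<close> is a denominator into Z, and by
    the uniqueness half of the universal property it equalizes \<open>f\<close> and \<open>g\<close>
    themselves.\<close>
  then obtain W v where v: "v:denominators U M' W (ob F Z)"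
    "Comp U W (ob F Z) (ob F Y) (mor F Z Y f) v = Comp U W (ob F Z) (ob F Y) (mor F Z Y g) v"
   using S.Q_eq_iff[OF FM[OF fg(1)] FM[OF fg(2)]] z(1) ob FO by blast
  have W: "W:Ob U" "v:Hom U W (ob F Z)" using S.B.den_sub v by auto
  obtain G \<eta> where G: "G:Ob T" "is_iso U W (ob F G) \<eta>"
   "!!X v. X:Ob T ==> v:Hom U W (ob F X) ==>
     \<exists>u\<in>Hom T G X. Comp U W (ob F G) (ob F X) (mor F G X u) \<eta> = v"
   "!!X u u'. X:Ob T ==> u:Hom T G X ==> u':Hom T G X ==>
     Comp U W (ob F G) (ob F X) (mor F G X u) \<eta> =
     Comp U W (ob F G) (ob F X) (mor F G X u') \<eta> ==> u = u'" using adj[OF W(1)] by metis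
  obtain u where u: "u:Hom T G Z" "Comp U W (ob F G) (ob F Z) (mor F G Z u) \<eta> = v" using G(3)[OF z(1) W(2)] by blast
  have eta: "\<eta>:Hom U W (ob F G)" using G unfolding is_iso_def by blast
  have "Comp T G Z Y f u = Comp T G Z Y g u" by (rule G(4)[OF ob(2)])
    (use fg u z(1) ob FM[OF u(1)] FM[OF fg(1)] FM[OF fg(2)] FO W eta v(2) G(1) in
     \<open>simp_all add: FC S.A.comp_assoc\<close>)
  moreover have "u:denominators T N' G Z" using lift[OF G(2) v(1) u(1) G(1) z(1) u(2)] .
  ultimately have "R.Q Z Y f = R.Q Z Y g" using R.Q_eq_iff[OF fg z(1) ob(2)] by blast
  then show "c = d" using R.VV.iso_cancel[OF R.Q_iso[OF w] *(3,4)] cw dw z(1) ob by simp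
 next
  fix Y assume "Y:Ob S.V.VB"
  then have Y: "Y:Ob U" by simp
  obtain G \<eta> where G: "G:Ob T" "is_iso U Y (ob F G) \<eta>" using adj[OF Y] by metis
  obtain \<zeta> where z: "is_iso U (ob F G) Y \<zeta>" using S.A.iso_inv[OF G(2)] by metis
  show "\<exists>X\<in>Ob R.V.VB. \<exists>e. is_iso S.V.VB (ob F2 X) Y e" using S.Q_iso[OF iso_den[OF FO[OF G(1)] Y z]] G(1) F2_ob by auto
 qed
 then have "is_equivalence R.VQ2 S.VQ2 F2" unfolding verdier_quotient_def[of R.VQ] verdier_quotient_def[of S.VQ]
  by (simp add: is_equivalence_def is_nat_iso_def)
 then show ?thesis unfolding is_triangle_equivalence_def using F2_triangle_functor by blast
qed

end

section \<open>Modules\<close>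

lemma (in abelian_group) a_inv_zero: "\<ominus> \<zero> = \<zero>" by (metis a_inv_closed l_zero r_neg zero_closed)

text \<open>Sets up the method \<open>algebra\<close> for sums and negatives in a bare abelian
  group, so that it can be used in the additive group of a module.\<close>

lemmas (in abelian_group) abelian_group_simprules
 [algebra abelian_group "zero G" "add G" "a_inv G" "a_minus G"] =
 a_closed zero_closed a_inv_closed minus_closed a_assoc l_zero l_neg a_comm minus_eq
 r_zero r_neg r_neg2 r_neg1 minus_add minus_minus a_inv_zero a_lcomm

lemma left_moduleI:
 fixes R (structure) and M (structure)
 assumes "ring R"
  and "\<zero>\<^sub>M:el M"
  and "!!x y. [|x:el M; y:el M|] ==> x\<oplus>\<^sub>M y:el M"
  and "!!x y z. [|x:el M; y:el M; z:el M|] ==> (x\<oplus>\<^sub>M y)\<oplus>\<^sub>M z = x\<oplus>\<^sub>M (y\<oplus>\<^sub>M z)"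
  and "!!x y. [|x:el M; y:el M|] ==> x\<oplus>\<^sub>M y = y\<oplus>\<^sub>M x"
  and "!!x. x:el M ==> \<zero>\<^sub>M\<oplus>\<^sub>M x = x"
  and "!!x. x:el M ==> \<exists>y\<in>el M. y\<oplus>\<^sub>M x = \<zero>\<^sub>M"
  and "!!a x. [|a:el R; x:el M|] ==> a\<odot>\<^sub>M x:el M"
  and "!!a b x. [|a:el R; b:el R; x:el M|] ==> (a\<oplus> b)\<odot>\<^sub>M x = a\<odot>\<^sub>M x\<oplus>\<^sub>M b\<odot>\<^sub>M x"
  and "!!a x y. [|a:el R; x:el M; y:el M|] ==> a\<odot>\<^sub>M (x\<oplus>\<^sub>M y) = a\<odot>\<^sub>M x\<oplus>\<^sub>M a\<odot>\<^sub>M y"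
  and "!!a b x. [|a:el R; b:el R; x:el M|] ==> (a\<otimes> b)\<odot>\<^sub>M x = a\<odot>\<^sub>M (b\<odot>\<^sub>M x)"
  and "!!x. x:el M ==> \<one>\<odot>\<^sub>M x = x"
 shows "lmod R M" using assms by (intro left_module.intro left_module_axioms.intro abelian_groupI) auto

context left_module
begin

lemma smult_l_null: "x:el M ==> \<zero>\<odot>\<^sub>M x = \<zero>\<^sub>M"
proof -
 assume x: "x:el M"
 have z: "\<zero>\<odot>\<^sub>M x:el M" using x smult_closed by simp
 have "\<zero>\<odot>\<^sub>M x\<oplus>\<^sub>M \<zero>\<odot>\<^sub>M x = \<zero>\<odot>\<^sub>M x" using x smult_l_distr[of \<zero> \<zero> x] by simp
 then show ?thesis using z M.add.r_cancel_one' by metis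
qed

lemma smult_r_null: "r:el R ==> r\<odot>\<^sub>M \<zero>\<^sub>M = \<zero>\<^sub>M"
proof -
 assume r: "r:el R"
 have z: "r\<odot>\<^sub>M \<zero>\<^sub>M:el M" using r smult_closed by simp
 have "r\<odot>\<^sub>M \<zero>\<^sub>M\<oplus>\<^sub>M r\<odot>\<^sub>M \<zero>\<^sub>M = r\<odot>\<^sub>M \<zero>\<^sub>M" using r smult_r_distr[of r "\<zero>\<^sub>M" "\<zero>\<^sub>M"] by simp
 then show ?thesis using z M.add.r_cancel_one' by metis
qed

lemma smult_l_minus: "[|r:el R; x:el M|] ==> (\<ominus> r)\<odot>\<^sub>M x =\<ominus>\<^sub>M (r\<odot>\<^sub>M x)"
 using smult_l_distr[of "\<ominus> r" r x] smult_l_null[of x] smult_closed by (metis M.minus_equality R.a_inv_closed R.l_neg)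

lemma smult_r_minus: "[|r:el R; x:el M|] ==> r\<odot>\<^sub>M (\<ominus>\<^sub>M x) =\<ominus>\<^sub>M (r\<odot>\<^sub>M x)"
 using smult_r_distr[of r "\<ominus>\<^sub>M x" x] smult_r_null[of r] smult_closed by (metis M.minus_equality M.a_inv_closed M.l_neg)

lemma minus_smult: "x:el M ==> (\<ominus> \<one>)\<odot>\<^sub>M x =\<ominus>\<^sub>M x" by (simp add: smult_l_minus smult_one)

end

text \<open>Closure under negation comes from the action of minus one and is left out.
  \<open>submodule_iff\<close> relates this form to the one in the definition of finite
  generation.\<close>

definition submod :: "('r, 'z) ring_scheme=>('r, 'm, 'y) module_scheme=>'m set=>bool" where
 "submod R M H\<longleftrightarrow>H<=el M&\<zero>\<^sub>M:H&(\<forall>x\<in>H. \<forall>y\<in>H. x\<oplus>\<^sub>M y:H)&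
  (\<forall>r\<in>el R. \<forall>x\<in>H. r\<odot>\<^sub>M x:H)"

lemma submodD:
 assumes "submod R M H"
 shows "H<=el M" "x:H ==> x:el M" "\<zero>\<^sub>M:H" "x:H ==> y:H ==> x\<oplus>\<^sub>M y:H"
  "r:el R ==> x:H ==> r\<odot>\<^sub>M x:H" using assms unfolding submod_def by auto

lemma submodI:
 assumes "H<=el M" "\<zero>\<^sub>M:H" "!!x y. x:H ==> y:H ==> x\<oplus>\<^sub>M y:H"
  "!!r x. r:el R ==> x:H ==> r\<odot>\<^sub>M x:H"
 shows "submod R M H" using assms unfolding submod_def by auto

lemma (in left_module) submod_minus: "submod R M H ==> x:H ==> \<ominus>\<^sub>M x:H"
 using submodD(5)[of R M H "\<ominus> \<one>" x] submodD(2)[of R M H x] minus_smult[of x] by simp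

lemma (in left_module) submodule_iff: "submodule H R M\<longleftrightarrow>submod R M H"
proof
 assume "submodule H R M"
 then interpret submodule H R M .
 show "submod R M H" using subset one_closed m_closed smult_closed by (auto intro!: submodI)
next
 assume H: "submod R M H"
 show "submodule H R M"
 proof (intro submodule.intro subgroup.intro submodule_axioms.intro)
  fix x assume x: "x:H"
  show "inv\<^bsub>add_monoid M\<^esub> x:H" using submod_minus[OF H x] unfolding a_inv_def .
 qed (use submodD[OF H] in auto)
qed

lemma (in left_module) submod_left_module:
 assumes "submod R M H"
 shows "lmod R (M\<lparr>carrier := H\<rparr>)"
proof (rule left_moduleI)
 show "ring R" by (rule R.ring_axioms)
 note s = submodD[OF assms]
 show "\<exists>y\<in>el (M\<lparr>carrier := H\<rparr>). y\<oplus>\<^bsub>M\<lparr>carrier := H\<rparr>\<^esub> x = \<zero>\<^bsub>M\<lparr>carrier := H\<rparr>\<^esub>"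
  if "x:el (M\<lparr>carrier := H\<rparr>)" for x
  using that s(2)[of x] submod_minus[OF assms, of x] by (intro bexI[of _ "\<ominus>\<^sub>M x"]) (simp_all add: M.l_neg)
qed (simp_all add: submodD(2-)[OF assms] M.a_ac smult_l_distr smult_r_distr smult_assoc1 smult_one)

lemma fin_gen_iff:
 assumes "lmod R M"
 shows "fin_gen R M\<longleftrightarrow>(\<exists>S. finite S&S<=el M&(\<forall>N. submod R M N&S<=N-->N = el M))"
 unfolding fin_gen_def left_module.submodule_iff[OF assms] ..

lemma fin_genE:
 assumes "fin_gen R M" "lmod R M"
 obtains S where "finite S" "S<=el M" "\<forall>H. submod R M H-->S<=H-->H = el M"
proof -
 obtain S where "finite S&S<=el M&(\<forall>N. submod R M N&S<=N-->N = el M)"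
  using assms(1)[unfolded fin_gen_iff[OF assms(2)]] by (rule exE)
 then show ?thesis by (intro that[of S]) auto
qed

lemma fin_genI:
 assumes "lmod R M" "finite S" "S<=el M"
  "!!H. submod R M H ==> S<=H ==> el M<=H"
 shows "fin_gen R M" unfolding fin_gen_iff[OF assms(1)]
proof (intro exI[of _ S] conjI allI impI)
 fix N assume "submod R M N&S<=N"
 then show "N = el M" using assms(4)[of N] submodD(1)[of R M N] by auto
qed (fact assms(2,3))+

locale modcat = ring R for R :: "'r ring" (structure)
begin

abbreviation "MOD\<equiv>Ob (mod_cat R)"
abbreviation "hm\<equiv>mod_hom R"

lemma MOD_iff: "M:MOD\<longleftrightarrow>lmod R M&fin_gen R M" unfolding mod_cat_def by simp

lemma MOD_lm [simp]: "M:MOD ==> lmod R M" by (simp add: MOD_iff)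

lemma MOD_fg: "M:MOD ==> fin_gen R M" by (simp add: MOD_iff)

lemma lm_ab [simp]: "lmod R M ==> abelian_group M" unfolding left_module_def by blast

lemma hmI:
 assumes "!!x. x:el M ==> f x:el N" "!!x. x\<notin>el M ==> f x = undefined"
  "!!x y. x:el M ==> y:el M ==> f (x\<oplus>\<^sub>M y) = f x\<oplus>\<^sub>N f y"
  "!!r x. r:el R ==> x:el M ==> f (r\<odot>\<^sub>M x) = r\<odot>\<^sub>N f x"
 shows "f:hm M N" using assms unfolding mod_hom_def by (auto simp: PiE_def extensional_def)

lemma hm_restrictI:
 assumes "lmod R M" "!!x. x:el M ==> f x:el N"
  "!!x y. x:el M ==> y:el M ==> f (x\<oplus>\<^sub>M y) = f x\<oplus>\<^sub>N f y"
  "!!r x. r:el R ==> x:el M ==> f (r\<odot>\<^sub>M x) = r\<odot>\<^sub>N f x"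
 shows "restrict f (el M):hm M N"
proof -
 interpret left_module R M by fact
 show ?thesis using assms(2-) by (intro hmI) (auto simp: smult_closed)
qed

lemma hm_closed: "f:hm M N ==> x:el M ==> f x:el N" unfolding mod_hom_def by auto

lemma hm_add: "f:hm M N ==> x:el M ==> y:el M ==> f (x\<oplus>\<^sub>M y) = f x\<oplus>\<^sub>N f y" unfolding mod_hom_def by auto

lemma hm_smult: "f:hm M N ==> r:el R ==> x:el M ==> f (r\<odot>\<^sub>M x) = r\<odot>\<^sub>N f x" unfolding mod_hom_def by auto

lemma hm_undef: "f:hm M N ==> x\<notin>el M ==> f x = undefined" unfolding mod_hom_def by (auto simp: PiE_def extensional_def)

lemma hm_ext: "f:hm M N ==> g:hm M N' ==> (!!x. x:el M ==> f x = g x) ==> f = g" by (metis ext hm_undef)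

lemma hm_zero: "f:hm M N ==> lmod R M ==> lmod R N ==> f \<zero>\<^sub>M = \<zero>\<^sub>N"
proof -
 assume f: "f:hm M N" and M: "lmod R M" and N: "lmod R N"
 interpret M: left_module R M by (rule M)
 interpret N: left_module R N by (rule N)
 have "f \<zero>\<^sub>M = f (\<zero>\<odot>\<^sub>M \<zero>\<^sub>M)" by (simp add: M.smult_l_null)
 also have "\<dots> = \<zero>\<^sub>N" using hm_smult[OF f, of \<zero> "\<zero>\<^sub>M"] hm_closed[OF f] by (simp add: N.smult_l_null)
 finally show ?thesis .
qed

lemma hm_minus:
 assumes "f:hm M N" "lmod R M" "lmod R N" "x:el M"
 shows "f (\<ominus>\<^sub>M x) =\<ominus>\<^sub>N f x"
 using left_module.minus_smult[OF assms(2,4)] left_module.minus_smult[OF assms(3) hm_closed[OF assms(1,4)]]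
  hm_smult[OF assms(1), of "\<ominus> \<one>" x] assms(4) by simp

lemma hm_compose: "f:hm L M ==> g:hm M N ==> lmod R L ==> compose (el L) g f:hm L N" unfolding compose_def
 by (rule hm_restrictI) (auto simp: hm_closed hm_add hm_smult)

lemma hm_ident: "lmod R M ==> (\<lambda>x\<in>el M. x):hm M M" by (rule hm_restrictI) auto

lemma hm_zero_map: "lmod R M ==> lmod R N ==> (\<lambda>x\<in>el M. \<zero>\<^sub>N):hm M N"
 by (rule hm_restrictI) (auto simp: left_module.smult_r_null abelian_group.axioms(1) abelian_monoid.zero_closed
    abelian_monoid.l_zero)

lemma hm_plus:
 assumes "f:hm M N" "g:hm M N" "lmod R M" "lmod R N"
 shows "(\<lambda>x\<in>el M. f x\<oplus>\<^sub>N g x):hm M N"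
proof -
 interpret M: left_module R M by fact
 interpret N: left_module R N by fact
 show ?thesis using assms(1,2) hm_closed[OF assms(1)] hm_closed[OF assms(2)]
  by (intro hm_restrictI) (auto simp: hm_add hm_smult N.smult_r_distr N.M.a_ac M.left_module_axioms)
qed

lemma hm_neg:
 assumes "f:hm M N" "lmod R M" "lmod R N"
 shows "(\<lambda>x\<in>el M.\<ominus>\<^sub>N f x):hm M N"
proof -
 interpret M: left_module R M by fact
 interpret N: left_module R N by fact
 show ?thesis using assms(1) hm_closed[OF assms(1)]
  by (intro hm_restrictI) (auto simp: hm_add hm_smult N.smult_r_minus N.M.minus_add N.smult_closed M.left_module_axioms)
qed

lemma submod_image:
 assumes "f:hm M N" "lmod R M" "lmod R N" "submod R M H"
 shows "submod R N (f ` H)"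
proof -
 note s = submodD[OF assms(4)]
 show ?thesis
 proof (rule submodI)
  show "f ` H<=el N" using s hm_closed[OF assms(1)] by auto
  show "\<zero>\<^sub>N:f ` H" using s hm_zero[OF assms(1-3)] by force
  show "x\<oplus>\<^sub>N y:f ` H" if "x:f ` H" "y:f ` H" for x y using that s(2,4) hm_add[OF assms(1), symmetric] by (auto intro!: imageI)
  show "r\<odot>\<^sub>N x:f ` H" if "r:el R" "x:f ` H" for x r using that s(2,5) hm_smult[OF assms(1), symmetric] by (auto intro!: imageI)
 qed
qed

lemma submod_vimage:
 assumes "f:hm M N" "lmod R M" "lmod R N" "submod R N H"
 shows "submod R M {x\<in>el M. f x:H}"
proof -
 interpret M: left_module R M by fact
 note s = submodD[OF assms(4)]
 show ?thesis
  by (rule submodI) (use s hm_zero[OF assms(1-3)] hm_add[OF assms(1)] hm_smult[OF assms(1)] in \<open>auto simp: M.smult_closed\<close>)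
qed

lemma submod_carrier: "lmod R M ==> submod R M (el M)"
proof -
 assume "lmod R M"
 then interpret M: left_module R M .
 show ?thesis by (rule submodI) (auto simp: M.smult_closed)
qed

lemma submod_zero: "lmod R M ==> submod R M {\<zero>\<^sub>M}"
proof -
 assume "lmod R M"
 then interpret M: left_module R M .
 show ?thesis by (rule submodI) (auto simp: M.smult_r_null)
qed

lemma hm_surj_fin_gen:
 assumes "f:hm M N" "lmod R M" "lmod R N" "fin_gen R M" "f ` el M = el N"
 shows "fin_gen R N"
proof -
 obtain S where S: "finite S" "S<=el M" "\<forall>H. submod R M H-->S<=H-->H = el M" using fin_genE[OF assms(4,2)] .
 show ?thesis
 proof (rule fin_genI[OF assms(3), of "f ` S"])
  show "f ` S<=el N" using S assms(5) by blast
  fix H assume H: "submod R N H" "f ` S<=H"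
  then have "{x\<in>el M. f x:H} = el M" using S submod_vimage[OF assms(1-3)] by (intro S(3)[rule_format]) auto
  then show "el N<=H" unfolding assms(5)[symmetric] by blast
 qed (use S in auto)
qed

end

lemma fst_seq_pair [simp]: "fst_seq (pair_seq x y) = x" unfolding fst_seq_def pair_seq_def by (auto simp: fun_eq_iff)

lemma snd_seq_pair [simp]: "snd_seq (pair_seq x y) = y" unfolding snd_seq_def pair_seq_def by (auto simp: fun_eq_iff)

lemma pair_seq_eq [simp]: "pair_seq x y = pair_seq x' y'\<longleftrightarrow>x = x'&y = y'" by (metis fst_seq_pair snd_seq_pair)

lemma ds_carrier [simp]: "pair_seq x y:el (direct_sum M N)\<longleftrightarrow>x:el M&y:el N" unfolding direct_sum_def by auto

lemma ds_carrierE: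
 assumes "z:el (direct_sum M N)"
 obtains x y where "z = pair_seq x y" "x:el M" "y:el N" using assms unfolding direct_sum_def by auto

lemma ds_simps [simp]:
 "\<zero>\<^bsub>direct_sum M N\<^esub> = pair_seq \<zero>\<^sub>M \<zero>\<^sub>N"
 "pair_seq x y\<oplus>\<^bsub>direct_sum M N\<^esub> pair_seq x' y' = pair_seq (x\<oplus>\<^sub>M x') (y\<oplus>\<^sub>N y')"
 "r\<odot>\<^bsub>direct_sum M N\<^esub> pair_seq x y = pair_seq (r\<odot>\<^sub>M x) (r\<odot>\<^sub>N y)" unfolding direct_sum_def by auto

lemma ds_left_module:
 assumes "lmod R M" "lmod R N"
 shows "lmod R (direct_sum M N)"
proof -
 interpret M: left_module R M by fact
 interpret N: left_module R N by fact
 show ?thesis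
 proof (rule left_moduleI)
  show "ring R" by (rule M.R.ring_axioms)
  fix x assume "x:el (direct_sum M N)"
  then show "\<exists>y\<in>el (direct_sum M N). y\<oplus>\<^bsub>direct_sum M N\<^esub> x = \<zero>\<^bsub>direct_sum M N\<^esub>"
   by (elim ds_carrierE) (auto intro!: bexI[of _ "pair_seq (\<ominus>\<^sub>M _) (\<ominus>\<^sub>N _)"] simp: M.M.l_neg N.M.l_neg)
 qed (auto elim!: ds_carrierE simp: M.smult_closed N.smult_closed M.smult_l_distr N.smult_l_distr
   M.smult_r_distr N.smult_r_distr M.smult_assoc1 N.smult_assoc1 M.smult_one N.smult_one M.M.a_ac N.M.a_ac)
qed

lemma ds_a_inv [simp]:
 assumes "lmod R M" "lmod R N" "x:el M" "y:el N"
 shows "\<ominus>\<^bsub>direct_sum M N\<^esub> pair_seq x y = pair_seq (\<ominus>\<^sub>M x) (\<ominus>\<^sub>N y)"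
proof -
 interpret M: left_module R M by fact
 interpret N: left_module R N by fact
 interpret D: left_module R "direct_sum M N" using ds_left_module assms by blast
 show ?thesis by (rule D.M.minus_equality) (use assms in \<open>auto simp: M.M.l_neg N.M.l_neg\<close>)
qed

context modcat
begin

lemma ds_MOD:
 assumes "M:MOD" "N:MOD"
 shows "direct_sum M N:MOD"
proof -
 have lm: "lmod R M" "lmod R N" using assms by auto
 interpret M: left_module R M by fact
 interpret N: left_module R N by fact
 have D: "lmod R (direct_sum M N)" using ds_left_module lm by blast
 interpret D: left_module R "direct_sum M N" by fact
 obtain S where S: "finite S" "S<=el M" "\<forall>H. submod R M H-->S<=H-->H = el M" using fin_genE[OF MOD_fg[OF assms(1)] lm(1)] .
 obtain T where T: "finite T" "T<=el N" "\<forall>H. submod R N H-->T<=H-->H = el N" using fin_genE[OF MOD_fg[OF assms(2)] lm(2)] .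
 let ?U = "(\<lambda>x. pair_seq x \<zero>\<^sub>N) ` S\<union>(\<lambda>y. pair_seq \<zero>\<^sub>M y) ` T"
 have "el (direct_sum M N)<=H" if H: "submod R (direct_sum M N) H" "?U<=H" for H
 proof -
  note s = submodD[OF H(1)]
  have "submod R M {x\<in>el M. pair_seq x \<zero>\<^sub>N:H}"
  proof (rule submodI)
   fix x y assume "x:{x\<in>el M. pair_seq x \<zero>\<^sub>N:H}" "y:{x\<in>el M. pair_seq x \<zero>\<^sub>N:H}"
   then show "x\<oplus>\<^sub>M y:{x\<in>el M. pair_seq x \<zero>\<^sub>N:H}"
    using s(4)[of "pair_seq x \<zero>\<^sub>N" "pair_seq y \<zero>\<^sub>N"] by simp
  next
   fix r x assume "r:el R" "x:{x\<in>el M. pair_seq x \<zero>\<^sub>N:H}"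
   then show "r\<odot>\<^sub>M x:{x\<in>el M. pair_seq x \<zero>\<^sub>N:H}"
    using s(5)[of r "pair_seq x \<zero>\<^sub>N"] by (simp add: M.smult_closed N.smult_r_null)
  qed (use s in auto)
  then have 1: "{x\<in>el M. pair_seq x \<zero>\<^sub>N:H} = el M" using S H by (intro S(3)[rule_format]) auto
  have "submod R N {y\<in>el N. pair_seq \<zero>\<^sub>M y:H}"
  proof (rule submodI)
   fix x y assume "x:{y\<in>el N. pair_seq \<zero>\<^sub>M y:H}" "y:{y\<in>el N. pair_seq \<zero>\<^sub>M y:H}"
   then show "x\<oplus>\<^sub>N y:{y\<in>el N. pair_seq \<zero>\<^sub>M y:H}"
    using s(4)[of "pair_seq \<zero>\<^sub>M x" "pair_seq \<zero>\<^sub>M y"] by simp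
  next
   fix r x assume "r:el R" "x:{y\<in>el N. pair_seq \<zero>\<^sub>M y:H}"
   then show "r\<odot>\<^sub>N x:{y\<in>el N. pair_seq \<zero>\<^sub>M y:H}"
    using s(5)[of r "pair_seq \<zero>\<^sub>M x"] by (simp add: N.smult_closed M.smult_r_null)
  qed (use s in auto)
  then have 2: "{y\<in>el N. pair_seq \<zero>\<^sub>M y:H} = el N" using T H by (intro T(3)[rule_format]) auto
  have "pair_seq x y:H" if "x:el M" "y:el N" for x y
   using s(4)[of "pair_seq x \<zero>\<^sub>N" "pair_seq \<zero>\<^sub>M y"] that 1 2 by auto
  then show ?thesis by (auto elim!: ds_carrierE)
 qed
 moreover have "finite ?U" "?U<=el (direct_sum M N)" using S T by auto
 ultimately show ?thesis unfolding MOD_iff using D fin_genI[OF D, of ?U] by simp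
qed

end

section \<open>Complexes up to homotopy\<close>

locale cplx = modcat R for R :: "'r ring" (structure) +
 fixes X :: "'r cochain"
 assumes bc: "bounded_complex R X"
begin

lemma X_MOD [simp]: "cobj X n:MOD" using bc unfolding bounded_complex_def by blast

lemma X_lm [simp]: "lmod R (cobj X n)" by simp

sublocale C: left_module R "cobj X n" for n by (rule X_lm)

declare C.smult_closed [simp]

text \<open>The target degree is a separate variable with an equation, so that the rule also fires
  when source and target are n - 1 and n, or n + 1 and n + 2.\<close>

lemma d_hm [simp]: "m = n+1 ==> cdiff X n:hm (cobj X n) (cobj X m)" using bc unfolding bounded_complex_def by blast

lemma d_closed [simp]: "x:cel X n ==> m = n+1 ==> cdiff X n x:cel X m" using d_hm hm_closed by blast

lemma d_add [simp]: "x:cel X n ==> y:cel X n ==>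
  cdiff X n (x\<oplus>\<^sub>X\<^sup>n y) = cdiff X n x\<oplus>\<^sub>X\<^sup>(n+1) cdiff X n y" by (rule hm_add[OF d_hm]) auto

lemma d_smult: "r:el R ==> x:cel X n ==>
  cdiff X n (r\<odot>\<^sub>X\<^sup>n x) = r\<odot>\<^sub>X\<^sup>(n+1) cdiff X n x" by (rule hm_smult[OF d_hm]) auto

lemma d_zero [simp]: "cdiff X n \<zero>\<^sub>X\<^sup>n = \<zero>\<^sub>X\<^sup>(n+1)" by (rule hm_zero[OF d_hm]) auto

lemma d_minus [simp]: "x:cel X n ==>
  cdiff X n (\<ominus>\<^sub>X\<^sup>n x) =\<ominus>\<^sub>X\<^sup>(n+1) cdiff X n x" by (rule hm_minus[OF d_hm]) auto

lemma dd [simp]: "m = n+1 ==> x:cel X n ==> cdiff X m (cdiff X n x) = \<zero>\<^sub>X\<^sup>(n+2)"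
proof -
 assume "m = n+1" "x:cel X n"
 moreover have "n+1 + 1 = n+2" by simp
 ultimately show ?thesis using bc unfolding bounded_complex_def by metis
qed

lemma bounded: "finite {n. cel X n~={\<zero>\<^sub>X\<^sup>n}}" using bc unfolding bounded_complex_def by blast

end

context modcat
begin

lemma cplxI:
 assumes "!!n. cobj X n:MOD" "!!n. cdiff X n:hm (cobj X n) (cobj X (n+1))"
  "!!n x. x:cel X n ==> cdiff X (n+1) (cdiff X n x) = \<zero>\<^sub>X\<^sup>(n+2)"
  "finite {n. cel X n~={\<zero>\<^sub>X\<^sup>n}}"
 shows "cplx R X"
proof
 have *: "n+1 + 1 = n+2" for n :: int by simp
 show "bounded_complex R X" unfolding bounded_complex_def * using assms by blast
qed

lemma cplx_iff: "cplx R X\<longleftrightarrow>bounded_complex R X" unfolding cplx_def cplx_axioms_def using modcat_axioms by simp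

end

locale chmap = X: cplx R X + Y: cplx R Y for R :: "'r ring" (structure) and X Y +
 fixes f :: "'r chainmap"
 assumes f: "f:chain_maps R X Y"
begin

lemma f_hm [simp]: "f n:mod_hom R (cobj X n) (cobj Y n)" using f unfolding chain_maps_def by blast

lemma f_closed [simp]: "x:cel X n ==> f n x:cel Y n" using f_hm X.hm_closed by blast

lemma f_add [simp]: "x:cel X n ==> y:cel X n ==>
  f n (x\<oplus>\<^sub>X\<^sup>n y) = f n x\<oplus>\<^sub>Y\<^sup>n f n y" by (rule X.hm_add[OF f_hm]) auto

lemma f_smult: "r:el R ==> x:cel X n ==>
  f n (r\<odot>\<^sub>X\<^sup>n x) = r\<odot>\<^sub>Y\<^sup>n f n x" by (rule X.hm_smult[OF f_hm]) auto

lemma f_zero [simp]: "f n \<zero>\<^sub>X\<^sup>n = \<zero>\<^sub>Y\<^sup>n" by (rule X.hm_zero[OF f_hm]) auto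

lemma f_minus [simp]: "x:cel X n ==> f n (\<ominus>\<^sub>X\<^sup>n x) =\<ominus>\<^sub>Y\<^sup>n f n x" by (rule X.hm_minus[OF f_hm]) auto

lemma f_d [simp]: "m = n+1 ==> x:cel X n ==> f m (cdiff X n x) = cdiff Y n (f n x)" using f unfolding chain_maps_def by blast

end

locale hmtp = X: cplx R X + Y: cplx R Y for R :: "'r ring" (structure) and X Y +
 fixes h :: "int=>'r modmap"
 assumes h: "h n:mod_hom R (cobj X n) (cobj Y (n-1))"
begin

lemma h_closed [simp]: "x:cel X n ==> m = n-1 ==> h n x:cel Y m" using h X.hm_closed by blast

lemma h_add [simp]: "x:cel X n ==> y:cel X n ==>
  h n (x\<oplus>\<^sub>X\<^sup>n y) = h n x\<oplus>\<^sub>Y\<^sup>(n-1) h n y" by (rule X.hm_add[OF h]) auto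

lemma h_smult: "r:el R ==> x:cel X n ==>
  h n (r\<odot>\<^sub>X\<^sup>n x) = r\<odot>\<^sub>Y\<^sup>(n-1) h n x" by (rule X.hm_smult[OF h]) auto

lemma h_zero [simp]: "h n \<zero>\<^sub>X\<^sup>n = \<zero>\<^sub>Y\<^sup>(n-1)" by (rule X.hm_zero[OF h]) auto

lemma h_minus [simp]: "x:cel X n ==> h n (\<ominus>\<^sub>X\<^sup>n x) =\<ominus>\<^sub>Y\<^sup>(n-1) h n x" by (rule X.hm_minus[OF h]) auto

end

context modcat
begin

lemma chmap_iff: "chmap R X Y f\<longleftrightarrow>cplx R X&cplx R Y&f:chain_maps R X Y" unfolding chmap_def chmap_axioms_def by auto

lemma hmtp_iff: "hmtp R X Y h\<longleftrightarrow>cplx R X&cplx R Y&(\<forall>n. h n:hm (cobj X n) (cobj Y (n-1)))"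
 unfolding hmtp_def hmtp_axioms_def by auto

lemma homotopicE:
 assumes "homotopic R X Y f g" "cplx R X" "cplx R Y"
 obtains h where "hmtp R X Y h" "!!n x. x:cel X n ==>
   f n x = g n x\<oplus>\<^sub>Y\<^sup>n (cdiff Y (n-1) (h n x)\<oplus>\<^sub>Y\<^sup>n h (n+1) (cdiff X n x))"
 using assms unfolding homotopic_def hmtp_iff by blast

lemma homotopicI:
 assumes "hmtp R X Y h" "!!n x. x:cel X n ==>
   f n x = g n x\<oplus>\<^sub>Y\<^sup>n (cdiff Y (n-1) (h n x)\<oplus>\<^sub>Y\<^sup>n h (n+1) (cdiff X n x))"
 shows "homotopic R X Y f g" using assms unfolding homotopic_def hmtp_iff by blast

lemma chmap_restrictI:
 assumes "cplx R X" "cplx R Y" "!!n x. x:cel X n ==> f n x:cel Y n"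
  "!!n x y. x:cel X n ==> y:cel X n ==> f n (x\<oplus>\<^sub>X\<^sup>n y) = f n x\<oplus>\<^sub>Y\<^sup>n f n y"
  "!!n r x. r:el R ==> x:cel X n ==> f n (r\<odot>\<^sub>X\<^sup>n x) = r\<odot>\<^sub>Y\<^sup>n f n x"
  "!!n x. x:cel X n ==> f (n+1) (cdiff X n x) = cdiff Y n (f n x)"
 shows "chmap R X Y (\<lambda>n. \<lambda>x\<in>cel X n. f n x)"
proof -
 interpret X: cplx R X by fact
 interpret Y: cplx R Y by fact
 show ?thesis unfolding chmap_iff chain_maps_def using assms by (auto intro!: hm_restrictI)
qed

lemma hmtp_restrictI:
 assumes "cplx R X" "cplx R Y" "!!n x. x:cel X n ==> h n x:cel Y (n-1)"
  "!!n x y. x:cel X n ==> y:cel X n ==> h n (x\<oplus>\<^sub>X\<^sup>n y) = h n x\<oplus>\<^sub>Y\<^sup>(n-1) h n y"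
  "!!n r x. r:el R ==> x:cel X n ==> h n (r\<odot>\<^sub>X\<^sup>n x) = r\<odot>\<^sub>Y\<^sup>(n-1) h n x"
 shows "hmtp R X Y (\<lambda>n. \<lambda>x\<in>cel X n. h n x)"
proof -
 interpret X: cplx R X by fact
 show ?thesis unfolding hmtp_iff using assms by (auto intro!: hm_restrictI)
qed

abbreviation cmp_map :: "'a cochain=>'a chainmap=>'a chainmap=>'a chainmap" where
 "cmp_map X g f\<equiv>(\<lambda>n. compose (cel X n) (g n) (f n))"

abbreviation id_map :: "'a cochain=>'a chainmap" where
 "id_map X\<equiv>(\<lambda>n. \<lambda>x\<in>cel X n. x)"

lemma chmap_comp: "chmap R X Y f ==> chmap R Y Z g ==> chmap R X Z (cmp_map X g f)"
proof -
 assume f: "chmap R X Y f" and g: "chmap R Y Z g"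
 interpret f: chmap R X Y f by fact
 interpret g: chmap R Y Z g by fact
 show ?thesis unfolding compose_def by (rule chmap_restrictI[OF f.X.cplx_axioms g.Y.cplx_axioms]) (auto simp: f.f_smult g.f_smult)
qed

lemma chmap_id: "cplx R X ==> chmap R X X (id_map X)" by (rule chmap_restrictI) auto

lemma homotopic_refl:
 assumes "chmap R X Y f"
 shows "homotopic R X Y f f"
proof -
 interpret f: chmap R X Y f by fact
 have "hmtp R X Y (\<lambda>n. \<lambda>x\<in>cel X n. \<zero>\<^sub>Y\<^sup>(n-1))"
  by (rule hmtp_restrictI) (auto simp: f.X.cplx_axioms f.Y.cplx_axioms f.Y.C.smult_r_null)
 then show ?thesis by (rule homotopicI) (auto simp: f.Y.d_zero[of "n-1" for n, simplified])
qed

lemma homotopic_sym: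
 assumes "homotopic R X Y f g" "chmap R X Y f" "chmap R X Y g"
 shows "homotopic R X Y g f"
proof -
 interpret f: chmap R X Y f by fact
 interpret g: chmap R X Y g by fact
 obtain h where h: "hmtp R X Y h" "!!n x. x:cel X n ==>
   f n x = g n x\<oplus>\<^sub>Y\<^sup>n (cdiff Y (n-1) (h n x)\<oplus>\<^sub>Y\<^sup>n h (n+1) (cdiff X n x))"
  using homotopicE[OF assms(1) f.X.cplx_axioms f.Y.cplx_axioms] by metis
 interpret h: hmtp R X Y h by fact
 have "hmtp R X Y (\<lambda>n. \<lambda>x\<in>cel X n.\<ominus>\<^sub>Y\<^sup>(n-1) h n x)" by (rule hmtp_restrictI)
   (auto simp: f.X.cplx_axioms f.Y.cplx_axioms h.h_smult f.Y.C.smult_r_minus f.Y.C.M.minus_add)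
 then show ?thesis
 proof (rule homotopicI)
  fix n x assume x: "x:cel X n"
  have 1: "cdiff Y (n-1) (h n x):cel Y n" "h (n+1) (cdiff X n x):cel Y n"
   "g n x:cel Y n" using x by auto
  show "g n x = f n x\<oplus>\<^sub>Y\<^sup>n (cdiff Y (n-1) ((\<lambda>x\<in>cel X n.\<ominus>\<^sub>Y\<^sup>(n-1) h n x) x)
   \<oplus>\<^sub>Y\<^sup>n (\<lambda>x\<in>cel X (n+1).\<ominus>\<^sub>Y\<^sup>(n+1 - 1) h (n+1) x) (cdiff X n x))"
   using x f.Y.d_minus[of "h n x" "n-1"] by (simp add: h(2)[OF x], insert 1, algebra)
 qed
qed

lemma homotopic_trans:
 assumes "homotopic R X Y f g" "homotopic R X Y g k" "chmap R X Y f" "chmap R X Y g" "chmap R X Y k"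
 shows "homotopic R X Y f k"
proof -
 interpret f: chmap R X Y f by fact
 interpret g: chmap R X Y g by fact
 interpret k: chmap R X Y k by fact
 obtain h where h: "hmtp R X Y h" "!!n x. x:cel X n ==>
   f n x = g n x\<oplus>\<^sub>Y\<^sup>n (cdiff Y (n-1) (h n x)\<oplus>\<^sub>Y\<^sup>n h (n+1) (cdiff X n x))"
  using homotopicE[OF assms(1) f.X.cplx_axioms f.Y.cplx_axioms] by metis
 obtain h' where h': "hmtp R X Y h'" "!!n x. x:cel X n ==>
   g n x = k n x\<oplus>\<^sub>Y\<^sup>n (cdiff Y (n-1) (h' n x)\<oplus>\<^sub>Y\<^sup>n h' (n+1) (cdiff X n x))"
  using homotopicE[OF assms(2) f.X.cplx_axioms f.Y.cplx_axioms] by metis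
 interpret h: hmtp R X Y h by fact
 interpret h': hmtp R X Y h' by fact
 have "hmtp R X Y (\<lambda>n. \<lambda>x\<in>cel X n. h n x\<oplus>\<^sub>Y\<^sup>(n-1) h' n x)" by (rule hmtp_restrictI)
   (auto simp: f.X.cplx_axioms f.Y.cplx_axioms h.h_smult h'.h_smult f.Y.C.smult_r_distr f.Y.C.M.a_ac)
 then show ?thesis
 proof (rule homotopicI)
  fix n x assume x: "x:cel X n"
  have 1: "cdiff Y (n-1) (h n x):cel Y n" "h (n+1) (cdiff X n x):cel Y n"
   "cdiff Y (n-1) (h' n x):cel Y n" "h' (n+1) (cdiff X n x):cel Y n"
   "k n x:cel Y n" using x by auto
  show "f n x = k n x\<oplus>\<^sub>Y\<^sup>n (cdiff Y (n-1) ((\<lambda>x\<in>cel X n. h n x\<oplus>\<^sub>Y\<^sup>(n-1) h' n x) x)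
   \<oplus>\<^sub>Y\<^sup>n (\<lambda>x\<in>cel X (n+1). h (n+1) x\<oplus>\<^sub>Y\<^sup>(n+1 - 1) h' (n+1) x) (cdiff X n x))"
   using x f.Y.d_add[of "h n x" "n-1" "h' n x"] by (simp add: h(2)[OF x] h'(2)[OF x], insert 1, algebra)
 qed
qed

lemma homotopic_comp_left:
 assumes "homotopic R X Y f f'" "chmap R X Y f" "chmap R X Y f'" "chmap R Y Z g"
 shows "homotopic R X Z (cmp_map X g f) (cmp_map X g f')"
proof -
 interpret f: chmap R X Y f by fact
 interpret f': chmap R X Y f' by fact
 interpret g: chmap R Y Z g by fact
 obtain h where h: "hmtp R X Y h" "!!n x. x:cel X n ==>
   f n x = f' n x\<oplus>\<^sub>Y\<^sup>n (cdiff Y (n-1) (h n x)\<oplus>\<^sub>Y\<^sup>n h (n+1) (cdiff X n x))"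
  using homotopicE[OF assms(1) f.X.cplx_axioms f.Y.cplx_axioms] by metis
 interpret h: hmtp R X Y h by fact
 have "hmtp R X Z (\<lambda>n. \<lambda>x\<in>cel X n. g (n-1) (h n x))" by (rule hmtp_restrictI)
   (auto simp: f.X.cplx_axioms g.Y.cplx_axioms h.h_smult g.f_smult)
 then show ?thesis
 proof (rule homotopicI)
  fix n x assume x: "x:cel X n"
  show "cmp_map X g f n x = cmp_map X g f' n x\<oplus>\<^sub>Z\<^sup>n
   (cdiff Z (n-1) ((\<lambda>x\<in>cel X n. g (n-1) (h n x)) x)
   \<oplus>\<^sub>Z\<^sup>n (\<lambda>x\<in>cel X (n+1). g (n+1 - 1) (h (n+1) x)) (cdiff X n x))"
   using x h(2)[OF x] g.f_d[of n "n-1" "h n x"] by (simp add: compose_def)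
 qed
qed

lemma homotopic_comp_right:
 assumes "homotopic R Y Z g g'" "chmap R X Y f" "chmap R Y Z g" "chmap R Y Z g'"
 shows "homotopic R X Z (cmp_map X g f) (cmp_map X g' f)"
proof -
 interpret f: chmap R X Y f by fact
 interpret g: chmap R Y Z g by fact
 interpret g': chmap R Y Z g' by fact
 obtain h where h: "hmtp R Y Z h" "!!n x. x:cel Y n ==>
   g n x = g' n x\<oplus>\<^sub>Z\<^sup>n (cdiff Z (n-1) (h n x)\<oplus>\<^sub>Z\<^sup>n h (n+1) (cdiff Y n x))"
  using homotopicE[OF assms(1) f.Y.cplx_axioms g.Y.cplx_axioms] by metis
 interpret h: hmtp R Y Z h by fact
 have "hmtp R X Z (\<lambda>n. \<lambda>x\<in>cel X n. h n (f n x))" by (rule hmtp_restrictI)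
   (auto simp: f.X.cplx_axioms g.Y.cplx_axioms h.h_smult f.f_smult)
 then show ?thesis
 proof (rule homotopicI)
  fix n x assume x: "x:cel X n"
  show "cmp_map X g f n x = cmp_map X g' f n x\<oplus>\<^sub>Z\<^sup>n
   (cdiff Z (n-1) ((\<lambda>x\<in>cel X n. h n (f n x)) x)
   \<oplus>\<^sub>Z\<^sup>n (\<lambda>x\<in>cel X (n+1). h (n+1) (f (n+1) x)) (cdiff X n x))"
   using x h(2)[of "f n x" n] by (simp add: compose_def)
 qed
qed

lemma homotopic_comp:
 assumes "homotopic R X Y f f'" "homotopic R Y Z g g'" "chmap R X Y f" "chmap R X Y f'" "chmap R Y Z g" "chmap R Y Z g'"
 shows "homotopic R X Z (cmp_map X g f) (cmp_map X g' f')"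
 by (rule homotopic_trans[OF homotopic_comp_left[OF assms(1,3,4,5)] homotopic_comp_right[OF assms(2,4,5,6)]])
  (use assms chmap_comp in auto)

abbreviation "hcl\<equiv>homotopy_class R"

lemma hcl_eq_iff:
 assumes "chmap R X Y f" "chmap R X Y g"
 shows "hcl X Y f = hcl X Y g\<longleftrightarrow>homotopic R X Y f g"
proof
 have m: "k:chain_maps R X Y\<longleftrightarrow>chmap R X Y k" for k using assms unfolding chmap_iff by blast
 assume "hcl X Y f = hcl X Y g"
 moreover have "g:hcl X Y g" unfolding homotopy_class_def m using assms homotopic_refl by blast
 ultimately show "homotopic R X Y f g" unfolding homotopy_class_def by blast
next
 have m: "k:chain_maps R X Y\<longleftrightarrow>chmap R X Y k" for k using assms unfolding chmap_iff by blast
 assume a: "homotopic R X Y f g"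
 then show "hcl X Y f = hcl X Y g" unfolding homotopy_class_def m using homotopic_trans homotopic_sym assms by meson
qed

lemma hcl_mem: "chmap R X Y f ==> g:hcl X Y f\<longleftrightarrow>chmap R X Y g&homotopic R X Y f g"
 unfolding homotopy_class_def by (auto simp: chmap_iff)

lemma Kb_sel [simp]: "Ob (Kb R) = {X. cplx R X}"
 "Ident (Kb R) X = hcl X X (id_map X)" "Shift (Kb R) = shift" unfolding Kb_def Kb_base_def cplx_iff by simp_all

lemma Kb_Hom: "cplx R X ==> cplx R Y ==> c:Hom (Kb R) X Y\<longleftrightarrow>(\<exists>f. chmap R X Y f&c = hcl X Y f)"
 unfolding Kb_def Kb_base_def by (auto simp: chmap_iff)

lemma Kb_HomE:
 assumes "c:Hom (Kb R) X Y" "cplx R X" "cplx R Y"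
 obtains f where "chmap R X Y f" "c = hcl X Y f" using assms Kb_Hom by blast

lemma Kb_Comp:
 assumes "chmap R X Y f" "chmap R Y Z g"
 shows "Comp (Kb R) X Y Z (hcl Y Z g) (hcl X Y f) = hcl X Z (cmp_map X g f)"
proof -
 have c: "chmap R X Z (cmp_map X g f)" using chmap_comp assms .
 have "Comp (Kb R) X Y Z (hcl Y Z g) (hcl X Y f) = {h\<in>chain_maps R X Z. \<exists>f'\<in>hcl X Y f. \<exists>g'\<in>hcl Y Z g.
    homotopic R X Z (cmp_map X g' f') h}" unfolding Kb_def Kb_base_def by simp
 also have "\<dots> = hcl X Z (cmp_map X g f)"
 proof (rule Set.set_eqI)
  fix h
  have "homotopic R X Z (cmp_map X g f) h" if "chmap R X Y f'" "homotopic R X Y f f'"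
   "chmap R Y Z g'" "homotopic R Y Z g g'" "homotopic R X Z (cmp_map X g' f') h" "h:chain_maps R X Z" for f' g'
   by (rule homotopic_trans[OF homotopic_comp[OF that(2,4)] that(5)])
    (use assms that chmap_comp c in \<open>auto simp: chmap_iff\<close>)
  moreover have "f:hcl X Y f" "g:hcl Y Z g" using homotopic_refl assms by (auto simp: hcl_mem)
  ultimately show "h:{h\<in>chain_maps R X Z. \<exists>f'\<in>hcl X Y f. \<exists>g'\<in>hcl Y Z g. homotopic R X Z (cmp_map X g' f') h}
   \<longleftrightarrow>h:hcl X Z (cmp_map X g f)"
   by (simp add: Bex_def hcl_mem[OF assms(1)] hcl_mem[OF assms(2)] homotopy_class_def[of R X Z]) blast
 qed
 finally show ?thesis .
qed

lemma chmap_ext: "chmap R X Y f ==> chmap R X Y' g ==> (!!n x. x:cel X n ==> f n x = g n x) ==> f = g"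
 unfolding chmap_iff chain_maps_def by (rule ext) (auto intro!: hm_ext)

lemma chmap_val: "chmap R X Y f ==> x:cel X n ==> f n x:cel Y n" unfolding chmap_iff chain_maps_def using hm_closed[of "f n"] by blast

lemma Kb_cat: "cat (Kb R)"
proof
 fix X assume "X:Ob (Kb R)"
 then show "Ident (Kb R) X:Hom (Kb R) X X" using chmap_id by (auto simp: Kb_Hom)
next
 fix X Y Z c d assume *: "c:Hom (Kb R) X Y" "d:Hom (Kb R) Y Z" "X:Ob (Kb R)" "Y:Ob (Kb R)" "Z:Ob (Kb R)"
 then show "Comp (Kb R) X Y Z d c:Hom (Kb R) X Z" by (auto simp: Kb_Hom Kb_Comp intro: chmap_comp)
next
 fix X Y c assume *: "c:Hom (Kb R) X Y" "X:Ob (Kb R)" "Y:Ob (Kb R)"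
 then have ob: "cplx R X" "cplx R Y" by auto
 obtain f where f: "chmap R X Y f" "c = hcl X Y f" using Kb_HomE[OF *(1) ob] .
 have "cmp_map X (id_map Y) f = f" by (rule chmap_ext[OF chmap_comp[OF f(1) chmap_id[OF ob(2)]] f(1)])
   (simp add: compose_def chmap_val[OF f(1)])
 moreover have "cmp_map X f (id_map X) = f" by (rule chmap_ext[OF chmap_comp[OF chmap_id[OF ob(1)] f(1)] f(1)]) (simp add: compose_def)
 ultimately show "Comp (Kb R) X Y Y (Ident (Kb R) Y) c = c" "Comp (Kb R) X X Y c (Ident (Kb R) X) = c"
  using f ob by (simp_all add: Kb_Comp chmap_id)
next
 fix X Y Z W c d e assume *: "c:Hom (Kb R) X Y" "d:Hom (Kb R) Y Z" "e:Hom (Kb R) Z W"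
  "X:Ob (Kb R)" "Y:Ob (Kb R)" "Z:Ob (Kb R)" "W:Ob (Kb R)"
 then have ob: "cplx R X" "cplx R Y" "cplx R Z" "cplx R W" by auto
 obtain f where f: "chmap R X Y f" "c = hcl X Y f" using Kb_HomE[OF *(1) ob(1,2)] .
 obtain g where g: "chmap R Y Z g" "d = hcl Y Z g" using Kb_HomE[OF *(2) ob(2,3)] .
 obtain k where k: "chmap R Z W k" "e = hcl Z W k" using Kb_HomE[OF *(3) ob(3,4)] .
 have "cmp_map X (cmp_map Y k g) f = cmp_map X k (cmp_map X g f)" by (intro ext) (auto simp: compose_def chmap_val[OF f(1)])
 then show "Comp (Kb R) X Y W (Comp (Kb R) Y Z W e d) c = Comp (Kb R) X Z W e (Comp (Kb R) X Y Z d c)" unfolding f(2) g(2) k(2)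
  using Kb_Comp[OF f(1) g(1)] Kb_Comp[OF g(1) k(1)] Kb_Comp[OF f(1) chmap_comp[OF g(1) k(1)]]
   Kb_Comp[OF chmap_comp[OF f(1) g(1)] k(1)] by simp
qed

end

text \<open>Degree arithmetic is left to the explicit list \<open>degree_simps\<close>, which brings
  iterated shifts and cones to the degrees n + k and n - k that occur in the statements.\<close>

declare [[simproc del: int_combine_numerals]]

lemma degree_simps [simp]:
 "n+1 + 1 = n + (2::int)" "n+1 + 2 = n + (3::int)" "n+2 + 1 = n + (3::int)" "n+2 + 2 = n + (4::int)"
 "n+2 - 1 = n + (1::int)" "n+3 - 1 = n + (2::int)" "n-1 + 2 = n + (1::int)" "n-1 + 3 = n + (2::int)"
 "n-1 - 1 = n - (2::int)" "n-2 + 1 = n - (1::int)" "n-2 + 2 = (n::int)" "n+1 - 2 = n - (1::int)" by simp_all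

section \<open>Shifts, cones and standard triangles\<close>

definition unshift :: "'r cochain=>'r cochain" where
 "unshift X = \<lparr>cobj = (\<lambda>n. cobj X (n-1)),
   cdiff = (\<lambda>n. \<lambda>x\<in>cel X (n-1).\<ominus>\<^sub>X\<^sup>n cdiff X (n-1) x)\<rparr>"

lemma shift_obj [simp]: "cobj (shift X) n = cobj X (n+1)" unfolding shift_complex_def by simp

lemma shift_d [simp]: "x:cel X (n+1) ==>
  cdiff (shift X) n x =\<ominus>\<^sub>X\<^sup>(n+2) cdiff X (n+1) x" unfolding shift_complex_def by (simp add: add.assoc)

lemma unshift_obj [simp]: "cobj (unshift X) n = cobj X (n-1)" unfolding unshift_def by simp

lemma unshift_d [simp]: "x:cel X (n-1) ==>
  cdiff (unshift X) n x =\<ominus>\<^sub>X\<^sup>n cdiff X (n-1) x" unfolding unshift_def by simp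

lemma cone_obj [simp]: "cobj (cone X Y f) n = direct_sum (cobj X (n+1)) (cobj Y n)" unfolding mapping_cone_def by simp

lemma cone_d [simp]: "x:cel X (n+1) ==> y:cel Y n ==>
  cdiff (cone X Y f) n (pair_seq x y) = pair_seq (\<ominus>\<^sub>X\<^sup>(n+2) cdiff X (n+1) x)
   (f (n+1) x\<oplus>\<^sub>Y\<^sup>(n+1) cdiff Y n y)" unfolding mapping_cone_def by (simp add: add.assoc)

lemma finite_translate:
 fixes P :: "int=>bool"
 assumes "finite {n. P n}"
 shows "finite {n. P (n + k)}" "finite {n. P (n - k)}"
proof -
 have "{n. P (n + k)} = (\<lambda>n. n - k) ` {n. P n}" "{n. P (n - k)} = (\<lambda>n. n + k) ` {n. P n}"
  by (auto simp: image_iff algebra_simps intro!: exI)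
 then show "finite {n. P (n + k)}" "finite {n. P (n - k)}" using assms by auto
qed

context modcat
begin

lemma shift_cplx:
 assumes "cplx R X"
 shows "cplx R (shift X)"
proof -
 interpret X: cplx R X by fact
 show ?thesis
 proof (rule cplxI)
  fix n
  show "cobj (shift X) n:MOD" by simp
  show "cdiff (shift X) n:hm (cobj (shift X) n) (cobj (shift X) (n+1))" unfolding shift_complex_def by (auto intro!: hm_neg X.d_hm)
  show "cdiff (shift X) (n+1) (cdiff (shift X) n x) = \<zero>\<^sub>(shift X)\<^sup>(n+2)" if "x:cel (shift X) n" for x
   using that X.d_minus[of "cdiff X (n+1) x" "n+2"] X.dd[of "n+2" "n+1" x] X.C.M.a_inv_zero[of "n+3"] by simp
 next
  show "finite {n. cel (shift X) n~={\<zero>\<^sub>(shift X)\<^sup>n}}" using finite_translate(1)[OF X.bounded, of 1] by simp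
 qed
qed

lemma unshift_cplx:
 assumes "cplx R X"
 shows "cplx R (unshift X)"
proof -
 interpret X: cplx R X by fact
 show ?thesis
 proof (rule cplxI)
  fix n
  show "cobj (unshift X) n:MOD" by simp
  show "cdiff (unshift X) n:hm (cobj (unshift X) n) (cobj (unshift X) (n+1))" unfolding unshift_def by (auto intro!: hm_neg X.d_hm)
  show "cdiff (unshift X) (n+1) (cdiff (unshift X) n x) = \<zero>\<^sub>(unshift X)\<^sup>(n+2)" if "x:cel (unshift X) n" for x
   using that X.d_minus[of "cdiff X (n-1) x" n] X.dd[of n "n-1" x] X.C.M.a_inv_zero[of "n+1"] by simp
 next
  show "finite {n. cel (unshift X) n~={\<zero>\<^sub>(unshift X)\<^sup>n}}" using finite_translate(2)[OF X.bounded, of 1] by simp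
 qed
qed

lemma cone_cplx:
 assumes "chmap R X Y f"
 shows "cplx R (cone X Y f)"
proof -
 interpret f: chmap R X Y f by fact
 show ?thesis
 proof (rule cplxI)
  fix n
  show "cobj (cone X Y f) n:MOD" by (simp add: ds_MOD)
  have "cdiff (cone X Y f) n = (\<lambda>z\<in>cel (cone X Y f) n. cdiff (cone X Y f) n z)" unfolding mapping_cone_def by auto
  also have "\<dots>:hm (cobj (cone X Y f) n) (cobj (cone X Y f) (n+1))"
  proof (rule hm_restrictI)
   show "lmod R (cobj (cone X Y f) n)" by (simp add: ds_left_module)
   fix x assume "x:cel (cone X Y f) n"
   then show "cdiff (cone X Y f) n x:cel (cone X Y f) (n+1)" by (auto elim!: ds_carrierE)
  next
   fix x y assume "x:cel (cone X Y f) n" "y:cel (cone X Y f) n"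
   then show "cdiff (cone X Y f) n (x\<oplus>\<^sub>(cone X Y f)\<^sup>n y) =
    cdiff (cone X Y f) n x\<oplus>\<^sub>(cone X Y f)\<^sup>(n+1) cdiff (cone X Y f) n y"
    using f.X.d_add[of _ "n+1"] by (auto elim!: ds_carrierE simp: f.X.C.M.minus_add f.Y.C.M.a_ac)
  next
   fix r x assume "r:el R" "x:cel (cone X Y f) n"
   then show "cdiff (cone X Y f) n (r\<odot>\<^sub>(cone X Y f)\<^sup>n x) =
    r\<odot>\<^sub>(cone X Y f)\<^sup>(n+1) cdiff (cone X Y f) n x" using f.X.d_smult[of r _ "n+1"]
    by (auto elim!: ds_carrierE simp: f.X.C.smult_r_minus f.Y.C.smult_r_distr f.f_smult f.Y.d_smult)
  qed
  finally show "cdiff (cone X Y f) n:hm (cobj (cone X Y f) n) (cobj (cone X Y f) (n+1))" .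
  fix z assume "z:cel (cone X Y f) n"
  then obtain x y where z: "z = pair_seq x y" "x:cel X (n+1)" "y:cel Y n" by (auto elim!: ds_carrierE)
  show "cdiff (cone X Y f) (n+1) (cdiff (cone X Y f) n z) = \<zero>\<^sub>(cone X Y f)\<^sup>(n+2)"
   using z f.X.d_minus[of "cdiff X (n+1) x" "n+2"] f.X.dd[of "n+2" "n+1" x] f.X.C.M.a_inv_zero
    f.f_minus[of "cdiff X (n+1) x" "n+2"] f.f_d[of "n+2" "n+1" x]
    f.Y.d_add[of "f (n+1) x" "n+1" "cdiff Y n y"] f.Y.C.M.l_neg[of "cdiff Y (n+1) (f (n+1) x)" "n+2"] by simp
 next
  have e: "el (direct_sum M N) = {\<zero>\<^bsub>direct_sum M N\<^esub>}" if "el M = {\<zero>\<^sub>M}" "el N = {\<zero>\<^sub>N}"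
   for M N :: "'r fgmod" using that unfolding direct_sum_def by auto
  show "finite {n. cel (cone X Y f) n~={\<zero>\<^sub>(cone X Y f)\<^sup>n}}"
   by (rule finite_subset[OF _ finite_UnI[OF finite_translate(1)[OF f.X.bounded, of 1] f.Y.bounded]])
    (use e in \<open>auto simp del: ds_simps\<close>)
 qed
qed

lemma cone_incl: "chmap R X Y f ==> chmap R Y (cone X Y f) (cone_inclusion X Y)"
proof -
 assume f: "chmap R X Y f"
 interpret f: chmap R X Y f by fact
 show ?thesis unfolding cone_inclusion_def by (rule chmap_restrictI) (auto simp: cone_cplx[OF f] f.Y.cplx_axioms f.X.C.smult_r_null
    f.X.d_zero[of "n+1" for n, simplified] f.X.C.M.a_inv_zero)
qed

lemma cone_proj: "chmap R X Y f ==> chmap R (cone X Y f) (shift X) (cone_projection X Y)"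
proof -
 assume f: "chmap R X Y f"
 interpret f: chmap R X Y f by fact
 have e: "cone_projection X Y = (\<lambda>n. \<lambda>z\<in>cel (cone X Y f) n. fst_seq z)" unfolding cone_projection_def by simp
 show ?thesis unfolding e by (rule chmap_restrictI) (auto simp: cone_cplx[OF f] shift_cplx f.X.cplx_axioms elim!: ds_carrierE)
qed

lemma shift_chmap: "chmap R X Y f ==> chmap R (shift X) (shift Y) (\<lambda>n. f (n+1))"
proof -
 assume f: "chmap R X Y f"
 interpret f: chmap R X Y f by fact
 have *: "f (n+2) (cdiff X (n+1) x) = cdiff Y (n+1) (f (n+1) x)"
   "cdiff X (n+1) x:cel X (n+2)" if "x:cel X (n+1)" for n x using that by auto
 have "f (n+1 + 1) (cdiff (shift X) n x) = cdiff (shift Y) n (f (n+1) x)" if "x:cel X (n+1)" for n x using that * by (simp add: add.assoc)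
 then show ?thesis unfolding chmap_iff chain_maps_def using shift_cplx[OF f.X.cplx_axioms] shift_cplx[OF f.Y.cplx_axioms] by simp
qed

lemma shift_homotopic:
 assumes "homotopic R X Y f g" "chmap R X Y f" "chmap R X Y g"
 shows "homotopic R (shift X) (shift Y) (\<lambda>n. f (n+1)) (\<lambda>n. g (n+1))"
proof -
 interpret f: chmap R X Y f by fact
 interpret g: chmap R X Y g by fact
 obtain h where h: "hmtp R X Y h" "!!n x. x:cel X n ==>
   f n x = g n x\<oplus>\<^sub>Y\<^sup>n (cdiff Y (n-1) (h n x)\<oplus>\<^sub>Y\<^sup>n h (n+1) (cdiff X n x))"
  using homotopicE[OF assms(1) f.X.cplx_axioms f.Y.cplx_axioms] by metis
 interpret h: hmtp R X Y h by fact
 have "hmtp R (shift X) (shift Y) (\<lambda>n. \<lambda>x\<in>cel (shift X) n.\<ominus>\<^sub>Y\<^sup>n h (n+1) x)"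
  by (rule hmtp_restrictI[OF shift_cplx[OF f.X.cplx_axioms] shift_cplx[OF f.Y.cplx_axioms]])
    (auto simp: h.h_add[of _ "n+1" for n, simplified] f.Y.C.M.minus_add h.h_smult[of _ _ "n+1" for n, simplified] f.Y.C.smult_r_minus)
 then show ?thesis
 proof (rule homotopicI)
  fix n x assume "x:cel (shift X) n"
  then have x: "x:cel X (n+1)" by simp
  then have dx: "cdiff X (n+1) x:cel X (n+2)" by simp
  have "h (n+2) (\<ominus>\<^sub>X\<^sup>(n+2) cdiff X (n+1) x) =\<ominus>\<^sub>Y\<^sup>(n+1) h (n+2) (cdiff X (n+1) x)"
   using h.h_minus[OF dx] by (simp add: algebra_simps)
  moreover have "cdiff Y n (\<ominus>\<^sub>Y\<^sup>n h (n+1) x) =\<ominus>\<^sub>Y\<^sup>(n+1) cdiff Y n (h (n+1) x)" using x by simp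
  ultimately show "f (n+1) x = g (n+1) x\<oplus>\<^sub>(shift Y)\<^sup>n
   (cdiff (shift Y) (n-1) ((\<lambda>x\<in>cel (shift X) n.\<ominus>\<^sub>Y\<^sup>n h (n+1) x) x)
   \<oplus>\<^sub>(shift Y)\<^sup>n (\<lambda>x\<in>cel (shift X) (n+1).\<ominus>\<^sub>Y\<^sup>(n+1) h (n+1 + 1) x) (cdiff (shift X) n x))"
   using x dx h(2)[OF x] by (simp add: add.assoc)
 qed
qed

lemma Kb_ShiftMor:
 assumes "chmap R X Y f"
 shows "ShiftMor (Kb R) X Y (hcl X Y f) = hcl (shift X) (shift Y) (\<lambda>n. f (n+1))"
proof -
 have "ShiftMor (Kb R) X Y (hcl X Y f) = {g\<in>chain_maps R (shift X) (shift Y). \<exists>f'\<in>hcl X Y f.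
    homotopic R (shift X) (shift Y) (\<lambda>n. f' (n+1)) g}" unfolding Kb_def Kb_base_def by simp
 also have "\<dots> = hcl (shift X) (shift Y) (\<lambda>n. f (n+1))"
 proof (rule Set.set_eqI)
  fix g
  have "homotopic R (shift X) (shift Y) (\<lambda>n. f (n+1)) g" if "chmap R X Y f'" "homotopic R X Y f f'"
   "homotopic R (shift X) (shift Y) (\<lambda>n. f' (n+1)) g" "g:chain_maps R (shift X) (shift Y)" for f'
   by (rule homotopic_trans[OF shift_homotopic[OF that(2)] that(3)])
    (use assms that shift_chmap[OF assms] shift_chmap[OF that(1)] in \<open>auto simp: chmap_iff\<close>)
  moreover have "f:hcl X Y f" using homotopic_refl assms by (auto simp: hcl_mem)
  ultimately show "g:{g\<in>chain_maps R (shift X) (shift Y). \<exists>f'\<in>hcl X Y f.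
    homotopic R (shift X) (shift Y) (\<lambda>n. f' (n+1)) g}
   \<longleftrightarrow>g:hcl (shift X) (shift Y) (\<lambda>n. f (n+1))"
   by (simp add: Bex_def hcl_mem[OF assms(1)] homotopy_class_def[of R "shift X"]) blast
 qed
 finally show ?thesis .
qed

lemma Kb_shift: "is_functor (Kb R) (Kb R) (shift_func (Kb R))" unfolding is_functor_def
proof (intro conjI ballI)
 fix X assume X: "X:Ob (Kb R)"
 then show "ob (shift_func (Kb R)) X:Ob (Kb R)" by (simp add: shift_func_def shift_cplx)
 have "(\<lambda>n. id_map X (n+1)) = id_map (shift X)" by simp
 then show "mor (shift_func (Kb R)) X X (Ident (Kb R) X) = Ident (Kb R) (ob (shift_func (Kb R)) X)"
  using X Kb_ShiftMor[OF chmap_id] by (simp add: shift_func_def)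
next
 fix X Y c assume *: "X:Ob (Kb R)" "Y:Ob (Kb R)" "c:Hom (Kb R) X Y"
 then obtain f where f: "chmap R X Y f" "c = hcl X Y f" by (auto elim: Kb_HomE)
 show "mor (shift_func (Kb R)) X Y c:Hom (Kb R) (ob (shift_func (Kb R)) X) (ob (shift_func (Kb R)) Y)"
  using Kb_ShiftMor[OF f(1)] shift_chmap[OF f(1)] * f by (auto simp: shift_func_def Kb_Hom shift_cplx)
next
 fix X Y Z c d assume *: "X:Ob (Kb R)" "Y:Ob (Kb R)" "Z:Ob (Kb R)" "c:Hom (Kb R) X Y" "d:Hom (Kb R) Y Z"
 obtain f where f: "chmap R X Y f" "c = hcl X Y f" using * by (auto elim: Kb_HomE)
 obtain g where g: "chmap R Y Z g" "d = hcl Y Z g" using * by (auto elim: Kb_HomE)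
 show "mor (shift_func (Kb R)) X Z (Comp (Kb R) X Y Z d c) =
    Comp (Kb R) (ob (shift_func (Kb R)) X) (ob (shift_func (Kb R)) Y) (ob (shift_func (Kb R)) Z)
    (mor (shift_func (Kb R)) Y Z d) (mor (shift_func (Kb R)) X Y c)"
  using Kb_ShiftMor[OF f(1)] Kb_ShiftMor[OF g(1)] Kb_ShiftMor[OF chmap_comp[OF f(1) g(1)]] f g
   Kb_Comp[OF f(1) g(1)] Kb_Comp[OF shift_chmap[OF f(1)] shift_chmap[OF g(1)]] by (simp add: shift_func_def)
qed

definition std_tri :: "'r cochain=>'r cochain=>'r chainmap=>('r cochain, 'r chainmap set) tri" where
 "std_tri X Y f = (X, Y, cone X Y f, hcl X Y f, hcl Y (cone X Y f) (cone_inclusion X Y),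
   hcl (cone X Y f) (shift X) (cone_projection X Y))"

lemma Kb_wt: "Kb R = with_triangles (Kb_base R) {std_tri X Y f | X Y f. chmap R X Y f}"
 unfolding Kb_def std_tri_def chmap_iff cplx_iff by (rule arg_cong[of _ _ "with_triangles (Kb_base R)"]) auto

lemma std_tri_triangle: "chmap R X Y f ==> is_triangle (Kb R) (std_tri X Y f)"
proof -
 assume f: "chmap R X Y f"
 interpret f: chmap R X Y f by fact
 note c = cone_cplx[OF f] f.X.cplx_axioms f.Y.cplx_axioms shift_cplx[OF f.X.cplx_axioms]
 show ?thesis unfolding is_triangle_def std_tri_def using f cone_incl[OF f] cone_proj[OF f] c by (auto simp: Kb_Hom)
qed

end

section \<open>Acyclicity and quasi-isomorphisms in terms of elements\<close>

definition acyc :: "'r cochain=>bool" where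
 "acyc X\<longleftrightarrow>(\<forall>n. \<forall>x\<in>cel X n. cdiff X n x = \<zero>\<^sub>X\<^sup>(n+1)-->
   (\<exists>x'\<in>cel X (n-1). cdiff X (n-1) x' = x))"

text \<open>Injectivity of the induced map on cohomology, and in \<open>hsurj\<close> its
  surjectivity, phrased with cycles and boundaries so that no cohomology modules have to be
  formed.\<close>

definition hinj :: "'r cochain=>'r cochain=>'r chainmap=>bool" where
 "hinj X Y f\<longleftrightarrow>(\<forall>n. \<forall>x\<in>cel X n. \<forall>y\<in>cel Y (n-1).
   cdiff X n x = \<zero>\<^sub>X\<^sup>(n+1)-->f n x = cdiff Y (n-1) y-->
   (\<exists>x'\<in>cel X (n-1). cdiff X (n-1) x' = x))"

definition hsurj :: "'r cochain=>'r cochain=>'r chainmap=>bool" where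
 "hsurj X Y f\<longleftrightarrow>(\<forall>n. \<forall>y\<in>cel Y n. cdiff Y n y = \<zero>\<^sub>Y\<^sup>(n+1)-->
   (\<exists>x\<in>cel X n. \<exists>y'\<in>cel Y (n-1). cdiff X n x = \<zero>\<^sub>X\<^sup>(n+1)&
    y = f n x\<oplus>\<^sub>Y\<^sup>n cdiff Y (n-1) y'))"

definition qis :: "'r cochain=>'r cochain=>'r chainmap=>bool" where
 "qis X Y f\<longleftrightarrow>hinj X Y f&hsurj X Y f"

lemma acycD: "[|acyc X; x:cel X n; cdiff X n x = \<zero>\<^sub>X\<^sup>(n+1)|] ==>
  \<exists>x'\<in>cel X (n-1). cdiff X (n-1) x' = x" unfolding acyc_def by blast

lemma hinjD: "[|hinj X Y f; x:cel X n; cdiff X n x = \<zero>\<^sub>X\<^sup>(n+1);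
  y:cel Y (n-1); f n x = cdiff Y (n-1) y|] ==>
  \<exists>x'\<in>cel X (n-1). cdiff X (n-1) x' = x" unfolding hinj_def by blast

lemma hsurjE:
 assumes "hsurj X Y f" "y:cel Y n" "cdiff Y n y = \<zero>\<^sub>Y\<^sup>(n+1)"
 obtains x y' where "x:cel X n" "y':cel Y (n-1)" "cdiff X n x = \<zero>\<^sub>X\<^sup>(n+1)"
  "y = f n x\<oplus>\<^sub>Y\<^sup>n cdiff Y (n-1) y'" using assms unfolding hsurj_def by blast

context modcat
begin

lemma acyclic_iff: "X:acyclic_complexes R\<longleftrightarrow>cplx R X&acyc X"
proof
 assume a: "X:acyclic_complexes R"
 then have X: "cplx R X" unfolding acyclic_complexes_def cplx_iff by blast
 interpret X: cplx R X by fact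
 have "cdiff X n ` cel X n = {x\<in>cel X (n+1). cdiff X (n+1) x = \<zero>\<^sub>X\<^sup>(n+2)}" for n
  using a unfolding acyclic_complexes_def by (simp add: add.assoc)
 then have "x:cdiff X (n-1) ` cel X (n-1)" if "x:cel X n" "cdiff X n x = \<zero>\<^sub>X\<^sup>(n+1)" for x n
  using that by (metis (mono_tags, lifting) degree_simps(7) diff_add_cancel mem_Collect_eq)
 then show "cplx R X&acyc X" unfolding acyc_def using X by blast
next
 assume a: "cplx R X&acyc X"
 then interpret X: cplx R X by blast
 have "x:cdiff X n ` cel X n" if "x:cel X (n+1)" "cdiff X (n+1) x = \<zero>\<^sub>X\<^sup>(n+2)" for x n
  using acycD[of X x "n+1"] that a by auto
 then show "X:acyclic_complexes R" using a unfolding acyclic_complexes_def by (auto simp: cplx_iff)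
qed

lemma hinj_homotopic:
 assumes "homotopic R X Y f g" "chmap R X Y f" "chmap R X Y g" "hinj X Y f"
 shows "hinj X Y g"
proof -
 interpret f: chmap R X Y f by fact
 interpret g: chmap R X Y g by fact
 obtain h where h: "hmtp R X Y h" "!!n x. x:cel X n ==>
   f n x = g n x\<oplus>\<^sub>Y\<^sup>n (cdiff Y (n-1) (h n x)\<oplus>\<^sub>Y\<^sup>n h (n+1) (cdiff X n x))"
  using homotopicE[OF assms(1) f.X.cplx_axioms f.Y.cplx_axioms] by metis
 interpret h: hmtp R X Y h by fact
 \<comment> \<open>On cycles the term of the homotopy that first applies the differential vanishes,
   so homotopic maps differ there by a boundary.\<close>
 have c: "f n x = g n x\<oplus>\<^sub>Y\<^sup>n cdiff Y (n-1) (h n x)" if "x:cel X n" "cdiff X n x = \<zero>\<^sub>X\<^sup>(n+1)" for x n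
  using h(2)[OF that(1)] that h.h_zero[of "n+1"] by simp
 show ?thesis unfolding hinj_def
 proof (intro allI ballI impI)
  fix n x y assume *: "x:cel X n" "y:cel Y (n-1)"
   "cdiff X n x = \<zero>\<^sub>X\<^sup>(n+1)" "g n x = cdiff Y (n-1) y"
  have e: "f n x = cdiff Y (n-1) (y\<oplus>\<^sub>Y\<^sup>(n-1) h n x)" using * c[OF *(1,3)] by simp
  show "\<exists>x'\<in>cel X (n-1). cdiff X (n-1) x' = x" by (rule hinjD[where f = f, OF _ *(1,3) _ e]) (use assms(4) * in auto)
 qed
qed

lemma hsurj_homotopic:
 assumes "homotopic R X Y f g" "chmap R X Y f" "chmap R X Y g" "hsurj X Y f"
 shows "hsurj X Y g"
proof -
 interpret f: chmap R X Y f by fact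
 interpret g: chmap R X Y g by fact
 obtain h where h: "hmtp R X Y h" "!!n x. x:cel X n ==>
   f n x = g n x\<oplus>\<^sub>Y\<^sup>n (cdiff Y (n-1) (h n x)\<oplus>\<^sub>Y\<^sup>n h (n+1) (cdiff X n x))"
  using homotopicE[OF assms(1) f.X.cplx_axioms f.Y.cplx_axioms] by metis
 interpret h: hmtp R X Y h by fact
 have c: "f n x = g n x\<oplus>\<^sub>Y\<^sup>n cdiff Y (n-1) (h n x)" if "x:cel X n" "cdiff X n x = \<zero>\<^sub>X\<^sup>(n+1)" for x n
  using h(2)[OF that(1)] that h.h_zero[of "n+1"] by simp
 show ?thesis unfolding hsurj_def
 proof (intro allI ballI impI)
  fix n y assume *: "y:cel Y n" "cdiff Y n y = \<zero>\<^sub>Y\<^sup>(n+1)"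
  obtain x y' where x: "x:cel X n" "y':cel Y (n-1)"
   "cdiff X n x = \<zero>\<^sub>X\<^sup>(n+1)" "y = f n x\<oplus>\<^sub>Y\<^sup>n cdiff Y (n-1) y'" using hsurjE[OF assms(4) *] .
  have "y = g n x\<oplus>\<^sub>Y\<^sup>n cdiff Y (n-1) (h n x\<oplus>\<^sub>Y\<^sup>(n-1) y')"
   using x c[OF x(1,3)] by (simp add: f.Y.C.M.a_assoc)
  then show "\<exists>x\<in>cel X n. \<exists>y'\<in>cel Y (n-1). cdiff X n x = \<zero>\<^sub>X\<^sup>(n+1)&
    y = g n x\<oplus>\<^sub>Y\<^sup>n cdiff Y (n-1) y'"
   using x by (intro bexI[of _ x] bexI[of _ "h n x\<oplus>\<^sub>Y\<^sup>(n-1) y'"]) auto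
 qed
qed

lemma qis_homotopic:
 assumes "homotopic R X Y f g" "chmap R X Y f" "chmap R X Y g" "qis X Y f"
 shows "qis X Y g" using hinj_homotopic[OF assms(1-3)] hsurj_homotopic[OF assms(1-3)] assms(4) unfolding qis_def by blast

text \<open>Composition and cancellation for quasi-isomorphisms, split into the injective and
  surjective halves: later arguments with one-sided inverses, as in \<open>Kb_iso_qis\<close> and
  \<open>Db_iso_qis\<close>, control only one half at a time.\<close>

context
 fixes X Y Z f g
 assumes f: "chmap R X Y f" and g: "chmap R Y Z g"
begin

interpretation f: chmap R X Y f by (rule f)
interpretation g: chmap R Y Z g by (rule g)

lemma hinj_comp: "hinj X Y f ==> hinj Y Z g ==> hinj X Z (cmp_map X g f)" unfolding hinj_def[of X Z]
proof (intro allI ballI impI)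
 fix n x z assume *: "hinj X Y f" "hinj Y Z g" "x:cel X n" "z:cel Z (n-1)"
   "cdiff X n x = \<zero>\<^sub>X\<^sup>(n+1)" "cmp_map X g f n x = cdiff Z (n-1) z"
 have "cdiff Y n (f n x) = \<zero>\<^sub>Y\<^sup>(n+1)" using * f.f_d[of "n+1" n x] by simp
 then obtain y where "y:cel Y (n-1)" "cdiff Y (n-1) y = f n x" using hinjD[OF *(2), of "f n x" n z] * by (auto simp: compose_def)
 then show "\<exists>x'\<in>cel X (n-1). cdiff X (n-1) x' = x" using hinjD[OF *(1,3,5)] by auto
qed

lemma hinj_comp_right: "hinj X Z (cmp_map X g f) ==> hinj X Y f" unfolding hinj_def[of X Y]
proof (intro allI ballI impI)
 fix n x y assume *: "hinj X Z (cmp_map X g f)" "x:cel X n" "y:cel Y (n-1)"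
   "cdiff X n x = \<zero>\<^sub>X\<^sup>(n+1)" "f n x = cdiff Y (n-1) y"
 have e: "cmp_map X g f n x = cdiff Z (n-1) (g (n-1) y)" using * by (simp add: compose_def)
 show "\<exists>x'\<in>cel X (n-1). cdiff X (n-1) x' = x" by (rule hinjD[OF *(1,2,4) _ e]) (use * in auto)
qed

lemma hsurj_comp: "hsurj X Y f ==> hsurj Y Z g ==> hsurj X Z (cmp_map X g f)" unfolding hsurj_def[of X Z]
proof (intro allI ballI impI)
 fix n z assume *: "hsurj X Y f" "hsurj Y Z g" "z:cel Z n" "cdiff Z n z = \<zero>\<^sub>Z\<^sup>(n+1)"
 obtain y z' where y: "y:cel Y n" "z':cel Z (n-1)"
   "cdiff Y n y = \<zero>\<^sub>Y\<^sup>(n+1)" "z = g n y\<oplus>\<^sub>Z\<^sup>n cdiff Z (n-1) z'" using hsurjE[OF *(2-4)] .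
 obtain x y' where x: "x:cel X n" "y':cel Y (n-1)"
   "cdiff X n x = \<zero>\<^sub>X\<^sup>(n+1)" "y = f n x\<oplus>\<^sub>Y\<^sup>n cdiff Y (n-1) y'" using hsurjE[OF *(1) y(1,3)] .
 have "z = cmp_map X g f n x\<oplus>\<^sub>Z\<^sup>n cdiff Z (n-1) (g (n-1) y'\<oplus>\<^sub>Z\<^sup>(n-1) z')"
  using x y g.f_add[of "f n x" n "cdiff Y (n-1) y'"] by (simp add: compose_def g.Y.C.M.a_assoc)
 then show "\<exists>x\<in>cel X n. \<exists>z'\<in>cel Z (n-1). cdiff X n x = \<zero>\<^sub>X\<^sup>(n+1)&
    z = cmp_map X g f n x\<oplus>\<^sub>Z\<^sup>n cdiff Z (n-1) z'"
  using x y by (intro bexI[of _ x] bexI[of _ "g (n-1) y'\<oplus>\<^sub>Z\<^sup>(n-1) z'"]) auto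
qed

lemma hsurj_comp_left: "hsurj X Z (cmp_map X g f) ==> hsurj Y Z g" unfolding hsurj_def[of Y Z]
proof (intro allI ballI impI)
 fix n z assume *: "hsurj X Z (cmp_map X g f)" "z:cel Z n" "cdiff Z n z = \<zero>\<^sub>Z\<^sup>(n+1)"
 obtain x z' where x: "x:cel X n" "z':cel Z (n-1)"
   "cdiff X n x = \<zero>\<^sub>X\<^sup>(n+1)" "z = cmp_map X g f n x\<oplus>\<^sub>Z\<^sup>n cdiff Z (n-1) z'" using hsurjE[OF *] .
 have "cdiff Y n (f n x) = \<zero>\<^sub>Y\<^sup>(n+1)" using x f.f_d[of "n+1" n x] by simp
 then show "\<exists>y\<in>cel Y n. \<exists>z'\<in>cel Z (n-1). cdiff Y n y = \<zero>\<^sub>Y\<^sup>(n+1)&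
    z = g n y\<oplus>\<^sub>Z\<^sup>n cdiff Z (n-1) z'" using x by (intro bexI[of _ "f n x"] bexI[of _ z']) (auto simp: compose_def)
qed

lemma hinj_comp_left: "hinj X Z (cmp_map X g f) ==> hsurj X Y f ==> hinj Y Z g" unfolding hinj_def[of Y Z]
proof (intro allI ballI impI)
 fix n y z assume *: "hinj X Z (cmp_map X g f)" "hsurj X Y f" "y:cel Y n" "z:cel Z (n-1)"
   "cdiff Y n y = \<zero>\<^sub>Y\<^sup>(n+1)" "g n y = cdiff Z (n-1) z"
 obtain x y' where x: "x:cel X n" "y':cel Y (n-1)"
   "cdiff X n x = \<zero>\<^sub>X\<^sup>(n+1)" "y = f n x\<oplus>\<^sub>Y\<^sup>n cdiff Y (n-1) y'" using hsurjE[OF *(2,3,5)] .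
 have gy: "g n y = g n (f n x)\<oplus>\<^sub>Z\<^sup>n cdiff Z (n-1) (g (n-1) y')" using x by simp
 have cl: "g n (f n x):cel Z n" "cdiff Z (n-1) (g (n-1) y'):cel Z n" using x by auto
 have "g n (f n x) = g n y\<ominus>\<^sub>Z\<^sup>n cdiff Z (n-1) (g (n-1) y')" unfolding gy using cl by algebra
 then have e: "cmp_map X g f n x = cdiff Z (n-1) (z\<ominus>\<^sub>Z\<^sup>(n-1) g (n-1) y')"
  using x * by (simp add: compose_def a_minus_def)
 have "z\<ominus>\<^sub>Z\<^sup>(n-1) g (n-1) y':cel Z (n-1)" using * x by simp
 then obtain x' where "x':cel X (n-1)" "cdiff X (n-1) x' = x" using hinjD[OF *(1) x(1,3) _ e] by blast
 then show "\<exists>x'\<in>cel Y (n-1). cdiff Y (n-1) x' = y"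
  using x by (intro bexI[of _ "f (n-1) x'\<oplus>\<^sub>Y\<^sup>(n-1) y'"]) auto
qed

lemma hsurj_comp_right: "hsurj X Z (cmp_map X g f) ==> hinj Y Z g ==> hsurj X Y f" unfolding hsurj_def[of X Y]
proof (intro allI ballI impI)
 fix n y assume *: "hsurj X Z (cmp_map X g f)" "hinj Y Z g" "y:cel Y n" "cdiff Y n y = \<zero>\<^sub>Y\<^sup>(n+1)"
 have "cdiff Z n (g n y) = \<zero>\<^sub>Z\<^sup>(n+1)" using * g.f_d[of "n+1" n y] by simp
 then obtain x z' where x: "x:cel X n" "z':cel Z (n-1)"
   "cdiff X n x = \<zero>\<^sub>X\<^sup>(n+1)" "g n y = cmp_map X g f n x\<oplus>\<^sub>Z\<^sup>n cdiff Z (n-1) z'"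
  using hsurjE[OF *(1), of "g n y" n] * by auto
 have cl: "g n (f n x):cel Z n" "cdiff Z (n-1) z':cel Z n" "f n x:cel Y n" using x by auto
 have 1: "g n (y\<ominus>\<^sub>Y\<^sup>n f n x) = cdiff Z (n-1) z'" using x * by (simp add: a_minus_def compose_def, insert cl, algebra)
 have 2: "cdiff Y n (y\<ominus>\<^sub>Y\<^sup>n f n x) = \<zero>\<^sub>Y\<^sup>(n+1)"
 proof -
  have "cdiff Y n (f n x) = \<zero>\<^sub>Y\<^sup>(n+1)" using x f.f_d[of "n+1" n x] by simp
  then show ?thesis using x * by (simp add: a_minus_def f.Y.C.M.a_inv_zero)
 qed
 obtain y' where y': "y':cel Y (n-1)" "cdiff Y (n-1) y' = y\<ominus>\<^sub>Y\<^sup>n f n x" using hinjD[OF *(2) _ 2 x(2) 1] * x by auto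
 have "y = f n x\<oplus>\<^sub>Y\<^sup>n cdiff Y (n-1) y'" unfolding y'(2) using *(3) cl by algebra
 then show "\<exists>x\<in>cel X n. \<exists>y'\<in>cel Y (n-1). cdiff X n x = \<zero>\<^sub>X\<^sup>(n+1)&
    y = f n x\<oplus>\<^sub>Y\<^sup>n cdiff Y (n-1) y'" using x y' by (intro bexI[of _ x] bexI[of _ y']) auto
qed

lemma qis_comp: "qis X Y f ==> qis Y Z g ==> qis X Z (cmp_map X g f)" unfolding qis_def using hinj_comp hsurj_comp by blast

lemma qis_comp_right: "qis X Z (cmp_map X g f) ==> qis Y Z g ==> qis X Y f"
 unfolding qis_def using hinj_comp_right hsurj_comp_right by blast

end

lemma qis_acyc_iff:
 assumes "chmap R X Y f" "qis X Y f"
 shows "acyc X\<longleftrightarrow>acyc Y"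
proof -
 interpret f: chmap R X Y f by fact
 show ?thesis
 proof
  assume X: "acyc X"
  show "acyc Y" unfolding acyc_def
  proof (intro allI ballI impI)
   fix n y assume *: "y:cel Y n" "cdiff Y n y = \<zero>\<^sub>Y\<^sup>(n+1)"
   obtain x y' where x: "x:cel X n" "y':cel Y (n-1)"
    "cdiff X n x = \<zero>\<^sub>X\<^sup>(n+1)" "y = f n x\<oplus>\<^sub>Y\<^sup>n cdiff Y (n-1) y'"
    using hsurjE[OF _ *, of X f] assms(2) unfolding qis_def by metis
   obtain x' where "x':cel X (n-1)" "cdiff X (n-1) x' = x" using acycD[OF X x(1,3)] by blast
   then show "\<exists>x'\<in>cel Y (n-1). cdiff Y (n-1) x' = y"
    using x by (intro bexI[of _ "f (n-1) x'\<oplus>\<^sub>Y\<^sup>(n-1) y'"]) auto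
  qed
 next
  assume Y: "acyc Y"
  show "acyc X" unfolding acyc_def
  proof (intro allI ballI impI)
   fix n x assume *: "x:cel X n" "cdiff X n x = \<zero>\<^sub>X\<^sup>(n+1)"
   have "cdiff Y n (f n x) = \<zero>\<^sub>Y\<^sup>(n+1)" using * f.f_d[of "n+1" n x] by simp
   then obtain y where "y:cel Y (n-1)" "cdiff Y (n-1) y = f n x" using acycD[OF Y, of "f n x" n] * by auto
   then show "\<exists>x'\<in>cel X (n-1). cdiff X (n-1) x' = x" using hinjD[OF _ *, of Y f y] assms(2) unfolding qis_def by auto
  qed
 qed
qed

lemma qis_id: "cplx R X ==> qis X X (id_map X)"
proof -
 assume "cplx R X"
 then interpret X: cplx R X .
 have "\<exists>x\<in>cel X n. \<exists>y'\<in>cel X (n-1). cdiff X n x = \<zero>\<^sub>X\<^sup>(n+1)&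
    y = id_map X n x\<oplus>\<^sub>X\<^sup>n cdiff X (n-1) y'" if "y:cel X n" "cdiff X n y = \<zero>\<^sub>X\<^sup>(n+1)" for y n
  using that by (intro bexI[of _ y] bexI[of _ "\<zero>\<^sub>X\<^sup>(n-1)"]) auto
 then show ?thesis unfolding qis_def hinj_def hsurj_def by auto
qed

lemma acyc_cone_iff:
 assumes "chmap R X Y f"
 shows "acyc (cone X Y f)\<longleftrightarrow>qis X Y f"
proof -
 interpret f: chmap R X Y f by fact
 show ?thesis
 proof
  assume a: "acyc (cone X Y f)"
  have "hinj X Y f" unfolding hinj_def
  proof (intro allI ballI impI)
   fix n x y assume *: "x:cel X n" "y:cel Y (n-1)"
    "cdiff X n x = \<zero>\<^sub>X\<^sup>(n+1)" "f n x = cdiff Y (n-1) y"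
   have "cdiff (cone X Y f) (n-1) (pair_seq x (\<ominus>\<^sub>Y\<^sup>(n-1) y)) = \<zero>\<^sub>(cone X Y f)\<^sup>n"
    using * by (simp add: f.X.C.M.a_inv_zero f.Y.C.M.r_neg)
   then obtain w where w: "w:cel (cone X Y f) (n-2)"
    "cdiff (cone X Y f) (n-2) w = pair_seq x (\<ominus>\<^sub>Y\<^sup>(n-1) y)"
    using acycD[OF a, of "pair_seq x (\<ominus>\<^sub>Y\<^sup>(n-1) y)" "n-1"] * by auto
   then obtain x' y' where "w = pair_seq x' y'" "x':cel X (n-1)" "y':cel Y (n-2)" by (auto elim!: ds_carrierE)
   then show "\<exists>x'\<in>cel X (n-1). cdiff X (n-1) x' = x" using w by (intro bexI[of _ "\<ominus>\<^sub>X\<^sup>(n-1) x'"]) auto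
  qed
  moreover have "hsurj X Y f" unfolding hsurj_def
  proof (intro allI ballI impI)
   fix n y assume *: "y:cel Y n" "cdiff Y n y = \<zero>\<^sub>Y\<^sup>(n+1)"
   have "cdiff (cone X Y f) n (pair_seq \<zero>\<^sub>X\<^sup>(n+1) y) = \<zero>\<^sub>(cone X Y f)\<^sup>(n+1)"
    using * f.X.d_zero[of "n+1"] f.f_zero by (simp add: f.X.C.M.a_inv_zero)
   then obtain w where w: "w:cel (cone X Y f) (n-1)"
    "cdiff (cone X Y f) (n-1) w = pair_seq \<zero>\<^sub>X\<^sup>(n+1) y"
    using acycD[OF a, of "pair_seq \<zero>\<^sub>X\<^sup>(n+1) y" n] * by auto
   then obtain x' y' where x: "w = pair_seq x' y'" "x':cel X n" "y':cel Y (n-1)" by (auto elim!: ds_carrierE)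
   have "\<ominus>\<^sub>X\<^sup>(n+1) cdiff X n x' = \<zero>\<^sub>X\<^sup>(n+1)" using w x by simp
   then have "cdiff X n x' = \<zero>\<^sub>X\<^sup>(n+1)"
    using x f.X.C.M.minus_minus[of "cdiff X n x'" "n+1"] by (simp add: f.X.C.M.a_inv_zero)
   then show "\<exists>x\<in>cel X n. \<exists>y'\<in>cel Y (n-1). cdiff X n x = \<zero>\<^sub>X\<^sup>(n+1)&
     y = f n x\<oplus>\<^sub>Y\<^sup>n cdiff Y (n-1) y'" using w x by (intro bexI[of _ x'] bexI[of _ y']) auto
  qed
  ultimately show "qis X Y f" unfolding qis_def by blast
 next
  assume q: "qis X Y f"
  show "acyc (cone X Y f)" unfolding acyc_def
  proof (intro allI ballI impI)
   fix n z assume z: "z:cel (cone X Y f) n"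
    "cdiff (cone X Y f) n z = \<zero>\<^sub>(cone X Y f)\<^sup>(n+1)"
   obtain x y where xy: "z = pair_seq x y" "x:cel X (n+1)" "y:cel Y n" using z(1) by (auto elim!: ds_carrierE)
   have dx: "cdiff X (n+1) x = \<zero>\<^sub>X\<^sup>(n+2)"
    using z xy f.X.C.M.minus_minus[of "cdiff X (n+1) x" "n+2"] by (simp add: f.X.C.M.a_inv_zero)
   have fx0: "f (n+1) x\<oplus>\<^sub>Y\<^sup>(n+1) cdiff Y n y = \<zero>\<^sub>Y\<^sup>(n+1)" using z xy by simp
   have fx: "f (n+1) x = cdiff Y n (\<ominus>\<^sub>Y\<^sup>n y)" using fx0 xy f.Y.C.M.minus_equality[OF fx0] by simp
   obtain x0 where x0: "x0:cel X n" "cdiff X n x0 = x"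
    using hinjD[of X Y f x "n+1" "\<ominus>\<^sub>Y\<^sup>n y"] q dx fx xy unfolding qis_def by auto
   have cl: "f n x0:cel Y n" "cdiff Y n y:cel Y (n+1)"
    "cdiff Y n (f n x0):cel Y (n+1)" using x0 xy by auto
   \<comment> \<open>Since \<open>x\<close> is the boundary of \<open>x0\<close>, the element y + f
     x0 is a cycle of Y. It equals f x1 plus the boundary of \<open>y1\<close> for some cycle
     \<open>x1\<close>, and then (x1 - x0, y1) has boundary (x, y) in the cone.\<close>
   have "cdiff Y n (y\<oplus>\<^sub>Y\<^sup>n f n x0) = \<zero>\<^sub>Y\<^sup>(n+1)"
    using fx0 x0 xy f.f_d[of "n+1" n x0] cl by (simp add: f.Y.C.M.a_comm)
   then obtain x1 y1 where 1: "x1:cel X n" "y1:cel Y (n-1)"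
    "cdiff X n x1 = \<zero>\<^sub>X\<^sup>(n+1)" "y\<oplus>\<^sub>Y\<^sup>n f n x0 = f n x1\<oplus>\<^sub>Y\<^sup>n cdiff Y (n-1) y1"
    using hsurjE[of X Y f "y\<oplus>\<^sub>Y\<^sup>n f n x0" n] q xy cl unfolding qis_def by auto
   have y: "y = (f n x1\<oplus>\<^sub>Y\<^sup>n cdiff Y (n-1) y1)\<ominus>\<^sub>Y\<^sup>n f n x0"
    unfolding 1(4)[symmetric] using xy(3) cl(1) by algebra
   have "f n x1:cel Y n" "cdiff Y (n-1) y1:cel Y n" using 1 by auto
   then have y2: "y = f n (x1\<ominus>\<^sub>X\<^sup>n x0)\<oplus>\<^sub>Y\<^sup>n cdiff Y (n-1) y1"
    unfolding y using cl(1) 1 x0 by (simp add: a_minus_def f.Y.C.M.a_ac)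
   have "\<ominus>\<^sub>X\<^sup>(n+1) cdiff X n (x1\<ominus>\<^sub>X\<^sup>n x0) = x"
    using 1 x0 xy by (simp add: a_minus_def f.X.C.M.minus_minus)
   then show "\<exists>x'\<in>cel (cone X Y f) (n-1). cdiff (cone X Y f) (n-1) x' = z"
    using 1 x0 xy y2 by (intro bexI[of _ "pair_seq (x1\<ominus>\<^sub>X\<^sup>n x0) y1"]) auto
  qed
 qed
qed

text \<open>Stands in for the long exact cohomology sequence: most comparison maps between iterated
  cones below are surjective, and acyclicity of the kernel is easy to check by exhibiting a
  preimage.\<close>

lemma surj_qis:
 assumes p: "chmap R X Y p" and surj: "!!n y. y:cel Y n ==> \<exists>x\<in>cel X n. p n x = y"
  and ker: "!!n x. [|x:cel X n; p n x = \<zero>\<^sub>Y\<^sup>n; cdiff X n x = \<zero>\<^sub>X\<^sup>(n+1)|] ==>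
   \<exists>x'\<in>cel X (n-1). p (n-1) x' = \<zero>\<^sub>Y\<^sup>(n-1)&cdiff X (n-1) x' = x"
 shows "qis X Y p"
proof -
 interpret p: chmap R X Y p by fact
 have "hinj X Y p" unfolding hinj_def
 proof (intro allI ballI impI)
  fix n x y assume *: "x:cel X n" "y:cel Y (n-1)"
   "cdiff X n x = \<zero>\<^sub>X\<^sup>(n+1)" "p n x = cdiff Y (n-1) y"
  obtain w where w: "w:cel X (n-1)" "p (n-1) w = y" using surj *(2) by blast
  have "p n (x\<ominus>\<^sub>X\<^sup>n cdiff X (n-1) w) = \<zero>\<^sub>Y\<^sup>n" using * w by (simp add: a_minus_def p.Y.C.M.r_neg)
  moreover have "cdiff X n (x\<ominus>\<^sub>X\<^sup>n cdiff X (n-1) w) = \<zero>\<^sub>X\<^sup>(n+1)"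
   using * w by (simp add: a_minus_def p.X.C.M.a_inv_zero)
  ultimately obtain v where v: "v:cel X (n-1)" "cdiff X (n-1) v = x\<ominus>\<^sub>X\<^sup>n cdiff X (n-1) w"
   using ker[of "x\<ominus>\<^sub>X\<^sup>n cdiff X (n-1) w" n] * w by auto
  have "cdiff X (n-1) w:cel X n" using w by simp
  then have "cdiff X (n-1) (v\<oplus>\<^sub>X\<^sup>(n-1) w) = x" using *(1) v w by (simp, algebra)
  then show "\<exists>x'\<in>cel X (n-1). cdiff X (n-1) x' = x" using v w by blast
 qed
 moreover have "hsurj X Y p" unfolding hsurj_def
 proof (intro allI ballI impI)
  fix n y assume *: "y:cel Y n" "cdiff Y n y = \<zero>\<^sub>Y\<^sup>(n+1)"
  obtain w where w: "w:cel X n" "p n w = y" using surj *(1) by blast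
  have "p (n+1) (cdiff X n w) = \<zero>\<^sub>Y\<^sup>(n+1)" using w * by simp
  then obtain v where v: "v:cel X n" "p n v = \<zero>\<^sub>Y\<^sup>n" "cdiff X n v = cdiff X n w"
   using ker[of "cdiff X n w" "n+1"] w by auto
  have "cdiff X n (w\<ominus>\<^sub>X\<^sup>n v) = \<zero>\<^sub>X\<^sup>(n+1)" "p n (w\<ominus>\<^sub>X\<^sup>n v) = y"
   using v w * by (simp_all add: a_minus_def p.X.C.M.r_neg p.Y.C.M.a_inv_zero)
  then show "\<exists>x\<in>cel X n. \<exists>y'\<in>cel Y (n-1). cdiff X n x = \<zero>\<^sub>X\<^sup>(n+1)&
     y = p n x\<oplus>\<^sub>Y\<^sup>n cdiff Y (n-1) y'"
   using v w * by (intro bexI[of _ "w\<ominus>\<^sub>X\<^sup>n v"] bexI[of _ "\<zero>\<^sub>Y\<^sup>(n-1)"]) auto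
 qed
 ultimately show ?thesis unfolding qis_def by blast
qed

end

section \<open>Homotopy fibres and comparison of iterated cones\<close>

lemma (in abelian_group) add_minus_zero_iff:
 "x:el G ==> y:el G ==> x\<oplus>\<ominus> y = \<zero>\<longleftrightarrow>x = y" by (metis a_inv_closed minus_equality minus_minus r_neg)

text \<open>The homotopy fibre. Its projection to X is how objects of a null system produce
  denominators, see \<open>W_fib_proj\<close>.\<close>

definition fib :: "'r cochain=>'r cochain=>'r chainmap=>'r cochain" where
 "fib X Y f = unshift (cone X Y f)"

definition fib_proj :: "'r cochain=>'r cochain=>'r chainmap" where
 "fib_proj X Y = (\<lambda>n. \<lambda>z\<in>el (direct_sum (cobj X n) (cobj Y (n-1))). fst_seq z)"

lemma fib_obj [simp]: "cobj (fib X Y f) n = direct_sum (cobj X n) (cobj Y (n-1))" unfolding fib_def by simp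

context modcat
begin

lemmas ds_a_inv_R [simp] = ds_a_inv[of R]

lemma fib_cplx: "chmap R X Y f ==> cplx R (fib X Y f)" unfolding fib_def by (intro unshift_cplx cone_cplx)

lemma fib_d [simp]:
 assumes "chmap R X Y f" "x:cel X n" "y:cel Y (n-1)"
 shows "cdiff (fib X Y f) n (pair_seq x y) =
  pair_seq (cdiff X n x) (\<ominus>\<^sub>Y\<^sup>n (f n x\<oplus>\<^sub>Y\<^sup>n cdiff Y (n-1) y))"
proof -
 interpret f: chmap R X Y f by fact
 show ?thesis unfolding fib_def using assms(2,3) by (simp add: f.X.C.M.minus_minus)
qed

lemma fib_proj: "chmap R X Y f ==> chmap R (fib X Y f) X (fib_proj X Y)"
proof -
 assume f: "chmap R X Y f"
 interpret f: chmap R X Y f by fact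
 have e: "fib_proj X Y = (\<lambda>n. \<lambda>z\<in>cel (fib X Y f) n. fst_seq z)" unfolding fib_proj_def by simp
 show ?thesis unfolding e by (rule chmap_restrictI) (auto simp: fib_cplx[OF f] f f.X.cplx_axioms elim!: ds_carrierE)
qed

lemma fib_proj_val [simp]: "x:cel X n ==> y:cel Y (n-1) ==>
  fib_proj X Y n (pair_seq x y) = x" unfolding fib_proj_def by simp

text \<open>Rotation of a triangle up to quasi-isomorphism. The comparison map sends ((x1, y), x0)
  to y - f x0; a cycle in its kernel is the boundary of ((x0, 0), 0).\<close>

lemma cone_fib_proj:
 assumes f: "chmap R X Y f"
 shows "\<exists>p. chmap R (cone (fib X Y f) X (fib_proj X Y)) Y p&
  qis (cone (fib X Y f) X (fib_proj X Y)) Y p"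
proof -
 interpret f: chmap R X Y f by fact
 let ?C = "cone (fib X Y f) X (fib_proj X Y)"
 interpret pr: chmap R "fib X Y f" X "fib_proj X Y" by (rule fib_proj[OF f])
 let ?p = "\<lambda>n. \<lambda>z\<in>cel ?C n. snd_seq (fst_seq z)\<ominus>\<^sub>Y\<^sup>n f n (snd_seq z)"
 have E: thesis if "z:cel ?C n"
  "!!x1 y x0. z = pair_seq (pair_seq x1 y) x0 ==> x1:cel X (n+1) ==> y:cel Y n ==>
    x0:cel X n ==> thesis" for z n thesis using that by (auto elim!: ds_carrierE)
 have dC: "cdiff ?C n (pair_seq (pair_seq x1 y) x0) = pair_seq (pair_seq (\<ominus>\<^sub>X\<^sup>(n+2) cdiff X (n+1) x1)
   (f (n+1) x1\<oplus>\<^sub>Y\<^sup>(n+1) cdiff Y n y)) (x1\<oplus>\<^sub>X\<^sup>(n+1) cdiff X n x0)"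
  if "x1:cel X (n+1)" "y:cel Y n" "x0:cel X n" for n x1 y x0 using that f by (simp add: f.Y.C.M.minus_minus)
 have p: "chmap R ?C Y ?p"
 proof (rule chmap_restrictI)
  show "cplx R ?C" by (rule cone_cplx[OF fib_proj[OF f]])
  show "cplx R Y" by (rule f.Y.cplx_axioms)
  show "snd_seq (fst_seq z)\<ominus>\<^sub>Y\<^sup>n f n (snd_seq z):cel Y n" if "z:cel ?C n" for n z using that by (rule E) simp
  show "snd_seq (fst_seq (z\<oplus>\<^sub>?C\<^sup>n w))\<ominus>\<^sub>Y\<^sup>n f n (snd_seq (z\<oplus>\<^sub>?C\<^sup>n w)) =
    (snd_seq (fst_seq z)\<ominus>\<^sub>Y\<^sup>n f n (snd_seq z))\<oplus>\<^sub>Y\<^sup>n (snd_seq (fst_seq w)\<ominus>\<^sub>Y\<^sup>n f n (snd_seq w))"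
   if "z:cel ?C n" "w:cel ?C n" for n z w by (rule E[OF that(1)], rule E[OF that(2)]) (simp add: a_minus_def f.Y.C.M.minus_add f.Y.C.M.a_ac)
  show "snd_seq (fst_seq (r\<odot>\<^sub>?C\<^sup>n z))\<ominus>\<^sub>Y\<^sup>n f n (snd_seq (r\<odot>\<^sub>?C\<^sup>n z)) =
    r\<odot>\<^sub>Y\<^sup>n (snd_seq (fst_seq z)\<ominus>\<^sub>Y\<^sup>n f n (snd_seq z))" if "r:el R" "z:cel ?C n" for n r z
   by (rule E[OF that(2)]) (use that(1) in \<open>simp add: a_minus_def f.f_smult f.Y.C.smult_r_distr f.Y.C.smult_r_minus\<close>)
  fix n z assume "z:cel ?C n"
  then show "snd_seq (fst_seq (cdiff ?C n z))\<ominus>\<^sub>Y\<^sup>(n+1) f (n+1) (snd_seq (cdiff ?C n z)) =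
    cdiff Y n (snd_seq (fst_seq z)\<ominus>\<^sub>Y\<^sup>n f n (snd_seq z))"
  proof (rule E)
   fix x1 y x0 assume z: "z = pair_seq (pair_seq x1 y) x0" "x1:cel X (n+1)" "y:cel Y n"
    "x0:cel X n"
   have cl: "f (n+1) x1:cel Y (n+1)" "cdiff Y n y:cel Y (n+1)"
    "cdiff Y n (f n x0):cel Y (n+1)" using z by auto
   show ?thesis unfolding z(1) dC[OF z(2-4)] using z(2-4) by (simp add: a_minus_def, insert cl, algebra)
  qed
 qed
 have "qis ?C Y ?p"
 proof (rule surj_qis[OF p])
  fix n y assume y: "y:cel Y n"
  show "\<exists>x\<in>cel ?C n. ?p n x = y"
   using y by (intro bexI[of _ "pair_seq (pair_seq \<zero>\<^sub>X\<^sup>(n+1) y) \<zero>\<^sub>X\<^sup>n"])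
     (simp_all add: a_minus_def f.Y.C.M.a_inv_zero)
 next
  fix n z assume z: "z:cel ?C n" "?p n z = \<zero>\<^sub>Y\<^sup>n" "cdiff ?C n z = \<zero>\<^sub>?C\<^sup>(n+1)"
  from z(1) show "\<exists>x'\<in>cel ?C (n-1). ?p (n-1) x' = \<zero>\<^sub>Y\<^sup>(n-1)&cdiff ?C (n-1) x' = z"
  proof (rule E)
   fix x1 y x0 assume e: "z = pair_seq (pair_seq x1 y) x0" "x1:cel X (n+1)" "y:cel Y n"
    "x0:cel X n"
   have y: "y = f n x0" using z(1,2) e by (simp add: a_minus_def f.Y.C.M.add_minus_zero_iff)
   have "x1\<oplus>\<^sub>X\<^sup>(n+1) cdiff X n x0 = \<zero>\<^sub>X\<^sup>(n+1)" using z(3) unfolding e(1) dC[OF e(2-4)] by simp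
   then have x1: "\<ominus>\<^sub>X\<^sup>(n+1) cdiff X n x0 = x1" using e by (intro f.X.C.M.minus_equality) auto
   have "cdiff ?C (n-1) (pair_seq (pair_seq x0 \<zero>\<^sub>Y\<^sup>(n-1)) \<zero>\<^sub>X\<^sup>(n-1)) = z"
    using dC[of x0 "n-1" "\<zero>\<^sub>Y\<^sup>(n-1)" "\<zero>\<^sub>X\<^sup>(n-1)"] e x1 y by simp
   moreover have "?p (n-1) (pair_seq (pair_seq x0 \<zero>\<^sub>Y\<^sup>(n-1)) \<zero>\<^sub>X\<^sup>(n-1)) = \<zero>\<^sub>Y\<^sup>(n-1)"
    using e by (simp add: a_minus_def f.Y.C.M.a_inv_zero)
   ultimately show ?thesis using e
    by (intro bexI[of _ "pair_seq (pair_seq x0 \<zero>\<^sub>Y\<^sup>(n-1)) \<zero>\<^sub>X\<^sup>(n-1)"]) auto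
  qed
 qed
 then show ?thesis using p by blast
qed

text \<open>The map of the octahedral axiom from the fibre of Y -> Z to the cone of X -> Y: project
  to Y, then include.\<close>

definition oct_map :: "'r cochain=>'r cochain=>'r cochain=>'r chainmap" where
 "oct_map X Y Z = (\<lambda>n. \<lambda>w\<in>el (direct_sum (cobj Y n) (cobj Z (n-1))). pair_seq \<zero>\<^sub>X\<^sup>(n+1) (fst_seq w))"

lemma oct_map: "chmap R X Y f ==> chmap R Y Z g ==> chmap R (fib Y Z g) (cone X Y f) (oct_map X Y Z)"
proof -
 assume f: "chmap R X Y f" and g: "chmap R Y Z g"
 interpret f: chmap R X Y f by fact
 interpret g: chmap R Y Z g by fact
 have e: "oct_map X Y Z = (\<lambda>n. \<lambda>w\<in>cel (fib Y Z g) n. pair_seq \<zero>\<^sub>X\<^sup>(n+1) (fst_seq w))"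
  unfolding oct_map_def by simp
 show ?thesis unfolding e by (rule chmap_restrictI) (auto simp: fib_cplx[OF g] cone_cplx[OF f] g f.X.C.smult_r_null
    f.X.d_zero[of "n+1" for n, simplified] f.X.C.M.a_inv_zero elim!: ds_carrierE)
qed

text \<open>The octahedral axiom up to quasi-isomorphism; it is behind closure of denominators under
  composition. The comparison map sends ((y1, z1), (x, y0)) to (-x, z1 - g y0), and a cycle in its
  kernel is the boundary of ((y0, 0), (0, 0)).\<close>

lemma cone_oct_map:
 assumes f: "chmap R X Y f" and g: "chmap R Y Z g"
 shows "\<exists>p. chmap R (cone (fib Y Z g) (cone X Y f) (oct_map X Y Z)) (cone X Z (cmp_map X g f)) p&
  qis (cone (fib Y Z g) (cone X Y f) (oct_map X Y Z)) (cone X Z (cmp_map X g f)) p"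
proof -
 interpret f: chmap R X Y f by fact
 interpret g: chmap R Y Z g by fact
 let ?C = "cone (fib Y Z g) (cone X Y f) (oct_map X Y Z)"
 let ?D = "cone X Z (cmp_map X g f)"
 interpret o: chmap R "fib Y Z g" "cone X Y f" "oct_map X Y Z" by (rule oct_map[OF f g])
 have gf: "chmap R X Z (cmp_map X g f)" by (rule chmap_comp[OF f g])
 let ?q = "\<lambda>n z. pair_seq (\<ominus>\<^sub>X\<^sup>(n+1) (fst_seq (snd_seq z))) (snd_seq (fst_seq z)\<ominus>\<^sub>Z\<^sup>n g n (snd_seq (snd_seq z)))"
 let ?p = "\<lambda>n. \<lambda>z\<in>cel ?C n. ?q n z"
 have E: thesis if "z:cel ?C n"
  "!!y1 z1 x y0. z = pair_seq (pair_seq y1 z1) (pair_seq x y0) ==> y1:cel Y (n+1) ==> z1:cel Z n ==>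
    x:cel X (n+1) ==> y0:cel Y n ==> thesis" for z n thesis using that by (auto elim!: ds_carrierE)
 have dC: "cdiff ?C n (pair_seq (pair_seq y1 z1) (pair_seq x y0)) =
   pair_seq (pair_seq (\<ominus>\<^sub>Y\<^sup>(n+2) cdiff Y (n+1) y1) (g (n+1) y1\<oplus>\<^sub>Z\<^sup>(n+1) cdiff Z n z1))
    (pair_seq (\<ominus>\<^sub>X\<^sup>(n+2) cdiff X (n+1) x) (y1\<oplus>\<^sub>Y\<^sup>(n+1) (f (n+1) x\<oplus>\<^sub>Y\<^sup>(n+1) cdiff Y n y0)))"
  if "y1:cel Y (n+1)" "z1:cel Z n" "x:cel X (n+1)" "y0:cel Y n" for n y1 z1 x y0 using that g by (simp add: g.Y.C.M.minus_minus oct_map_def)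
 have p: "chmap R ?C ?D ?p"
 proof (rule chmap_restrictI)
  show "cplx R ?C" by (rule cone_cplx[OF oct_map[OF f g]])
  show "cplx R ?D" by (rule cone_cplx[OF gf])
  show "?q n z:cel ?D n" if "z:cel ?C n" for n z using that by (rule E) simp
  show "?q n (z\<oplus>\<^sub>?C\<^sup>n w) = ?q n z\<oplus>\<^sub>?D\<^sup>n ?q n w" if "z:cel ?C n" "w:cel ?C n" for n z w
   by (rule E[OF that(1)], rule E[OF that(2)])
    (simp add: a_minus_def g.Y.C.M.minus_add f.X.C.M.minus_add g.Y.C.M.a_ac)
  show "?q n (r\<odot>\<^sub>?C\<^sup>n z) = r\<odot>\<^sub>?D\<^sup>n ?q n z" if "r:el R" "z:cel ?C n" for n r z by (rule E[OF that(2)])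
    (use that(1) in \<open>simp add: a_minus_def g.f_smult g.Y.C.smult_r_distr g.Y.C.smult_r_minus f.X.C.smult_r_minus\<close>)
  fix n z assume "z:cel ?C n"
  then show "?q (n+1) (cdiff ?C n z) = cdiff ?D n (?q n z)"
  proof (rule E)
   fix y1 z1 x y0 assume z: "z = pair_seq (pair_seq y1 z1) (pair_seq x y0)" "y1:cel Y (n+1)"
    "z1:cel Z n" "x:cel X (n+1)" "y0:cel Y n"
   have cl: "g (n+1) y1:cel Z (n+1)" "cdiff Z n z1:cel Z (n+1)"
    "g (n+1) (f (n+1) x):cel Z (n+1)" "cdiff Z n (g n y0):cel Z (n+1)" using z by auto
   have "(g (n+1) y1\<oplus>\<^sub>Z\<^sup>(n+1) cdiff Z n z1)\<oplus>\<^sub>Z\<^sup>(n+1)\<ominus>\<^sub>Z\<^sup>(n+1)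
     (g (n+1) y1\<oplus>\<^sub>Z\<^sup>(n+1) (g (n+1) (f (n+1) x)\<oplus>\<^sub>Z\<^sup>(n+1) cdiff Z n (g n y0))) =
     \<ominus>\<^sub>Z\<^sup>(n+1) g (n+1) (f (n+1) x)\<oplus>\<^sub>Z\<^sup>(n+1)
     (cdiff Z n z1\<oplus>\<^sub>Z\<^sup>(n+1)\<ominus>\<^sub>Z\<^sup>(n+1) cdiff Z n (g n y0))" using cl by algebra
   then show ?thesis unfolding z(1) dC[OF z(2-5)] using z(2-5) f.X.d_minus[of x "n+1"]
    by (simp add: a_minus_def compose_def f.X.C.M.minus_minus)
  qed
 qed
 have "qis ?C ?D ?p"
 proof (rule surj_qis[OF p])
  fix n w assume w: "w:cel ?D n"
  then obtain x z1 where "w = pair_seq x z1" "x:cel X (n+1)" "z1:cel Z n" by (auto elim!: ds_carrierE)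
  then show "\<exists>x\<in>cel ?C n. ?p n x = w"
   by (intro bexI[of _ "pair_seq (pair_seq \<zero>\<^sub>Y\<^sup>(n+1) z1) (pair_seq (\<ominus>\<^sub>X\<^sup>(n+1) x) \<zero>\<^sub>Y\<^sup>n)"])
     (simp_all add: a_minus_def g.Y.C.M.a_inv_zero f.X.C.M.minus_minus)
 next
  fix n z assume z: "z:cel ?C n" "?p n z = \<zero>\<^sub>?D\<^sup>n" "cdiff ?C n z = \<zero>\<^sub>?C\<^sup>(n+1)"
  from z(1) show "\<exists>x'\<in>cel ?C (n-1). ?p (n-1) x' = \<zero>\<^sub>?D\<^sup>(n-1)&cdiff ?C (n-1) x' = z"
  proof (rule E)
   fix y1 z1 x y0 assume e: "z = pair_seq (pair_seq y1 z1) (pair_seq x y0)" "y1:cel Y (n+1)"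
    "z1:cel Z n" "x:cel X (n+1)" "y0:cel Y n"
   have x: "x = \<zero>\<^sub>X\<^sup>(n+1)" using z(1,2) e f.X.C.M.minus_minus[of x "n+1"] by (simp add: f.X.C.M.a_inv_zero)
   have z1: "z1 = g n y0" using z(1,2) e by (simp add: a_minus_def g.Y.C.M.add_minus_zero_iff)
   have "y1\<oplus>\<^sub>Y\<^sup>(n+1) cdiff Y n y0 = \<zero>\<^sub>Y\<^sup>(n+1)"
    using z(3)[unfolded e(1) dC[OF e(2-5)]] e(5) by (simp add: x)
   then have y1: "\<ominus>\<^sub>Y\<^sup>(n+1) cdiff Y n y0 = y1" using e by (intro f.Y.C.M.minus_equality) auto
   let ?w = "pair_seq (pair_seq y0 \<zero>\<^sub>Z\<^sup>(n-1)) (pair_seq \<zero>\<^sub>X\<^sup>n \<zero>\<^sub>Y\<^sup>(n-1))"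
   have "cdiff ?C (n-1) ?w = z"
    using dC[of y0 "n-1" "\<zero>\<^sub>Z\<^sup>(n-1)" "\<zero>\<^sub>X\<^sup>n" "\<zero>\<^sub>Y\<^sup>(n-1)"] e x y1 z1
    by (simp add: f.X.C.M.a_inv_zero)
   moreover have "?p (n-1) ?w = \<zero>\<^sub>?D\<^sup>(n-1)" using e by (simp add: a_minus_def g.Y.C.M.a_inv_zero f.X.C.M.a_inv_zero)
   ultimately show ?thesis using e by (intro bexI[of _ ?w]) auto
  qed
 qed
 then show ?thesis using p by blast
qed

lemma neg_eq_zero_iff:
 assumes "lmod R M" "x:el M"
 shows "\<ominus>\<^sub>M x = \<zero>\<^sub>M\<longleftrightarrow>x = \<zero>\<^sub>M"
proof -
 interpret M: left_module R M by fact
 show ?thesis using M.M.minus_minus[OF assms(2)] M.M.a_inv_zero by metis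
qed

lemma cone_incl_qis:
 assumes f: "chmap R A Y f" and A: "acyc A"
 shows "qis Y (cone A Y f) (cone_inclusion A Y)"
proof -
 interpret chmap R A Y f by (rule f)
 have i: "cone_inclusion A Y n y = pair_seq \<zero>\<^sub>A\<^sup>(n+1) y" if "y:cel Y n" for n y
  using that unfolding cone_inclusion_def by simp
 show ?thesis unfolding qis_def hinj_def hsurj_def
 proof (intro conjI allI ballI impI)
  fix n y z assume y: "y:cel Y n" and z: "z:cel (cone A Y f) (n-1)"
   and e: "cone_inclusion A Y n y = cdiff (cone A Y f) (n-1) z"
  obtain u w where uw: "z = pair_seq u w" "u:cel A n" "w:cel Y (n-1)" using z by (auto elim: ds_carrierE)
  have 1: "cdiff A n u = \<zero>\<^sub>A\<^sup>(n+1)" "y = f n u\<oplus>\<^sub>Y\<^sup>n cdiff Y (n-1) w"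
   using e uw y neg_eq_zero_iff[of "cobj A (n+1)" "cdiff A n u"] by (simp_all add: i)
  obtain v where v: "v:cel A (n-1)" "cdiff A (n-1) v = u" using acycD[OF A uw(2) 1(1)] by blast
  then show "\<exists>x'\<in>cel Y (n-1). cdiff Y (n-1) x' = y"
   using uw(3) f_d[of n "n-1" v] by (intro bexI[of _ "f (n-1) v\<oplus>\<^sub>Y\<^sup>(n-1) w"]) (simp_all add: 1(2))
 next
  fix n z assume z: "z:cel (cone A Y f) n"
   and e: "cdiff (cone A Y f) n z = \<zero>\<^sub>(cone A Y f)\<^sup>(n+1)"
  obtain u y where uw: "z = pair_seq u y" "u:cel A (n+1)" "y:cel Y n" using z by (auto elim: ds_carrierE)
  have 1: "cdiff A (n+1) u = \<zero>\<^sub>A\<^sup>(n+2)" "f (n+1) u\<oplus>\<^sub>Y\<^sup>(n+1) cdiff Y n y = \<zero>\<^sub>Y\<^sup>(n+1)"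
   using e uw neg_eq_zero_iff[of "cobj A (n+2)" "cdiff A (n+1) u"] by simp_all
  obtain v where v: "v:cel A n" "cdiff A n v = u" using acycD[OF A uw(2)] 1(1) by auto
  let ?y = "y\<oplus>\<^sub>Y\<^sup>n f n v" and ?z = "pair_seq (\<ominus>\<^sub>A\<^sup>n v) \<zero>\<^sub>Y\<^sup>(n-1)"
  have "cdiff Y n ?y = \<zero>\<^sub>Y\<^sup>(n+1)" using 1(2) uw(3) v f_d[of "n+1" n v] by (simp add: Y.C.M.a_comm)
  moreover have "z = cone_inclusion A Y n ?y\<oplus>\<^sub>(cone A Y f)\<^sup>n cdiff (cone A Y f) (n-1) ?z"
   using uw v by (simp add: i Y.C.M.a_assoc Y.C.M.r_neg)
  moreover have "?y:cel Y n" "?z:cel (cone A Y f) (n-1)" using uw v by simp_all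
  ultimately show "\<exists>x\<in>cel Y n. \<exists>y'\<in>cel (cone A Y f) (n-1). cdiff Y n x = \<zero>\<^sub>Y\<^sup>(n+1)&
    z = cone_inclusion A Y n x\<oplus>\<^sub>(cone A Y f)\<^sup>n cdiff (cone A Y f) (n-1) y'" by blast
 qed
qed

lemma unshift_acyc:
 assumes "cplx R X" "acyc X"
 shows "acyc (unshift X)"
proof -
 interpret X: cplx R X by fact
 show ?thesis unfolding acyc_def
 proof (intro allI ballI impI)
  fix n x assume *: "x:cel (unshift X) n" "cdiff (unshift X) n x = \<zero>\<^sub>(unshift X)\<^sup>(n+1)"
  then have x: "x:cel X (n-1)" by simp
  then have "cdiff X (n-1) x = \<zero>\<^sub>X\<^sup>n" using *(2) neg_eq_zero_iff[of "cobj X n"] by simp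
  then obtain x' where "x':cel X (n-2)" "cdiff X (n-2) x' = x" using acycD[OF assms(2) x] by auto
  then show "\<exists>x'\<in>cel (unshift X) (n-1). cdiff (unshift X) (n-1) x' = x"
   by (intro bexI[of _ "\<ominus>\<^sub>X\<^sup>(n-2) x'"]) (auto simp: X.C.M.minus_minus)
 qed
qed

lemma cone_proj_qis:
 assumes f: "chmap R U A f" and A: "acyc A"
 shows "qis (cone U A f) (shift U) (cone_projection U A)"
proof (rule surj_qis[OF cone_proj[OF f]])
 interpret chmap R U A f by (rule f)
 fix n
 show "\<exists>z\<in>cel (cone U A f) n. cone_projection U A n z = x" if "x:cel (shift U) n" for x
  using that by (intro bexI[of _ "pair_seq x \<zero>\<^sub>A\<^sup>n"]) (simp_all add: cone_projection_def)
 fix z assume z: "z:cel (cone U A f) n" and e: "cone_projection U A n z = \<zero>\<^sub>(shift U)\<^sup>n"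
  "cdiff (cone U A f) n z = \<zero>\<^sub>(cone U A f)\<^sup>(n+1)"
 obtain x where x: "z = pair_seq \<zero>\<^sub>U\<^sup>(n+1) x" "x:cel A n"
  using z e(1) by (auto elim!: ds_carrierE simp: cone_projection_def)
 have "cdiff A n x = \<zero>\<^sub>A\<^sup>(n+1)" using e(2) x by simp
 then obtain y where y: "y:cel A (n-1)" "cdiff A (n-1) y = x" using acycD[OF A x(2)] by blast
 then show "\<exists>z'\<in>cel (cone U A f) (n-1). cone_projection U A (n-1) z' = \<zero>\<^sub>(shift U)\<^sup>(n-1)&
   cdiff (cone U A f) (n-1) z' = z" using x f_zero[of n] X.d_zero[of n] X.C.M.a_inv_zero[of "n+1"]
  by (intro bexI[of _ "pair_seq \<zero>\<^sub>U\<^sup>n y"]) (simp_all add: cone_projection_def)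
qed

lemma cone_homotopic_qis:
 assumes hom: "homotopic R X Y f g" and f: "chmap R X Y f" and g: "chmap R X Y g"
 shows "\<exists>p. chmap R (cone X Y f) (cone X Y g) p&qis (cone X Y f) (cone X Y g) p"
proof -
 interpret f: chmap R X Y f by fact
 interpret g: chmap R X Y g by fact
 obtain h where h: "hmtp R X Y h" "!!n x. x:cel X n ==>
   f n x = g n x\<oplus>\<^sub>Y\<^sup>n (cdiff Y (n-1) (h n x)\<oplus>\<^sub>Y\<^sup>n h (n+1) (cdiff X n x))"
  using homotopicE[OF hom f.X.cplx_axioms f.Y.cplx_axioms] by metis
 interpret h: hmtp R X Y h by fact
 let ?C = "cone X Y f" and ?D = "cone X Y g"
 \<comment> \<open>The homotopy shears the second component. The map is bijective, so the condition
   on the kernel in \<open>surj_qis\<close> reduces to zero.\<close>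
 let ?q = "\<lambda>n z. pair_seq (fst_seq z) (snd_seq z\<oplus>\<^sub>Y\<^sup>n h (n+1) (fst_seq z))"
 let ?p = "\<lambda>n. \<lambda>z\<in>cel ?C n. ?q n z"
 have h1: "h (n+1) (x\<oplus>\<^sub>X\<^sup>(n+1) y) = h (n+1) x\<oplus>\<^sub>Y\<^sup>n h (n+1) y"
   "h (n+2) (\<ominus>\<^sub>X\<^sup>(n+2) z) =\<ominus>\<^sub>Y\<^sup>(n+1) h (n+2) z"
  if "x:cel X (n+1)" "y:cel X (n+1)" "z:cel X (n+2)" for n x y z using that h.h_add[of x "n+1" y] h.h_minus[of z "n+2"] by simp_all
 have p: "chmap R ?C ?D ?p"
 proof (rule chmap_restrictI)
  show "cplx R ?C" "cplx R ?D" by (rule cone_cplx[OF f], rule cone_cplx[OF g])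
  show "?q n z:cel ?D n" if "z:cel ?C n" for n z using that by (auto elim!: ds_carrierE)
  show "?q n (z\<oplus>\<^sub>?C\<^sup>n w) = ?q n z\<oplus>\<^sub>?D\<^sup>n ?q n w" if "z:cel ?C n" "w:cel ?C n" for n z w
   using that by (auto elim!: ds_carrierE simp: h1 f.Y.C.M.a_ac)
  show "?q n (r\<odot>\<^sub>?C\<^sup>n z) = r\<odot>\<^sub>?D\<^sup>n ?q n z" if "r:el R" "z:cel ?C n" for n r z
   using that by (auto elim!: ds_carrierE simp: h.h_smult[of _ _ "n+1" for n, simplified] f.Y.C.smult_r_distr)
  fix n z assume "z:cel ?C n"
  then obtain x y where z: "z = pair_seq x y" "x:cel X (n+1)" "y:cel Y n" by (auto elim!: ds_carrierE)
  have dx: "cdiff X (n+1) x:cel X (n+2)" using z by simp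
  have cl: "g (n+1) x:cel Y (n+1)" "cdiff Y n (h (n+1) x):cel Y (n+1)"
   "h (n+2) (cdiff X (n+1) x):cel Y (n+1)" "cdiff Y n y:cel Y (n+1)" using z dx by auto
  have "((g (n+1) x\<oplus>\<^sub>Y\<^sup>(n+1) (cdiff Y n (h (n+1) x)\<oplus>\<^sub>Y\<^sup>(n+1)
      h (n+2) (cdiff X (n+1) x)))\<oplus>\<^sub>Y\<^sup>(n+1) cdiff Y n y)\<oplus>\<^sub>Y\<^sup>(n+1)
     \<ominus>\<^sub>Y\<^sup>(n+1) h (n+2) (cdiff X (n+1) x) =
     g (n+1) x\<oplus>\<^sub>Y\<^sup>(n+1) (cdiff Y n y\<oplus>\<^sub>Y\<^sup>(n+1) cdiff Y n (h (n+1) x))" using cl by algebra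
  then show "?q (n+1) (cdiff ?C n z) = cdiff ?D n (?q n z)" using z dx h(2)[OF z(2)] h1(2)[OF z(2,2) dx] by simp
 qed
 have "qis ?C ?D ?p"
 proof (rule surj_qis[OF p])
  fix n w assume "w:cel ?D n"
  then obtain x y where "w = pair_seq x y" "x:cel X (n+1)" "y:cel Y n" by (auto elim!: ds_carrierE)
  then show "\<exists>z\<in>cel ?C n. ?p n z = w"
   by (intro bexI[of _ "pair_seq x (y\<ominus>\<^sub>Y\<^sup>n h (n+1) x)"]) (simp_all add: a_minus_def f.Y.C.M.a_assoc f.Y.C.M.l_neg)
 next
  fix n z assume "z:cel ?C n" "?p n z = \<zero>\<^sub>?D\<^sup>n"
  then have "z = \<zero>\<^sub>?C\<^sup>n" using h.h_zero[of "n+1"] by (auto elim!: ds_carrierE)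
  then show "\<exists>z'\<in>cel ?C (n-1). ?p (n-1) z' = \<zero>\<^sub>?D\<^sup>(n-1)&cdiff ?C (n-1) z' = z"
   using h.h_zero[of n] f.f_zero[of n] f.X.d_zero[of n] f.X.C.M.a_inv_zero[of "n+1"]
   by (intro bexI[of _ "\<zero>\<^sub>?C\<^sup>(n-1)"]) simp_all
 qed
 then show ?thesis using p by blast
qed

text \<open>An equality of records: the two sign changes of the differential cancel, and off the
  carrier both differentials are \<open>undefined\<close>.\<close>

lemma shift_fib: "chmap R X Y f ==> shift (fib X Y f) = cone X Y f"
proof -
 assume f: "chmap R X Y f"
 interpret C: cplx R "cone X Y f" by (rule cone_cplx[OF f])
 have "cdiff (shift (fib X Y f)) n x = cdiff (cone X Y f) n x" for n x
 proof (cases "x:cel (cone X Y f) n")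
  case True
  then show ?thesis unfolding fib_def using C.C.M.minus_minus[of _ "n+1"] by (simp del: cone_obj)
 next
  case False
  then show ?thesis
   using C.d_hm[of "n+1" n] unfolding fib_def shift_complex_def mod_hom_def by (auto simp del: cone_obj simp: PiE_def extensional_def)
 qed
 then show ?thesis by (intro cochain.equality ext) (simp_all add: fib_def)
qed

text \<open>The cones of f, b f, f' a and f' are linked in this order. The outer links are instances
  of the octahedral comparison in which the cone of \<open>b\<close> or \<open>a\<close> is acyclic,
  the middle one comes from the homotopy. \<open>N\<close> is any class invariant under
  quasi-isomorphism, so that a zigzag of comparison maps is enough.\<close>

lemma cone_square:
 assumes N: "!!X Y f. chmap R X Y f ==> qis X Y f ==> X:N\<longleftrightarrow>Y:N"
  and f: "chmap R X Y f" and f': "chmap R X' Y' f'" and a: "chmap R X X' a" and b: "chmap R Y Y' b"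
  and hom: "homotopic R X Y' (cmp_map X b f) (cmp_map X f' a)" and q: "qis X X' a" "qis Y Y' b"
 shows "cone X Y f:N\<longleftrightarrow>cone X' Y' f':N"
proof -
 have ac: "acyc (fib Y Y' b)" "acyc (cone X X' a)"
  unfolding fib_def using q acyc_cone_iff[OF a] acyc_cone_iff[OF b] unshift_acyc[OF cone_cplx[OF b]] by auto
 note o = oct_map[OF f b] oct_map[OF a f'] chmap_comp[OF f b] chmap_comp[OF a f']
 have "cone X Y f:N\<longleftrightarrow>cone X Y' (cmp_map X b f):N"
  using cone_oct_map[OF f b] N[OF cone_incl[OF o(1)] cone_incl_qis[OF o(1) ac(1)]] N by blast
 moreover have "cone X Y' (cmp_map X b f):N\<longleftrightarrow>cone X Y' (cmp_map X f' a):N"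
  using cone_homotopic_qis[OF hom o(3,4)] N by blast
 moreover have "cone X Y' (cmp_map X f' a):N\<longleftrightarrow>shift (fib X' Y' f'):N"
  using cone_oct_map[OF a f'] N[OF cone_proj[OF o(2)] cone_proj_qis[OF o(2) ac(2)]] N by blast
 ultimately show ?thesis unfolding shift_fib[OF f'] by blast
qed

end

lemma triangle_iso_refl:
 assumes "cat C" "is_functor C C (shift_func C)" "is_triangle C t"
 shows "triangle_iso C t t"
proof -
 interpret cat C by fact
 obtain X Y Z u v w where t: "t = (X, Y, Z, u, v, w)" by (cases t)
 have m: "X:Ob C" "Y:Ob C" "Z:Ob C" "u:Hom C X Y" "v:Hom C Y Z" "w:Hom C Z (Shift C X)" using assms(3) unfolding is_triangle_def t by auto
 have S: "Shift C X:Ob C" "ShiftMor C X X (Ident C X) = Ident C (Shift C X)"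
  using functor_ob[OF assms(2) m(1)] functor_ident[OF assms(2) m(1)] by (simp_all add: shift_func_def)
 show ?thesis unfolding triangle_iso_def t prod.case by (rule exI[of _ "Ident C X"], rule exI[of _ "Ident C Y"], rule exI[of _ "Ident C Z"])
   (use m S in \<open>simp add: iso_ident\<close>)
qed

context modcat
begin

lemma cmp_id_left: "chmap R X Y f ==> cmp_map X (id_map Y) f = f"
proof -
 assume f: "chmap R X Y f"
 then have Y: "cplx R Y" by (simp add: chmap_iff)
 show ?thesis by (rule chmap_ext[OF chmap_comp[OF f chmap_id[OF Y]] f]) (simp add: compose_def chmap_val[OF f])
qed

lemma cmp_id_right: "chmap R X Y f ==> cmp_map X f (id_map X) = f"
proof -
 assume f: "chmap R X Y f"
 then have X: "cplx R X" by (simp add: chmap_iff)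
 show ?thesis by (rule chmap_ext[OF chmap_comp[OF chmap_id[OF X] f] f]) (simp add: compose_def)
qed

lemma chmap_cplx: "chmap R X Y f ==> cplx R X" "chmap R X Y f ==> cplx R Y" by (simp_all add: chmap_iff)

lemma Kb_iso_qis:
 assumes "is_iso (Kb R) X Y (hcl X Y f)" "chmap R X Y f"
 shows "qis X Y f"
proof -
 note c = chmap_cplx[OF assms(2)]
 obtain g' where g': "g':Hom (Kb R) Y X" "Comp (Kb R) X Y X g' (hcl X Y f) = Ident (Kb R) X"
   "Comp (Kb R) Y X Y (hcl X Y f) g' = Ident (Kb R) Y" using assms(1) unfolding is_iso_def by blast
 obtain g where g: "chmap R Y X g" "g' = hcl Y X g" using Kb_HomE[OF g'(1) c(2,1)] .
 have "hcl X X (cmp_map X g f) = hcl X X (id_map X)" "hcl Y Y (cmp_map Y f g) = hcl Y Y (id_map Y)"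
  using g'(2,3) Kb_Comp[OF assms(2) g(1)] Kb_Comp[OF g(1) assms(2)] unfolding g(2) by simp_all
 then have h: "homotopic R X X (id_map X) (cmp_map X g f)" "homotopic R Y Y (id_map Y) (cmp_map Y f g)"
  using hcl_eq_iff[OF chmap_id[OF c(1)] chmap_comp[OF assms(2) g(1)]]
   hcl_eq_iff[OF chmap_id[OF c(2)] chmap_comp[OF g(1) assms(2)]] by simp_all
 have "qis X X (cmp_map X g f)" "qis Y Y (cmp_map Y f g)"
  using qis_homotopic[OF h(1) chmap_id[OF c(1)] chmap_comp[OF assms(2) g(1)] qis_id[OF c(1)]]
   qis_homotopic[OF h(2) chmap_id[OF c(2)] chmap_comp[OF g(1) assms(2)] qis_id[OF c(2)]] .
 then show ?thesis using hinj_comp_right[OF assms(2) g(1)] hsurj_comp_left[OF g(1) assms(2)] unfolding qis_def by blast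
qed

lemma Kb_base_iso [simp]: "is_iso (Kb_base R) = is_iso (Kb R)" unfolding Kb_wt by simp

lemma Kb_base_triangle [simp]: "is_triangle (Kb_base R) = is_triangle (Kb R)" unfolding Kb_wt by simp

lemma Kb_base_triangle_iso [simp]: "triangle_iso (Kb_base R) = triangle_iso (Kb R)" unfolding Kb_wt triangle_iso_def by simp

lemma Kb_Dist: "t:Dist (Kb R)\<longleftrightarrow>is_triangle (Kb R) t&(\<exists>X Y f. chmap R X Y f&triangle_iso (Kb R) t (std_tri X Y f))"
 by (subst Kb_wt, simp only: Dist_wt mem_Collect_eq Kb_base_triangle Kb_base_triangle_iso) blast

lemma std_tri_Dist: "chmap R X Y f ==> std_tri X Y f:Dist (Kb R)"
 unfolding Kb_Dist using std_tri_triangle triangle_iso_refl[OF Kb_cat Kb_shift] by blast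

end

text \<open>The closure properties shared by acyclic and perfect complexes. They imply the calculus
  of fractions for the maps with cone in \<open>N\<close>, so that both localizations of the
  homotopy category are handled by one set of constructions.\<close>

locale nullsys = modcat R for R :: "'r ring" (structure) +
 fixes N :: "'r cochain set"
 assumes N_cplx: "X:N ==> cplx R X"
  and N_acyc: "cplx R X ==> acyc X ==> X:N"
  and N_qis: "chmap R X Y f ==> qis X Y f ==> X:N\<longleftrightarrow>Y:N"
  and N_cone: "chmap R X Y f ==> X:N ==> Y:N ==> cone X Y f:N"
  and N_unshift: "X:N ==> unshift X:N"
  and N_shift: "X:N ==> shift X:N"
begin

definition W :: "'r cochain=>'r cochain=>'r chainmap=>bool" where
 "W X Y f\<longleftrightarrow>chmap R X Y f&cone X Y f:N"

lemma W_qis: "chmap R X Y f ==> qis X Y f ==> W X Y f" unfolding W_def using N_acyc cone_cplx acyc_cone_iff by blast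

lemma W_comp: "W X Y f ==> W Y Z g ==> W X Z (cmp_map X g f)"
proof -
 assume a: "W X Y f" "W Y Z g"
 then have f: "chmap R X Y f" "cone X Y f:N" and g: "chmap R Y Z g" "fib Y Z g:N" unfolding W_def fib_def using N_unshift by auto
 obtain p where p: "chmap R (cone (fib Y Z g) (cone X Y f) (oct_map X Y Z)) (cone X Z (cmp_map X g f)) p"
  "qis (cone (fib Y Z g) (cone X Y f) (oct_map X Y Z)) (cone X Z (cmp_map X g f)) p" using cone_oct_map[OF f(1) g(1)] by blast
 show ?thesis using N_qis[OF p] N_cone[OF oct_map[OF f(1) g(1)] g(2) f(2)] chmap_comp[OF f(1) g(1)] unfolding W_def by simp
qed

lemma W_square:
 assumes "chmap R X Y f" "chmap R X' Y' f'" "chmap R X X' a" "chmap R Y Y' b"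
  "homotopic R X Y' (cmp_map X b f) (cmp_map X f' a)" "qis X X' a" "qis Y Y' b"
 shows "W X Y f\<longleftrightarrow>W X' Y' f'"
proof -
 have "cone X Y f:N\<longleftrightarrow>cone X' Y' f':N" by (rule cone_square[OF _ assms]) (rule N_qis)
 then show ?thesis using assms(1,2) unfolding W_def by blast
qed

lemma W_homotopic:
 assumes "homotopic R X Y f g" "chmap R X Y f" "chmap R X Y g"
 shows "W X Y f\<longleftrightarrow>W X Y g" using W_square[OF assms(2,3) chmap_id chmap_id] assms(1) qis_id chmap_cplx[OF assms(2)]
 by (simp add: cmp_id_left[OF assms(2)] cmp_id_right[OF assms(3)])

lemma W_post:
 assumes "chmap R Y Y' b" "qis Y Y' b" "chmap R X Y f"
 shows "W X Y' (cmp_map X b f)\<longleftrightarrow>W X Y f"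
proof -
 note fa = chmap_comp[OF assms(3,1)]
 have X: "cplx R X" using chmap_cplx assms by blast
 have "W X Y f\<longleftrightarrow>W X Y' (cmp_map X b f)"
  by (rule W_square[OF assms(3) fa chmap_id[OF X] assms(1) _ qis_id[OF X] assms(2)])
   (unfold cmp_id_right[OF fa], rule homotopic_refl[OF fa])
 then show ?thesis ..
qed

lemma W_fib_proj:
 assumes "chmap R X Y f" "Y:N"
 shows "W (fib X Y f) X (fib_proj X Y)"
proof -
 obtain p where p: "chmap R (cone (fib X Y f) X (fib_proj X Y)) Y p" "qis (cone (fib X Y f) X (fib_proj X Y)) Y p"
  using cone_fib_proj[OF assms(1)] by blast
 show ?thesis using N_qis[OF p] assms(2) fib_proj[OF assms(1)] unfolding W_def by simp
qed

text \<open>The completing object is the fibre of U -> Y -> cone t. For an element (u, (v, y)) of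
  it, u and -v are the two legs of the square and -y is the homotopy that makes it commute. The cone
  of the leg to U is the cone of \<open>t\<close> up to quasi-isomorphism.\<close>

lemma W_ore:
 assumes f: "chmap R U Y f" and t: "W V Y t"
 shows "\<exists>A t' f'. W A U t'&chmap R A V f'&homotopic R A Y (cmp_map A f t') (cmp_map A t f')"
proof -
 have t': "chmap R V Y t" "cone V Y t:N" using t unfolding W_def by auto
 interpret f: chmap R U Y f by fact
 interpret t: chmap R V Y t by (rule t'(1))
 let ?g = "cmp_map U (cone_inclusion V Y) f"
 have g: "chmap R U (cone V Y t) ?g" by (rule chmap_comp[OF f cone_incl[OF t'(1)]])
 interpret g: chmap R U "cone V Y t" ?g by (rule g)
 let ?A = "fib U (cone V Y t) ?g"
 let ?t = "fib_proj U (cone V Y t)"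
 have W: "W ?A U ?t" by (rule W_fib_proj[OF g t'(2)])
 have A: "cplx R ?A" by (rule fib_cplx[OF g])
 have E: thesis if "z:cel ?A n"
  "!!u v y. z = pair_seq u (pair_seq v y) ==> u:cel U n ==> v:cel V n ==>
    y:cel Y (n-1) ==> thesis" for z n thesis using that by (auto elim!: ds_carrierE)
 have dA: "cdiff ?A n (pair_seq u (pair_seq v y)) = pair_seq (cdiff U n u) (pair_seq (cdiff V n v)
   (\<ominus>\<^sub>Y\<^sup>n (f n u\<oplus>\<^sub>Y\<^sup>n (t n v\<oplus>\<^sub>Y\<^sup>n cdiff Y (n-1) y))))"
  if "u:cel U n" "v:cel V n" "y:cel Y (n-1)" for n u v y
  using that g t.X.C.M.l_zero t.X.C.M.minus_minus by (simp add: compose_def cone_inclusion_def)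
 let ?q = "\<lambda>n z.\<ominus>\<^sub>V\<^sup>n fst_seq (snd_seq z)"
 let ?f = "\<lambda>n. \<lambda>z\<in>cel ?A n. ?q n z"
 have f': "chmap R ?A V ?f"
 proof (rule chmap_restrictI[OF A t.X.cplx_axioms])
  show "?q n z:cel V n" if "z:cel ?A n" for n z using that by (rule E) simp
  show "?q n (z\<oplus>\<^sub>?A\<^sup>n w) = ?q n z\<oplus>\<^sub>V\<^sup>n ?q n w" if "z:cel ?A n" "w:cel ?A n" for n z w
   by (rule E[OF that(1)], rule E[OF that(2)]) (simp add: t.X.C.M.minus_add)
  show "?q n (r\<odot>\<^sub>?A\<^sup>n z) = r\<odot>\<^sub>V\<^sup>n ?q n z" if "r:el R" "z:cel ?A n" for n r z
   by (rule E[OF that(2)]) (use that(1) in \<open>simp add: t.X.C.smult_r_minus\<close>)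
  show "?q (n+1) (cdiff ?A n z) = cdiff V n (?q n z)" if "z:cel ?A n" for n z using that by (rule E) (simp add: dA)
 qed
 let ?h = "\<lambda>n z.\<ominus>\<^sub>Y\<^sup>(n-1) snd_seq (snd_seq z)"
 have "hmtp R ?A Y (\<lambda>n. \<lambda>z\<in>cel ?A n. ?h n z)"
 proof (rule hmtp_restrictI[OF A f.Y.cplx_axioms])
  show "?h n z:cel Y (n-1)" if "z:cel ?A n" for n z using that by (rule E) simp
  show "?h n (z\<oplus>\<^sub>?A\<^sup>n w) = ?h n z\<oplus>\<^sub>Y\<^sup>(n-1) ?h n w" if "z:cel ?A n" "w:cel ?A n" for n z w
   by (rule E[OF that(1)], rule E[OF that(2)]) (simp add: f.Y.C.M.minus_add)
  show "?h n (r\<odot>\<^sub>?A\<^sup>n z) = r\<odot>\<^sub>Y\<^sup>(n-1) ?h n z" if "r:el R" "z:cel ?A n" for n r z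
   by (rule E[OF that(2)]) (use that(1) in \<open>simp add: f.Y.C.smult_r_minus\<close>)
 qed
 then have "homotopic R ?A Y (cmp_map ?A f ?t) (cmp_map ?A t ?f)"
 proof (rule homotopicI)
  fix n z assume z: "z:cel ?A n"
  interpret A: cplx R ?A by (rule A)
  have dz: "cdiff ?A n z:cel ?A (n+1)" using A.d_closed[OF z] by simp
  from z show "cmp_map ?A f ?t n z = cmp_map ?A t ?f n z\<oplus>\<^sub>Y\<^sup>n
    (cdiff Y (n-1) ((\<lambda>z\<in>cel ?A n. ?h n z) z)\<oplus>\<^sub>Y\<^sup>n
     (\<lambda>z\<in>cel ?A (n+1). ?h (n+1) z) (cdiff ?A n z))"
  proof (rule E)
   fix u v y assume e: "z = pair_seq u (pair_seq v y)" "u:cel U n" "v:cel V n"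
    "y:cel Y (n-1)"
   have cl: "f n u:cel Y n" "t n v:cel Y n" "cdiff Y (n-1) y:cel Y n" using e by auto
   have 1: "f n u =\<ominus>\<^sub>Y\<^sup>n t n v\<oplus>\<^sub>Y\<^sup>n (\<ominus>\<^sub>Y\<^sup>n cdiff Y (n-1) y\<oplus>\<^sub>Y\<^sup>n
     (f n u\<oplus>\<^sub>Y\<^sup>n (t n v\<oplus>\<^sub>Y\<^sup>n cdiff Y (n-1) y)))" using cl by algebra
   have 2: "?h (n+1) (cdiff ?A n z) = f n u\<oplus>\<^sub>Y\<^sup>n (t n v\<oplus>\<^sub>Y\<^sup>n cdiff Y (n-1) y)"
    unfolding e(1) dA[OF e(2-4)] using e cl by (simp add: f.Y.C.M.minus_minus)
   have 3: "?h n z =\<ominus>\<^sub>Y\<^sup>(n-1) y" "?q n z =\<ominus>\<^sub>V\<^sup>n v" "?t n z = u" unfolding e(1) using e by simp_all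
   have 4: "cdiff Y (n-1) (\<ominus>\<^sub>Y\<^sup>(n-1) y) =\<ominus>\<^sub>Y\<^sup>n cdiff Y (n-1) y" using e by simp
   show ?thesis unfolding compose_eq[OF z] restrict_apply'[OF z] restrict_apply'[OF dz] 2 3 4 t.f_minus[OF e(3)] by (rule 1)
  qed
 qed
 then show ?thesis using W f' by blast
qed

text \<open>A null homotopy \<open>h\<close> of s (f - g) lifts f - g to the fibre of
  \<open>s\<close> by x -> (f x - g x, -h x). On the fibre A of this lift the difference becomes
  null homotopic, and the projection from A is a denominator because the fibre of \<open>s\<close>
  lies in \<open>N\<close>.\<close>

lemma W_cancel:
 assumes f: "chmap R X Y f" and g: "chmap R X Y g" and s: "W Y Z s"
  and hom: "homotopic R X Z (cmp_map X s f) (cmp_map X s g)"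
 shows "\<exists>A t. W A X t&homotopic R A Y (cmp_map A f t) (cmp_map A g t)"
proof -
 have s': "chmap R Y Z s" "fib Y Z s:N" using s N_unshift unfolding W_def fib_def by auto
 interpret f: chmap R X Y f by fact
 interpret g: chmap R X Y g by fact
 interpret s: chmap R Y Z s by (rule s'(1))
 obtain h where h: "hmtp R X Z h" "!!n x. x:cel X n ==> cmp_map X s f n x =
   cmp_map X s g n x\<oplus>\<^sub>Z\<^sup>n (cdiff Z (n-1) (h n x)\<oplus>\<^sub>Z\<^sup>n h (n+1) (cdiff X n x))"
  using homotopicE[OF hom f.X.cplx_axioms s.Y.cplx_axioms] by metis
 interpret h: hmtp R X Z h by fact
 let ?B = "fib Y Z s"
 have B: "cplx R ?B" by (rule fib_cplx[OF s'(1)])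
 let ?p = "\<lambda>n x. pair_seq (f n x\<oplus>\<^sub>Y\<^sup>n\<ominus>\<^sub>Y\<^sup>n g n x) (\<ominus>\<^sub>Z\<^sup>(n-1) h n x)"
 let ?\<phi> = "\<lambda>n. \<lambda>x\<in>cel X n. ?p n x"
 have phi: "chmap R X ?B ?\<phi>"
 proof (rule chmap_restrictI[OF f.X.cplx_axioms B])
  show "?p n x:cel ?B n" if "x:cel X n" for n x using that by simp
  show "?p n (x\<oplus>\<^sub>X\<^sup>n y) = ?p n x\<oplus>\<^sub>?B\<^sup>n ?p n y" if "x:cel X n" "y:cel X n" for n x y
   using that by (simp add: f.Y.C.M.a_ac f.Y.C.M.minus_add s.Y.C.M.minus_add)
  show "?p n (r\<odot>\<^sub>X\<^sup>n x) = r\<odot>\<^sub>?B\<^sup>n ?p n x" if "r:el R" "x:cel X n" for n r x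
   using that by (simp add: f.f_smult g.f_smult h.h_smult f.Y.C.smult_r_distr f.Y.C.smult_r_minus s.Y.C.smult_r_minus)
  fix n x assume x: "x:cel X n"
  have cl: "s n (g n x):cel Z n" "cdiff Z (n-1) (h n x):cel Z n"
   "h (n+1) (cdiff X n x):cel Z n" using x by auto
  have "\<ominus>\<^sub>Z\<^sup>n ((s n (g n x)\<oplus>\<^sub>Z\<^sup>n (cdiff Z (n-1) (h n x)\<oplus>\<^sub>Z\<^sup>n h (n+1) (cdiff X n x)))
    \<oplus>\<^sub>Z\<^sup>n\<ominus>\<^sub>Z\<^sup>n s n (g n x)\<oplus>\<^sub>Z\<^sup>n\<ominus>\<^sub>Z\<^sup>n cdiff Z (n-1) (h n x)) =
   \<ominus>\<^sub>Z\<^sup>n h (n+1) (cdiff X n x)" using cl by algebra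
  moreover have "s n (f n x) = s n (g n x)\<oplus>\<^sub>Z\<^sup>n (cdiff Z (n-1) (h n x)\<oplus>\<^sub>Z\<^sup>n h (n+1) (cdiff X n x))"
   using h(2)[OF x] x by (simp add: compose_def)
  ultimately show "?p (n+1) (cdiff X n x) = cdiff ?B n (?p n x)" using x s'(1) by simp
 qed
 interpret phi: chmap R X ?B ?\<phi> by (rule phi)
 let ?A = "fib X ?B ?\<phi>"
 let ?t = "fib_proj X ?B"
 have W: "W ?A X ?t" by (rule W_fib_proj[OF phi s'(2)])
 have A: "cplx R ?A" by (rule fib_cplx[OF phi])
 have E: thesis if "z:cel ?A n"
  "!!x y z'. z = pair_seq x (pair_seq y z') ==> x:cel X n ==> y:cel Y (n-1) ==>
    z':cel Z (n-2) ==> thesis" for z n thesis using that by (auto elim!: ds_carrierE)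
 have dA: "fst_seq (snd_seq (cdiff ?A n (pair_seq x (pair_seq y z)))) =
   \<ominus>\<^sub>Y\<^sup>n ((f n x\<oplus>\<^sub>Y\<^sup>n\<ominus>\<^sub>Y\<^sup>n g n x)\<oplus>\<^sub>Y\<^sup>n cdiff Y (n-1) y)"
  if "x:cel X n" "y:cel Y (n-1)" "z:cel Z (n-2)" for n x y z
 proof -
  have "cdiff (fib Y Z s) (n-1) (pair_seq y z) = pair_seq (cdiff Y (n-1) y)
    (\<ominus>\<^sub>Z\<^sup>(n-1) (s (n-1) y\<oplus>\<^sub>Z\<^sup>(n-1) cdiff Z (n-2) z))"
   using fib_d[OF s'(1), of y "n-1" z] that by simp
  moreover have "pair_seq y z:cel ?B (n-1)" using that by simp
  ultimately show ?thesis using fib_d[OF phi that(1), of "pair_seq y z"] that by simp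
 qed
 let ?h = "\<lambda>n z.\<ominus>\<^sub>Y\<^sup>(n-1) fst_seq (snd_seq z)"
 have "hmtp R ?A Y (\<lambda>n. \<lambda>z\<in>cel ?A n. ?h n z)"
 proof (rule hmtp_restrictI[OF A f.Y.cplx_axioms])
  show "?h n z:cel Y (n-1)" if "z:cel ?A n" for n z using that by (rule E) simp
  show "?h n (z\<oplus>\<^sub>?A\<^sup>n w) = ?h n z\<oplus>\<^sub>Y\<^sup>(n-1) ?h n w" if "z:cel ?A n" "w:cel ?A n" for n z w
   by (rule E[OF that(1)], rule E[OF that(2)]) (simp add: f.Y.C.M.minus_add)
  show "?h n (r\<odot>\<^sub>?A\<^sup>n z) = r\<odot>\<^sub>Y\<^sup>(n-1) ?h n z" if "r:el R" "z:cel ?A n" for n r z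
   by (rule E[OF that(2)]) (use that(1) in \<open>simp add: f.Y.C.smult_r_minus\<close>)
 qed
 then have "homotopic R ?A Y (cmp_map ?A f ?t) (cmp_map ?A g ?t)"
 proof (rule homotopicI)
  fix n z assume z: "z:cel ?A n"
  interpret A: cplx R ?A by (rule A)
  have dz: "cdiff ?A n z:cel ?A (n+1)" using A.d_closed[OF z] by simp
  from z show "cmp_map ?A f ?t n z = cmp_map ?A g ?t n z\<oplus>\<^sub>Y\<^sup>n
    (cdiff Y (n-1) ((\<lambda>z\<in>cel ?A n. ?h n z) z)\<oplus>\<^sub>Y\<^sup>n
     (\<lambda>z\<in>cel ?A (n+1). ?h (n+1) z) (cdiff ?A n z))"
  proof (rule E)
   fix x y z' assume e: "z = pair_seq x (pair_seq y z')" "x:cel X n" "y:cel Y (n-1)"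
    "z':cel Z (n-2)"
   have cl: "f n x:cel Y n" "g n x:cel Y n" "cdiff Y (n-1) y:cel Y n" using e by auto
   have 1: "f n x = g n x\<oplus>\<^sub>Y\<^sup>n (\<ominus>\<^sub>Y\<^sup>n cdiff Y (n-1) y\<oplus>\<^sub>Y\<^sup>n
     ((f n x\<oplus>\<^sub>Y\<^sup>n\<ominus>\<^sub>Y\<^sup>n g n x)\<oplus>\<^sub>Y\<^sup>n cdiff Y (n-1) y))" using cl by algebra
   have 2: "?h (n+1) (cdiff ?A n z) = (f n x\<oplus>\<^sub>Y\<^sup>n\<ominus>\<^sub>Y\<^sup>n g n x)\<oplus>\<^sub>Y\<^sup>n cdiff Y (n-1) y"
    unfolding e(1) dA[OF e(2-4)] using e cl by (simp add: f.Y.C.M.minus_minus)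
   have 3: "?h n z =\<ominus>\<^sub>Y\<^sup>(n-1) y" "?t n z = x" unfolding e(1) using e by simp_all
   have 4: "cdiff Y (n-1) (\<ominus>\<^sub>Y\<^sup>(n-1) y) =\<ominus>\<^sub>Y\<^sup>n cdiff Y (n-1) y" using e by simp
   show ?thesis unfolding compose_eq[OF z] restrict_apply'[OF z] restrict_apply'[OF dz] 2 3 4 by (rule 1)
  qed
 qed
 then show ?thesis using W by blast
qed

text \<open>A denominator comes with a triangle that is only isomorphic to a standard one.
  Isomorphisms in the homotopy category are quasi-isomorphisms, so \<open>W_square\<close>
  transports the condition from the standard triangle to any representing chain map.\<close>

lemma den_iff: "s:denominators (Kb R) N X Y\<longleftrightarrow>(\<exists>f. W X Y f&s = hcl X Y f)"
proof
 assume "s:denominators (Kb R) N X Y"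
 then obtain Z v w where Z: "Z:N" "(X, Y, Z, s, v, w):Dist (Kb R)" unfolding denominators_def by blast
 then have "is_triangle (Kb R) (X, Y, Z, s, v, w)" unfolding Kb_Dist by blast
 then have m: "cplx R X" "cplx R Y" "cplx R Z" "s:Hom (Kb R) X Y" unfolding is_triangle_def by auto
 obtain X' Y' f' where f': "chmap R X' Y' f'" "triangle_iso (Kb R) (X, Y, Z, s, v, w) (std_tri X' Y' f')"
  using Z(2) unfolding Kb_Dist by blast
 note m' = chmap_cplx[OF f'(1)] cone_cplx[OF f'(1)]
 obtain a b c where abc: "is_iso (Kb R) X X' a" "is_iso (Kb R) Y Y' b" "is_iso (Kb R) Z (cone X' Y' f') c"
  "Comp (Kb R) X Y Y' b s = Comp (Kb R) X X' Y' (hcl X' Y' f') a" using f'(2) unfolding triangle_iso_def std_tri_def by auto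
 have h: "a:Hom (Kb R) X X'" "b:Hom (Kb R) Y Y'" "c:Hom (Kb R) Z (cone X' Y' f')" using abc unfolding is_iso_def by auto
 obtain f where f: "chmap R X Y f" "s = hcl X Y f" using Kb_HomE[OF m(4,1,2)] .
 obtain \<alpha> where al: "chmap R X X' \<alpha>" "a = hcl X X' \<alpha>" using Kb_HomE[OF h(1) m(1) m'(1)] .
 obtain \<beta> where be: "chmap R Y Y' \<beta>" "b = hcl Y Y' \<beta>" using Kb_HomE[OF h(2) m(2) m'(2)] .
 obtain \<gamma> where ga: "chmap R Z (cone X' Y' f') \<gamma>" "c = hcl Z (cone X' Y' f') \<gamma>" using Kb_HomE[OF h(3) m(3) m'(3)] .
 have q: "qis X X' \<alpha>" "qis Y Y' \<beta>" "qis Z (cone X' Y' f') \<gamma>" using Kb_iso_qis abc al be ga by auto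
 have "W X' Y' f'" unfolding W_def using f'(1) N_qis[OF ga(1) q(3)] Z(1) by blast
 moreover have "homotopic R X Y' (cmp_map X \<beta> f) (cmp_map X f' \<alpha>)"
  using abc(4) unfolding f(2) al(2) be(2) Kb_Comp[OF f(1) be(1)] Kb_Comp[OF al(1) f'(1)]
   hcl_eq_iff[OF chmap_comp[OF f(1) be(1)] chmap_comp[OF al(1) f'(1)]] .
 ultimately have "W X Y f" using W_square[OF f(1) f'(1) al(1) be(1) _ q(1,2)] by blast
 then show "\<exists>f. W X Y f&s = hcl X Y f" using f(2) by blast
next
 assume "\<exists>f. W X Y f&s = hcl X Y f"
 then obtain f where f: "chmap R X Y f" "cone X Y f:N" "s = hcl X Y f" unfolding W_def by blast
 show "s:denominators (Kb R) N X Y" using std_tri_Dist[OF f(1)] f(2,3) unfolding denominators_def std_tri_def by blast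
qed

lemma ore_Kb: "ore (Kb R) N"
proof (rule ore.intro[OF Kb_cat], rule ore_axioms.intro)
 fix s X Y assume "s:denominators (Kb R) N X Y"
 then obtain f where f: "chmap R X Y f" "s = hcl X Y f" unfolding den_iff W_def by blast
 then show "X:Ob (Kb R)&Y:Ob (Kb R)&s:Hom (Kb R) X Y" using chmap_cplx[OF f(1)] by (auto simp: Kb_Hom)
next
 fix X assume "X:Ob (Kb R)"
 then show "Ident (Kb R) X:denominators (Kb R) N X X" unfolding den_iff using W_qis[OF chmap_id qis_id] by auto
next
 fix s t X Y Z assume "s:denominators (Kb R) N X Y" "t:denominators (Kb R) N Y Z"
 then obtain f g where fg: "W X Y f" "s = hcl X Y f" "W Y Z g" "t = hcl Y Z g" unfolding den_iff by blast
 then have c: "chmap R X Y f" "chmap R Y Z g" unfolding W_def by blast+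
 show "Comp (Kb R) X Y Z t s:denominators (Kb R) N X Z" unfolding den_iff fg(2,4) Kb_Comp[OF c] using W_comp[OF fg(1,3)] by blast
next
 fix c t U V Y assume *: "c:Hom (Kb R) U Y" "t:denominators (Kb R) N V Y" "U:Ob (Kb R)"
 obtain g where g: "W V Y g" "t = hcl V Y g" using *(2) unfolding den_iff by blast
 have cg: "chmap R V Y g" using g unfolding W_def by blast
 obtain f where f: "chmap R U Y f" "c = hcl U Y f" using Kb_HomE[OF *(1)] *(3) chmap_cplx(2)[OF cg] by auto
 obtain A t' f' where a: "W A U t'" "chmap R A V f'" "homotopic R A Y (cmp_map A f t') (cmp_map A g f')" using W_ore[OF f(1) g(1)] by blast
 have ct: "chmap R A U t'" using a unfolding W_def by blast
 have "Comp (Kb R) A U Y c (hcl A U t') = Comp (Kb R) A V Y t (hcl A V f')"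
  unfolding f(2) g(2) using a(3) hcl_eq_iff[OF chmap_comp[OF ct f(1)] chmap_comp[OF a(2) cg]]
  by (simp add: Kb_Comp[OF ct f(1)] Kb_Comp[OF a(2) cg])
 moreover have "hcl A U t':denominators (Kb R) N A U" unfolding den_iff using a(1) by blast
 moreover have "hcl A V f':Hom (Kb R) A V" "A:Ob (Kb R)" using a(2) chmap_cplx[OF a(2)] by (auto simp: Kb_Hom)
 ultimately show "\<exists>W\<in>Ob (Kb R). \<exists>t'\<in>denominators (Kb R) N W U. \<exists>f'\<in>Hom (Kb R) W V.
   Comp (Kb R) W U Y c t' = Comp (Kb R) W V Y t f'" by blast
next
 fix c d s X Y Z assume *: "c:Hom (Kb R) X Y" "d:Hom (Kb R) X Y" "X:Ob (Kb R)"
  "s:denominators (Kb R) N Y Z" "Comp (Kb R) X Y Z s c = Comp (Kb R) X Y Z s d"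
 obtain t where t: "W Y Z t" "s = hcl Y Z t" using *(4) unfolding den_iff by blast
 have ct: "chmap R Y Z t" using t unfolding W_def by blast
 have ob: "cplx R X" "cplx R Y" using *(3) chmap_cplx[OF ct] by auto
 obtain f where f: "chmap R X Y f" "c = hcl X Y f" using Kb_HomE[OF *(1) ob] .
 obtain g where g: "chmap R X Y g" "d = hcl X Y g" using Kb_HomE[OF *(2) ob] .
 have "homotopic R X Z (cmp_map X t f) (cmp_map X t g)" using *(5) unfolding f(2) g(2) t(2) Kb_Comp[OF f(1) ct] Kb_Comp[OF g(1) ct]
   hcl_eq_iff[OF chmap_comp[OF f(1) ct] chmap_comp[OF g(1) ct]] .
 then obtain A u where a: "W A X u" "homotopic R A Y (cmp_map A f u) (cmp_map A g u)" using W_cancel[OF f(1) g(1) t(1)] by blast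
 have cu: "chmap R A X u" using a unfolding W_def by blast
 have "Comp (Kb R) A X Y c (hcl A X u) = Comp (Kb R) A X Y d (hcl A X u)"
  unfolding f(2) g(2) using a(2) hcl_eq_iff[OF chmap_comp[OF cu f(1)] chmap_comp[OF cu g(1)]]
  by (simp add: Kb_Comp[OF cu f(1)] Kb_Comp[OF cu g(1)])
 moreover have "hcl A X u:denominators (Kb R) N A X" unfolding den_iff using a(1) by blast
 moreover have "A:Ob (Kb R)" using chmap_cplx[OF cu] by auto
 ultimately show "\<exists>W\<in>Ob (Kb R). \<exists>t\<in>denominators (Kb R) N W X. Comp (Kb R) W X Y c t = Comp (Kb R) W X Y d t"
  by blast
qed

lemma W_shift:
 assumes "W X Y f"
 shows "W (shift X) (shift Y) (\<lambda>n. f (n+1))"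
proof -
 have f: "chmap R X Y f" "cone X Y f:N" using assms unfolding W_def by auto
 interpret f: chmap R X Y f by (rule f)
 have sf: "chmap R (shift X) (shift Y) (\<lambda>n. f (n+1))" by (rule shift_chmap[OF f(1)])
 let ?C = "shift (cone X Y f)"
 let ?D = "cone (shift X) (shift Y) (\<lambda>n. f (n+1))"
 \<comment> \<open>The shift negates the whole differential of a cone, including the component given
   by \<open>f\<close>. A sign on the first component turns it into the cone of the shifted
   map.\<close>
 let ?q = "\<lambda>n z. pair_seq (\<ominus>\<^sub>X\<^sup>(n+2) fst_seq z) (snd_seq z)"
 let ?p = "\<lambda>n. \<lambda>z\<in>cel ?C n. ?q n z"
 have E: thesis if "z:cel ?C n"
  "!!x y. z = pair_seq x y ==> x:cel X (n+2) ==> y:cel Y (n+1) ==> thesis" for z n thesis using that by (auto elim!: ds_carrierE)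
 have dx: "cdiff X (n+2) x:cel X (n+3)" if "x:cel X (n+2)" for n x using that by simp
 have dxm: "cdiff X (n+2) (\<ominus>\<^sub>X\<^sup>(n+2) x) =\<ominus>\<^sub>X\<^sup>(n+3) cdiff X (n+2) x"
  if "x:cel X (n+2)" for n x using f.X.d_minus[of x "n+2"] that by simp
 have dY: "cdiff Y (n+1) y:cel Y (n+2)" if "y:cel Y (n+1)" for n y using that by simp
 have p: "chmap R ?C ?D ?p"
 proof (rule chmap_restrictI)
  show "cplx R ?C" by (rule shift_cplx[OF cone_cplx[OF f(1)]])
  show "cplx R ?D" by (rule cone_cplx[OF sf])
  show "?q n z:cel ?D n" if "z:cel ?C n" for n z using that by (rule E) simp
  show "?q n (z\<oplus>\<^sub>?C\<^sup>n w) = ?q n z\<oplus>\<^sub>?D\<^sup>n ?q n w" if "z:cel ?C n" "w:cel ?C n" for n z w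
   by (rule E[OF that(1)], rule E[OF that(2)]) (simp add: f.X.C.M.minus_add)
  show "?q n (r\<odot>\<^sub>?C\<^sup>n z) = r\<odot>\<^sub>?D\<^sup>n ?q n z" if "r:el R" "z:cel ?C n" for n r z
   by (rule E[OF that(2)]) (use that(1) in \<open>simp add: f.X.C.smult_r_minus\<close>)
  fix n z assume "z:cel ?C n"
  then show "?q (n+1) (cdiff ?C n z) = cdiff ?D n (?q n z)"
  proof (rule E)
   fix x y assume e: "z = pair_seq x y" "x:cel X (n+2)" "y:cel Y (n+1)"
   have "f (n+2) x:cel Y (n+2)" using e by simp
   then show ?thesis using e dx[OF e(2)] dY[OF e(3)] dxm[OF e(2)] cone_d[of x X "n+1" y Y f]
    by (simp add: f.X.C.M.minus_minus f.Y.C.M.minus_add)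
  qed
 qed
 interpret p: chmap R ?C ?D ?p by (rule p)
 have "qis ?C ?D ?p"
 proof (rule surj_qis[OF p])
  fix n z assume "z:cel ?D n"
  then obtain x y where e: "z = pair_seq x y" "x:cel X (n+2)" "y:cel Y (n+1)" by (auto elim!: ds_carrierE)
  then show "\<exists>x\<in>cel ?C n. ?p n x = z"
   by (intro bexI[of _ "pair_seq (\<ominus>\<^sub>X\<^sup>(n+2) x) y"]) (simp_all add: f.X.C.M.minus_minus)
 next
  fix n z assume z: "z:cel ?C n" "?p n z = \<zero>\<^sub>?D\<^sup>n"
  obtain x y where e: "z = pair_seq x y" "x:cel X (n+2)" "y:cel Y (n+1)" using z(1) by (rule E)
  have z0: "z = \<zero>\<^sub>?C\<^sup>n" using z(2) e f.X.C.M.minus_minus[of x "n+2"] by (simp add: f.X.C.M.a_inv_zero)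
  have "cdiff ?C (n-1) \<zero>\<^sub>?C\<^sup>(n-1) = z" unfolding z0 using p.X.d_zero[of "n-1"] unfolding diff_add_cancel .
  then show "\<exists>x'\<in>cel ?C (n-1). ?p (n-1) x' = \<zero>\<^sub>?D\<^sup>(n-1)&cdiff ?C (n-1) x' = z"
   using p.f_zero[of "n-1"] p.X.C.M.zero_closed[of "n-1"] by blast
 qed
 then have "?D:N" using N_qis[OF p] N_shift[OF f(2)] by blast
 then show ?thesis unfolding W_def using sf by blast
qed

lemma den_shift: "s:denominators (Kb R) N X Y ==>
  ShiftMor (Kb R) X Y s:denominators (Kb R) N (Shift (Kb R) X) (Shift (Kb R) Y)"
proof -
 assume "s:denominators (Kb R) N X Y"
 then obtain f where f: "W X Y f" "s = hcl X Y f" unfolding den_iff by blast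
 then have c: "chmap R X Y f" unfolding W_def by blast
 show ?thesis unfolding den_iff f(2) Kb_ShiftMor[OF c] using W_shift[OF f(1)] by auto
qed

end

text \<open>Choice by downward recursion over the integers: above \<open>b\<close> the family
  \<open>z\<close> is prescribed, below it each member is chosen from its successor.
  \<open>I\<close> is the invariant carried along and \<open>G\<close> the relation between
  neighbours.\<close>

lemma descending_choice:
 fixes b :: int
 assumes base: "!!n. n > b ==> I n (z n)" "!!n. n > b ==> G n (z n) (z (n+1))"
  and step: "!!n h1. n\<le>b ==> I (n+1) h1 ==> \<exists>h0. I n h0&G n h0 h1"
 shows "\<exists>h. \<forall>n. I n (h n)&G n (h n) (h (n+1))"
proof -
 define H where "H = rec_nat (z (b+1)) (\<lambda>k h1. SOME h0. I (b - int k) h0&G (b - int k) h0 h1)"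
 have H0: "H 0 = z (b+1)" and HS: "H (Suc k) = (SOME h0. I (b - int k) h0&G (b - int k) h0 (H k))" for k unfolding H_def by simp_all
 have 1: "I (b+1 - int k) (H k)" for k
 proof (induction k)
  case 0
  then show ?case using base(1)[of "b+1"] by (simp add: H0)
 next
  case (Suc k)
  then have "I (b - int k+1) (H k)" by (simp add: algebra_simps)
  from someI_ex[OF step[OF _ this]] show ?case unfolding HS by simp
 qed
 have 2: "G (b - int k) (H (Suc k)) (H k)" for k
 proof -
  have "I (b - int k+1) (H k)" using 1[of k] by (simp add: algebra_simps)
  from someI_ex[OF step[OF _ this]] show ?thesis unfolding HS by simp
 qed
 define h where "h n = (if n > b then z n else H (nat (b+1 - n)))" for n
 have "I n (h n)" for n using 1[of "nat (b+1 - n)"] base(1)[of n] unfolding h_def by auto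
 moreover have "G n (h n) (h (n+1))" for n
 proof (cases "n > b")
  case True
  then show ?thesis using base(2)[of n] unfolding h_def by simp
 next
  case False
  have e: "nat (b+1 - n) = Suc (nat (b - n))" "b - int (nat (b - n)) = n" using False by auto
  have "h (n+1) = H (nat (b - n))"
  proof (cases "n = b")
   case True
   then show ?thesis unfolding h_def by (simp add: H0)
  qed (use False in \<open>simp add: h_def\<close>)
  moreover have "h n = H (Suc (nat (b - n)))" using False e(1) unfolding h_def by simp
  ultimately show ?thesis using 2[of "nat (b - n)"] unfolding e(2) by simp
 qed
 ultimately show ?thesis by blast
qed

section \<open>Complexes of projectives and perfect complexes\<close>

context modcat
begin

lemma submod_hm: "submod R N H ==> f:hm M N ==> (!!x. x:el M ==> f x:H) ==> f:hm M (N\<lparr>carrier := H\<rparr>)"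
 by (rule hmI) (auto simp: hm_undef hm_add hm_smult)

lemma image_MOD:
 assumes "M:MOD" "N:MOD" "f:hm M N"
 shows "N\<lparr>carrier := f ` el M\<rparr>:MOD" "f:hm M (N\<lparr>carrier := f ` el M\<rparr>)"
proof -
 have s: "submod R N (f ` el M)" using submod_image[OF assms(3) _ _ submod_carrier] assms(1,2) by simp
 then have l: "lmod R (N\<lparr>carrier := f ` el M\<rparr>)" by (rule left_module.submod_left_module[OF MOD_lm[OF assms(2)]])
 show h: "f:hm M (N\<lparr>carrier := f ` el M\<rparr>)" using submod_hm[OF s assms(3)] by auto
 show "N\<lparr>carrier := f ` el M\<rparr>:MOD" using hm_surj_fin_gen[OF h _ l MOD_fg[OF assms(1)]] assms(1) l by (simp add: MOD_iff)
qed

text \<open>Projectivity is a lifting property against surjections of finitely generated modules.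
  The image of \<open>g\<close> is again finitely generated, so it may serve as the target, and
  \<open>g\<close> itself need not be surjective.\<close>

lemma proj_lift:
 assumes P: "is_projective R P" and f: "f:hm P N" and g: "g:hm M N" and MN: "M:MOD" "N:MOD"
  and im: "!!x. x:el P ==> f x:g ` el M"
 shows "\<exists>h\<in>hm P M. \<forall>x\<in>el P. g (h x) = f x"
proof -
 note B = image_MOD[OF MN g]
 have s: "submod R N (g ` el M)" using submod_image[OF g _ _ submod_carrier] MN by simp
 have f': "f:hm P (N\<lparr>carrier := g ` el M\<rparr>)" using submod_hm[OF s f im] .
 have "\<forall>M\<in>MOD. \<forall>N\<in>MOD. \<forall>g\<in>hm M N. \<forall>f\<in>hm P N. g ` el M = el N-->(\<exists>h\<in>hm P M. compose (el P) g h = f)"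
  using P unfolding is_projective_def by (rule conjunct2)
 from this[rule_format, OF MN(1) B f'] obtain h where h: "h:hm P M" "compose (el P) g h = f" by auto
 then show ?thesis by (intro bexI[of _ h]) (auto simp: compose_def)
qed

abbreviation "PROJ\<equiv>projective_complexes R"

lemma PROJ_iff: "P:PROJ\<longleftrightarrow>cplx R P&(\<forall>n. is_projective R (cobj P n))"
 unfolding projective_complexes_def cplx_iff by blast

lemma cplx_bound:
 assumes "cplx R X"
 obtains b where "\<forall>n>b. cel X n = {\<zero>\<^sub>X\<^sup>n}"
proof -
 interpret X: cplx R X by fact
 obtain b where "\<forall>n\<in>{n. cel X n~={\<zero>\<^sub>X\<^sup>n}}. n\<le>b"
  using bdd_above_finite[OF X.bounded] unfolding bdd_above_def by blast
 then show ?thesis using that[of b] by (metis (mono_tags, lifting) linorder_not_less mem_Collect_eq)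
qed

lemma proj_null_homotopic:
 assumes P: "P:PROJ" and A: "cplx R A" "acyc A" and f: "chmap R P A f"
 shows "\<exists>h. hmtp R P A h&(\<forall>n. \<forall>x\<in>cel P n.
  f n x = cdiff A (n-1) (h n x)\<oplus>\<^sub>A\<^sup>n h (n+1) (cdiff P n x))"
proof -
 interpret f: chmap R P A f by fact
 obtain b where b0: "\<forall>n>b. cel P n = {\<zero>\<^sub>P\<^sup>n}" using cplx_bound[OF f.X.cplx_axioms] .
 note b = b0[rule_format]
 \<comment> \<open>The invariant says that \<open>h\<close> solves the equation on cycles. Applied
   to the cycle d x it shows that f x - h (d x), one degree lower, is a cycle of A, hence a
   boundary, so that projectivity provides the next component.\<close>
 let ?I = "\<lambda>n h. h:hm (cobj P n) (cobj A (n-1))&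
   (\<forall>x\<in>cel P n. cdiff P n x = \<zero>\<^sub>P\<^sup>(n+1)-->f n x = cdiff A (n-1) (h x))"
 let ?G = "\<lambda>n h0 h1. \<forall>x\<in>cel P n. f n x = cdiff A (n-1) (h0 x)\<oplus>\<^sub>A\<^sup>n h1 (cdiff P n x)"
 have "\<exists>h. \<forall>n. ?I n (h n)&?G n (h n) (h (n+1))"
 proof (rule descending_choice[where z = "\<lambda>n. \<lambda>x\<in>cel P n. \<zero>\<^sub>A\<^sup>(n-1)"])
  fix n assume n: "n > b"
  show "?I n (\<lambda>x\<in>cel P n. \<zero>\<^sub>A\<^sup>(n-1))"
   using b[OF n] f.f_zero[of n] f.Y.d_zero[of "n-1"] hm_zero_map[of "cobj P n" "cobj A (n-1)"] by simp
  show "?G n (\<lambda>x\<in>cel P n. \<zero>\<^sub>A\<^sup>(n-1)) (\<lambda>x\<in>cel P (n+1). \<zero>\<^sub>A\<^sup>(n+1 - 1))"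
   using b[OF n] f.f_zero[of n] f.Y.d_zero[of "n-1"] by simp
 next
  fix n h1 assume h1: "?I (n+1) h1"
  then have h1h: "h1:hm (cobj P (n+1)) (cobj A n)" by simp
  have h1c: "h1 x:cel A n" if "x:cel P (n+1)" for x using hm_closed[OF h1h that] .
  let ?u = "\<lambda>x. f n x\<oplus>\<^sub>A\<^sup>n\<ominus>\<^sub>A\<^sup>n h1 (cdiff P n x)"
  have u: "restrict ?u (cel P n):hm (cobj P n) (cobj A n)"
   by (rule hm_restrictI) (auto simp: h1c hm_add[OF h1h] hm_smult[OF h1h] f.Y.C.M.a_ac f.Y.C.M.minus_add
     f.f_smult f.X.d_smult f.Y.C.smult_r_distr f.Y.C.smult_r_minus)
  have im: "?u x:cdiff A (n-1) ` cel A (n-1)" if x: "x:cel P n" for x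
  proof -
   have dx: "cdiff P n x:cel P (n+1)" using x by simp
   have ddx: "cdiff P (n+1) (cdiff P n x) = \<zero>\<^sub>P\<^sup>(n+1 + 1)" using x by simp
   have "f (n+1) (cdiff P n x) = cdiff A (n+1 - 1) (h1 (cdiff P n x))" using conjunct2[OF h1, rule_format, OF dx ddx] .
   then have "cdiff A n (?u x) = \<zero>\<^sub>A\<^sup>(n+1)" using x h1c[OF dx] by (simp add: f.Y.C.M.r_neg)
   then show ?thesis using acycD[OF A(2), of "?u x" n] x h1c[OF dx] by force
  qed
  obtain h0 where h0: "h0:hm (cobj P n) (cobj A (n-1))" "\<forall>x\<in>cel P n. cdiff A (n-1) (h0 x) = ?u x"
   using proj_lift[OF _ u, of "cdiff A (n-1)" "cobj A (n-1)"] P im by (auto simp: PROJ_iff)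
  have G: "?G n h0 h1"
  proof
   fix x assume x: "x:cel P n"
   have "f n x:cel A n" "h1 (cdiff P n x):cel A n" using x h1c by auto
   then show "f n x = cdiff A (n-1) (h0 x)\<oplus>\<^sub>A\<^sup>n h1 (cdiff P n x)" using h0(2) x by (simp, algebra)
  qed
  have "h1 \<zero>\<^sub>P\<^sup>(n+1) = \<zero>\<^sub>A\<^sup>n" using hm_zero[OF h1h] by simp
  moreover have "h0 x:cel A (n-1)" if "x:cel P n" for x using hm_closed[OF h0(1) that] .
  ultimately have "?I n h0" using h0(1) G by simp
  then show "\<exists>h0. ?I n h0&?G n h0 h1" using G by blast
 qed
 then show ?thesis unfolding hmtp_iff using f.X.cplx_axioms A(1) by blast
qed

text \<open>The map from P into the acyclic cone of \<open>s\<close> is null homotopic. The first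
  components of the null homotopy form the lift \<open>g'\<close>, the second components the
  homotopy.\<close>

lemma proj_lift_qis:
 assumes P: "P:PROJ" and s: "chmap R X Y s" "qis X Y s" and g: "chmap R P Y g"
 shows "\<exists>g'. chmap R P X g'&homotopic R P Y g (cmp_map P s g')"
proof -
 interpret s: chmap R X Y s by fact
 interpret g: chmap R P Y g by fact
 let ?A = "cone X Y s"
 have f: "chmap R P ?A (cmp_map P (cone_inclusion X Y) g)" by (rule chmap_comp[OF g cone_incl[OF s(1)]])
 have A: "cplx R ?A" "acyc ?A" using cone_cplx acyc_cone_iff s by auto
 obtain h where h: "hmtp R P ?A h" "!!n x. x:cel P n ==>
   cmp_map P (cone_inclusion X Y) g n x = cdiff ?A (n-1) (h n x)\<oplus>\<^sub>?A\<^sup>n h (n+1) (cdiff P n x)"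
  using proj_null_homotopic[OF P A f] by blast
 interpret h: hmtp R P ?A h by fact
 have E: thesis if "x:cel P n"
  "!!p q. h n x = pair_seq p q ==> p:cel X n ==> q:cel Y (n-1) ==> thesis" for x n thesis
  using h.h_closed[OF that(1), of "n-1"] that(2) by (auto elim!: ds_carrierE)
 have add: "h n (x\<oplus>\<^sub>P\<^sup>n y) = h n x\<oplus>\<^bsub>direct_sum (cobj X n) (cobj Y (n-1))\<^esub> h n y"
  if "x:cel P n" "y:cel P n" for x y n using h.h_add[OF that] by simp
 have sm: "h n (r\<odot>\<^sub>P\<^sup>n x) = r\<odot>\<^bsub>direct_sum (cobj X n) (cobj Y (n-1))\<^esub> h n x"
  if "r:el R" "x:cel P n" for r x n using h.h_smult[OF that] by simp
 have key: "fst_seq (h (n+1) (cdiff P n x)) = cdiff X n (fst_seq (h n x))&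
   g n x = s n (fst_seq (h n x))\<oplus>\<^sub>Y\<^sup>n (cdiff Y (n-1) (snd_seq (h n x))\<oplus>\<^sub>Y\<^sup>n snd_seq (h (n+1) (cdiff P n x)))"
  if x: "x:cel P n" for n x using x
 proof (rule E)
  fix p q assume pq: "h n x = pair_seq p q" "p:cel X n" "q:cel Y (n-1)"
  have "cdiff P n x:cel P (n+1)" using x by simp
  then show ?thesis
  proof (rule E)
   fix p' q' assume p': "h (n+1) (cdiff P n x) = pair_seq p' q'" "p':cel X (n+1)" "q':cel Y (n+1 - 1)"
   have eq: "pair_seq \<zero>\<^sub>X\<^sup>(n+1) (g n x) = pair_seq (\<ominus>\<^sub>X\<^sup>(n+1) cdiff X n p\<oplus>\<^sub>X\<^sup>(n+1) p')
    ((s n p\<oplus>\<^sub>Y\<^sup>n cdiff Y (n-1) q)\<oplus>\<^sub>Y\<^sup>n q')"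
    using h(2)[OF x] x pq p' by (simp add: compose_def cone_inclusion_def)
   then have "p'\<oplus>\<^sub>X\<^sup>(n+1)\<ominus>\<^sub>X\<^sup>(n+1) cdiff X n p = \<zero>\<^sub>X\<^sup>(n+1)"
    using p' pq s.X.C.M.a_comm by simp
   then have "p' = cdiff X n p" using p' pq s.X.C.M.add_minus_zero_iff by simp
   moreover have "g n x = s n p\<oplus>\<^sub>Y\<^sup>n (cdiff Y (n-1) q\<oplus>\<^sub>Y\<^sup>n q')"
    using eq pq p' by (simp add: s.Y.C.M.a_assoc)
   ultimately show ?thesis using pq p' by simp
  qed
 qed
 let ?g = "\<lambda>n. \<lambda>x\<in>cel P n. fst_seq (h n x)"
 have g': "chmap R P X ?g"
 proof (rule chmap_restrictI[OF g.X.cplx_axioms s.X.cplx_axioms])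
  show "fst_seq (h n x):cel X n" if "x:cel P n" for n x using that by (rule E) simp
  show "fst_seq (h n (x\<oplus>\<^sub>P\<^sup>n y)) = fst_seq (h n x)\<oplus>\<^sub>X\<^sup>n fst_seq (h n y)"
   if "x:cel P n" "y:cel P n" for n x y by (rule E[OF that(1)], rule E[OF that(2)]) (simp add: add[OF that])
  show "fst_seq (h n (r\<odot>\<^sub>P\<^sup>n x)) = r\<odot>\<^sub>X\<^sup>n fst_seq (h n x)" if "r:el R" "x:cel P n" for n r x
   by (rule E[OF that(2)]) (simp add: sm[OF that])
 qed (use key in blast)
 have "hmtp R P Y (\<lambda>n. \<lambda>x\<in>cel P n. snd_seq (h n x))"
 proof (rule hmtp_restrictI[OF g.X.cplx_axioms s.Y.cplx_axioms])
  show "snd_seq (h n x):cel Y (n-1)" if "x:cel P n" for n x using that by (rule E) simp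
  show "snd_seq (h n (x\<oplus>\<^sub>P\<^sup>n y)) = snd_seq (h n x)\<oplus>\<^sub>Y\<^sup>(n-1) snd_seq (h n y)"
   if "x:cel P n" "y:cel P n" for n x y by (rule E[OF that(1)], rule E[OF that(2)]) (simp add: add[OF that])
  show "snd_seq (h n (r\<odot>\<^sub>P\<^sup>n x)) = r\<odot>\<^sub>Y\<^sup>(n-1) snd_seq (h n x)" if "r:el R" "x:cel P n" for n r x
   by (rule E[OF that(2)]) (simp add: sm[OF that])
 qed
 then have "homotopic R P Y g (cmp_map P s ?g)" by (rule homotopicI) (use key in \<open>simp add: compose_def\<close>)
 then show ?thesis using g' by blast
qed

lemma ds_projective:
 assumes "is_projective R P" "is_projective R Q"
 shows "is_projective R (direct_sum P Q)" unfolding is_projective_def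
proof (intro conjI ballI impI)
 have PQ: "P:MOD" "Q:MOD" using assms unfolding is_projective_def by auto
 show "direct_sum P Q:MOD" using ds_MOD PQ .
 fix M N g f assume *: "M:MOD" "N:MOD" "g:hm M N" "f:hm (direct_sum P Q) N" "g ` el M = el N"
 interpret P: left_module R P using PQ by simp
 interpret Q: left_module R Q using PQ by simp
 interpret M: left_module R M using * by simp
 interpret N: left_module R N using * by simp
 have f1: "(\<lambda>x\<in>el P. f (pair_seq x \<zero>\<^sub>Q)):hm P N"
  using hm_closed[OF *(4)] hm_add[OF *(4), of "pair_seq _ \<zero>\<^sub>Q" "pair_seq _ \<zero>\<^sub>Q"]
   hm_smult[OF *(4), of _ "pair_seq _ \<zero>\<^sub>Q"] by (intro hm_restrictI) (auto simp: P.left_module_axioms Q.smult_r_null)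
 have f2: "(\<lambda>x\<in>el Q. f (pair_seq \<zero>\<^sub>P x)):hm Q N"
  using hm_closed[OF *(4)] hm_add[OF *(4), of "pair_seq \<zero>\<^sub>P _" "pair_seq \<zero>\<^sub>P _"]
   hm_smult[OF *(4), of _ "pair_seq \<zero>\<^sub>P _"] by (intro hm_restrictI) (auto simp: Q.left_module_axioms P.smult_r_null)
 obtain h1 where h1: "h1:hm P M" "!!x. x:el P ==> g (h1 x) = f (pair_seq x \<zero>\<^sub>Q)"
  using proj_lift[OF assms(1) f1 *(3,1,2)] *(5) hm_closed[OF f1] by auto
 obtain h2 where h2: "h2:hm Q M" "!!x. x:el Q ==> g (h2 x) = f (pair_seq \<zero>\<^sub>P x)"
  using proj_lift[OF assms(2) f2 *(3,1,2)] *(5) hm_closed[OF f2] by auto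
 let ?h = "\<lambda>z\<in>el (direct_sum P Q). h1 (fst_seq z)\<oplus>\<^sub>M h2 (snd_seq z)"
 have h: "?h:hm (direct_sum P Q) M"
  by (rule hm_restrictI) (auto elim!: ds_carrierE simp: ds_left_module P.left_module_axioms Q.left_module_axioms
   hm_closed[OF h1(1)] hm_closed[OF h2(1)] hm_add[OF h1(1)] hm_add[OF h2(1)] hm_smult[OF h1(1)] hm_smult[OF h2(1)]
   M.M.a_ac M.smult_r_distr M.smult_closed)
 have "compose (el (direct_sum P Q)) g ?h = f"
 proof (rule hm_ext[OF hm_compose[OF h *(3)] *(4)])
  show "lmod R (direct_sum P Q)" using ds_left_module P.left_module_axioms Q.left_module_axioms by blast
  fix z assume z: "z:el (direct_sum P Q)"
  then obtain x y where xy: "z = pair_seq x y" "x:el P" "y:el Q" by (rule ds_carrierE)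
  have "f z = f (pair_seq x \<zero>\<^sub>Q\<oplus>\<^bsub>direct_sum P Q\<^esub> pair_seq \<zero>\<^sub>P y)" using xy by simp
  also have "\<dots> = f (pair_seq x \<zero>\<^sub>Q)\<oplus>\<^sub>N f (pair_seq \<zero>\<^sub>P y)" using xy by (intro hm_add[OF *(4)]) auto
  finally show "compose (el (direct_sum P Q)) g ?h z = f z"
   using z xy h1 h2 hm_add[OF *(3)] hm_closed[OF h1(1)] hm_closed[OF h2(1)] by (simp add: compose_def)
 qed
 then show "\<exists>h\<in>hm (direct_sum P Q) M. compose (el (direct_sum P Q)) g h = f" using h by blast
qed

text \<open>One quasi-isomorphism out of a complex of projectives is enough instead of a zigzag,
  since \<open>proj_lift_qis\<close> straightens zigzags.\<close>

definition perf :: "'r cochain set" where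
 "perf = {X. cplx R X&(\<exists>P f. P:PROJ&chmap R P X f&qis P X f)}"

lemma zero_module:
 assumes "M:MOD"
 shows "is_projective R (M\<lparr>carrier := {\<zero>\<^sub>M}\<rparr>)"
proof -
 interpret M: left_module R M using assms by simp
 have l: "lmod R (M\<lparr>carrier := {\<zero>\<^sub>M}\<rparr>)" using M.submod_left_module[OF submod_zero[OF M.left_module_axioms]] .
 have Z: "M\<lparr>carrier := {\<zero>\<^sub>M}\<rparr>:MOD"
  unfolding MOD_iff using l fin_genI[OF l, of "{}"] submodD(3)[of R "M\<lparr>carrier := {\<zero>\<^sub>M}\<rparr>"] by simp
 show ?thesis unfolding is_projective_def
 proof (intro conjI Z ballI impI)
  fix K N g f assume *: "K:MOD" "N:MOD" "g:hm K N" "f:hm (M\<lparr>carrier := {\<zero>\<^sub>M}\<rparr>) N"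
  have h: "(\<lambda>x\<in>el (M\<lparr>carrier := {\<zero>\<^sub>M}\<rparr>). \<zero>\<^sub>K):hm (M\<lparr>carrier := {\<zero>\<^sub>M}\<rparr>) K"
   by (rule hm_zero_map) (use l * in auto)
  have "compose (el (M\<lparr>carrier := {\<zero>\<^sub>M}\<rparr>)) g (\<lambda>x\<in>el (M\<lparr>carrier := {\<zero>\<^sub>M}\<rparr>). \<zero>\<^sub>K) = f"
   by (rule hm_ext[OF hm_compose[OF h *(3) l] *(4)])
    (use hm_zero[OF *(3)] hm_zero[OF *(4)] l * in \<open>simp add: compose_def\<close>)
  then show "\<exists>h\<in>hm (M\<lparr>carrier := {\<zero>\<^sub>M}\<rparr>) K. compose (el (M\<lparr>carrier := {\<zero>\<^sub>M}\<rparr>)) g h = f"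
   using h by blast
 qed
qed

lemma acyc_perf:
 assumes X: "cplx R X" "acyc X"
 shows "X:perf"
proof -
 interpret X: cplx R X by fact
 \<comment> \<open>The zero submodule is taken in each degree separately: each term keeps the record
   of \<open>cobj X n\<close>, whose zero element depends on the degree.\<close>
 let ?M = "\<lambda>n. cobj X n\<lparr>carrier := {\<zero>\<^sub>X\<^sup>n}\<rparr>"
 let ?P = "\<lparr>cobj = ?M, cdiff = \<lambda>n. \<lambda>x\<in>{\<zero>\<^sub>X\<^sup>n}. \<zero>\<^sub>X\<^sup>(n+1)\<rparr> :: 'r cochain"
 have p: "is_projective R (?M n)" for n by (rule zero_module) simp
 have M: "?M n:MOD" for n using p unfolding is_projective_def by blast
 have l: "lmod R (?M n)" for n using M by simp
 have P: "cplx R ?P"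
 proof (rule cplxI)
  show "cobj ?P n:MOD" for n using M by simp
  have "(\<lambda>x\<in>el (?M n). \<zero>\<^bsub>?M (n+1)\<^esub>):hm (?M n) (?M (n+1))" for n by (rule hm_zero_map[OF l l])
  then show "cdiff ?P n:hm (cobj ?P n) (cobj ?P (n+1))" for n by simp
 qed auto
 have f: "chmap R ?P X (\<lambda>n. \<lambda>x\<in>cel ?P n. x)" by (rule chmap_restrictI[OF P X(1)]) auto
 have "qis ?P X (\<lambda>n. \<lambda>x\<in>cel ?P n. x)" unfolding qis_def hinj_def hsurj_def using acycD[OF X(2)] by force
 then show ?thesis unfolding perf_def using X(1) P p f by (auto simp: PROJ_iff)
qed

lemma unshift_chmap: "chmap R X Y f ==> chmap R (unshift X) (unshift Y) (\<lambda>n. f (n-1))"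
proof -
 assume f: "chmap R X Y f"
 interpret f: chmap R X Y f by fact
 show ?thesis unfolding chmap_iff chain_maps_def using unshift_cplx[OF f.X.cplx_axioms] unshift_cplx[OF f.Y.cplx_axioms] by simp
qed

lemma shift_acyc:
 assumes "cplx R X" "acyc X"
 shows "acyc (shift X)"
proof -
 interpret X: cplx R X by fact
 show ?thesis unfolding acyc_def
 proof (intro allI ballI impI)
  fix n x assume *: "x:cel (shift X) n" "cdiff (shift X) n x = \<zero>\<^sub>(shift X)\<^sup>(n+1)"
  then have x: "x:cel X (n+1)" by simp
  then have "cdiff X (n+1) x = \<zero>\<^sub>X\<^sup>(n+2)" using *(2) neg_eq_zero_iff[of "cobj X (n+2)"] by simp
  then obtain x' where "x':cel X n" "cdiff X n x' = x" using acycD[OF assms(2) x] by auto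
  then show "\<exists>x'\<in>cel (shift X) (n-1). cdiff (shift X) (n-1) x' = x"
   by (intro bexI[of _ "\<ominus>\<^sub>X\<^sup>n x'"]) (auto simp: X.C.M.minus_minus)
 qed
qed

lemma nullsys_acyclic: "nullsys R (acyclic_complexes R)"
proof (rule nullsys.intro[OF modcat_axioms], rule nullsys_axioms.intro, unfold acyclic_iff)
 fix X Y f assume f: "chmap R X Y f" and XY: "cplx R X&acyc X" "cplx R Y&acyc Y"
 interpret f: chmap R X Y f by fact
 have "hinj X Y f" unfolding hinj_def using acycD XY by blast
 moreover have "hsurj X Y f" unfolding hsurj_def
 proof (intro allI ballI impI)
  fix n y assume *: "y:cel Y n" "cdiff Y n y = \<zero>\<^sub>Y\<^sup>(n+1)"
  then obtain y' where "y':cel Y (n-1)" "cdiff Y (n-1) y' = y" using acycD XY by blast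
  then show "\<exists>x\<in>cel X n. \<exists>y'\<in>cel Y (n-1). cdiff X n x = \<zero>\<^sub>X\<^sup>(n+1)&
    y = f n x\<oplus>\<^sub>Y\<^sup>n cdiff Y (n-1) y'" using * by (intro bexI[of _ "\<zero>\<^sub>X\<^sup>n"] bexI[of _ y']) auto
 qed
 ultimately show "cplx R (cone X Y f)&acyc (cone X Y f)" using cone_cplx[OF f] acyc_cone_iff[OF f] unfolding qis_def by blast
next
 fix X Y f assume "chmap R X Y f" "qis X Y f"
 then show "(cplx R X&acyc X) = (cplx R Y&acyc Y)" using qis_acyc_iff chmap_cplx by blast
qed (use unshift_cplx shift_cplx unshift_acyc shift_acyc in blast)+

text \<open>A quasi-isomorphism is a denominator for the null system of acyclic complexes, and those
  were shown to be stable under the shift in general.\<close>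

lemma shift_qis: "chmap R X Y f ==> qis X Y f ==> qis (shift X) (shift Y) (\<lambda>n. f (n+1))"
proof -
 interpret N: nullsys R "acyclic_complexes R" by (rule nullsys_acyclic)
 assume f: "chmap R X Y f" and q: "qis X Y f"
 have "N.W (shift X) (shift Y) (\<lambda>n. f (n+1))" using N.W_shift N.W_qis[OF f q] .
 then show ?thesis unfolding N.W_def acyclic_iff using acyc_cone_iff by blast
qed

lemma unshift_qis:
 assumes f: "chmap R X Y f" and q: "qis X Y f"
 shows "qis (unshift X) (unshift Y) (\<lambda>n. f (n-1))"
proof -
 interpret f: chmap R X Y f by fact
 have "hinj (unshift X) (unshift Y) (\<lambda>n. f (n-1))" unfolding hinj_def
 proof (intro allI ballI impI)
  fix n x y assume *: "x:cel (unshift X) n" "y:cel (unshift Y) (n-1)"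
   "cdiff (unshift X) n x = \<zero>\<^sub>(unshift X)\<^sup>(n+1)" "f (n-1) x = cdiff (unshift Y) (n-1) y"
  have x: "x:cel X (n-1)" "cdiff X (n-1) x = \<zero>\<^sub>X\<^sup>n"
    "\<ominus>\<^sub>Y\<^sup>(n-2) y:cel Y (n-2)"
    "f (n-1) x = cdiff Y (n-2) (\<ominus>\<^sub>Y\<^sup>(n-2) y)" using * neg_eq_zero_iff[of "cobj X n"] by simp_all
  obtain x' where "x':cel X (n-2)" "cdiff X (n-2) x' = x"
   using hinjD[of X Y f x "n-1" "\<ominus>\<^sub>Y\<^sup>(n-2) y"] q x unfolding qis_def by auto
  then show "\<exists>x'\<in>cel (unshift X) (n-1). cdiff (unshift X) (n-1) x' = x"
   by (intro bexI[of _ "\<ominus>\<^sub>X\<^sup>(n-2) x'"]) (auto simp: f.X.C.M.minus_minus)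
 qed
 moreover have "hsurj (unshift X) (unshift Y) (\<lambda>n. f (n-1))" unfolding hsurj_def
 proof (intro allI ballI impI)
  fix n y assume *: "y:cel (unshift Y) n" "cdiff (unshift Y) n y = \<zero>\<^sub>(unshift Y)\<^sup>(n+1)"
  then have y: "y:cel Y (n-1)" "cdiff Y (n-1) y = \<zero>\<^sub>Y\<^sup>n" using neg_eq_zero_iff[of "cobj Y n"] by simp_all
  obtain x y' where "x:cel X (n-1)" "y':cel Y (n-2)"
   "cdiff X (n-1) x = \<zero>\<^sub>X\<^sup>n" "y = f (n-1) x\<oplus>\<^sub>Y\<^sup>(n-1) cdiff Y (n-2) y'"
   using hsurjE[of X Y f y "n-1"] q y unfolding qis_def by auto
  then show "\<exists>x\<in>cel (unshift X) n. \<exists>y'\<in>cel (unshift Y) (n-1).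
    cdiff (unshift X) n x = \<zero>\<^sub>(unshift X)\<^sup>(n+1)&
    y = f (n-1) x\<oplus>\<^sub>(unshift Y)\<^sup>n cdiff (unshift Y) (n-1) y'"
   by (intro bexI[of _ x] bexI[of _ "\<ominus>\<^sub>Y\<^sup>(n-2) y'"]) (auto simp: f.Y.C.M.minus_minus f.X.C.M.a_inv_zero)
 qed
 ultimately show ?thesis unfolding qis_def by blast
qed

lemma perf_qis:
 assumes f: "chmap R X Y f" and q: "qis X Y f"
 shows "X:perf\<longleftrightarrow>Y:perf"
proof -
 note c = chmap_cplx[OF f]
 show ?thesis
 proof
  assume "X:perf"
  then obtain P p where p: "P:PROJ" "chmap R P X p" "qis P X p" unfolding perf_def by blast
  then show "Y:perf" unfolding perf_def using c chmap_comp[OF p(2) f] qis_comp[OF p(2) f p(3) q] by blast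
 next
  assume "Y:perf"
  then obtain P p where p: "P:PROJ" "chmap R P Y p" "qis P Y p" unfolding perf_def by blast
  obtain g where g: "chmap R P X g" "homotopic R P Y p (cmp_map P f g)" using proj_lift_qis[OF p(1) f q p(2)] by blast
  have "qis P Y (cmp_map P f g)" using qis_homotopic[OF g(2) p(2) chmap_comp[OF g(1) f] p(3)] .
  then have "qis P X g" using qis_comp_right[OF g(1) f _ q] by blast
  then show "X:perf" unfolding perf_def using c p g by blast
 qed
qed

lemma nullsys_perf: "nullsys R perf"
proof (rule nullsys.intro[OF modcat_axioms], rule nullsys_axioms.intro)
 show "X:perf ==> cplx R X" for X unfolding perf_def by blast
 show "cplx R X ==> acyc X ==> X:perf" for X by (rule acyc_perf)
 show "X:perf\<longleftrightarrow>Y:perf" if "chmap R X Y f" "qis X Y f" for X Y f by (rule perf_qis[OF that])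
next
 fix X Y f assume f: "chmap R X Y f" and X: "X:perf" and Y: "Y:perf"
 obtain P p where p: "P:PROJ" "chmap R P X p" "qis P X p" using X unfolding perf_def by blast
 obtain Q q where q: "Q:PROJ" "chmap R Q Y q" "qis Q Y q" using Y unfolding perf_def by blast
 have fp: "chmap R P Y (cmp_map P f p)" using chmap_comp[OF p(2) f] .
 \<comment> \<open>The map lifts up to homotopy to one between the projective replacements. Its cone
   consists of projectives, and \<open>cone_square\<close> compares it with the cone of
   \<open>f\<close>.\<close>
 obtain g where g: "chmap R P Q g" "homotopic R P Y (cmp_map P f p) (cmp_map P q g)" using proj_lift_qis[OF p(1) q(2,3) fp] by blast
 have g2: "homotopic R P Y (cmp_map P q g) (cmp_map P f p)" using homotopic_sym[OF g(2) fp chmap_comp[OF g(1) q(2)]] .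
 have "cone P Q g:PROJ" using p(1) q(1) cone_cplx[OF g(1)] ds_projective by (simp add: PROJ_iff)
 then have "cone P Q g:perf" unfolding perf_def using qis_id chmap_id PROJ_iff by blast
 moreover have "cone P Q g:perf\<longleftrightarrow>cone X Y f:perf"
  by (rule cone_square[OF _ g(1) f p(2) q(2) g2 p(3) q(3)]) (rule perf_qis)
 ultimately show "cone X Y f:perf" by blast
next
 fix X assume "X:perf"
 then obtain P p where p: "P:PROJ" "chmap R P X p" "qis P X p" "cplx R X" unfolding perf_def by blast
 have "unshift P:PROJ" "shift P:PROJ" using p(1) unshift_cplx shift_cplx by (simp_all add: PROJ_iff)
 then show "unshift X:perf" "shift X:perf"
  unfolding perf_def using unshift_chmap[OF p(2)] unshift_qis[OF p(2,3)] shift_chmap[OF p(2)] shift_qis[OF p(2,3)]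
   unshift_cplx[OF p(4)] shift_cplx[OF p(4)] by blast+
qed

end

section \<open>The homotopy category localized in two steps\<close>

context modcat
begin

lemma cmp_assoc: "chmap R X Y f ==> cmp_map X (cmp_map Y k g) f = cmp_map X k (cmp_map X g f)"
 by (intro ext) (auto simp: compose_def chmap_val)

interpretation NA: nullsys R "acyclic_complexes R" by (rule nullsys_acyclic)
interpretation NP: nullsys R perf by (rule nullsys_perf)
interpretation A: ore "Kb R" "acyclic_complexes R" by (rule NA.ore_Kb)
interpretation B: ore "Kb R" perf by (rule NP.ore_Kb)

lemma qis_den: "s:A.S X Y\<longleftrightarrow>(\<exists>f. chmap R X Y f&qis X Y f&s = hcl X Y f)"
proof -
 have "NA.W X Y f\<longleftrightarrow>chmap R X Y f&qis X Y f" for f unfolding NA.W_def acyclic_iff using acyc_cone_iff cone_cplx by blast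
 then show ?thesis unfolding NA.den_iff by blast
qed

lemma hcl_comp_eqD:
 assumes "chmap R X Y f" "chmap R Y Z g" "chmap R X Y' f'" "chmap R Y' Z g'"
  "Comp (Kb R) X Y Z (hcl Y Z g) (hcl X Y f) = Comp (Kb R) X Y' Z (hcl Y' Z g') (hcl X Y' f')"
 shows "homotopic R X Z (cmp_map X g f) (cmp_map X g' f')" using assms(5) unfolding Kb_Comp[OF assms(1,2)] Kb_Comp[OF assms(3,4)]
  hcl_eq_iff[OF chmap_comp[OF assms(1,2)] chmap_comp[OF assms(3,4)]] .

text \<open>The inverse of \<open>f\<close> in the derived category is a fraction g s^-1, so f g and
  the quasi-isomorphism \<open>s\<close> become equal there, and homotopic after a further
  quasi-isomorphism. The last conclusion, that the resulting map is again invertible, allows the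
  lemma to be applied to it in turn.\<close>

lemma Db_iso_section:
 assumes iso: "is_iso A.VB X Y (A.qm X Y (hcl X Y f))" and f: "chmap R X Y f"
 shows "\<exists>V g. chmap R V X g&qis V Y (cmp_map V f g)&is_iso A.VB V X (A.qm V X (hcl V X g))"
proof -
 note cp = chmap_cplx[OF f]
 interpret VB: cat A.VB by (rule A.vb_cat)
 let ?F = "hcl X Y f"
 have F: "?F:Hom (Kb R) X Y" using f cp by (auto simp: Kb_Hom)
 obtain c where c: "is_iso A.VB Y X c" "c:Hom A.VB Y X" "Comp A.VB Y X Y (A.qm X Y ?F) c = Ident A.VB Y" using VB.iso_inv[OF iso] by metis
 obtain K S G where K: "(K, S, G):roofs (Kb R) (acyclic_complexes R) Y X" "c = A.cls Y X (K, S, G)" using c(2) by (rule A.hom_vbE)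
 note rd = A.roofsD[OF K(1)]
 obtain s where s: "chmap R K Y s" "qis K Y s" "S = hcl K Y s" using rd(2) unfolding qis_den by blast
 have cK: "cplx R K" using chmap_cplx[OF s(1)] by blast
 obtain g where g: "chmap R K X g" "G = hcl K X g" using Kb_HomE[OF rd(4) cK cp(1)] .
 have ob: "X:Ob (Kb R)" "Y:Ob (Kb R)" "K:Ob (Kb R)" using cp cK by auto
 note fg = chmap_comp[OF g(1) f]
 have S2: "(K, S, S):roofs (Kb R) (acyclic_complexes R) Y Y"
  "(K, S, Comp (Kb R) K X Y ?F G):roofs (Kb R) (acyclic_complexes R) Y Y" using rd F ob by (auto intro!: A.roofsI)
 have "A.cls Y Y (K, S, Comp (Kb R) K X Y ?F G) = A.cls Y Y (K, S, S)"
  using A.qm_comp_cls[OF K(1) F ob(1,2)] c(3) A.cls_dup[OF rd(2)] unfolding K(2) by simp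
 then have "A.qm K Y (Comp (Kb R) K X Y ?F G) = A.qm K Y S" using A.cls_qm_den[OF S2(1) ob(2)] A.cls_qm_den[OF S2(2) ob(2)] by simp
 then have "A.qm K Y (hcl K Y (cmp_map K f g)) = A.qm K Y (hcl K Y s)" unfolding g(2) s(3) Kb_Comp[OF g(1) f] .
 moreover have "hcl K Y (cmp_map K f g):Hom (Kb R) K Y" "hcl K Y s:Hom (Kb R) K Y" using fg s(1) cK cp by (auto simp: Kb_Hom)
 ultimately obtain V t where t: "t:A.S V K"
  "Comp (Kb R) V K Y (hcl K Y (cmp_map K f g)) t = Comp (Kb R) V K Y (hcl K Y s) t"
  using A.qm_eq_iff[of "hcl K Y (cmp_map K f g)" K Y "hcl K Y s"] ob by blast
 obtain \<tau> where ta: "chmap R V K \<tau>" "qis V K \<tau>" "t = hcl V K \<tau>" using t(1) unfolding qis_den by blast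
 have h: "homotopic R V Y (cmp_map V s \<tau>) (cmp_map V (cmp_map K f g) \<tau>)"
  by (rule hcl_comp_eqD[OF ta(1) s(1) ta(1) fg]) (use t(2) ta(3) in simp)
 have "qis V Y (cmp_map V f (cmp_map V g \<tau>))"
  using qis_homotopic[OF h chmap_comp[OF ta(1) s(1)] chmap_comp[OF ta(1) fg] qis_comp[OF ta(1) s(1) ta(2) s(2)]]
  unfolding cmp_assoc[OF ta(1)] .
 moreover have "is_iso A.VB K X (A.qm K X G)"
  using VB.iso_comp[OF A.qm_inv(4)[OF rd(2)] c(1)] A.cls_qm_den[OF K(1) ob(1)] ob unfolding K(2) by simp
 then have "is_iso A.VB V X (A.qm V X (hcl V X (cmp_map V g \<tau>)))"
  using VB.iso_comp[OF A.qm_inv(4)[OF t(1)]] A.qm_comp[OF A.den_hom[OF t(1)] rd(4)] A.den_sub[OF t(1)] ob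
  unfolding ta(3) g(2) Kb_Comp[OF ta(1) g(1)] by simp
 ultimately show ?thesis using chmap_comp[OF ta(1) g(1)] by blast
qed

text \<open>A one-sided inverse \<open>g\<close> in the derived category makes \<open>f\<close> surjective on cohomology, and the same
 argument for \<open>g\<close> makes it injective.\<close>

lemma Db_iso_qis:
 assumes iso: "is_iso A.VB X Y (A.qm X Y (hcl X Y f))" and f: "chmap R X Y f"
 shows "qis X Y f"
proof -
 obtain V g where g: "chmap R V X g" "qis V Y (cmp_map V f g)" "is_iso A.VB V X (A.qm V X (hcl V X g))"
  using Db_iso_section[OF assms] by blast
 obtain U k where k: "chmap R U V k" "qis U X (cmp_map U g k)" using Db_iso_section[OF g(3,1)] by blast
 show ?thesis using hsurj_comp_left[OF g(1) f] hinj_comp_left[OF g(1) f] hsurj_comp_left[OF k(1) g(1)] g(2) k(2) unfolding qis_def by blast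
qed

text \<open>The numerator of a fraction representing an isomorphism is the composite of two
  isomorphisms of the derived category, hence a quasi-isomorphism by
  \<open>Db_iso_qis\<close>.\<close>

lemma Db_iso_normal:
 assumes "is_iso A.VB X Y c" "X:Ob (Kb R)" "Y:Ob (Kb R)"
 obtains K a b where "a:A.S K X" "b:A.S K Y" "c = A.cls X Y (K, a, b)"
proof -
 interpret VB: cat A.VB by (rule A.vb_cat)
 have "c:Hom A.VB X Y" using assms(1) unfolding is_iso_def by blast
 then obtain K a b where K: "(K, a, b):roofs (Kb R) (acyclic_complexes R) X Y" "c = A.cls X Y (K, a, b)" by (rule A.hom_vbE)
 note rd = A.roofsD[OF K(1)]
 have cc: "cplx R K" "cplx R X" "cplx R Y" using rd assms by auto
 obtain \<beta> where be: "chmap R K Y \<beta>" "b = hcl K Y \<beta>" using Kb_HomE[OF rd(4) cc(1,3)] .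
 have "is_iso A.VB K Y (Comp A.VB K X Y c (A.qm K X a))" using VB.iso_comp[OF A.qm_inv(4)[OF rd(2)] assms(1)] rd assms by simp
 then have "is_iso A.VB K Y (A.qm K Y b)" using A.cls_qm_den[OF K(1) assms(3)] unfolding K(2) by simp
 then have "b:A.S K Y" unfolding be(2) qis_den using Db_iso_qis[OF _ be(1)] be(1) by blast
 then show ?thesis using that[OF rd(2) _ K(2)] by blast
qed

lemma den_AB: "A.S X Y<=B.S X Y"
proof
 fix s assume "s:A.S X Y"
 then obtain f where "chmap R X Y f" "qis X Y f" "s = hcl X Y f" unfolding qis_den by blast
 then show "s:B.S X Y" unfolding NP.den_iff using NP.W_qis by blast
qed

lemma den_left_AB:
 assumes "s:A.S V Y" "c:Hom (Kb R) X V" "X:Ob (Kb R)" "Comp (Kb R) X V Y s c:B.S X Y"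
 shows "c:B.S X V"
proof -
 obtain \<sigma> where s: "chmap R V Y \<sigma>" "qis V Y \<sigma>" "s = hcl V Y \<sigma>" using assms(1) unfolding qis_den by blast
 have cp: "cplx R X" "cplx R V" "cplx R Y" using assms(3) chmap_cplx[OF s(1)] by auto
 obtain f where f: "chmap R X V f" "c = hcl X V f" using Kb_HomE[OF assms(2) cp(1,2)] .
 obtain g where g: "NP.W X Y g" "hcl X Y (cmp_map X \<sigma> f) = hcl X Y g"
  using assms(4) unfolding s(3) f(2) Kb_Comp[OF f(1) s(1)] NP.den_iff by blast
 have g': "chmap R X Y g" using g(1) unfolding NP.W_def by blast
 have sf: "chmap R X Y (cmp_map X \<sigma> f)" by (rule chmap_comp[OF f(1) s(1)])
 have "homotopic R X Y (cmp_map X \<sigma> f) g" using g(2) hcl_eq_iff[OF sf g'] by blast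
 then have "NP.W X Y (cmp_map X \<sigma> f)" using NP.W_homotopic[OF _ sf g'] g(1) by blast
 then have "NP.W X V f" using NP.W_post[OF s(1,2) f(1)] by blast
 then show ?thesis unfolding NP.den_iff f(2) by blast
qed

lemma PROJ_perf: "P:PROJ ==> P:perf" unfolding perf_def PROJ_iff using chmap_id qis_id by blast

lemma Dist_perf_den: "(X, Y, Z, s, v, w):Dist (Kb R) ==> Z:perf ==> s:B.S X Y" unfolding denominators_def by blast

text \<open>Forwards, the triangle is isomorphic in the derived category to the image of a triangle
  of the homotopy category, whose third object must then be perfect; the two remaining isomorphisms
  are written with quasi-isomorphisms as legs and absorbed into the roof. Backwards, the cone of the
  numerator is replaced by a complex of projectives and the first object by X.\<close>

lemma Db_den:
 "denominators (verdier_quotient (Kb R) (acyclic_complexes R)) PROJ X Y =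
  A.cls X Y ` {(Z, s, f). s:A.S Z X&f:B.S Z Y}" (is "?L = ?R")
proof (intro Set.equalityI subsetI)
 interpret VB: cat A.VB by (rule A.vb_cat)
 fix s assume "s:?L"
 then obtain Z v w where Z: "Z:PROJ" "(X, Y, Z, s, v, w):Dist (verdier_quotient (Kb R) (acyclic_complexes R))"
  unfolding denominators_def by blast
 then obtain t' where t': "t':{(X, Y, Z, A.qm X Y u, A.qm Y Z v, A.qm Z (Shift (Kb R) X) w) |X Y Z u v w.
    (X, Y, Z, u, v, w):Dist (Kb R)}" "triangle_iso A.VB (X, Y, Z, s, v, w) t'"
   and tr: "is_triangle A.VB (X, Y, Z, s, v, w)" unfolding verdier_quotient_def Dist_wt by blast
 obtain X' Y' Z' u v' w' where d: "(X', Y', Z', u, v', w'):Dist (Kb R)"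
  "triangle_iso A.VB (X, Y, Z, s, v, w) (X', Y', Z', A.qm X' Y' u, A.qm Y' Z' v', A.qm Z' (Shift (Kb R) X') w')" using t' by blast
 have m: "X:Ob (Kb R)" "Y:Ob (Kb R)" "Z:Ob (Kb R)" "s:Hom A.VB X Y" using tr unfolding is_triangle_def by auto
 have "is_triangle (Kb R) (X', Y', Z', u, v', w')" using d(1) unfolding Kb_Dist by blast
 then have m': "X':Ob (Kb R)" "Y':Ob (Kb R)" "Z':Ob (Kb R)" "u:Hom (Kb R) X' Y'" unfolding is_triangle_def by auto
 obtain \<alpha> \<beta> \<gamma> where abc: "is_iso A.VB X X' \<alpha>" "is_iso A.VB Y Y' \<beta>" "is_iso A.VB Z Z' \<gamma>"
  "Comp A.VB X Y Y' \<beta> s = Comp A.VB X X' Y' (A.qm X' Y' u) \<alpha>" using d(2) unfolding triangle_iso_def by auto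
 obtain L a b where L: "a:A.S L Z" "b:A.S L Z'" using Db_iso_normal[OF abc(3) m(3) m'(3)] by metis
 obtain a' b' where ab: "chmap R L Z a'" "qis L Z a'" "chmap R L Z' b'" "qis L Z' b'" using L unfolding qis_den by blast
 \<comment> \<open>Both legs of the roof Z <- L -> Z' are quasi-isomorphisms, so perfection passes
   from \<open>Z\<close> to \<open>Z'\<close>.\<close>
 then have "Z':perf" using PROJ_perf[OF Z(1)] NP.N_qis by blast
 then have u: "u:B.S X' Y'" using Dist_perf_den[OF d(1)] by blast
 obtain K a1 a2 where K: "a2:A.S K X" "a1:A.S K X'" "\<alpha> = A.cls X X' (K, a2, a1)" using Db_iso_normal[OF abc(1) m(1) m'(1)] by metis
 have Kr: "(K, a2, a1):roofs (Kb R) (acyclic_complexes R) X X'" using K by (auto intro: A.roofsI)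
 have KO: "K:Ob (Kb R)" using A.den_sub K(1) by blast
 have ua: "Comp (Kb R) K X' Y' u a1:B.S K Y'" using B.den_comp[OF _ u] K(2) den_AB by blast
 have e1: "Comp A.VB X Y Y' \<beta> s = A.cls X Y' (K, a2, Comp (Kb R) K X' Y' u a1)"
  unfolding abc(4) K(3) by (rule A.qm_comp_cls[OF Kr m'(4,1,2)])
 obtain \<beta>' where b': "is_iso A.VB Y' Y \<beta>'" "Comp A.VB Y Y' Y \<beta>' \<beta> = Ident A.VB Y"
  "Comp A.VB Y' Y Y' \<beta> \<beta>' = Ident A.VB Y'" "\<beta>:Hom A.VB Y Y'" "\<beta>':Hom A.VB Y' Y" by (rule VB.iso_inv[OF abc(2)])
 obtain M b1 b2 where M: "b2:A.S M Y'" "b1:A.S M Y" "\<beta>' = A.cls Y' Y (M, b2, b1)" using Db_iso_normal[OF b'(1) m'(2) m(2)] by metis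
 obtain E p q where E: "E:Ob (Kb R)" "p:A.S E K" "q:Hom (Kb R) E M"
  "Comp (Kb R) E K Y' (Comp (Kb R) K X' Y' u a1) p = Comp (Kb R) E M Y' b2 q" using A.den_ore[OF B.den_hom[OF ua] M(1) KO] by blast
 \<comment> \<open>The composite of \<open>q\<close> with the quasi-isomorphism \<open>b2\<close> is
   u a1 p, a composite of maps with perfect cone.\<close>
 have q: "q:B.S E M" using den_left_AB[OF M(1) E(3,1)] B.den_comp[OF _ ua, of p E] E(2,4) den_AB by fastforce
 have d2: "Comp (Kb R) E K X a2 p:A.S E X" using A.den_comp[OF E(2) K(1)] .
 have r: "(K, a2, Comp (Kb R) K X' Y' u a1):roofs (Kb R) (acyclic_complexes R) X Y'" using K(1) B.den_hom[OF ua] by (rule A.roofsI)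
 have "A.cls X Y' (K, a2, Comp (Kb R) K X' Y' u a1) = A.cls X Y' (E, Comp (Kb R) E K X a2 p, Comp (Kb R) E M Y' b2 q)"
  unfolding E(4)[symmetric] by (rule A.cls_refine[OF r A.den_hom[OF E(2)] d2 m'(2)])
 then have "Comp A.VB X Y' Y \<beta>' (Comp A.VB X Y Y' \<beta> s) = A.cls X Y (E, Comp (Kb R) E K X a2 p, Comp (Kb R) E M Y b1 q)"
  unfolding e1 M(3) using A.frac_comp[OF d2 E(3) A.roofsI[OF M(1) A.den_hom[OF M(2)]] m(2)] by simp
 moreover have "Comp A.VB X Y' Y \<beta>' (Comp A.VB X Y Y' \<beta> s) = s" using VB.comp_inv_ext[OF b'(2,5,4) m(4)] m m' by simp
 ultimately have "s = A.cls X Y (E, Comp (Kb R) E K X a2 p, Comp (Kb R) E M Y b1 q)" by simp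
 moreover have "Comp (Kb R) E M Y b1 q:B.S E Y" using B.den_comp[OF q] M(2) den_AB by blast
 ultimately show "s:?R" using d2 by auto
next
 interpret VB: cat A.VB by (rule A.vb_cat)
 interpret SF: den_functor "Kb R" "acyclic_complexes R" "Kb R" "acyclic_complexes R" "shift_func (Kb R)"
  by unfold_locales (rule Kb_shift, use NA.den_shift in \<open>simp add: shift_func_def\<close>)
 have sf: "shift_func A.VB = verdier_func (Kb R) (acyclic_complexes R) (shift_func (Kb R))"
  unfolding verdier_func_def verdier_base_def shift_func_def by simp
 have SV: "is_functor A.VB A.VB (shift_func A.VB)" using SF.vf_functor unfolding sf .
 fix s assume "s:?R"
 then obtain K a f where K: "a:A.S K X" "f:B.S K Y" "s = A.cls X Y (K, a, f)" by auto
 obtain \<phi> where f: "NP.W K Y \<phi>" "f = hcl K Y \<phi>" using K(2) unfolding NP.den_iff by blast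
 then have f': "chmap R K Y \<phi>" "cone K Y \<phi>:perf" unfolding NP.W_def by auto
 let ?C = "cone K Y \<phi>"
 obtain P g where P: "P:PROJ" "chmap R P ?C g" "qis P ?C g" using f'(2) unfolding perf_def by blast
 have g: "hcl P ?C g:A.S P ?C" using P unfolding qis_den by blast
 have ob: "X:Ob A.VB" "Y:Ob A.VB" "K:Ob A.VB" "?C:Ob A.VB" "P:Ob A.VB" using A.den_sub[OF K(1)] A.den_sub[OF g] B.den_sub[OF K(2)] by auto
 have obK: "X:Ob (Kb R)" "Y:Ob (Kb R)" "K:Ob (Kb R)" "?C:Ob (Kb R)" "P:Ob (Kb R)" using ob by simp_all
 have SO: "Shift (Kb R) A:Ob (Kb R)" if "A:Ob (Kb R)" for A using functor_ob[OF Kb_shift that] by (simp add: shift_func_def)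
 have sO: "Shift A.VB A:Ob A.VB" if "A:Ob A.VB" for A using functor_ob[OF SV that] by (simp add: shift_func_def)
 define i where "i = hcl Y ?C (cone_inclusion K Y)"
 define pr where "pr = hcl ?C (shift K) (cone_projection K Y)"
 have st: "(K, Y, ?C, f, i, pr):Dist (Kb R)" using std_tri_Dist[OF f'(1)] unfolding std_tri_def i_def pr_def f(2) .
 then have "is_triangle (Kb R) (K, Y, ?C, f, i, pr)" unfolding Kb_Dist by blast
 then have h: "f:Hom (Kb R) K Y" "i:Hom (Kb R) Y ?C" "pr:Hom (Kb R) ?C (Shift (Kb R) K)" unfolding is_triangle_def by auto
 have qh: "A.qm K Y f:Hom A.VB K Y" "A.qm Y ?C i:Hom A.VB Y ?C" "A.qm ?C (Shift (Kb R) K) pr:Hom A.VB ?C (Shift A.VB K)"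
  using A.qm_hom h obK by auto
 define \<gamma> where "\<gamma> = A.qm P ?C (hcl P ?C g)"
 have gi: "is_iso A.VB P ?C \<gamma>" unfolding \<gamma>_def by (rule A.qm_inv(4)[OF g])
 obtain \<gamma>' where g': "\<gamma>':Hom A.VB ?C P" "Comp A.VB ?C P ?C \<gamma> \<gamma>' = Ident A.VB ?C" "\<gamma>:Hom A.VB P ?C"
  using VB.iso_inv[OF gi] by metis
 define \<alpha> where "\<alpha> = A.cls X K (K, a, Ident (Kb R) K)"
 note al = A.qm_inv[OF K(1), folded \<alpha>_def]
 have qa: "A.qm K X a:Hom A.VB K X" using A.qm_hom[OF A.den_hom[OF K(1)]] obK by blast
 \<comment> \<open>The standard triangle of the numerator \<open>f\<close> is transported along
   three isomorphisms: the denominator \<open>a\<close> at the first object, the identity at Y, and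
   \<gamma> from P to the cone.\<close>
 define v where "v = Comp A.VB Y ?C P \<gamma>' (A.qm Y ?C i)"
 define w where "w = Comp A.VB P (Shift A.VB K) (Shift A.VB X) (ShiftMor A.VB K X (A.qm K X a))
   (Comp A.VB P ?C (Shift A.VB K) (A.qm ?C (Shift (Kb R) K) pr) \<gamma>)"
 have Sq: "ShiftMor A.VB K X (A.qm K X a):Hom A.VB (Shift A.VB K) (Shift A.VB X)"
   "ShiftMor A.VB X K \<alpha>:Hom A.VB (Shift A.VB X) (Shift A.VB K)"
  using functor_mor[OF SV qa] functor_mor[OF SV al(1)] ob by (simp_all add: shift_func_def)
 have SS: "Comp A.VB (Shift A.VB K) (Shift A.VB X) (Shift A.VB K) (ShiftMor A.VB X K \<alpha>) (ShiftMor A.VB K X (A.qm K X a))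
   = Ident A.VB (Shift A.VB K)" using functor_comp[OF SV qa al(1)] functor_ident[OF SV ob(3)] ob al(2) by (simp add: shift_func_def)
 have sh: "s:Hom A.VB X Y" unfolding K(3) using K(1) h(1) by (intro A.cls_hom A.roofsI)
 have pg: "Comp A.VB P ?C (Shift A.VB K) (A.qm ?C (Shift (Kb R) K) pr) \<gamma>:Hom A.VB P (Shift A.VB K)"
  by (rule VB.comp_in[OF g'(3) qh(3)]) (use ob sO in auto)
 have vh: "v:Hom A.VB Y P" unfolding v_def by (rule VB.comp_in[OF qh(2) g'(1)]) (use ob in auto)
 have wh: "w:Hom A.VB P (Shift A.VB X)" unfolding w_def by (rule VB.comp_in[OF pg Sq(1)]) (use ob sO in auto)
 have tr: "is_triangle A.VB (X, Y, P, s, v, w)" unfolding is_triangle_def using ob sh vh wh by simp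
 have e1: "Comp A.VB X Y Y (Ident A.VB Y) s = Comp A.VB X K Y (A.qm K Y f) \<alpha>"
  using VB.comp_idl[OF sh] A.cls_split[OF A.roofsI[OF K(1) h(1)]] ob unfolding K(3) \<alpha>_def by simp
 have e2: "Comp A.VB Y P ?C \<gamma> v = Comp A.VB Y Y ?C (A.qm Y ?C i) (Ident A.VB Y)"
  unfolding v_def using VB.comp_inv_ext[OF g'(2,3,1) qh(2)] VB.comp_idr[OF qh(2)] ob by simp
 have e3: "Comp A.VB P (Shift A.VB X) (Shift A.VB K) (ShiftMor A.VB X K \<alpha>) w =
   Comp A.VB P ?C (Shift A.VB K) (A.qm ?C (Shift (Kb R) K) pr) \<gamma>"
  unfolding w_def using VB.comp_inv_ext[OF SS Sq(2,1) pg] ob sO by simp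
 have "triangle_iso A.VB (X, Y, P, s, v, w) (K, Y, ?C, A.qm K Y f, A.qm Y ?C i, A.qm ?C (Shift (Kb R) K) pr)"
  unfolding triangle_iso_def prod.case using al(5) VB.iso_ident[OF ob(2)] gi e1 e2 e3 by blast
 then have "(X, Y, P, s, v, w):Dist (verdier_quotient (Kb R) (acyclic_complexes R))"
  unfolding verdier_quotient_def Dist_wt using tr st by blast
 then show "s:?L" unfolding denominators_def using P(1) by blast
qed

theorem two_step_Kb: "two_step (Kb R) (acyclic_complexes R) perf PROJ"
proof (rule two_step.intro[OF NA.ore_Kb NP.ore_Kb], rule two_step_axioms.intro)
 show "A.S X Y<=B.S X Y" for X Y by (rule den_AB)
 show "f:B.S X V" if "s:A.S V Y" "f:Hom (Kb R) X V" "X:Ob (Kb R)" "Comp (Kb R) X V Y s f:B.S X Y" for s V Y f X using den_left_AB that .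
 show "denominators (verdier_quotient (Kb R) (acyclic_complexes R)) PROJ X Y =
  A.cls X Y ` {(Z, s, f). s:A.S Z X&f:B.S Z Y}" for X Y by (rule Db_den)
 show "is_functor (Kb R) (Kb R) (shift_func (Kb R))" by (rule Kb_shift)
 show "ShiftMor (Kb R) X Y s:A.S (Shift (Kb R) X) (Shift (Kb R) Y)" if "s:A.S X Y" for s X Y using NA.den_shift[OF that] .
 show "ShiftMor (Kb R) X Y s:B.S (Shift (Kb R) X) (Shift (Kb R) Y)" if "s:B.S X Y" for s X Y using NP.den_shift[OF that] .
 show "is_triangle (Kb R) t" if "t:Dist (Kb R)" for t using that unfolding Kb_Dist by blast
qed

end

section \<open>Projective modules and dual bases\<close>

definition linear_form :: "('r, 'z) ring_scheme=>('r, 'm, 'y) module_scheme=>('m=>'r)=>bool" where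
 "linear_form R M \<phi>\<longleftrightarrow>(\<forall>x\<in>el M. \<phi> x:el R)&
  (\<forall>x\<in>el M. \<forall>y\<in>el M. \<phi> (x\<oplus>\<^sub>M y) = \<phi> x\<oplus>\<^sub>R \<phi> y)&
  (\<forall>r\<in>el R. \<forall>x\<in>el M. \<phi> (r\<odot>\<^sub>M x) = r\<otimes>\<^sub>R \<phi> x)"

text \<open>The map x -> sum of \<phi>(x) m over a dual basis, as a list so that sums of maps become
  concatenations. The element types of source and target are independent: left ideals and
  \<open>aR\<close> consist of ring elements, objects of \<open>mod_cat\<close> of
  sequences.\<close>

fun comb :: "('r, 'm, 'y) module_scheme=>(('n=>'r)\<times>'m) list=>'n=>'m" where
 "comb M [] x = \<zero>\<^sub>M"
| "comb M ((\<phi>, m) # l) x = \<phi> x\<odot>\<^sub>M m\<oplus>\<^sub>M comb M l x"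

definition dual_list :: "('r, 'z) ring_scheme=>('r, 'n, 'x) module_scheme=>('r, 'm, 'y) module_scheme
 =>(('n=>'r)\<times>'m) list=>bool" where
 "dual_list R N M l\<longleftrightarrow>(\<forall>(\<phi>, m)\<in>set l. linear_form R N \<phi>&m:el M)"

text \<open>\<open>factors R N M f\<close>: the map \<open>f\<close> from \<open>N\<close> to \<open>M\<close> factors through a finitely generated free module.
 A module is finitely generated projective iff its identity does.\<close>

definition factors :: "('r, 'z) ring_scheme=>('r, 'n, 'x) module_scheme=>('r, 'm, 'y) module_scheme
 =>('n=>'m)=>bool" where
 "factors R N M f\<longleftrightarrow>(\<exists>l. dual_list R N M l&(\<forall>x\<in>el N. f x = comb M l x))"

lemma dual_list_simps [simp]: "dual_list R N M []"
 "dual_list R N M ((\<phi>, m) # l)\<longleftrightarrow>linear_form R N \<phi>&m:el M&dual_list R N M l"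
 "dual_list R N M (l @ l')\<longleftrightarrow>dual_list R N M l&dual_list R N M l'" unfolding dual_list_def by auto

lemma linear_formD:
 assumes "linear_form R M \<phi>"
 shows "x:el M ==> \<phi> x:el R"
  "x:el M ==> y:el M ==> \<phi> (x\<oplus>\<^sub>M y) = \<phi> x\<oplus>\<^sub>R \<phi> y"
  "r:el R ==> x:el M ==> \<phi> (r\<odot>\<^sub>M x) = r\<otimes>\<^sub>R \<phi> x" using assms unfolding linear_form_def by auto

lemma factorsE:
 assumes "factors R N M f"
 obtains l where "dual_list R N M l" "!!x. x:el N ==> f x = comb M l x" using assms unfolding factors_def by auto

lemma factors_cong: "factors R N M f ==> (!!x. x:el N ==> g x = f x) ==> factors R N M g" unfolding factors_def by simp

context left_module
begin

lemma comb_closed: "dual_list R N M l ==> x:el N ==> comb M l x:el M" by (induction l) (auto simp: smult_closed linear_formD(1))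

lemma comb_append: "dual_list R N M l ==> dual_list R N M l' ==> x:el N ==>
  comb M (l @ l') x = comb M l x\<oplus>\<^sub>M comb M l' x"
 by (induction l) (auto simp: comb_closed smult_closed linear_formD(1) M.a_assoc)

lemma factors_zero: "factors R N M (\<lambda>x. \<zero>\<^sub>M)" unfolding factors_def by (intro exI[of _ "[]"]) simp

lemma factors_add: "factors R N M f ==> factors R N M g ==> factors R N M (\<lambda>x. f x\<oplus>\<^sub>M g x)"
proof -
 assume "factors R N M f" "factors R N M g"
 then obtain l l' where "dual_list R N M l" "!!x. x:el N ==> f x = comb M l x"
  "dual_list R N M l'" "!!x. x:el N ==> g x = comb M l' x" by (elim factorsE) blast
 then show ?thesis unfolding factors_def by (intro exI[of _ "l @ l'"]) (simp add: comb_append)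
qed

lemma factors_single: "linear_form R N \<phi> ==> m:el M ==> factors R N M (\<lambda>x. \<phi> x\<odot>\<^sub>M m)" unfolding factors_def
 by (intro exI[of _ "[(\<phi>, m)]"]) (simp add: smult_closed linear_formD(1))

lemma factors_finsum:
 assumes "finite I" "!!i. i:I ==> factors R N M (f i)" "!!i x. i:I ==> x:el N ==> f i x:el M"
 shows "factors R N M (\<lambda>x. finsum M (\<lambda>i. f i x) I)" using assms
proof (induction I rule: finite_induct)
 case empty
 then show ?case using factors_zero by simp
next
 case (insert i I)
 have "factors R N M (\<lambda>x. f i x\<oplus>\<^sub>M finsum M (\<lambda>i. f i x) I)" using insert by (intro factors_add) auto
 then show ?case by (rule factors_cong) (use insert in \<open>auto intro!: M.finsum_insert\<close>)
qed

end

lemma factors_pre: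
 assumes "factors R N M f" "!!x. x:el N' ==> h x:el N"
  "!!x y. x:el N' ==> y:el N' ==> h (x\<oplus>\<^sub>N' y) = h x\<oplus>\<^sub>N h y"
  "!!r x. r:el R ==> x:el N' ==> h (r\<odot>\<^sub>N' x) = r\<odot>\<^sub>N h x"
 shows "factors R N' M (\<lambda>x. f (h x))"
proof -
 obtain l where l: "dual_list R N M l" "!!x. x:el N ==> f x = comb M l x" using factorsE[OF assms(1)] by blast
 have "dual_list R N' M (map (\<lambda>(\<phi>, m). (\<lambda>x. \<phi> (h x), m)) l)"
  using l(1) assms(2-4) by (auto simp: dual_list_def linear_form_def)
 moreover have "comb M (map (\<lambda>(\<phi>, m). (\<lambda>x. \<phi> (h x), m)) l) x = comb M l (h x)" for x by (induction l) auto
 ultimately show ?thesis unfolding factors_def using l(2) assms(2) by (intro exI conjI) auto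
qed

lemma factors_post:
 assumes "lmod R M" "factors R N M f" "!!x. x:el M ==> h x:el M'"
  "!!x y. x:el M ==> y:el M ==> h (x\<oplus>\<^sub>M y) = h x\<oplus>\<^sub>M' h y"
  "!!r x. r:el R ==> x:el M ==> h (r\<odot>\<^sub>M x) = r\<odot>\<^sub>M' h x" "h \<zero>\<^sub>M = \<zero>\<^sub>M'"
 shows "factors R N M' (\<lambda>x. h (f x))"
proof -
 interpret M: left_module R M by fact
 obtain l where l: "dual_list R N M l" "!!x. x:el N ==> f x = comb M l x" using factorsE[OF assms(2)] by blast
 have "dual_list R N M' (map (\<lambda>(\<phi>, m). (\<phi>, h m)) l)" using l(1) assms(3) by (auto simp: dual_list_def)
 moreover have "comb M' (map (\<lambda>(\<phi>, m). (\<phi>, h m)) l) x = h (comb M l x)" if "x:el N" for x using l(1)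
 proof (induction l)
  case (Cons p l)
  then show ?case using that by (cases p) (auto simp: assms M.comb_closed M.smult_closed linear_formD(1))
 qed (use assms in simp)
 ultimately show ?thesis unfolding factors_def using l(2) by (intro exI[of _ "map (\<lambda>(\<phi>, m). (\<phi>, h m)) l"]) auto
qed

text \<open>An extension of a projective module by a projective one is projective. Lifting the
  vectors of the dual basis of L along \<open>p\<close> gives a linear section, and x is the sum of
  the image of p x under it and an element of the kernel. The identity of the kernel is only
  required to factor as a map into K.\<close>

lemma factors_extension:
 assumes K: "lmod R K" and L: "lmod R L"
  and p: "!!x. x:el K ==> p x:el L"
  "!!x y. x:el K ==> y:el K ==> p (x\<oplus>\<^sub>K y) = p x\<oplus>\<^sub>L p y"
  "!!r x. r:el R ==> x:el K ==> p (r\<odot>\<^sub>K x) = r\<odot>\<^sub>L p x"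
  and surj: "!!y. y:el L ==> \<exists>x\<in>el K. p x = y"
  and idL: "factors R L L (\<lambda>x. x)" and idker: "factors R (K\<lparr>carrier := {x\<in>el K. p x = \<zero>\<^sub>L}\<rparr>) K (\<lambda>x. x)"
 shows "factors R K K (\<lambda>x. x)"
proof -
 interpret K: left_module R K by fact
 interpret L: left_module R L by fact
 let ?k = "K\<lparr>carrier := {x\<in>el K. p x = \<zero>\<^sub>L}\<rparr>"
 obtain l where l: "dual_list R L L l" "!!x. x:el L ==> x = comb L l x" using factorsE[OF idL] by blast
 have "\<exists>l'. dual_list R L K l'&(\<forall>x\<in>el L. p (comb K l' x) = comb L l x)" using l(1)
 proof (induction l)
  case Nil
  have "p \<zero>\<^sub>K = \<zero>\<^sub>L" using p(3)[of "\<zero>\<^sub>R" "\<zero>\<^sub>K"] p(1)[of "\<zero>\<^sub>K"] by (simp add: K.smult_l_null L.smult_l_null)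
  then show ?case by (intro exI[of _ "[]"]) simp
 next
  case (Cons q l)
  obtain \<phi> m where q: "q = (\<phi>, m)" by (cases q)
  obtain l' where l': "dual_list R L K l'" "\<forall>x\<in>el L. p (comb K l' x) = comb L l x" using Cons q by auto
  obtain y where "y:el K" "p y = m" using surj Cons.prems q by auto
  then show ?case using l' Cons.prems q by (intro exI[of _ "(\<phi>, y) # l'"]) (auto simp: p K.comb_closed K.smult_closed linear_formD(1))
 qed
 then obtain l' where l': "dual_list R L K l'" "\<forall>x\<in>el L. p (comb K l' x) = comb L l x" by blast
 have pl: "p (comb K l' x) = x" if "x:el L" for x using l'(2) l(2)[OF that, symmetric] that by simp
 let ?s = "\<lambda>x. comb K l' (p x)"
 have "factors R L K (comb K l')" unfolding factors_def using l'(1) by blast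
 then have s: "factors R K K ?s" by (rule factors_pre[where h = p and f = "comb K l'"]) (rule p; assumption)+
 have sc: "?s x:el K" if "x:el K" for x using K.comb_closed[OF l'(1)] p(1) that by blast
 \<comment> \<open>The section is linear because every map \<open>comb\<close> is linear in its
   argument.\<close>
 have lin: "comb K l' (x\<oplus>\<^sub>L y) = comb K l' x\<oplus>\<^sub>K comb K l' y" "r:el R ==> comb K l' (r\<odot>\<^sub>L x) = r\<odot>\<^sub>K comb K l' x"
  if "x:el L" "y:el L" for x y r
 proof -
  show "comb K l' (x\<oplus>\<^sub>L y) = comb K l' x\<oplus>\<^sub>K comb K l' y" using l'(1)
  proof (induction l')
   case (Cons q l)
   obtain \<phi> m where q: "q = (\<phi>, m)" by (cases q)
   have "\<phi> x\<odot>\<^sub>K m:el K" "\<phi> y\<odot>\<^sub>K m:el K" "comb K l x:el K" "comb K l y:el K"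
    using Cons.prems q that by (auto simp: K.comb_closed K.smult_closed linear_formD(1))
   then show ?case using Cons q that by (auto simp: linear_formD K.smult_l_distr K.M.a_ac)
  qed simp
  show "comb K l' (r\<odot>\<^sub>L x) = r\<odot>\<^sub>K comb K l' x" if r: "r:el R" using l'(1)
  proof (induction l')
   case (Cons q l)
   obtain \<phi> m where q: "q = (\<phi>, m)" by (cases q)
   then show ?case using Cons \<open>x \<in> carrier L\<close> r
    by (auto simp: linear_formD K.smult_r_distr K.smult_assoc1 K.comb_closed K.smult_closed)
  qed (use r in \<open>simp add: K.smult_r_null\<close>)
 qed
 have pm: "p (\<ominus>\<^sub>K x) =\<ominus>\<^sub>L p x" if "x:el K" for x
  using p(3)[of "\<ominus>\<^sub>R \<one>\<^sub>R" x] that K.minus_smult[OF that] L.minus_smult[OF p(1)[OF that]] by simp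
 have "factors R K K (\<lambda>x. x\<oplus>\<^sub>K\<ominus>\<^sub>K ?s x)"
 proof (rule factors_pre[OF idker, where h = "\<lambda>x. x\<oplus>\<^sub>K\<ominus>\<^sub>K ?s x"])
  fix x assume x: "x:el K"
  then show "x\<oplus>\<^sub>K\<ominus>\<^sub>K ?s x:el ?k" using sc[OF x] pl[OF p(1)[OF x]] p(1)[OF x] by (simp add: p pm L.M.r_neg)
  fix y assume y: "y:el K"
  show "x\<oplus>\<^sub>K y\<oplus>\<^sub>K\<ominus>\<^sub>K ?s (x\<oplus>\<^sub>K y) = (x\<oplus>\<^sub>K\<ominus>\<^sub>K ?s x)\<oplus>\<^sub>?k (y\<oplus>\<^sub>K\<ominus>\<^sub>K ?s y)"
   using x y sc[OF x] sc[OF y] p(1)[OF x] p(1)[OF y] by (simp add: p(2) lin(1) K.M.minus_add K.M.a_ac)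
 next
  fix r x assume r: "r:el R" and x: "x:el K"
  show "r\<odot>\<^sub>K x\<oplus>\<^sub>K\<ominus>\<^sub>K ?s (r\<odot>\<^sub>K x) = r\<odot>\<^sub>?k (x\<oplus>\<^sub>K\<ominus>\<^sub>K ?s x)"
   using r x sc[OF x] p(1)[OF x] by (simp add: p(3) lin(2)[OF p(1)[OF x] p(1)[OF x] r] K.smult_r_distr K.smult_r_minus)
 qed
 from K.factors_add[OF s this] show ?thesis
 proof (rule factors_cong)
  fix x assume "x:el K"
  then show "x = ?s x\<oplus>\<^sub>K (x\<oplus>\<^sub>K\<ominus>\<^sub>K ?s x)" using sc[of x] by (simp, algebra)
 qed
qed

text \<open>Vectors are padded with zeros, which realizes the free module on sequences and makes it
  an object of \<open>mod_cat\<close>.\<close>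

definition free_mod :: "'r ring=>nat=>'r fgmod" where
 "free_mod R n = \<lparr>carrier = {x. (\<forall>i<n. x i:el R)&(\<forall>i\<ge>n. x i = \<zero>\<^sub>R)},
   mult = undefined, one = undefined, zero = (\<lambda>_. \<zero>\<^sub>R), add = (\<lambda>x y i. x i\<oplus>\<^sub>R y i),
   smult = (\<lambda>r x i. r\<otimes>\<^sub>R x i)\<rparr>"

definition unit_vec :: "'r ring=>nat=>nat=>'r" where
 "unit_vec R i = (\<lambda>j. if j = i then \<one>\<^sub>R else \<zero>\<^sub>R)"

primrec lc :: "('r, 'm, 'y) module_scheme=>nat=>(nat=>'r)=>(nat=>'m)=>'m" where
 "lc M 0 x m = \<zero>\<^sub>M"
| "lc M (Suc n) x m = lc M n x m\<oplus>\<^sub>M x n\<odot>\<^sub>M m n"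

lemma (in left_module) lc_closed:
 "(!!i. i < n ==> x i:el R) ==> (!!i. i < n ==> m i:el M) ==> lc M n x m:el M" by (induction n) (auto simp: smult_closed)

lemma (in left_module) lc_add:
 assumes "!!i. i < n ==> x i:el R" "!!i. i < n ==> y i:el R" "!!i. i < n ==> m i:el M"
 shows "lc M n (\<lambda>i. x i\<oplus> y i) m = lc M n x m\<oplus>\<^sub>M lc M n y m" using assms
proof (induction n)
 case (Suc n)
 have "lc M n x m:el M" "lc M n y m:el M" "x n\<odot>\<^sub>M m n:el M" "y n\<odot>\<^sub>M m n:el M"
  using Suc.prems lc_closed smult_closed by auto
 then show ?case using Suc by (simp add: smult_l_distr M.a_ac)
qed simp

lemma (in left_module) lc_smult:
 assumes "!!i. i < n ==> x i:el R" "!!i. i < n ==> m i:el M" "r:el R"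
 shows "lc M n (\<lambda>i. r\<otimes> x i) m = r\<odot>\<^sub>M lc M n x m" using assms
 by (induction n) (auto simp: smult_r_null smult_r_distr smult_assoc1 smult_closed lc_closed)

context modcat
begin

lemma free_carrier: "el (free_mod R n) = {x. (\<forall>i. x i:el R)&(\<forall>i\<ge>n. x i = \<zero>)}"
 unfolding free_mod_def by (auto, metis linorder_not_less zero_closed)

lemma free_ops: "zero (free_mod R n) = (\<lambda>_. \<zero>)" "add (free_mod R n) = (\<lambda>x y i. x i\<oplus> y i)"
 "smult (free_mod R n) = (\<lambda>r x i. r\<otimes> x i)" unfolding free_mod_def by simp_all

lemma free_left_module: "lmod R (free_mod R n)"
proof (rule left_moduleI)
 show "\<exists>y\<in>el (free_mod R n). y\<oplus>\<^bsub>free_mod R n\<^esub> x = \<zero>\<^bsub>free_mod R n\<^esub>"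
  if "x:el (free_mod R n)" for x using that by (intro bexI[of _ "\<lambda>i.\<ominus> x i"]) (auto simp: free_carrier free_ops l_neg)
qed (auto simp: free_carrier free_ops a_ac l_distr r_distr m_assoc ring_axioms)

lemma free_mem: "x:el (free_mod R n) ==> x i:el R" by (simp add: free_carrier)

lemma unit_vec_free: "i < n ==> unit_vec R i:el (free_mod R n)" unfolding free_mod_def unit_vec_def by simp

lemma free_factors: "factors R (free_mod R n) (free_mod R n) (\<lambda>x. x)"
proof -
 let ?F = "free_mod R n"
 let ?l = "\<lambda>k. map (\<lambda>i. (\<lambda>x. x i, unit_vec R i)) [k..<n]"
 have "linear_form R ?F (\<lambda>x. x i)" if "i < n" for i using that unfolding linear_form_def free_mod_def by simp
 then have dl: "dual_list R ?F ?F (?l k)" for k using unit_vec_free unfolding dual_list_def by auto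
 \<comment> \<open>Downward induction on k: the tail of the list from k on reproduces the
   coordinates from k on and erases the others.\<close>
 have "comb ?F (?l k) x = (\<lambda>i. if i < k then \<zero> else x i)" if "x:el ?F" "k\<le>n" for x k using that(2)
 proof (induction k rule: inc_induct)
  case base
  show ?case using that(1) by (auto simp: free_mod_def fun_eq_iff)
 next
  case (step k)
  have xi: "x i:el R" for i using that(1) by (cases "i < n") (auto simp: free_mod_def)
  have e: "[k..<n] = k # [Suc k..<n]" using step by (simp add: upt_conv_Cons)
  have "comb ?F (?l k) x = x k\<odot>\<^sub>?F unit_vec R k\<oplus>\<^sub>?F (\<lambda>i. if i < Suc k then \<zero> else x i)"
   unfolding e using step by simp
  also have "\<dots> = (\<lambda>i. if i < k then \<zero> else x i)"
   using xi by (auto simp: free_mod_def unit_vec_def fun_eq_iff less_Suc_eq)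
  finally show ?case .
 qed
 from this[of _ 0] show ?thesis unfolding factors_def using dl[of 0] by (intro exI[of _ "?l 0"]) simp
qed

lemma factors_MOD:
 assumes M: "lmod R (M :: 'r fgmod)" and id: "factors R M M (\<lambda>x. x)"
 shows "M:MOD"
proof -
 interpret M: left_module R M by fact
 obtain l where l: "dual_list R M M l" "!!x. x:el M ==> x = comb M l x" using factorsE[OF id] by blast
 have "fin_gen R M"
 proof (rule fin_genI[OF M, of "snd ` set l"])
  show "snd ` set l<=el M" using l(1) unfolding dual_list_def by auto
  fix H assume H: "submod R M H" "snd ` set l<=H"
  have "comb M l x:H" if "x:el M" for x using l(1) H(2)
  proof (induction l)
   case Nil
   then show ?case using submodD(3)[OF H(1)] by simp
  next
   case (Cons q l)
   obtain \<phi> m where q: "q = (\<phi>, m)" by (cases q)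
   then show ?case using Cons that submodD(4)[OF H(1)] submodD(5)[OF H(1)] by (auto simp: linear_formD(1))
  qed
  then show "el M<=H" using l(2) by force
 qed simp
 then show ?thesis using M by (simp add: MOD_iff)
qed

lemma factors_projective:
 assumes M: "lmod R (P :: 'r fgmod)" and id: "factors R P P (\<lambda>x. x)"
 shows "is_projective R P" unfolding is_projective_def
proof (intro conjI ballI impI)
 show "P:MOD" by (rule factors_MOD[OF assms])
 interpret P: left_module R P by fact
 obtain l where l: "dual_list R P P l" "!!x. x:el P ==> x = comb P l x" using factorsE[OF id] by blast
 fix M N g f assume *: "M:MOD" "N:MOD" "g:hm M N" "f:hm P N" "g ` el M = el N"
 interpret M: left_module R M using * by simp
 interpret N: left_module R N using * by simp
 have "\<exists>h\<in>hm P M. \<forall>x\<in>el P. g (h x) = f (comb P l x)" using l(1)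
 proof (induction l)
  case Nil
  have "(\<lambda>x\<in>el P. \<zero>\<^sub>M):hm P M" using hm_zero_map P.left_module_axioms M.left_module_axioms by blast
  then show ?case using hm_zero[OF *(3)] hm_zero[OF *(4) M] *(1,2) by (intro bexI) auto
 next
  case (Cons q l)
  obtain \<phi> m where q: "q = (\<phi>, m)" by (cases q)
  have phi: "linear_form R P \<phi>" "m:el P" "dual_list R P P l" using Cons.prems q by auto
  obtain h where h: "h:hm P M" "\<forall>x\<in>el P. g (h x) = f (comb P l x)" using Cons phi by blast
  have "f m:g ` el M" using hm_closed[OF *(4) phi(2)] *(5) by simp
  then obtain y where y: "y:el M" "g y = f m" by auto
  have 1: "(\<lambda>x\<in>el P. \<phi> x\<odot>\<^sub>M y):hm P M"
   by (rule hm_restrictI) (use phi(1) y in \<open>auto simp: P.left_module_axioms linear_formD M.smult_closed M.smult_l_distr M.smult_assoc1\<close>)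
  have e: "g (\<phi> x\<odot>\<^sub>M y\<oplus>\<^sub>M h x) = f (comb P (q # l) x)" if x: "x:el P" for x
   using x y h(2) hm_closed[OF h(1) x] linear_formD(1)[OF phi(1) x] P.comb_closed[OF phi(3) x] phi(2)
   by (simp add: q hm_add[OF *(3)] hm_add[OF *(4)] hm_smult[OF *(3)] hm_smult[OF *(4)] M.smult_closed P.smult_closed)
  have "lmod R M" using M.left_module_axioms .
  note hm_plus[OF 1 h(1) P.left_module_axioms this]
  then show ?case by (rule bexI[rotated]) (simp add: e)
 qed
 then obtain h where h: "h:hm P M" "\<forall>x\<in>el P. g (h x) = f (comb P l x)" by blast
 have "compose (el P) g h = f" by (rule hm_ext[OF hm_compose[OF h(1) *(3) M] *(4)]) (simp add: compose_def h(2) l(2)[symmetric])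
 then show "\<exists>h\<in>hm P M. compose (el P) g h = f" by (intro bexI[of _ h] h(1))
qed

lemma free_projective: "is_projective R (free_mod R n)" by (rule factors_projective[OF free_left_module free_factors])

lemma free_MOD: "free_mod R n:MOD" by (rule factors_MOD[OF free_left_module free_factors])

lemma lc_hm:
 assumes "lmod R M" "!!i. i < n ==> m i:el M"
 shows "(\<lambda>x\<in>el (free_mod R n). lc M n x m):hm (free_mod R n) M"
proof -
 interpret M: left_module R M by fact
 show ?thesis
 proof (rule hm_restrictI[OF free_left_module])
  fix x assume x: "x:el (free_mod R n)"
  note x' = free_mem[OF x]
  show "lc M n x m:el M" using assms(2) x' by (intro M.lc_closed)
  show "lc M n (r\<odot>\<^bsub>free_mod R n\<^esub> x) m = r\<odot>\<^sub>M lc M n x m" if "r:el R" for r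
   unfolding free_ops using assms(2) x' that by (intro M.lc_smult)
  fix y assume y: "y:el (free_mod R n)"
  show "lc M n (x\<oplus>\<^bsub>free_mod R n\<^esub> y) m = lc M n x m\<oplus>\<^sub>M lc M n y m"
   unfolding free_ops using assms(2) x' free_mem[OF y] by (intro M.lc_add)
 qed
qed

lemma lc_unit_vec:
 assumes "lmod R M" "!!i. i < n ==> m i:el M" "i < n"
 shows "lc M n (unit_vec R i) m = m i"
proof -
 interpret M: left_module R M by fact
 have z: "lc M k (unit_vec R i) m = \<zero>\<^sub>M" if "k\<le>i" "k\<le>n" for k
  using that by (induction k) (auto simp: unit_vec_def M.smult_l_null assms(2))
 have "lc M k (unit_vec R i) m = m i" if "Suc i\<le>k" "k\<le>n" for k using that
 proof (induction k rule: dec_induct)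
  case base
  then show ?case using z[of i] assms by (simp add: unit_vec_def M.smult_one)
 next
  case (step k)
  then show ?case using assms by (simp add: unit_vec_def M.smult_l_null)
 qed
 then show ?thesis using assms(3) by simp
qed

end

context modcat
begin

lemma free_surj:
 assumes "M:MOD"
 obtains n m where "\<forall>i<n. m i:el M" "(\<lambda>x. lc M n x m) ` el (free_mod R n) = el M"
  "\<forall>H. submod R M H-->(\<forall>i<n. m i:H)-->H = el M"
proof -
 interpret M: left_module R M using assms by simp
 obtain S where S: "finite S" "S<=el M" "\<forall>H. submod R M H-->S<=H-->H = el M"
  using fin_genE[OF MOD_fg[OF assms] M.left_module_axioms] .
 obtain n and m :: "nat=>nat=>'r" where m: "S = m ` {i. i < n}" using finite_imp_nat_seg_image_inj_on[OF S(1)] by (elim exE conjE)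
 have mc: "\<forall>i<n. m i:el M" using S(2) m by auto
 have gen: "\<forall>H. submod R M H-->(\<forall>i<n. m i:H)-->H = el M" using S(3) m by auto
 have h: "(\<lambda>x\<in>el (free_mod R n). lc M n x m):hm (free_mod R n) M" using mc by (intro lc_hm M.left_module_axioms) auto
 have "m i:(\<lambda>x\<in>el (free_mod R n). lc M n x m) ` el (free_mod R n)" if "i < n" for i
  using lc_unit_vec[OF M.left_module_axioms _ that, of m] mc unit_vec_free[OF that] that by (auto simp: image_iff intro!: bexI[of _ "unit_vec R i"])
 then have "(\<lambda>x\<in>el (free_mod R n). lc M n x m) ` el (free_mod R n) = el M"
  by (intro gen[rule_format] submod_image[OF h free_left_module M.left_module_axioms submod_carrier[OF free_left_module]])
 then show ?thesis by (intro that[of n m] mc gen) simp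
qed

text \<open>A section of a free cover, obtained from projectivity, pulls the dual basis of the free
  module back to P.\<close>

lemma projective_factors:
 assumes "is_projective R P"
 shows "factors R P P (\<lambda>x. x)"
proof -
 have P: "P:MOD" using assms unfolding is_projective_def by (rule conjunct1)
 interpret P: left_module R P using P by simp
 obtain n m where m: "\<forall>i<n. m i:el P" "(\<lambda>x. lc P n x m) ` el (free_mod R n) = el P" using free_surj[OF P] .
 let ?e = "\<lambda>x\<in>el (free_mod R n). lc P n x m"
 have e: "?e:hm (free_mod R n) P" using m(1) by (intro lc_hm P.left_module_axioms) auto
 have surj: "x:?e ` el (free_mod R n)" if "x:el P" for x using m(2) that by auto
 obtain s where s: "s:hm P (free_mod R n)" "!!x. x:el P ==> ?e (s x) = x"
  using proj_lift[OF assms hm_ident[OF P.left_module_axioms] e free_MOD P] surj by auto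
 have "factors R (free_mod R n) P ?e"
  by (rule factors_post[where M = "free_mod R n" and h = ?e, OF free_left_module free_factors hm_closed[OF e] hm_add[OF e] hm_smult[OF e]
    hm_zero[OF e free_left_module P.left_module_axioms]])
 then have "factors R P P (\<lambda>x. ?e (s x))" by (rule factors_pre) (use hm_closed[OF s(1)] hm_add[OF s(1)] hm_smult[OF s(1)] in simp)+
 then show ?thesis by (rule factors_cong) (use s(2) in simp)
qed

lemma free_unique:
 assumes "f:hm (free_mod R n) M" "g:hm (free_mod R n) M" "lmod R M"
  and "!!i. i < n ==> f (unit_vec R i) = g (unit_vec R i)"
 shows "f = g"
proof (rule hm_ext[OF assms(1,2)])
 note F = free_left_module[of n]
 interpret F: left_module R "free_mod R n" by (rule F)
 fix x assume x: "x:el (free_mod R n)"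
 define p where "p k = (\<lambda>i. if i < k then x i else \<zero>)" for k
 have "p k:el (free_mod R n)&f (p k) = g (p k)" if "k\<le>n" for k using that
 proof (induction k)
  case 0
  have "p 0 = \<zero>\<^bsub>free_mod R n\<^esub>" unfolding p_def free_ops by simp
  then show ?case using hm_zero[OF assms(1) F assms(3)] hm_zero[OF assms(2) F assms(3)] by simp
 next
  case (Suc k)
  have "p (Suc k) = p k\<oplus>\<^bsub>free_mod R n\<^esub> x k\<odot>\<^bsub>free_mod R n\<^esub> unit_vec R k"
   using free_mem[OF x] by (auto simp: p_def free_ops unit_vec_def fun_eq_iff less_Suc_eq)
  then show ?case using Suc unit_vec_free[of k n] free_mem[OF x, of k] assms(4)[of k]
   by (simp add: F.smult_closed hm_add[OF assms(1)] hm_add[OF assms(2)] hm_smult[OF assms(1)] hm_smult[OF assms(2)])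
 qed
 moreover have "p n = x" using x by (auto simp: p_def free_carrier fun_eq_iff)
 ultimately show "f x = g x" by force
qed

lemma hm_factor:
 assumes p: "\<pi>:hm M Q" "\<pi> ` el M = el Q" and g: "g:hm M N"
  and L: "lmod R M" "lmod R Q" "lmod R N"
  and ker: "!!x. x:el M ==> \<pi> x = \<zero>\<^sub>Q ==> g x = \<zero>\<^sub>N"
 obtains h where "h:hm Q N" "!!x. x:el M ==> h (\<pi> x) = g x"
proof -
 interpret M: left_module R M by fact
 interpret Q: left_module R Q by fact
 interpret N: left_module R N by fact
 have w: "g x = g y" if "x:el M" "y:el M" "\<pi> x = \<pi> y" for x y
 proof -
  have "\<pi> (x\<oplus>\<^sub>M\<ominus>\<^sub>M y) = \<zero>\<^sub>Q"
   using that by (simp add: hm_add[OF p(1)] hm_minus[OF p(1) L(1,2)] hm_closed[OF p(1)] Q.M.r_neg)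
  then have "g x\<oplus>\<^sub>N\<ominus>\<^sub>N g y = \<zero>\<^sub>N"
   using ker[of "x\<oplus>\<^sub>M\<ominus>\<^sub>M y"] that by (simp add: hm_add[OF g] hm_minus[OF g L(1,3)])
  then show ?thesis using that hm_closed[OF g] by (simp add: N.M.add_minus_zero_iff)
 qed
 define s where "s q = (SOME x. x:el M&\<pi> x = q)" for q
 have s: "s q:el M" "\<pi> (s q) = q" if "q:el Q" for q
 proof -
  have "\<exists>x. x:el M&\<pi> x = q" using that unfolding p(2)[symmetric] by auto
  from someI_ex[OF this] show "s q:el M" "\<pi> (s q) = q" unfolding s_def by auto
 qed
 show ?thesis
 proof (rule that[of "\<lambda>q\<in>el Q. g (s q)"])
  show v: "(\<lambda>q\<in>el Q. g (s q)) (\<pi> x) = g x" if "x:el M" for x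
   using w[of "s (\<pi> x)" x] s[of "\<pi> x"] that hm_closed[OF p(1)] by simp
  show "(\<lambda>q\<in>el Q. g (s q)):hm Q N"
  proof (rule hm_restrictI[OF L(2)])
   fix x assume x: "x:el Q"
   show "g (s x):el N" using s(1)[OF x] hm_closed[OF g] by simp
   show "g (s (r\<odot>\<^sub>Q x)) = r\<odot>\<^sub>N g (s x)" if "r:el R" for r
    using w[of "s (r\<odot>\<^sub>Q x)" "r\<odot>\<^sub>M s x"] s x that
    by (simp add: Q.smult_closed M.smult_closed hm_smult[OF p(1)] hm_smult[OF g])
   fix y assume y: "y:el Q"
   show "g (s (x\<oplus>\<^sub>Q y)) = g (s x)\<oplus>\<^sub>N g (s y)"
    using w[of "s (x\<oplus>\<^sub>Q y)" "s x\<oplus>\<^sub>M s y"] s x y by (simp add: hm_add[OF p(1)] hm_add[OF g])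
  qed
 qed
qed

text \<open>Elements of objects of \<open>mod_cat\<close> are sequences, so a coset cannot be an
  element. The quotient is carried by a set of chosen representatives, on which the operations are
  followed by the choice function \<open>q\<close>.\<close>

lemma quotient_module:
 assumes M: "M:MOD" and T: "submod R M T"
 obtains Q \<pi> where "Q:MOD" "\<pi>:hm M Q" "\<pi> ` el M = el Q"
  "!!x. x:el M ==> \<pi> x = \<zero>\<^sub>Q\<longleftrightarrow>x:T"
proof -
 have L: "lmod R M" using M by simp
 interpret M: left_module R M by (rule L)
 note T' = submodD[OF T]
 \<comment> \<open>For congruent elements the predicates under the choice operator coincide, so the
   same representative is chosen; this is \<open>qe\<close>.\<close>
 define q where "q x = (SOME y. y:el M&x\<oplus>\<^sub>M\<ominus>\<^sub>M y:T)" for x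
 have q: "q x:el M" "x\<oplus>\<^sub>M\<ominus>\<^sub>M q x:T" if "x:el M" for x
  using someI[of "\<lambda>y. y:el M&x\<oplus>\<^sub>M\<ominus>\<^sub>M y:T" x] that T'(3) M.M.r_neg[OF that] unfolding q_def by auto
 have qe: "q x = q y" if "x\<oplus>\<^sub>M\<ominus>\<^sub>M y:T" "x:el M" "y:el M" for x y
 proof -
  have "x\<oplus>\<^sub>M\<ominus>\<^sub>M z:T\<longleftrightarrow>y\<oplus>\<^sub>M\<ominus>\<^sub>M z:T" if z: "z:el M" for z
  proof -
   have 1: "x\<oplus>\<^sub>M\<ominus>\<^sub>M z = (x\<oplus>\<^sub>M\<ominus>\<^sub>M y)\<oplus>\<^sub>M (y\<oplus>\<^sub>M\<ominus>\<^sub>M z)"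
    "y\<oplus>\<^sub>M\<ominus>\<^sub>M z =\<ominus>\<^sub>M (x\<oplus>\<^sub>M\<ominus>\<^sub>M y)\<oplus>\<^sub>M (x\<oplus>\<^sub>M\<ominus>\<^sub>M z)"
    using that(1) \<open>x \<in> carrier M\<close> \<open>y \<in> carrier M\<close> z by algebra+
   then show ?thesis using T'(4) M.submod_minus[OF T] \<open>x \<oplus>\<^bsub>M\<^esub> \<ominus>\<^bsub>M\<^esub> y \<in> T\<close> by metis
  qed
  then show ?thesis unfolding q_def by (metis (no_types, lifting))
 qed
 let ?Q = "M\<lparr>carrier := q ` el M, zero := q \<zero>\<^sub>M, add := \<lambda>x y. q (x\<oplus>\<^sub>M y), smult := \<lambda>r x. q (r\<odot>\<^sub>M x)\<rparr>"
 have qa: "q (q x\<oplus>\<^sub>M q y) = q (x\<oplus>\<^sub>M y)" if "x:el M" "y:el M" for x y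
 proof (rule qe[symmetric])
  have "x\<oplus>\<^sub>M y\<oplus>\<^sub>M\<ominus>\<^sub>M (q x\<oplus>\<^sub>M q y) = (x\<oplus>\<^sub>M\<ominus>\<^sub>M q x)\<oplus>\<^sub>M (y\<oplus>\<^sub>M\<ominus>\<^sub>M q y)"
   using that q(1)[OF that(1)] q(1)[OF that(2)] by algebra
  then show "x\<oplus>\<^sub>M y\<oplus>\<^sub>M\<ominus>\<^sub>M (q x\<oplus>\<^sub>M q y):T" using T'(4) q that by simp
 qed (use that q in auto)
 have qs: "q (r\<odot>\<^sub>M q x) = q (r\<odot>\<^sub>M x)" if "r:el R" "x:el M" for r x
 proof (rule qe[symmetric])
  show "r\<odot>\<^sub>M x\<oplus>\<^sub>M\<ominus>\<^sub>M (r\<odot>\<^sub>M q x):T"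
   using T'(5)[OF that(1) q(2)[OF that(2)]] that q by (simp add: M.smult_r_distr M.smult_r_minus)
 qed (use that q M.smult_closed in auto)
 have qa': "q (q x\<oplus>\<^sub>M y) = q (x\<oplus>\<^sub>M y)" "q (y\<oplus>\<^sub>M q x) = q (y\<oplus>\<^sub>M x)"
  if "x:el M" "y:el M" for x y
  using qa[of "q x" y] qa[of x y] qa[of y "q x"] qa[of y x] qa[of "\<zero>\<^sub>M" x] qa[of "\<zero>\<^sub>M" "q x"] q that
  by (metis M.M.l_zero M.M.zero_closed qe[OF q(2)[OF that(1)]])+
 have LQ: "lmod R ?Q"
 proof (rule left_moduleI[OF ring_axioms], goal_cases)
  case (5 x)
  then obtain y where y: "x = q y" "y:el M" by auto
  then show ?case by (simp add: qa' q)
 next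
  case (6 x)
  then obtain y where y: "x = q y" "y:el M" by auto
  then show ?case by (intro bexI[of _ "q (\<ominus>\<^sub>M y)"]) (simp_all add: qa q M.M.l_neg)
 qed (auto simp: qa qa' qs q M.smult_closed M.M.a_assoc M.smult_r_distr,
    auto simp: M.M.a_comm M.smult_l_distr M.smult_assoc1 M.smult_one)
 have p: "restrict q (el M):hm M ?Q" by (rule hm_restrictI[OF L]) (simp_all add: qa qs)
 have im: "restrict q (el M) ` el M = el ?Q" by simp
 have "?Q:MOD" using hm_surj_fin_gen[OF p L LQ MOD_fg[OF M] im] LQ by (simp add: MOD_iff)
 moreover have "restrict q (el M) x = \<zero>\<^sub>?Q\<longleftrightarrow>x:T" if x: "x:el M" for x
 proof
  assume "restrict q (el M) x = \<zero>\<^sub>?Q"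
  then have "q x = q \<zero>\<^sub>M" using x by simp
  moreover have "x = (x\<oplus>\<^sub>M\<ominus>\<^sub>M q x)\<oplus>\<^sub>M\<ominus>\<^sub>M (\<zero>\<^sub>M\<oplus>\<^sub>M\<ominus>\<^sub>M q x)" using x q(1)[OF x] by algebra
  ultimately show "x:T" using q(2)[OF x] q(2)[OF M.M.zero_closed] T'(4) M.submod_minus[OF T] by metis
 qed (use qe[of x "\<zero>\<^sub>M"] x in \<open>simp add: M.M.a_inv_zero\<close>)
 ultimately show ?thesis using that p im by blast
qed

end

section \<open>The corner functor\<close>

locale idem = modcat R for R :: "'r ring" (structure) +
 fixes a assumes a [simp]: "a:el R" and aa [simp]: "a\<otimes> a = a"
begin

abbreviation "S\<equiv>corner_ring R a"
abbreviation "F\<equiv>corner_functor a :: 'r mod_func"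
abbreviation "FM\<equiv>ob F"
abbreviation "FX\<equiv>complex_image F"
abbreviation "Fm X f\<equiv>(\<lambda>n. restrict (f n) (el (FM (cobj X n))))"

lemma aax [simp]: "x:el R ==> a\<otimes> (a\<otimes> x) = a\<otimes> x" by (simp flip: m_assoc)

lemma S_carrier: "s:el S\<longleftrightarrow>s:el R&a\<otimes> s = s&s\<otimes> a = s"
 by (auto simp: corner_ring_def m_assoc image_def intro: bexI[of _ s])

lemma S_ops [simp]: "mult S = mult R" "one S = a" "zero S = zero R" "add S = add R" unfolding corner_ring_def by simp_all

lemma S_ring: "ring S"
proof (rule ringI)
 have "\<exists>t\<in>el S. t\<oplus> s = \<zero>" if "s:el S" for s
  using that by (intro bexI[of _ "\<ominus> s"]) (auto simp: S_carrier l_neg r_minus l_minus)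
 then show "abelian_group S" by (intro abelian_groupI) (auto simp: S_carrier a_ac r_distr l_distr)
 show "monoid S" by (rule monoidI) (auto simp: S_carrier m_assoc, simp flip: m_assoc)
qed (auto simp: S_carrier r_distr l_distr)

sublocale S: modcat S by (rule modcat.intro[OF S_ring])

lemma FM_ops [simp]: "zero (FM M) = zero M" "add (FM M) = add M" "smult (FM M) = smult M" unfolding corner_functor_def by simp_all

lemma FM_carrier [simp]: "lmod R M ==> x:el (FM M)\<longleftrightarrow>x:el M&a\<odot>\<^sub>M x = x"
proof -
 assume "lmod R M"
 then interpret M: left_module R M .
 show ?thesis by (auto simp: corner_functor_def image_def M.smult_closed M.smult_assoc1[symmetric] intro: bexI[of _ x])
qed

lemma F_mor: "mor F M N f = restrict f (el (FM M))" unfolding corner_functor_def by simp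

lemma FM_lm [simp]: "lmod R M ==> left_module S (FM M)"
proof -
 assume M: "lmod R M"
 then interpret M: left_module R M .
 show ?thesis
 proof (rule left_moduleI[OF S_ring], goal_cases)
  case (6 x)
  then show ?case using M by (intro bexI[of _ "\<ominus>\<^sub>M x"]) (auto simp: M.smult_r_minus M.M.l_neg)
 qed (use M in \<open>auto simp: M.smult_r_null M.smult_r_distr S_carrier M.smult_closed M.M.a_ac M.smult_l_distr
   simp flip: M.smult_assoc1\<close>)
qed

lemma FM_inv [simp]:
 assumes "lmod R M" "x:el M" "a\<odot>\<^sub>M x = x"
 shows "\<ominus>\<^bsub>FM M\<^esub> x =\<ominus>\<^sub>M x"
proof -
 interpret M: left_module R M by fact
 interpret FM: left_module S "FM M" using assms(1) by simp
 show ?thesis by (rule FM.M.minus_equality) (use assms in \<open>auto simp: M.smult_r_minus M.M.l_neg\<close>)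
qed

lemma hm_FM_closed: "f:hm M N ==> lmod R M ==> lmod R N ==> x:el M ==> a\<odot>\<^sub>M x = x ==>
  a\<odot>\<^sub>N f x = f x" using hm_smult[of f M N a x] by simp

lemma F_hm: "f:hm M N ==> lmod R M ==> lmod R N ==> restrict f (el (FM M)):S.hm (FM M) (FM N)"
 by (rule S.hm_restrictI) (auto simp: hm_closed hm_FM_closed hm_add hm_smult S_carrier)

text \<open>The left module a\<Lambda> over the corner ring. Its elements are ring elements, so its
  projectivity is expressed by a dual basis and not by \<open>is_projective\<close>.\<close>

definition aR :: "('r, 'r) module" where
 "aR = \<lparr>carrier = {x\<in>el R. a\<otimes> x = x}, mult = (\<otimes>), one = \<one>, zero = \<zero>, add = (\<oplus>), smult = (\<otimes>)\<rparr>"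

lemma aR_lm: "left_module S aR"
proof (rule left_moduleI[OF S_ring], goal_cases)
 case (6 x)
 then show ?case by (intro bexI[of _ "\<ominus> x"]) (auto simp: aR_def r_minus l_neg)
qed (auto simp: aR_def S_carrier r_distr l_distr a_ac simp flip: m_assoc)

end

text \<open>The condition says that a\<Lambda> is a finitely generated projective left module over
  the corner ring. It makes \<open>F\<close> preserve finite generation and projectivity.\<close>

locale corner = idem +
 assumes aR_factors: "factors S aR aR (\<lambda>x. x)"
begin

text \<open>For x in aP the values of a linear form on P lie in a\<Lambda>. There they are expanded
  by the dual basis of \<open>aR\<close>, and multiplication with the vector \<open>m\<close>
  carries the result into aP.\<close>

lemma FM_factors:
 assumes P: "lmod R P" and id: "factors R P P (\<lambda>x. x)"
 shows "factors S (FM P) (FM P) (\<lambda>x. x)"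
proof -
 interpret P: left_module R P by fact
 interpret FP: left_module S "FM P" using P by simp
 obtain l where l: "dual_list R P P l" "!!x. x:el P ==> x = comb P l x" using factorsE[OF id] by blast
 have "factors S (FM P) (FM P) (comb P l)" using l(1)
 proof (induction l)
  case Nil
  show ?case by (rule factors_cong[OF FP.factors_zero]) simp
 next
  case (Cons q l)
  obtain \<phi> m where q: "q = (\<phi>, m)" by (cases q)
  have phi: "linear_form R P \<phi>" "m:el P" using Cons.prems q by auto
  have "factors S (FM P) aR \<phi>" by (rule factors_pre[OF aR_factors, where h = \<phi>])
    (use linear_formD[OF phi(1)] linear_formD(3)[OF phi(1) a] P in \<open>auto simp: aR_def S_carrier simp flip: linear_formD(3)[OF phi(1)]\<close>)
  then have "factors S (FM P) (FM P) (\<lambda>x. \<phi> x\<odot>\<^sub>P m)"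
   by (rule factors_post[OF aR_lm, where h = "\<lambda>y. y\<odot>\<^sub>P m"])
    (use P phi in \<open>auto simp: aR_def S_carrier P.smult_closed P.smult_l_distr P.smult_l_null simp flip: P.smult_assoc1\<close>)
  from FP.factors_add[OF this Cons.IH] show ?case by (rule factors_cong) (use Cons.prems q in auto)
 qed
 then show ?thesis by (rule factors_cong) (use l(2) P in simp)
qed

lemma FM_projective: "is_projective R P ==> is_projective S (FM P)"
proof -
 assume P: "is_projective R P"
 then have "lmod R P" unfolding is_projective_def by simp
 then show ?thesis by (intro S.factors_projective FM_factors FM_lm projective_factors P)
qed

text \<open>A free cover of M stays surjective after applying \<open>F\<close>, since a preimage of
  a fixed element can be multiplied by \<open>a\<close>; and the image of the free module is
  finitely generated by \<open>FM_factors\<close>.\<close>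

lemma FM_MOD [simp]: "M:MOD ==> FM M:S.MOD"
proof -
 assume M: "M:MOD"
 then have L: "lmod R M" by simp
 then interpret M: left_module R M .
 obtain n m where m: "\<forall>i<n. m i:el M" "(\<lambda>x. lc M n x m) ` el (free_mod R n) = el M" using free_surj[OF M] .
 let ?e = "\<lambda>x\<in>el (free_mod R n). lc M n x m"
 note FL = free_left_module[of n]
 interpret FL: left_module R "free_mod R n" by (rule FL)
 have e: "?e:hm (free_mod R n) M" using m(1) by (intro lc_hm L) auto
 let ?Fe = "restrict ?e (el (FM (free_mod R n)))"
 have "x:?Fe ` el (FM (free_mod R n))" if x: "x:el (FM M)" for x
 proof -
  have "x:?e ` el (free_mod R n)" using x m(2) L by simp
  then obtain y where y: "y:el (free_mod R n)" "?e y = x" by blast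
  have "?e (a\<odot>\<^bsub>free_mod R n\<^esub> y) = x" using hm_smult[OF e a y(1)] y(2) x L by simp
  then show ?thesis using FL y(1) FL.smult_closed[OF a y(1)]
   by (intro image_eqI[of _ _ "a\<odot>\<^bsub>free_mod R n\<^esub> y"]) (simp_all add: FL.smult_assoc1[symmetric])
 qed
 then have "?Fe ` el (FM (free_mod R n)) = el (FM M)" using S.hm_closed[OF F_hm[OF e FL L]] by blast
 from S.hm_surj_fin_gen[OF F_hm[OF e FL L] FM_lm[OF FL] FM_lm[OF L] _ this] show ?thesis
  using FM_lm[OF L] S.MOD_fg[OF S.factors_MOD[OF FM_lm[OF FL] FM_factors[OF FL free_factors]]] by (simp add: S.MOD_iff)
qed

lemma F_restrict_comp: "lmod R M ==> lmod R N ==> f:hm M N ==>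
  restrict (compose (el M) g f) (el (FM M)) =
  compose (el (FM M)) (restrict g (el (FM N))) (restrict f (el (FM M)))" by (auto simp: compose_def fun_eq_iff hm_closed hm_FM_closed)

lemma F_functor: "is_functor (mod_cat R) (mod_cat S) F"
proof -
 have [simp]: "Hom (mod_cat B) = mod_hom B" "Ident (mod_cat B) = (\<lambda>M. \<lambda>x\<in>el M. x)"
  "Comp (mod_cat B) = (\<lambda>M N P g f. compose (el M) g f)" for B :: "'r ring" by (simp_all add: mod_cat_def)
 show ?thesis unfolding is_functor_def
 proof (intro conjI ballI, goal_cases)
  case (2 M N f)
  then show ?case by (simp add: F_mor F_hm)
 next
  case (3 M)
  then show ?case by (simp add: F_mor fun_eq_iff)
 next
  case (4 M N P f g)
  then show ?case by (simp add: F_mor F_restrict_comp)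
 qed simp
qed

lemma F_exact: "exact_functor R S F" unfolding exact_functor_def
proof (intro conjI F_functor ballI allI impI)
 fix M N f g assume *: "M:MOD" "N:MOD" "f:hm M N" "g:hm M N"
 show "mor F M N (\<lambda>x\<in>el M. f x\<oplus>\<^sub>N g x) =
   (\<lambda>x\<in>el (FM M). mor F M N f x\<oplus>\<^bsub>FM N\<^esub> mor F M N g x)" using * by (auto simp: F_mor fun_eq_iff)
next
 fix L M N f g assume *: "L:MOD" "M:MOD" "N:MOD" and "short_exact R L M N f g"
 then have e: "f:hm L M" "g:hm M N" "inj_on f (el L)" "f ` el L = {x\<in>el M. g x = \<zero>\<^sub>N}"
  "g ` el M = el N" unfolding short_exact_def by auto
 have lm [simp]: "lmod R L" "lmod R M" "lmod R N" using * by auto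
 interpret L: left_module R L by simp
 interpret M: left_module R M by simp
 interpret N: left_module R N by simp
 have gf: "f x:el M" "g (f x) = \<zero>\<^sub>N" if "x:el L" for x using e(4) that by auto
 show "short_exact S (FM L) (FM M) (FM N) (mor F L M f) (mor F M N g)" unfolding short_exact_def F_mor
 proof (intro conjI F_hm e lm Set.set_eqI)
  show "inj_on (restrict f (el (FM L))) (el (FM L))" using e(3) by (auto simp: inj_on_def)
  fix x
  show "x:restrict f (el (FM L)) ` el (FM L)\<longleftrightarrow>
    x:{x\<in>el (FM M). restrict g (el (FM M)) x = \<zero>\<^bsub>FM N\<^esub>}"
  proof
   assume "x:{x\<in>el (FM M). restrict g (el (FM M)) x = \<zero>\<^bsub>FM N\<^esub>}"
   then have x: "x:el M" "a\<odot>\<^sub>M x = x" "x:f ` el L" using e(4) by auto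
   then obtain y where y: "y:el L" "x = f y" by blast
   have "f (a\<odot>\<^sub>L y) = f y" using x y hm_smult[OF e(1) a y(1)] by simp
   then have "a\<odot>\<^sub>L y = y" using e(3) y L.smult_closed[OF a y(1)] by (simp add: inj_on_def)
   then show "x:restrict f (el (FM L)) ` el (FM L)" using y by (intro image_eqI[of _ _ y]) auto
  qed (use gf hm_FM_closed[OF e(1)] in auto)
  show "x:restrict g (el (FM M)) ` el (FM M)\<longleftrightarrow>x:el (FM N)"
  proof
   assume x: "x:el (FM N)"
   then have "x:g ` el M" using e(5) by simp
   then obtain y where y: "y:el M" "x = g y" by blast
   then have "g (a\<odot>\<^sub>M y) = x" using x hm_smult[OF e(2) a y(1)] by simp
   then show "x:restrict g (el (FM M)) ` el (FM M)" using y M.smult_closed[OF a y(1)]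
    by (intro image_eqI[of _ _ "a\<odot>\<^sub>M y"]) (simp_all add: M.smult_assoc1[symmetric])
  qed (use hm_closed[OF e(2)] hm_FM_closed[OF e(2)] in auto)
 qed
qed

end

section \<open>The corner functor on complexes and triangles\<close>

context corner
begin

lemma FX_sel [simp]: "cobj (FX X) n = FM (cobj X n)" "cdiff (FX X) n = restrict (cdiff X n) (el (FM (cobj X n)))"
 unfolding complex_image_def F_mor by simp_all

lemma FX_cplx [simp]:
 assumes "cplx R X"
 shows "cplx S (FX X)"
proof -
 interpret X: cplx R X by fact
 show ?thesis
 proof (rule S.cplxI)
  show "finite {n. cel (FX X) n~={\<zero>\<^sub>(FX X)\<^sup>n}}"
  proof (rule finite_subset[OF _ X.bounded], clarsimp)
   fix n assume "el (FM (cobj X n))~={\<zero>\<^sub>X\<^sup>n}" "cel X n = {\<zero>\<^sub>X\<^sup>n}"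
   then show False using FM_carrier[OF X.X_lm, of _ n] X.C.smult_r_null[OF a, of n] by (metis subsetI subset_antisym singletonD singletonI)
  qed
 qed (simp_all add: F_hm hm_FM_closed[OF X.d_hm])
qed

lemma F_chmap [simp]:
 assumes "chmap R X Y f"
 shows "chmap S (FX X) (FX Y) (Fm X f)"
proof -
 interpret chmap R X Y f by fact
 have "chmap S (FX X) (FX Y) (\<lambda>n. \<lambda>x\<in>cel (FX X) n. f n x)" by (rule S.chmap_restrictI)
   (simp_all add: X.cplx_axioms Y.cplx_axioms hm_FM_closed[OF f_hm] hm_FM_closed[OF X.d_hm] S_carrier f_smult)
 then show ?thesis by simp
qed

lemma F_homotopic:
 assumes "homotopic R X Y f g" "cplx R X" "cplx R Y"
 shows "homotopic S (FX X) (FX Y) (Fm X f) (Fm X g)"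
proof -
 obtain h where h: "hmtp R X Y h" and e: "!!n x. x:cel X n ==>
   f n x = g n x\<oplus>\<^sub>Y\<^sup>n (cdiff Y (n-1) (h n x)\<oplus>\<^sub>Y\<^sup>n h (n+1) (cdiff X n x))"
  by (rule homotopicE[OF assms]) (rule that)
 interpret hmtp R X Y h by fact
 show ?thesis
 proof (rule S.homotopicI)
  show "hmtp S (FX X) (FX Y) (\<lambda>n. \<lambda>x\<in>cel (FX X) n. h n x)" by (rule S.hmtp_restrictI)
    (simp_all add: X.cplx_axioms Y.cplx_axioms hm_FM_closed[OF h] S_carrier h_smult)
 qed (simp add: e hm_FM_closed[OF h] hm_FM_closed[OF X.d_hm])
qed

abbreviation "FK\<equiv>Kb_func S F"

lemma FK_ob [simp]: "ob FK X = FX X" unfolding Kb_func_def by simp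

lemma FK_hcl:
 assumes "chmap R X Y f"
 shows "mor FK X Y (hcl X Y f) = S.hcl (FX X) (FX Y) (Fm X f)"
proof -
 have X: "cplx R X" "cplx R Y" using assms chmap_cplx by blast+
 have 1: "homotopic S (FX X) (FX Y) (Fm X f') g\<longleftrightarrow>homotopic S (FX X) (FX Y) (Fm X f) g"
  if "f':hcl X Y f" "chmap S (FX X) (FX Y) g" for f' g
 proof -
  have f': "chmap R X Y f'" "homotopic R X Y f f'" using that hcl_mem[OF assms] by auto
  note 2 = F_homotopic[OF f'(2) X]
  from S.homotopic_trans[OF 2] S.homotopic_trans[OF S.homotopic_sym[OF 2]] show ?thesis
   using F_chmap[OF assms] F_chmap[OF f'(1)] that(2) by blast
 qed
 have "f:hcl X Y f" using assms homotopic_refl by (simp add: hcl_mem)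
 then show ?thesis unfolding Kb_func_def homotopy_class_def[of S] F_mor using 1 S.chmap_iff X FX_cplx by auto
qed

lemma FK_functor: "is_functor (Kb R) (Kb S) FK" unfolding is_functor_def
proof (intro conjI ballI; simp)
 fix X Y c assume X: "cplx R X" "cplx R Y" and "c:Hom (Kb R) X Y"
 then obtain f where f: "chmap R X Y f" "c = hcl X Y f" using Kb_HomE by metis
 then show "mor FK X Y c:Hom (Kb S) (FX X) (FX Y)"
  using S.Kb_Hom[OF FX_cplx[OF X(1)] FX_cplx[OF X(2)]] F_chmap[OF f(1)] unfolding f(2) FK_hcl[OF f(1)] by blast
next
 fix X assume X: "cplx R X"
 then interpret X: cplx R X .
 have "Fm X (id_map X) = S.id_map (FX X)" by (auto simp: fun_eq_iff)
 then show "mor FK X X (hcl X X (id_map X)) = S.hcl (FX X) (FX X) (\<lambda>n. \<lambda>x\<in>el (FM (cobj X n)). x)"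
  using FK_hcl[OF chmap_id[OF X]] by simp
next
 fix X Y Z c d assume X: "cplx R X" "cplx R Y" "cplx R Z" and "c:Hom (Kb R) X Y" "d:Hom (Kb R) Y Z"
 then obtain f g where f: "chmap R X Y f" "c = hcl X Y f" and g: "chmap R Y Z g" "d = hcl Y Z g" using Kb_HomE by metis
 interpret f: chmap R X Y f by (rule f)
 have "Fm X (cmp_map X g f) = S.cmp_map (FX X) (Fm Y g) (Fm X f)"
  unfolding FX_sel by (rule ext) (rule F_restrict_comp[OF f.X.X_lm f.Y.X_lm f.f_hm])
 then show "mor FK X Z (Comp (Kb R) X Y Z d c) = Comp (Kb S) (FX X) (FX Y) (FX Z) (mor FK Y Z d) (mor FK X Y c)"
  using f g by (simp add: Kb_Comp FK_hcl chmap_comp S.Kb_Comp)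
qed

text \<open>An equality of records, as are \<open>FM_ds\<close> and \<open>FX_cone\<close>:
  \<open>F\<close> only shrinks carriers and leaves all operations alone. This makes the induced
  functor strict and maps standard triangles to standard triangles.\<close>

lemma FX_shift: "cplx R X ==> FX (shift X) = shift (FX X)"
proof -
 assume "cplx R X"
 then interpret X: cplx R X .
 show ?thesis unfolding complex_image_def shift_complex_def F_mor by (auto simp: fun_eq_iff hm_FM_closed[OF X.d_hm])
qed

lemma FM_ds: "lmod R M ==> lmod R N ==> FM (direct_sum M N) = direct_sum (FM M) (FM N)"
proof -
 assume lm: "lmod R M" "lmod R N"
 have "el (FM (direct_sum M N)) = el (direct_sum (FM M) (FM N))" using lm ds_left_module[OF lm] by (auto elim!: ds_carrierE)
 then show ?thesis by (intro module.equality) (simp_all, simp_all add: direct_sum_def corner_functor_def)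
qed

lemma FX_cone:
 assumes "chmap R X Y f"
 shows "FX (cone X Y f) = cone (FX X) (FX Y) (Fm X f)"
proof -
 interpret chmap R X Y f by fact
 have o: "FM (direct_sum (cobj X (n+1)) (cobj Y n)) = direct_sum (FM (cobj X (n+1))) (FM (cobj Y n))" for n by (rule FM_ds) simp_all
 have "cdiff (FX (cone X Y f)) n = cdiff (cone (FX X) (FX Y) (Fm X f)) n" for n unfolding FX_sel cone_obj o
  by (auto simp: fun_eq_iff mapping_cone_def o hm_FM_closed[OF X.d_hm] elim!: ds_carrierE)
 moreover have "cobj (FX (cone X Y f)) = cobj (cone (FX X) (FX Y) (Fm X f))" by (simp add: fun_eq_iff o)
 ultimately show ?thesis by (intro cochain.equality) auto
qed

lemma FK_shift: "strict_shift (Kb R) (Kb S) FK" unfolding strict_shift_def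
proof (intro conjI ballI; simp add: FX_shift)
 fix X Y c assume X: "cplx R X" "cplx R Y" and "c:Hom (Kb R) X Y"
 then obtain f where f: "chmap R X Y f" "c = hcl X Y f" using Kb_HomE by metis
 then show "mor FK (shift X) (shift Y) (ShiftMor (Kb R) X Y c) = ShiftMor (Kb S) (FX X) (FX Y) (mor FK X Y c)"
  using X by (simp add: Kb_ShiftMor FK_hcl shift_chmap S.Kb_ShiftMor FX_shift)
qed

lemma FK_std_tri:
 assumes f: "chmap R X Y f" and t: "(A, B, C, u, v, w) = std_tri X Y f"
 shows "(ob FK A, ob FK B, ob FK C, mor FK A B u, mor FK B C v, mor FK C (Shift (Kb R) A) w)
  = S.std_tri (FX X) (FX Y) (Fm X f)"
proof -
 interpret chmap R X Y f by (rule f)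
 have o: "FM (direct_sum (cobj X (n+1)) (cobj Y n)) = direct_sum (FM (cobj X (n+1))) (FM (cobj Y n))" for n by (rule FM_ds) simp_all
 have "Fm Y (cone_inclusion X Y) = cone_inclusion (FX X) (FX Y)"
  "Fm (cone X Y f) (cone_projection X Y) = cone_projection (FX X) (FX Y)"
  by (auto simp: fun_eq_iff cone_inclusion_def cone_projection_def o elim!: ds_carrierE)
 then show ?thesis using t unfolding std_tri_def S.std_tri_def
  by (simp add: FK_hcl assms(1) cone_incl cone_proj FX_cone FX_shift X.cplx_axioms)
qed

lemma FK_Dist:
 assumes "(X, Y, Z, u, v, w):Dist (Kb R)"
 shows "(ob FK X, ob FK Y, ob FK Z, mor FK X Y u, mor FK Y Z v, mor FK Z (Shift (Kb R) X) w):Dist (Kb S)"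
proof -
 have 1: "is_functor (Kb_base R) (Kb_base S) FK" "strict_shift (Kb_base R) (Kb_base S) FK"
  "is_functor (Kb_base R) (Kb_base R) (shift_func (Kb_base R))"
  using FK_functor FK_shift Kb_shift unfolding Kb_def is_functor_def strict_shift_def shift_func_def with_triangles_def by simp_all
 have sh: "Shift (Kb_base R) = Shift (Kb R)" unfolding Kb_def with_triangles_def by simp
 have tri: "is_triangle (Kb_base R) t" if "t:{std_tri X Y f | X Y f. chmap R X Y f}" for t using that std_tri_triangle by auto
 have im: "(ob FK A, ob FK B, ob FK C, mor FK A B u, mor FK B C v, mor FK C (Shift (Kb_base R) A) w)
  :{S.std_tri X Y f | X Y f. chmap S X Y f}" if t: "(A, B, C, u, v, w):{std_tri X Y f | X Y f. chmap R X Y f}" for A B C u v w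
 proof -
  obtain X Y f where f: "chmap R X Y f" "(A, B, C, u, v, w) = std_tri X Y f" using t by blast
  show ?thesis unfolding sh FK_std_tri[OF f] using F_chmap[OF f(1)] by auto
 qed
 show ?thesis unfolding S.Kb_wt sh[symmetric] by (rule Dist_image[OF 1 tri im]) (assumption | rule assms[unfolded Kb_wt])+
qed

lemma F_acyc: "cplx R X ==> acyc X ==> acyc (FX X)"
proof -
 assume X: "cplx R X" "acyc X"
 then interpret X: cplx R X by simp
 show ?thesis unfolding acyc_def
 proof (intro allI ballI impI)
  fix n x assume x: "x:cel (FX X) n" "cdiff (FX X) n x = \<zero>\<^sub>(FX X)\<^sup>(n+1)"
  then obtain y where y: "y:cel X (n-1)" "cdiff X (n-1) y = x" using acycD[OF X(2), of x n] by auto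
  then have "cdiff X (n-1) (a\<odot>\<^sub>X\<^sup>(n-1) y) = x" using x(1) X.d_smult[OF a y(1)] by simp
  then show "\<exists>x'\<in>cel (FX X) (n-1). cdiff (FX X) (n-1) x' = x"
   using y(1) by (intro bexI[of _ "a\<odot>\<^sub>X\<^sup>(n-1) y"]) (simp_all add: X.C.smult_assoc1[symmetric])
 qed
qed

lemma F_qis:
 assumes "chmap R X Y f" "qis X Y f"
 shows "qis (FX X) (FX Y) (Fm X f)"
 using F_acyc[OF cone_cplx[OF assms(1)]] assms(2) acyc_cone_iff[OF assms(1)] S.acyc_cone_iff[OF F_chmap[OF assms(1)]]
 unfolding FX_cone[OF assms(1)] by simp

lemma F_PROJ: "P:PROJ ==> FX P:S.PROJ" by (simp add: PROJ_iff S.PROJ_iff FM_projective)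

lemma F_perf: "X:perf ==> FX X:S.perf"
proof -
 assume "X:perf"
 then obtain P f where P: "cplx R X" "P:PROJ" "chmap R P X f" "qis P X f" unfolding perf_def by auto
 then show ?thesis using F_PROJ[OF P(2)] F_chmap[OF P(3)] F_qis[OF P(3,4)] unfolding S.perf_def
  by (intro CollectI conjI exI[of _ "FX P"] exI[of _ "Fm P f"] FX_cplx)
qed

lemma FK_den:
 assumes "nullsys R N" "nullsys S N'" "!!X. X:N ==> FX X:N'" "s:denominators (Kb R) N X Y"
 shows "mor FK X Y s:denominators (Kb S) N' (FX X) (FX Y)"
proof -
 interpret N: nullsys R N by fact
 interpret N': nullsys S N' by fact
 obtain f where f: "N.W X Y f" "s = hcl X Y f" using assms(4) unfolding N.den_iff by auto
 then have c: "chmap R X Y f" "cone X Y f:N" unfolding N.W_def by auto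
 then have "N'.W (FX X) (FX Y) (Fm X f)" unfolding N'.W_def using assms(3)[OF c(2)] FX_cone[OF c(1)] by simp
 then show ?thesis unfolding N'.den_iff f(2) FK_hcl[OF c(1)] by auto
qed

lemma FK_two_step: "two_step_functor (Kb R) (acyclic_complexes R) perf PROJ (Kb S) (acyclic_complexes S) S.perf S.PROJ FK"
proof (intro two_step_functor.intro two_step_Kb S.two_step_Kb two_step_functor_axioms.intro FK_functor FK_shift FK_Dist)
 show "mor FK X Y s:denominators (Kb S) (acyclic_complexes S) (ob FK X) (ob FK Y)"
  if "s:denominators (Kb R) (acyclic_complexes R) X Y" for s X Y
  using FK_den[OF nullsys_acyclic S.nullsys_acyclic _ that] F_acyc by (simp add: acyclic_iff S.acyclic_iff)
 show "mor FK X Y s:denominators (Kb S) S.perf (ob FK X) (ob FK Y)" if "s:denominators (Kb R) perf X Y" for s X Y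
  using FK_den[OF nullsys_perf S.nullsys_perf F_perf that] by simp
qed

end

lemma (in left_module) lc_cong: "(!!i. i < n ==> x i\<odot>\<^sub>M m i = x' i\<odot>\<^sub>M m i) ==> lc M n x m = lc M n x' m"
 by (induction n) auto

section \<open>The left adjoint on modules\<close>

context corner
begin

text \<open>\<open>universal N G \<eta>\<close>: the map \<open>\<eta>\<close> exhibits \<open>G\<close> as the value at \<open>N\<close> of a left adjoint of \<open>F\<close>,
 that is, as \<open>\<Lambda>a \<otimes> N\<close>.\<close>

definition universal :: "'a fgmod=>'a fgmod=>'a modmap=>bool" where
 "universal N G \<eta>\<longleftrightarrow>G:MOD&\<eta>:S.hm N (FM G)&bij_betw \<eta> (el N) (el (FM G))&
  (\<forall>M\<in>MOD. \<forall>f\<in>S.hm N (FM M). \<exists>g\<in>hm G M. \<forall>x\<in>el N. g (\<eta> x) = f x)&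
  (\<forall>M\<in>MOD. \<forall>g\<in>hm G M. \<forall>g'\<in>hm G M. (\<forall>x\<in>el N. g (\<eta> x) = g' (\<eta> x))-->g = g')"

text \<open>With N presented as a quotient of the free module of rank n over the corner ring, G is
  the quotient of the free module of the same rank over \<open>R\<close> by two kinds of elements:
  those with components in R(1 - a), which leave (Ra)^n, and the relations of N. The work lies in
  showing that this creates no new relations in the corner.\<close>

lemma universal_ex:
 assumes N: "N:S.MOD"
 shows "\<exists>G \<eta>. universal N G \<eta>"
proof -
 have NL: "left_module S N" using N by simp
 interpret N: left_module S N by (rule NL)
 obtain n y where y: "\<forall>i<n. y i:el N" "(\<lambda>x. lc N n x y) ` el (free_mod S n) = el N" using S.free_surj[OF N] .
 let ?U = "free_mod R n"
 note UL = free_left_module[of n]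
 interpret U: left_module R ?U by (rule UL)
 \<comment> \<open>Evaluation in N through the corner parts a x a of the coordinates. It is defined
   on all of the free module but linear over the corner only on the vectors fixed by
   \<open>a\<close>.\<close>
 define ev where "ev x = lc N n (\<lambda>i. a\<otimes> x i\<otimes> a) y" for x
 have corner_mem: "a\<otimes> x\<otimes> a:el S" if "x:el R" for x using that by (simp add: S_carrier m_assoc)
 have evc: "ev x:el N" if "x:el ?U" for x unfolding ev_def using y(1) corner_mem free_mem[OF that] by (intro N.lc_closed) auto
 have ev_add: "ev (x\<oplus>\<^sub>?U z) = ev x\<oplus>\<^sub>N ev z" if "x:el ?U" "z:el ?U" for x z
  using N.lc_add[of n "\<lambda>i. a\<otimes> x i\<otimes> a" "\<lambda>i. a\<otimes> z i\<otimes> a" y] y(1) corner_mem free_mem[OF that(1)] free_mem[OF that(2)]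
  by (simp add: ev_def free_ops r_distr l_distr)
 have ev_smult: "ev (r\<odot>\<^sub>?U x) = (a\<otimes> r\<otimes> a)\<odot>\<^sub>N ev x"
  if x: "x:el ?U" "a\<odot>\<^sub>?U x = x" and r: "r:el R" for r x
 proof -
  have "a\<otimes> x i = x i" for i using fun_cong[OF x(2), of i] by (simp add: free_ops)
  then have "a\<otimes> (r\<otimes> x i)\<otimes> a = (a\<otimes> r\<otimes> a)\<otimes> (a\<otimes> x i\<otimes> a)" for i
   using r free_mem[OF x(1), of i] by (simp add: m_assoc) (simp flip: m_assoc)
  then show ?thesis using N.lc_smult[of n "\<lambda>i. a\<otimes> x i\<otimes> a" y "a\<otimes> r\<otimes> a"] y(1) corner_mem free_mem[OF x(1)] r
   by (simp add: ev_def free_ops)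
 qed
 have FU: "x:el (FM ?U)\<longleftrightarrow>x:el ?U&a\<odot>\<^sub>?U x = x" for x using UL by simp
 define E where "E = (\<lambda>x\<in>el (FM ?U). ev x)"
 have E: "E:S.hm (FM ?U) N" unfolding E_def by (rule S.hm_restrictI) (use UL evc ev_add ev_smult in \<open>auto simp: S_carrier\<close>)
 have Esurj: "\<exists>x\<in>el (FM ?U). E x = z" if "z:el N" for z
 proof -
  have "z:(\<lambda>x. lc N n x y) ` el (free_mod S n)" using y(2) that by simp
  then obtain x where x: "x:el (free_mod S n)" "lc N n x y = z" by blast
  have xS: "x i:el R" "a\<otimes> x i = x i" "x i\<otimes> a = x i" for i using S.free_mem[OF x(1), of i] by (simp_all add: S_carrier)
  have "x:el (FM ?U)" using x(1) xS by (simp add: UL free_carrier S.free_carrier free_ops)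
  then show ?thesis using x(2) xS by (intro bexI[of _ x]) (simp_all add: E_def ev_def)
 qed
 \<comment> \<open>The relations of N, and the vectors whose coordinates are killed by
   \<open>a\<close> on the right.\<close>
 define A where "A = {x\<in>el ?U. (a\<odot>\<^sub>?U x = x&ev x = \<zero>\<^sub>N)\<or>(\<forall>i. x i\<otimes> a = \<zero>)}"
 define T where "T = \<Inter>{H. submod R ?U H&A<=H}"
 have AT: "A<=T" unfolding T_def by auto
 have T_sub: "T<=H" if "submod R ?U H" "A<=H" for H unfolding T_def using that by auto
 have T: "submod R ?U T"
 proof (rule submodI)
  show "T<=el ?U" by (rule T_sub[OF submod_carrier[OF UL]]) (auto simp: A_def)
 qed (unfold T_def, auto dest: submodD(3,4,5))
 have T2: "ev x = \<zero>\<^sub>N" if "x:T" for x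
 proof -
  \<comment> \<open>The vectors all of whose multiples evaluate to zero form a submodule that
    contains \<open>A\<close>, hence \<open>T\<close>. So \<open>T\<close> meets the corner only in
    relations of N, which is the injectivity of the universal arrow.\<close>
  let ?T2 = "{x\<in>el ?U. \<forall>r\<in>el R. ev (r\<odot>\<^sub>?U x) = \<zero>\<^sub>N}"
  have z: "ev \<zero>\<^sub>?U = \<zero>\<^sub>N" using S.hm_zero[OF E FM_lm[OF UL] NL] FU U.smult_r_null[OF a] by (simp add: E_def)
  have "submod R ?U ?T2" by (rule submodI) (auto simp: z ev_add U.smult_closed U.smult_r_null U.smult_r_distr simp flip: U.smult_assoc1)
  moreover have "A<=?T2"
  proof
   fix x assume x: "x:A"
   have "ev (r\<odot>\<^sub>?U x) = \<zero>\<^sub>N" if r: "r:el R" for r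
   proof (cases "a\<odot>\<^sub>?U x = x&ev x = \<zero>\<^sub>N")
    case True
    then show ?thesis using x r corner_mem[OF r] by (simp add: A_def ev_smult N.smult_r_null)
   next
    case False
    then have "x i\<otimes> a = \<zero>" for i using x unfolding A_def by auto
    then have "a\<otimes> (r\<otimes> x i)\<otimes> a = \<zero>" for i using x r free_mem[of x n i] by (simp add: A_def m_assoc)
    then show ?thesis using z by (simp add: ev_def free_ops)
   qed
   then show "x:?T2" using x by (simp add: A_def)
  qed
  ultimately have "x:?T2" using T_sub that by blast
  then have "ev (\<one>\<odot>\<^sub>?U x) = \<zero>\<^sub>N" by blast
  then show ?thesis using \<open>x \<in> ?T2\<close> by (simp add: U.smult_one)
 qed
 obtain G \<pi> where G: "G:MOD" "\<pi>:hm ?U G" "\<pi> ` el ?U = el G"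
  "!!x. x:el ?U ==> \<pi> x = \<zero>\<^sub>G\<longleftrightarrow>x:T" using quotient_module[OF free_MOD T] by metis
 have GL: "lmod R G" using G(1) by simp
 interpret G: left_module R G by (rule GL)
 have hE: "E ` el (FM ?U) = el N" using Esurj S.hm_closed[OF E] by (auto simp: image_def)
 have hk: "restrict \<pi> (el (FM ?U)) x = \<zero>\<^bsub>FM G\<^esub>" if "x:el (FM ?U)" "E x = \<zero>\<^sub>N" for x
 proof -
  have "x:A" using that FU by (simp add: A_def E_def)
  then show ?thesis using that(1) AT G(4)[of x] FU by auto
 qed
 obtain \<eta> where e: "\<eta>:S.hm N (FM G)" "!!x. x:el (FM ?U) ==> \<eta> (E x) = restrict \<pi> (el (FM ?U)) x"
  by (rule S.hm_factor[OF E hE F_hm[OF G(2) UL GL] FM_lm[OF UL] NL FM_lm[OF GL] hk]) (assumption | rule that)+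
 have e2: "\<eta> (E x) = \<pi> x" if "x:el ?U" "a\<odot>\<^sub>?U x = x" for x using e(2)[of x] that UL by simp
 have surj: "q:\<eta> ` el N" if q: "q:el (FM G)" for q
 proof -
  have q': "q:el G" "a\<odot>\<^sub>G q = q" using q GL by auto
  then have "q:\<pi> ` el ?U" using G(3) by simp
  then obtain z where z: "z:el ?U" "q = \<pi> z" by blast
  let ?z = "a\<odot>\<^sub>?U z"
  have z': "?z:el ?U" "a\<odot>\<^sub>?U ?z = ?z" using z U.smult_closed by (simp_all flip: U.smult_assoc1)
  have "\<eta> (E ?z) = q" using e2[OF z'] hm_smult[OF G(2) a z(1)] z(2) q'(2) by simp
  moreover have "E ?z:el N" using S.hm_closed[OF E] FU z' by simp
  ultimately show ?thesis by (intro image_eqI[of _ _ "E ?z"]) simp_all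
 qed
 have ker: "z = \<zero>\<^sub>N" if z: "z:el N" "\<eta> z = \<zero>\<^sub>G" for z
 proof -
  obtain x where x: "x:el (FM ?U)" "E x = z" using Esurj z(1) by blast
  then have "x:T" using e2[of x] z(2) FU G(4)[of x] by simp
  from T2[OF this] show ?thesis using x by (simp add: E_def)
 qed
 have inj: "inj_on \<eta> (el N)"
 proof (rule inj_onI)
  fix z z' assume z: "z:el N" "z':el N" "\<eta> z = \<eta> z'"
  have c: "\<eta> z':el G" "a\<odot>\<^sub>G \<eta> z' = \<eta> z'" using S.hm_closed[OF e(1) z(2)] GL by auto
  have "\<eta> (z\<oplus>\<^sub>N\<ominus>\<^sub>N z') = \<zero>\<^sub>G"
   using z c S.hm_minus[OF e(1) NL FM_lm[OF GL] z(2)] GL by (simp add: S.hm_add[OF e(1)] G.M.r_neg)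
  then show "z = z'" using ker[of "z\<oplus>\<^sub>N\<ominus>\<^sub>N z'"] z by (simp add: N.M.add_minus_zero_iff)
 qed
 have bij: "bij_betw \<eta> (el N) (el (FM G))" using inj surj S.hm_closed[OF e(1)] unfolding bij_betw_def by blast
 have ext: "\<exists>g\<in>hm G M. \<forall>x\<in>el N. g (\<eta> x) = f x" if M: "M:MOD" and f: "f:S.hm N (FM M)" for M f
 proof -
  have LM: "lmod R M" using M by simp
  interpret M: left_module R M by (rule LM)
  let ?m = "\<lambda>i. f (y i)"
  have m: "?m i:el M" "a\<odot>\<^sub>M ?m i = ?m i" if "i < n" for i using S.hm_closed[OF f, of "y i"] y(1) that LM by auto
  \<comment> \<open>The unit vectors go to the images under \<open>f\<close> of the generators.
    These are fixed by \<open>a\<close>, so \<open>?p\<close> kills vectors with components in R(1 -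
    a), and on the corner it agrees with \<open>f\<close> after evaluation.\<close>
  let ?p = "\<lambda>x\<in>el ?U. lc M n x ?m"
  have p: "?p:hm ?U M" using m by (intro lc_hm[OF LM])
  have ma: "(r\<otimes> a)\<odot>\<^sub>M ?m i = r\<odot>\<^sub>M ?m i" if "i < n" "r:el R" for r i
   using m[OF that(1)] that(2) by (simp add: M.smult_assoc1)
  have pf: "?p x = f (E x)" if x: "x:el ?U" "a\<odot>\<^sub>?U x = x" for x
  proof -
   have ax: "a\<otimes> x i = x i" for i using fun_cong[OF x(2), of i] by (simp add: free_ops)
   have "lc M k x ?m = f (lc N k (\<lambda>i. a\<otimes> x i\<otimes> a) y)" if "k\<le>n" for k using that
   proof (induction k)
    case 0
    show ?case using S.hm_zero[OF f NL FM_lm[OF LM]] by simp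
   next
    case (Suc k)
    have c: "a\<otimes> x k\<otimes> a:el S" "y k:el N" "lc N k (\<lambda>i. a\<otimes> x i\<otimes> a) y:el N"
     using y(1) Suc.prems corner_mem free_mem[OF x(1)] by (auto intro: N.lc_closed)
    have "f ((a\<otimes> x k\<otimes> a)\<odot>\<^sub>N y k) = x k\<odot>\<^sub>M ?m k"
     using S.hm_smult[OF f c(1,2)] ma[of k "x k"] Suc.prems free_mem[OF x(1)] by (simp add: ax)
    then show ?case using Suc S.hm_add[OF f c(3) N.smult_closed[OF c(1,2)]] by simp
   qed
   from this[of n] show ?thesis using x UL by (simp add: E_def ev_def)
  qed
  have "A<={x\<in>el ?U. ?p x:{\<zero>\<^sub>M}}"
  proof
   fix x assume x: "x:A"
   then have xU: "x:el ?U" unfolding A_def by simp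
   have "?p x = \<zero>\<^sub>M"
   proof (cases "a\<odot>\<^sub>?U x = x&ev x = \<zero>\<^sub>N")
    case True
    then show ?thesis using pf[OF xU] xU UL S.hm_zero[OF f NL FM_lm[OF LM]] by (simp add: E_def)
   next
    case False
    then have 0: "x i\<otimes> a = \<zero>" for i using x unfolding A_def by auto
    have "lc M n x ?m = lc M n \<zero>\<^sub>?U ?m" using ma[OF _ free_mem[OF xU]] by (intro M.lc_cong) (simp add: 0 free_ops)
    then show ?thesis using hm_zero[OF p UL LM] xU by simp
   qed
   then show "x:{x\<in>el ?U. ?p x:{\<zero>\<^sub>M}}" using xU by simp
  qed
  then have "T<={x\<in>el ?U. ?p x:{\<zero>\<^sub>M}}" by (rule T_sub[OF submod_vimage[OF p UL LM submod_zero[OF LM]]])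
  then have "?p x = \<zero>\<^sub>M" if "x:el ?U" "\<pi> x = \<zero>\<^sub>G" for x using G(4)[OF that(1)] that(2) by blast
  then obtain g where g: "g:hm G M" "!!x. x:el ?U ==> g (\<pi> x) = ?p x" using hm_factor[OF G(2,3) p UL GL LM] by metis
  have "g (\<eta> z) = f z" if z: "z:el N" for z
  proof -
   obtain x where x: "x:el (FM ?U)" "E x = z" using Esurj z by blast
   then have x': "x:el ?U" "a\<odot>\<^sub>?U x = x" using FU by auto
   show ?thesis using g(2)[OF x'(1)] e2[OF x'] pf[OF x'] x(2) by simp
  qed
  then show ?thesis using g(1) by (intro bexI[of _ g]) simp
 qed
 have uniq: "g = g'" if M: "M:MOD" and g: "g:hm G M" "g':hm G M" and gg: "\<forall>x\<in>el N. g (\<eta> x) = g' (\<eta> x)" for M g g'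
 proof -
  have LM: "lmod R M" using M by simp
  \<comment> \<open>A unit vector and its multiple by \<open>a\<close> have the same image in G, and
    the latter is in the image of the universal arrow.\<close>
  have ge: "g (\<pi> (unit_vec R i)) = g' (\<pi> (unit_vec R i))" if i: "i < n" for i
  proof -
   let ?u = "unit_vec R i" and ?v = "a\<odot>\<^sub>?U unit_vec R i"
   note u = unit_vec_free[OF i]
   have v: "?v:el ?U" "a\<odot>\<^sub>?U ?v = ?v" using u U.smult_closed by (simp_all flip: U.smult_assoc1)
   have "?u\<oplus>\<^sub>?U (\<ominus> \<one>)\<odot>\<^sub>?U ?v:A"
    using U.M.a_closed[OF u U.smult_closed[OF _ v(1)], of "\<ominus> \<one>"]
    by (simp add: A_def free_ops unit_vec_def l_distr l_minus r_neg m_assoc)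
   then have "\<pi> (?u\<oplus>\<^sub>?U\<ominus>\<^sub>?U ?v) = \<zero>\<^sub>G" using AT G(4) T submodD(2)[OF T] v(1) by (auto simp: U.minus_smult)
   then have "\<pi> ?u = \<pi> ?v" using u v hm_closed[OF G(2)] by (simp add: hm_add[OF G(2)] hm_minus[OF G(2) UL GL] G.M.add_minus_zero_iff)
   then show ?thesis using e2[OF v] gg S.hm_closed[OF E, of ?v] FU v by metis
  qed
  have ce: "compose (el ?U) g \<pi> = compose (el ?U) g' \<pi>"
   by (rule free_unique[OF hm_compose[OF G(2) g(1) UL] hm_compose[OF G(2) g(2) UL] LM])
    (use ge unit_vec_free in \<open>simp add: compose_def\<close>)
  have pe: "g (\<pi> x) = g' (\<pi> x)" if "x:el ?U" for x using fun_cong[OF ce, of x] that by (simp add: compose_def)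
  show ?thesis
  proof (rule hm_ext[OF g])
   fix q assume "q:el G"
   then have "q:\<pi> ` el ?U" using G(3) by simp
   then show "g q = g' q" using pe by auto
  qed
 qed
 show ?thesis unfolding universal_def by (intro exI[of _ G] exI[of _ \<eta>] conjI ballI impI G(1) e(1) bij) (erule (1) ext, erule (3) uniq)
qed

end

section \<open>The left adjoint on complexes\<close>

context modcat
begin

lemma bij_Kb_iso:
 assumes "chmap R X Y f" and bij: "!!n. bij_betw (f n) (cel X n) (cel Y n)"
 shows "is_iso (Kb R) X Y (hcl X Y f)"
proof -
 interpret chmap R X Y f by fact
 define g where "g n = inv_into (cel X n) (f n)" for n
 have g: "g n y:cel X n" "f n (g n y) = y" if "y:cel Y n" for n y
  using bij_betw_inv_into_right[OF bij that] bij_betwE[OF bij_betw_inv_into[OF bij]] that unfolding g_def by auto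
 have inj: "x = x'" if "f n x = f n x'" "x:cel X n" "x':cel X n" for n x x' using bij_betw_imp_inj_on[OF bij] that by (rule inj_onD)
 let ?g = "\<lambda>n. \<lambda>y\<in>cel Y n. g n y"
 have gc: "chmap R Y X ?g"
 proof (rule chmap_restrictI[OF Y.cplx_axioms X.cplx_axioms], goal_cases)
  case (2 n x y)
  then show ?case by - (rule inj[of n], simp_all add: g)
 next
  case (3 n r x)
  then show ?case by - (rule inj[of n], simp_all add: g f_smult)
 next
  case (4 n x)
  then show ?case by - (rule inj[of "n+1"], simp_all add: g)
 qed (rule g)
 have gf: "g n (f n x) = x" if "x:cel X n" for n x using that by - (rule inj[of n], simp_all add: g)
 have "cmp_map X ?g f = id_map X" "cmp_map Y f ?g = id_map Y" by (auto simp: fun_eq_iff compose_def g gf)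
 then have "Comp (Kb R) X Y X (hcl Y X ?g) (hcl X Y f) = Ident (Kb R) X"
  "Comp (Kb R) Y X Y (hcl X Y f) (hcl Y X ?g) = Ident (Kb R) Y" using Kb_Comp[OF assms(1) gc] Kb_Comp[OF gc assms(1)] by simp_all
 moreover have "hcl X Y f:Hom (Kb R) X Y" "hcl Y X ?g:Hom (Kb R) Y X" using Kb_Hom assms(1) gc X.cplx_axioms Y.cplx_axioms by blast+
 ultimately show ?thesis unfolding is_iso_def by blast
qed

lemma acyc_qis:
 assumes "chmap R X Y f" "acyc X" "acyc Y"
 shows "qis X Y f"
proof -
 interpret chmap R X Y f by fact
 show ?thesis unfolding qis_def hinj_def hsurj_def
 proof (intro conjI allI ballI impI)
  fix n y assume y: "y:cel Y n" "cdiff Y n y = \<zero>\<^sub>Y\<^sup>(n+1)"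
  obtain y' where "y':cel Y (n-1)" "cdiff Y (n-1) y' = y" using acycD[OF assms(3) y] by auto
  then show "\<exists>x\<in>cel X n. \<exists>y'\<in>cel Y (n-1). cdiff X n x = \<zero>\<^sub>X\<^sup>(n+1)&
    y = f n x\<oplus>\<^sub>Y\<^sup>n cdiff Y (n-1) y'" using y(1) by (intro bexI[of _ "\<zero>\<^sub>X\<^sup>n"] bexI[of _ y']) auto
 qed (rule acycD[OF assms(2)])
qed

text \<open>Two-out-of-three by composition of denominators. Let A be the fibre of the identity of
  X, which is acyclic. The maps A -> X and X -> Y have perfect cones, hence so does the composite;
  and the cone of a map out of an acyclic complex is its target up to quasi-isomorphism.\<close>

lemma perf_target:
 assumes f: "chmap R X Y f" and C: "cone X Y f:perf" and X: "X:perf"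
 shows "Y:perf"
proof -
 interpret N: nullsys R perf by (rule nullsys_perf)
 have Xc: "cplx R X" using chmap_cplx[OF f] by blast
 note i = chmap_id[OF Xc]
 let ?A = "fib X X (id_map X)"
 have A: "acyc ?A" unfolding fib_def using unshift_acyc[OF cone_cplx[OF i]] acyc_cone_iff[OF i] qis_id[OF Xc] by blast
 let ?h = "cmp_map ?A f (fib_proj X X)"
 have "N.W ?A Y ?h" using N.W_comp[OF N.W_fib_proj[OF i X]] f C unfolding N.W_def by blast
 then have h: "chmap R ?A Y ?h" "cone ?A Y ?h:perf" unfolding N.W_def by auto
 show ?thesis using N.N_qis[OF cone_incl[OF h(1)] cone_incl_qis[OF h(1) A]] h(2) by blast
qed

lemma submod_sub: "submod R M H ==> H<=H' ==> submod R (M\<lparr>carrier := H'\<rparr>) H" unfolding submod_def by simp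

end

context corner
begin

lemma universalD:
 assumes "universal N G \<eta>"
 shows "G:MOD" "lmod R G" "\<eta>:S.hm N (FM G)" "bij_betw \<eta> (el N) (el (FM G))"
  "x:el N ==> \<eta> x:el G" "x:el N ==> a\<odot>\<^sub>G \<eta> x = \<eta> x"
 using assms S.hm_closed[of \<eta> N "FM G" x] unfolding universal_def by auto

lemma universal_ext:
 assumes "universal N G \<eta>" "M:MOD" "f:S.hm N (FM M)"
 obtains g where "g:hm G M" "\<forall>x\<in>el N. g (\<eta> x) = f x"
proof -
 have "\<exists>g\<in>hm G M. \<forall>x\<in>el N. g (\<eta> x) = f x" using assms unfolding universal_def by simp
 then show ?thesis using that by auto
qed

lemma universal_uniq:
 assumes "universal N G \<eta>" "M:MOD" "g:hm G M" "g':hm G M" "!!x. x:el N ==> g (\<eta> x) = g' (\<eta> x)"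
 shows "g = g'" using assms unfolding universal_def by simp

text \<open>A left adjoint of an exact functor preserves projectives: a lifting problem for G is
  transposed to one for N, solved there, and transposed back, where uniqueness shows that the
  solution is one.\<close>

lemma universal_projective:
 assumes u: "universal N G \<eta>" and N: "is_projective S N"
 shows "is_projective R G" unfolding is_projective_def
proof (intro conjI ballI impI)
 note U = universalD[OF u]
 show "G:MOD" by (rule U)
 have NL: "left_module S N" using N unfolding is_projective_def by simp
 fix M M' g f assume M: "M:MOD" "M':MOD" and g: "g:hm M M'" and f: "f:hm G M'" and s: "g ` el M = el M'"
 have L: "lmod R M" "lmod R M'" using M by auto
 interpret M: left_module R M by (rule L)
 have f': "compose (el N) (restrict f (el (FM G))) \<eta>:S.hm N (FM M')" by (rule S.hm_compose[OF U(3) F_hm[OF f U(2) L(2)] NL])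
 have v: "compose (el N) (restrict f (el (FM G))) \<eta> x = f (\<eta> x)" if "x:el N" for x
  using that U(2) U(5,6)[OF that] by (simp add: compose_def)
 have "f (\<eta> x):restrict g (el (FM M)) ` el (FM M)" if x: "x:el N" for x
 proof -
  have "f (\<eta> x):g ` el M" using s hm_closed[OF f] U(5)[OF x] by simp
  then obtain z where z: "z:el M" "g z = f (\<eta> x)" by auto
  \<comment> \<open>A preimage of a vector fixed by \<open>a\<close> is moved into the corner by
    multiplying it by \<open>a\<close>.\<close>
  then have "g (a\<odot>\<^sub>M z) = f (\<eta> x)" using hm_smult[OF g a z(1)] hm_smult[OF f a U(5)[OF x]] U(6)[OF x] by simp
  then show ?thesis using z(1) L M.smult_closed by (intro image_eqI[of _ _ "a\<odot>\<^sub>M z"]) (simp_all flip: M.smult_assoc1)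
 qed
 then obtain h where h: "h:S.hm N (FM M)" "\<forall>x\<in>el N. restrict g (el (FM M)) (h x) = f (\<eta> x)"
  using S.proj_lift[OF N f' F_hm[OF g L] FM_MOD[OF M(1)] FM_MOD[OF M(2)]] v by auto
 obtain k where k: "k:hm G M" "\<forall>x\<in>el N. k (\<eta> x) = h x" using universal_ext[OF u M(1) h(1)] .
 have "compose (el G) g k = f"
 proof (rule universal_uniq[OF u M(2) hm_compose[OF k(1) g U(2)] f])
  fix x assume x: "x:el N"
  have "h x:el (FM M)" using S.hm_closed[OF h(1) x] .
  then have "g (h x) = f (\<eta> x)" using bspec[OF h(2) x] by simp
  then show "compose (el G) g k (\<eta> x) = f (\<eta> x)" using x k(2) U(5)[OF x] by (simp add: compose_def)
 qed
 then show "\<exists>h\<in>hm G M. compose (el G) g h = f" by (intro bexI[of _ k] k(1))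
qed

definition universal_cplx :: "'a cochain=>'a cochain=>'a chainmap=>bool" where
 "universal_cplx Y G \<eta>\<longleftrightarrow>cplx R G&chmap S Y (FX G) \<eta>&(\<forall>n. universal (cobj Y n) (cobj G n) (\<eta> n))"

text \<open>The adjoint is applied in each degree. Uniqueness of extensions makes consecutive
  differentials compose to zero and preserves boundedness.\<close>

lemma universal_cplx_ex:
 assumes "cplx S Y"
 shows "\<exists>G \<eta>. universal_cplx Y G \<eta>"
proof -
 interpret Y: cplx S Y by fact
 obtain G \<eta> where u: "!!n. universal (cobj Y n) (G n) (\<eta> n)" using universal_ex[OF Y.X_MOD] by metis
 note U = universalD[OF u]
 have f: "compose (cel Y n) (\<eta> (n+1)) (cdiff Y n):S.hm (cobj Y n) (FM (G (n+1)))" for n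
  by (rule S.hm_compose[OF Y.d_hm U(3) Y.X_lm]) simp
 have "\<exists>d. d:hm (G n) (G (n+1))&(\<forall>x\<in>cel Y n. d (\<eta> n x) = \<eta> (n+1) (cdiff Y n x))" for n
  by (rule universal_ext[OF u U(1) f, of n]) (auto simp: compose_def)
 then obtain d where d: "!!n. d n:hm (G n) (G (n+1))"
  "!!n x. x:cel Y n ==> d n (\<eta> n x) = \<eta> (n+1) (cdiff Y n x)" by metis
 let ?G = "\<lparr>cobj = G, cdiff = d\<rparr>"
 have z: "\<eta> n \<zero>\<^sub>Y\<^sup>n = \<zero>\<^bsub>G n\<^esub>" for n using S.hm_zero[OF U(3) Y.X_lm FM_lm[OF U(2)]] by simp
 have G: "cplx R ?G"
 proof (rule cplxI; (unfold cochain.simps)?)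
  fix n x assume x: "x:el (G n)"
  have "compose (el (G n)) (d (n+1)) (d n) = (\<lambda>x\<in>el (G n). \<zero>\<^bsub>G (n+1 + 1)\<^esub>)"
   by (rule universal_uniq[OF u U(1) hm_compose[OF d(1) d(1) U(2)] hm_zero_map[OF U(2) U(2)]])
    (simp add: compose_def U(5) d(2) z)
  from fun_cong[OF this, of x] show "d (n+1) (d n x) = \<zero>\<^bsub>G (n+2)\<^esub>" using x by (simp add: compose_def)
 next
  \<comment> \<open>Over a zero module the identity and the zero map of \<open>G n\<close> have the
    same restriction along the universal arrow, so they are equal.\<close>
  have "el (G n) = {\<zero>\<^bsub>G n\<^esub>}" if n: "cel Y n = {\<zero>\<^sub>Y\<^sup>n}" for n
  proof -
   interpret G: left_module R "G n" by (rule U(2))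
   have "(\<lambda>x\<in>el (G n). x) = (\<lambda>x\<in>el (G n). \<zero>\<^bsub>G n\<^esub>)"
    by (rule universal_uniq[OF u U(1) hm_ident[OF U(2)] hm_zero_map[OF U(2) U(2)]]) (simp add: n z)
   then have "x = \<zero>\<^bsub>G n\<^esub>" if "x:el (G n)" for x using fun_cong[of _ _ x] that by (metis restrict_apply')
   then show ?thesis by auto
  qed
  then show "finite {n. el (G n)~={\<zero>\<^bsub>G n\<^esub>}}" by (auto intro!: finite_subset[OF _ Y.bounded])
 qed (simp_all add: U d)
 have "\<eta> n:S.hm (cobj Y n) (FM (G n))" for n by (rule U)
 then have "\<eta>:chain_maps S Y (FX ?G)" unfolding chain_maps_def using U(2,5,6) d(2) by (simp add: U)
 then have "chmap S Y (FX ?G) \<eta>" using assms G by (simp add: S.chmap_iff)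
 then show ?thesis using G u unfolding universal_cplx_def by (intro exI[of _ ?G] exI[of _ \<eta>]) simp
qed

context
 fixes Y G \<eta>
 assumes uc: "universal_cplx Y G \<eta>"
begin

lemma uc: "cplx R G" "cplx S Y" "chmap S Y (FX G) \<eta>" "universal (cobj Y n) (cobj G n) (\<eta> n)"
 using uc S.chmap_cplx unfolding universal_cplx_def by blast+

interpretation G: cplx R G by (rule uc)
interpretation e: chmap S Y "FX G" \<eta> by (rule uc)

lemma uc_val [simp]: "x:cel Y n ==> \<eta> n x:cel G n" "x:cel Y n ==> a\<odot>\<^sub>G\<^sup>n \<eta> n x = \<eta> n x"
 using universalD(5,6)[OF uc(4)] by auto

lemma uc_d: "x:cel Y n ==> cdiff G n (\<eta> n x) = \<eta> (n+1) (cdiff Y n x)" using e.f_d[of "n+1" n x] by simp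

lemma uc_iso: "is_iso (Kb S) Y (FX G) (S.hcl Y (FX G) \<eta>)" by (rule S.bij_Kb_iso[OF uc(3)]) (use universalD(4)[OF uc(4)] in simp)

lemma uc_chmap:
 assumes "cplx R X" "chmap S Y (FX X) v"
 shows "\<exists>u. chmap R G X u&cmp_map Y (Fm G u) \<eta> = v"
proof -
 interpret X: cplx R X by fact
 interpret v: chmap S Y "FX X" v by fact
 have vh: "v n:S.hm (cobj Y n) (FM (cobj X n))" for n using v.f_hm by simp
 have "\<exists>u. u:hm (cobj G n) (cobj X n)&(\<forall>x\<in>cel Y n. u (\<eta> n x) = v n x)" for n
  by (rule universal_ext[OF uc(4) X.X_MOD vh, of n]) auto
 then obtain u where u: "!!n. u n:hm (cobj G n) (cobj X n)" "!!n x. x:cel Y n ==> u n (\<eta> n x) = v n x" by metis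
 have vd: "v (n+1) (cdiff Y n x) = cdiff X n (v n x)" "v n x:cel X n" if "x:cel Y n" for n x
  using v.f_d[of "n+1" n x] v.f_closed[OF that] that by auto
 have "u (n+1) (cdiff G n x) = cdiff X n (u n x)" if x: "x:cel G n" for n x
 proof -
  have "compose (cel G n) (u (n+1)) (cdiff G n) = compose (cel G n) (cdiff X n) (u n)"
   by (rule universal_uniq[OF uc(4)[of n] X.X_MOD hm_compose[OF G.d_hm[OF refl] u(1) G.X_lm] hm_compose[OF u(1) X.d_hm[OF refl] G.X_lm]])
    (simp add: compose_def uc_d u(2) vd del: e.f_d v.f_d)
  from fun_cong[OF this, of x] show ?thesis using x by (simp add: compose_def)
 qed
 then have "chmap R G X u" using u(1) uc(1) assms(1) by (simp add: chmap_iff chain_maps_def)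
 moreover have "cmp_map Y (Fm G u) \<eta> n = v n" for n
  by (rule S.hm_ext[OF S.hm_compose[OF e.f_hm[of n, unfolded FX_sel] F_hm[OF u(1) G.X_lm X.X_lm] e.X.X_lm] vh]) (simp add: compose_def u(2))
 ultimately show ?thesis by blast
qed

text \<open>Homotopies consist of degreewise homomorphisms and are transposed in the same way as
  chain maps, so the universal property passes to the homotopy category.\<close>

lemma uc_homotopic:
 assumes u: "chmap R G X u" "chmap R G X u'" and h: "homotopic S Y (FX X) (cmp_map Y (Fm G u) \<eta>) (cmp_map Y (Fm G u') \<eta>)"
 shows "homotopic R G X u u'"
proof -
 interpret u: chmap R G X u by fact
 interpret u': chmap R G X u' by fact
 obtain k where k: "hmtp S Y (FX X) k" and e: "!!n x. x:cel Y n ==>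
   cmp_map Y (Fm G u) \<eta> n x = cmp_map Y (Fm G u') \<eta> n x\<oplus>\<^sub>(FX X)\<^sup>n
   (cdiff (FX X) (n-1) (k n x)\<oplus>\<^sub>(FX X)\<^sup>n k (n+1) (cdiff Y n x))"
  by (rule S.homotopicE[OF h uc(2) FX_cplx[OF u.Y.cplx_axioms]]) (rule that)
 interpret k: hmtp S Y "FX X" k by fact
 have kh: "k n:S.hm (cobj Y n) (FM (cobj X (n-1)))" for n using k.h by simp
 have "\<exists>l. l:hm (cobj G n) (cobj X (n-1))&(\<forall>x\<in>cel Y n. l (\<eta> n x) = k n x)" for n
  by (rule universal_ext[OF uc(4) u.Y.X_MOD kh, of n]) auto
 then obtain l where l: "!!n. l n:hm (cobj G n) (cobj X (n-1))" "!!n x. x:cel Y n ==> l n (\<eta> n x) = k n x" by metis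
 have lh: "hmtp R G X l" unfolding hmtp_iff using uc(1) u.Y.cplx_axioms l(1) by blast
 interpret l: hmtp R G X l by (rule lh)
 let ?r = "\<lambda>n x. u' n x\<oplus>\<^sub>X\<^sup>n (cdiff X (n-1) (l n x)\<oplus>\<^sub>X\<^sup>n l (n+1) (cdiff G n x))"
 have kc: "k n x:cel X (n-1)" "a\<odot>\<^sub>X\<^sup>(n-1) k n x = k n x" if "x:cel Y n" for n x using k.h_closed[OF that] by auto
 have ur: "u n = (\<lambda>x\<in>cel G n. ?r n x)" for n
 proof (rule universal_uniq[OF uc(4) u.Y.X_MOD u.f_hm])
  show "(\<lambda>x\<in>cel G n. ?r n x):hm (cobj G n) (cobj X n)"
   by (rule hm_restrictI) (simp_all add: l.h_smult u'.f_smult G.d_smult u.Y.d_smult u.Y.C.smult_r_distr u.Y.C.M.a_ac)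
  fix x assume x: "x:cel Y n"
  show "u n (\<eta> n x) = (\<lambda>x\<in>cel G n. ?r n x) (\<eta> n x)"
   using e[OF x] x kc[OF x] by (simp add: compose_def uc_d l(2) del: e.f_d)
 qed
 have "u n x = ?r n x" if "x:cel G n" for n x using fun_cong[OF ur, of n x] that by simp
 then show ?thesis by (rule homotopicI[OF lh])
qed

lemma uc_PROJ: "Y:S.PROJ ==> G:PROJ" using universal_projective[OF uc(4)] uc(1) by (simp add: PROJ_iff S.PROJ_iff)

end

lemma F_adjoint:
 assumes "cplx S Y"
 shows "\<exists>G\<in>Ob (Kb R). \<exists>e. is_iso (Kb S) Y (ob FK G) e&(\<forall>X\<in>Ob (Kb R).
  (\<forall>v\<in>Hom (Kb S) Y (ob FK X). \<exists>u\<in>Hom (Kb R) G X. Comp (Kb S) Y (ob FK G) (ob FK X) (mor FK G X u) e = v)&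
  (\<forall>u\<in>Hom (Kb R) G X. \<forall>u'\<in>Hom (Kb R) G X. Comp (Kb S) Y (ob FK G) (ob FK X) (mor FK G X u) e =
     Comp (Kb S) Y (ob FK G) (ob FK X) (mor FK G X u') e-->u = u'))"
proof -
 obtain G \<eta> where u: "universal_cplx Y G \<eta>" using universal_cplx_ex[OF assms] by blast
 note U = uc[OF u]
 have c: "Comp (Kb S) Y (FX G) (FX X) (mor FK G X (hcl G X w)) (S.hcl Y (FX G) \<eta>) = S.hcl Y (FX X) (cmp_map Y (Fm G w) \<eta>)"
  if "chmap R G X w" for X w using S.Kb_Comp[OF U(3) F_chmap[OF that]] FK_hcl[OF that] by simp
 show ?thesis
 proof (intro bexI[of _ G] exI[of _ "S.hcl Y (FX G) \<eta>"] conjI ballI impI; (unfold FK_ob)?)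
  show "G:Ob (Kb R)" using U by simp
  show "is_iso (Kb S) Y (FX G) (S.hcl Y (FX G) \<eta>)" by (rule uc_iso[OF u])
  fix X assume "X:Ob (Kb R)"
  then have X: "cplx R X" by simp
  { fix v assume "v:Hom (Kb S) Y (FX X)"
   then obtain w where w: "chmap S Y (FX X) w" "v = S.hcl Y (FX X) w" using S.Kb_HomE[OF _ U(2) FX_cplx[OF X]] by blast
   obtain g where g: "chmap R G X g" "cmp_map Y (Fm G g) \<eta> = w" using uc_chmap[OF u X w(1)] by blast
   show "\<exists>u\<in>Hom (Kb R) G X. Comp (Kb S) Y (FX G) (FX X) (mor FK G X u) (S.hcl Y (FX G) \<eta>) = v"
    using c[OF g(1)] g w Kb_Hom[OF U(1) X] by (intro bexI[of _ "hcl G X g"]) auto }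
  fix p q assume "p:Hom (Kb R) G X" "q:Hom (Kb R) G X"
   and e: "Comp (Kb S) Y (FX G) (FX X) (mor FK G X p) (S.hcl Y (FX G) \<eta>) = Comp (Kb S) Y (FX G) (FX X) (mor FK G X q) (S.hcl Y (FX G) \<eta>)"
  then obtain g g' where g: "chmap R G X g" "p = hcl G X g" "chmap R G X g'" "q = hcl G X g'" using Kb_HomE[OF _ U(1) X] by metis
  have "homotopic S Y (FX X) (cmp_map Y (Fm G g) \<eta>) (cmp_map Y (Fm G g') \<eta>)" using e unfolding g(2,4) c[OF g(1)] c[OF g(3)]
   by (subst (asm) S.hcl_eq_iff[OF S.chmap_comp[OF U(3) F_chmap[OF g(1)]] S.chmap_comp[OF U(3) F_chmap[OF g(3)]]])
  from uc_homotopic[OF u g(1,3) this] show "p = q" using g hcl_eq_iff[OF g(1,3)] by simp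
 qed
qed

end

section \<open>Corner functors that are singular equivalences\<close>

text \<open>\<open>approximation\<close> is a projective resolution of length one of Z/B, for a
  quotient annihilated by \<open>a\<close>, stated without forming the quotient: P covers Z modulo
  B, and the preimage of B is the kernel of P -> Z/B. \<open>noetherian\<close> is needed for the
  module of cycles, to which it is applied.\<close>

locale singular_corner = corner R a for R :: "'r ring" (structure) and a +
 assumes noetherian: "M:MOD ==> submod R M H ==> M\<lparr>carrier := H\<rparr>:MOD"
  and approximation: "[|Z:MOD; submod R Z B; !!x. x:el Z ==> a\<odot>\<^sub>Z x:B|] ==>
   \<exists>P \<pi>. is_projective R P&\<pi>:hm P Z&(\<forall>z\<in>el Z. \<exists>p\<in>el P. \<exists>b\<in>B. z = \<pi> p\<oplus>\<^sub>Z b)&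
    is_projective R (P\<lparr>carrier := {p\<in>el P. \<pi> p:B}\<rparr>)"
begin

abbreviation exact_at :: "'r cochain=>int=>bool" where
 "exact_at X n\<equiv>\<forall>x\<in>cel X n. cdiff X n x = \<zero>\<^sub>X\<^sup>(n+1)-->
   (\<exists>x'\<in>cel X (n-1). cdiff X (n-1) x' = x)"

text \<open>A projective resolution of length one of the top cohomology of \<open>X\<close> is mapped to \<open>X\<close>, and the cone of
 this map has cohomology in one degree less.\<close>

lemma kill_top_cohomology:
 assumes X: "cplx R X" "acyc (FX X)" and ln: "l\<le>n" and ex: "!!j. j < l\<or>j > n ==> exact_at X j"
 shows "\<exists>Q t. Q:PROJ&chmap R Q X t&acyc (FX (cone Q X t))&
  (\<forall>j. j < l\<or>j\<ge>n-->exact_at (cone Q X t) j)"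
proof -
 interpret X: cplx R X by (rule X)
 let ?Z = "{x\<in>cel X n. cdiff X n x:{\<zero>\<^sub>X\<^sup>(n+1)}}"
 let ?B = "cdiff X (n-1) ` cel X (n-1)"
 let ?ZM = "cobj X n\<lparr>carrier := ?Z\<rparr>"
 have Zs: "submod R (cobj X n) ?Z" by (rule submod_vimage[OF X.d_hm X.X_lm X.X_lm submod_zero[OF X.X_lm]]) simp
 have BZ: "?B<=?Z" by auto
 have "submod R (cobj X n) ?B" by (rule submod_image[OF X.d_hm X.X_lm X.X_lm submod_carrier[OF X.X_lm]]) simp
 note Bs = submod_sub[OF this BZ]
 \<comment> \<open>The image of a cycle under \<open>a\<close> is a cycle of the acyclic complex
   \<open>FX X\<close>, hence already a boundary.\<close>
 have aB: "a\<odot>\<^sub>?ZM x:?B" if "x:el ?ZM" for x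
 proof -
  have "a\<odot>\<^sub>X\<^sup>n x:cel (FX X) n" "cdiff (FX X) n (a\<odot>\<^sub>X\<^sup>n x) = \<zero>\<^sub>(FX X)\<^sup>(n+1)"
   using that X.d_smult[OF a, of x n] by (simp_all add: X.C.smult_r_null flip: X.C.smult_assoc1)
  from acycD[OF X(2) this] obtain y where "y:cel (FX X) (n-1)" "cdiff (FX X) (n-1) y = a\<odot>\<^sub>X\<^sup>n x" by blast
  then show ?thesis by (intro image_eqI[of _ _ y]) simp_all
 qed
 obtain P \<pi> where P: "is_projective R P" "\<pi>:hm P ?ZM" "\<forall>z\<in>?Z. \<exists>p\<in>el P. \<exists>b\<in>?B. z = \<pi> p\<oplus>\<^sub>X\<^sup>n b"
  "is_projective R (P\<lparr>carrier := {p\<in>el P. \<pi> p:?B}\<rparr>)" using approximation[OF noetherian[OF X.X_MOD Zs] Bs aB] by auto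
 have PM: "P:MOD" using P(1) unfolding is_projective_def by (rule conjunct1)
 then have PL: "lmod R P" by simp
 interpret P: left_module R P by (rule PL)
 let ?P1 = "{p\<in>el P. \<pi> p:?B}"
 have ZL: "lmod R ?ZM" by (rule X.C.submod_left_module[OF Zs])
 have P1s: "submod R P ?P1" by (rule submod_vimage[OF P(2) PL ZL Bs])
 have P1L: "lmod R (P\<lparr>carrier := ?P1\<rparr>)" by (rule P.submod_left_module[OF P1s])
 have pc: "\<pi> p:cel X n" "cdiff X n (\<pi> p) = \<zero>\<^sub>X\<^sup>(n+1)" if "p:el P" for p using hm_closed[OF P(2) that] by auto
 have p_add: "\<pi> (p\<oplus>\<^sub>P q) = \<pi> p\<oplus>\<^sub>X\<^sup>n \<pi> q" if "p:el P" "q:el P" for p q using hm_add[OF P(2) that] by simp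
 have p_smult: "\<pi> (r\<odot>\<^sub>P p) = r\<odot>\<^sub>X\<^sup>n \<pi> p" if "r:el R" "p:el P" for r p using hm_smult[OF P(2) that] by simp
 have p_zero: "\<pi> \<zero>\<^sub>P = \<zero>\<^sub>X\<^sup>n" using hm_zero[OF P(2) PL ZL] by simp
 have "restrict \<pi> ?P1:hm (P\<lparr>carrier := ?P1\<rparr>) (cobj X n)"
  using hm_restrictI[OF P1L, of \<pi> "cobj X n"] by (simp add: pc p_add p_smult)
 \<comment> \<open>On the kernel \<open>?P1\<close> the map \<open>\<pi>\<close> takes values in
   boundaries, so by projectivity it lifts through the differential. This is the component of the
   chain map in degree n - 1.\<close>
 then obtain \<tau> where t: "\<tau>:hm (P\<lparr>carrier := ?P1\<rparr>) (cobj X (n-1))" "\<forall>p\<in>?P1. cdiff X (n-1) (\<tau> p) = \<pi> p"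
  using proj_lift[OF P(4) _ X.d_hm X.X_MOD X.X_MOD, of "restrict \<pi> ?P1" n "n-1"] by auto
 have tc: "\<tau> p:cel X (n-1)" if "p:?P1" for p using hm_closed[OF t(1), of p] that by simp
 have t_add: "\<tau> (p\<oplus>\<^sub>P q) = \<tau> p\<oplus>\<^sub>X\<^sup>(n-1) \<tau> q" if "p:?P1" "q:?P1" for p q using hm_add[OF t(1), of p q] that by simp
 have t_smult: "\<tau> (r\<odot>\<^sub>P p) = r\<odot>\<^sub>X\<^sup>(n-1) \<tau> p" if "r:el R" "p:?P1" for r p using hm_smult[OF t(1), of r p] that by simp
 have t_zero: "\<tau> \<zero>\<^sub>P = \<zero>\<^sub>X\<^sup>(n-1)" using hm_zero[OF t(1) P1L X.X_lm] by simp
 \<comment> \<open>The complex \<open>Q\<close> is the inclusion of \<open>?P1\<close> into P,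
   placed in degrees n - 1 and n; every other term is the zero submodule of P.\<close>
 define C where "C m = (if m = n then el P else if m = n-1 then ?P1 else {\<zero>\<^sub>P})" for m
 define Q where "Q = \<lparr>cobj = (\<lambda>m. P\<lparr>carrier := C m\<rparr>), cdiff = (\<lambda>m. \<lambda>x\<in>C m. if m = n-1 then x else \<zero>\<^sub>P)\<rparr>"
 have Qo: "cobj Q m = P\<lparr>carrier := C m\<rparr>" for m unfolding Q_def by simp
 have Qd: "x:C m ==> cdiff Q m x = (if m = n-1 then x else \<zero>\<^sub>P)" for m x unfolding Q_def by simp
 have Cs: "submod R P (C m)" for m unfolding C_def using submod_carrier[OF PL] P1s submod_zero[OF PL] by auto
 note CD = submodD[OF Cs]
 have Cproj: "is_projective R (P\<lparr>carrier := C m\<rparr>)" for m unfolding C_def using P(1,4) zero_module[OF PM] by auto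
 have CM: "P\<lparr>carrier := C m\<rparr>:MOD" for m using Cproj unfolding is_projective_def by (rule conjunct1)
 have C0: "x:C m ==> m~=n ==> m~=n-1 ==> x = \<zero>\<^sub>P" for x m unfolding C_def by simp
 have Cn: "x:C n\<longleftrightarrow>x:el P" "x:C (n-1)\<longleftrightarrow>x:?P1" for x unfolding C_def by auto
 have Q: "cplx R Q"
 proof (rule cplxI)
  show "cobj Q m:MOD" for m unfolding Qo by (rule CM)
  show "cdiff Q m:hm (cobj Q m) (cobj Q (m+1))" for m
  proof -
   have "(\<lambda>x\<in>el (P\<lparr>carrier := C m\<rparr>). if m = n-1 then x else \<zero>\<^sub>P):hm (P\<lparr>carrier := C m\<rparr>) (P\<lparr>carrier := C (m+1)\<rparr>)"
    by (rule hm_restrictI[OF MOD_lm[OF CM]]) (use CD(2)[of _ m] CD(3)[of m] CD(3)[of "m+1"] Cn in \<open>auto simp: P.smult_r_null\<close>)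
   then show ?thesis unfolding Q_def by simp
  qed
  show "cdiff Q (m+1) (cdiff Q m x) = \<zero>\<^sub>Q\<^sup>(m+2)" if "x:cel Q m" for m x
   using that CD(3)[of "m+1"] Cn by (auto simp: Qo Qd)
  have "{m. cel Q m~={\<zero>\<^sub>Q\<^sup>m}}<={n-1, n}" by (auto simp: Qo C_def)
  then show "finite {m. cel Q m~={\<zero>\<^sub>Q\<^sup>m}}" by (rule finite_subset) simp
 qed
 then have QP: "Q:PROJ" using Cproj by (simp add: PROJ_iff Qo)
 interpret Q: cplx R Q by (rule Q)
 define t where "t m x = (if m = n then \<pi> x else if m = n-1 then \<tau> x else \<zero>\<^sub>X\<^sup>m)" for m x
 let ?t = "\<lambda>m. \<lambda>x\<in>cel Q m. t m x"
 have tm: "chmap R Q X ?t"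
 proof (rule chmap_restrictI[OF Q X(1)], goal_cases)
  case (4 m x)
  then show ?case using C0[of x m] Cn CD(3)[of "m+1"] t(2)
   by (cases "m = n"; cases "m = n-1"; cases "m = n-2") (auto simp: t_def Qo Qd pc t_zero p_zero)
 qed (auto simp: t_def Qo Cn pc p_add p_smult tc t_add t_smult X.C.smult_r_null)
 interpret t: chmap R Q X ?t by (rule tm)
 have FQo: "x:el (FM (P\<lparr>carrier := C m\<rparr>))\<longleftrightarrow>x:C m&a\<odot>\<^sub>P x = x" for x m
  using FM_carrier[OF Q.X_lm, of x m] by (simp add: Qo)
 \<comment> \<open>A vector of P fixed by \<open>a\<close> is mapped into \<open>?B\<close> by
   \<open>aB\<close>, so it lies in \<open>?P1\<close>: the inclusion becomes bijective in the
   corner.\<close>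
 have FQ: "acyc (FX Q)" unfolding acyc_def
 proof (intro allI ballI impI)
  fix m x assume x: "x:cel (FX Q) m" and d: "cdiff (FX Q) m x = \<zero>\<^sub>(FX Q)\<^sup>(m+1)"
  from x have x': "x:C m" "a\<odot>\<^sub>P x = x" by (auto simp: Qo FQo)
  have d': "cdiff Q m x = \<zero>\<^sub>P" using d x by (simp add: Qo)
  have 0: "\<zero>\<^sub>P:cel (FX Q) (m-1)" "cdiff (FX Q) (m-1) \<zero>\<^sub>P = \<zero>\<^sub>P"
   using Q.C.M.zero_closed[of "m-1"] Q.C.smult_r_null[OF a, of "m-1"] Q.d_zero[of "m-1"] by (simp_all add: Qo FQo)
  show "\<exists>x'\<in>cel (FX Q) (m-1). cdiff (FX Q) (m-1) x' = x"
  proof (cases "m = n")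
   case True
   then have "\<pi> x:?B" using p_smult[OF a, of x] x' aB[of "\<pi> x"] pc[of x] by (simp add: Cn)
   then have "x:C (m-1)" using True x' by (simp add: Cn)
   then show ?thesis using x'(2) True by (intro bexI[of _ x]) (simp_all add: Qo Qd FQo)
  next
   case False
   then have "x = \<zero>\<^sub>P" using C0[OF x'(1)] d' Qd[OF x'(1)] by (cases "m = n-1") auto
   then show ?thesis using 0 by blast
  qed
 qed
 have "acyc (FX (cone Q X ?t))"
  unfolding FX_cone[OF tm] using S.acyc_cone_iff[OF F_chmap[OF tm]] S.acyc_qis[OF F_chmap[OF tm] FQ X(2)] by blast
 moreover have "exact_at (cone Q X ?t) j" if j: "j < l\<or>j\<ge>n" for j
 proof (intro ballI impI)
  fix z assume z: "z:cel (cone Q X ?t) j" and dz: "cdiff (cone Q X ?t) j z = \<zero>\<^sub>(cone Q X ?t)\<^sup>(j+1)"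
  obtain q x where qx: "z = pair_seq q x" "q:cel Q (j+1)" "x:cel X j" using z by (auto elim: ds_carrierE)
  have qC: "q:C (j+1)" using qx(2) by (simp add: Qo)
  have e: "cdiff Q (j+1) q = \<zero>\<^sub>P" "?t (j+1) q\<oplus>\<^sub>X\<^sup>(j+1) cdiff X j x = \<zero>\<^sub>X\<^sup>(j+1)"
   using dz qx neg_eq_zero_iff[OF Q.X_lm Q.d_closed, of q "j+1" "j+2"] by (simp_all add: Qo)
  let ?G = "\<exists>x'\<in>cel (cone Q X ?t) (j-1). cdiff (cone Q X ?t) (j-1) x' = z"
  have goal: ?G if "q':cel Q j" "x':cel X (j-1)" "q =\<ominus>\<^sub>Q\<^sup>(j+1) cdiff Q j q'"
   "x = ?t j q'\<oplus>\<^sub>X\<^sup>j cdiff X (j-1) x'" for q' x' using that qx(1) by (intro bexI[of _ "pair_seq q' x'"]) simp_all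
  have trivial: ?G if q: "q = \<zero>\<^sub>P" and jn: "j~=n"
  proof -
   have "cdiff X j x = \<zero>\<^sub>X\<^sup>(j+1)" using e(2) q qx(3) t.f_zero[of "j+1"] by (simp add: Qo)
   moreover have "exact_at X j" using ex[of j] j jn ln by auto
   ultimately obtain x' where x': "x':cel X (j-1)" "cdiff X (j-1) x' = x" using qx(3) by blast
   show ?thesis using t.f_zero[of j] Q.d_zero[of j] Q.C.M.a_inv_zero[of "j+1"] Q.C.M.zero_closed[of j] q x' qx(3)
    by (intro goal[of "\<zero>\<^sub>P" x']) (simp_all add: Qo)
  qed
  \<comment> \<open>Degree n is exact because P covers the cycles modulo boundaries. Degree n - 1
    has to be treated only when l = n, where the cone must come out exact everywhere. In all other
    degrees the component in \<open>Q\<close> vanishes and exactness is inherited from X.\<close>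
  consider "j > n" | "j = n" | "j = n-1" "j < l" | "j = n-2" "j < l" | "j < n-2" using j ln by linarith
  then show ?G
  proof cases
   case 2
   have q: "q = \<zero>\<^sub>P" using C0[OF qC] 2 by simp
   then have "cdiff X n x = \<zero>\<^sub>X\<^sup>(n+1)" using e(2) 2 qx(3) t.f_zero[of "n+1"] by (simp add: Qo)
   then have "x:?Z" using qx(3) 2 by simp
   from bspec[OF P(3) this] obtain p x' where p: "p:el P" "x':cel X (n-1)" "x = \<pi> p\<oplus>\<^sub>X\<^sup>n cdiff X (n-1) x'" by blast
   show ?thesis using p q 2 Q.C.M.a_inv_zero[of "n+1"] Qd[of p n] by (intro goal[of p x']) (simp_all add: Qo Cn t_def)
  next
   case 3
   have qP: "q:el P" using qC 3 by (simp add: Cn)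
   have "\<pi> q\<oplus>\<^sub>X\<^sup>n cdiff X (n-1) x = \<zero>\<^sub>X\<^sup>n" "cdiff X (n-1) x:cel X n" using qx(3) e(2) 3 qx(2) X.d_closed[of x "n-1" n] by (simp_all add: t_def)
   then have pq: "\<ominus>\<^sub>X\<^sup>n cdiff X (n-1) x = \<pi> q" "\<pi> q = cdiff X (n-1) (\<ominus>\<^sub>X\<^sup>(n-1) x)"
    using X.C.M.minus_equality[OF _ _ pc(1)[OF qP]] qx(3) 3 by simp_all
   have "\<pi> q:?B" unfolding pq(2) using qx(3) 3 by (intro imageI) simp
   then have q1: "q:?P1" using qP by simp
   then have q1': "q:cel Q (n-1)" by (simp add: Qo Cn)
   have tq: "?t (n-1) q = \<tau> q" using q1' by (simp add: t_def)
   have "cdiff X (n-1) (x\<oplus>\<^sub>X\<^sup>(n-1) \<tau> q) = \<zero>\<^sub>X\<^sup>n"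
    using qx(3) 3 tc[OF q1] t(2) q1 by (simp flip: pq(1) add: X.C.M.r_neg)
   then obtain x' where x': "x':cel X (n-2)" "cdiff X (n-2) x' = x\<oplus>\<^sub>X\<^sup>(n-1) \<tau> q"
    using bspec[OF ex[of "n-1"], of "x\<oplus>\<^sub>X\<^sup>(n-1) \<tau> q"] 3 qx(3) tc[OF q1] by auto
   show ?thesis
   proof (rule goal[of "\<ominus>\<^sub>Q\<^sup>(n-1) q" x'])
    have "cdiff Q (n-1) (\<ominus>\<^sub>Q\<^sup>(n-1) q) =\<ominus>\<^sub>Q\<^sup>n q"
     using Q.d_minus[OF q1'] q1' Qd[of q "n-1"] by (simp add: Qo)
    then show "q =\<ominus>\<^sub>Q\<^sup>(j+1) cdiff Q j (\<ominus>\<^sub>Q\<^sup>(n-1) q)" using 3 Q.C.M.minus_minus[of q n] qx(2) by simp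
    show "x = ?t j (\<ominus>\<^sub>Q\<^sup>(n-1) q)\<oplus>\<^sub>X\<^sup>j cdiff X (j-1) x'"
     using 3 t.f_minus[OF q1'] tq x'(2) qx(3) tc[OF q1] by (simp, insert qx(3), algebra)
   qed (use 3 q1' x' in simp_all)
  next
   case 4
   then show ?thesis using e(1) Qd[OF qC] by (intro trivial) simp_all
  qed (use C0[OF qC] in \<open>intro trivial; simp\<close>)+
 qed
 ultimately show ?thesis using QP tm by blast
qed

text \<open>Induction on the number k of degrees, starting at l, in which X may fail to be exact.
  The top degree is killed by the cone of a map from a perfect complex, and
  \<open>perf_target\<close> returns from the cone to X.\<close>

lemma F_acyclic_perf:
 assumes X: "cplx R X" "acyc (FX X)"
 shows "X:perf"
proof -
 have *: "X:perf" if "cplx R X" "acyc (FX X)" "!!j. j < l\<or>j\<ge>l + int k ==> exact_at X j" for X l k using that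
 proof (induction k arbitrary: X)
  case 0
  have "j < l\<or>j\<ge>l + int 0" for j by auto
  then show ?case using acyc_perf[OF 0(1)] 0(3) unfolding acyc_def by blast
 next
  case (Suc k)
  have "exact_at X j" if "j < l\<or>j > l + int k" for j using Suc.prems(3)[of j] that by auto
  then obtain Q t where Q: "Q:PROJ" "chmap R Q X t" "acyc (FX (cone Q X t))"
   "\<forall>j. j < l\<or>j\<ge>l + int k-->exact_at (cone Q X t) j" using kill_top_cohomology[OF Suc.prems(1,2), of l "l + int k"] by auto
  have "cone Q X t:perf" using Suc.IH[OF cone_cplx[OF Q(2)] Q(3)] Q(4) by blast
  then show ?case using perf_target[OF Q(2) _ PROJ_perf[OF Q(1)]] by blast
 qed
 interpret X: cplx R X by (rule X)
 \<comment> \<open>Zero is inserted so that minimum and maximum exist for the zero complex as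
   well.\<close>
 let ?D = "insert 0 {n. cel X n~={\<zero>\<^sub>X\<^sup>n}}"
 have f: "finite ?D" using X.bounded by simp
 let ?l = "Min ?D" and ?u = "Max ?D"
 show ?thesis
 proof (rule *[OF X, of ?l "nat (?u+1 - ?l)"])
  fix j assume "j < ?l\<or>j\<ge>?l + int (nat (?u+1 - ?l))"
  then have "j < ?l\<or>j > ?u" by linarith
  then have "j\<notin>?D" using Min_le[OF f, of j] Max_ge[OF f, of j] by linarith
  then have "cel X j = {\<zero>\<^sub>X\<^sup>j}" by blast
  then show "exact_at X j" using X.d_zero[of "j-1"] by (intro ballI impI bexI[of _ "\<zero>\<^sub>X\<^sup>(j-1)"]) simp_all
 qed
qed

text \<open>A projective replacement P of F C is moved to the source: its adjoint G consists of
  projectives, and F G is isomorphic to P. So the transpose G -> C becomes a quasi-isomorphism under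
  \<open>F\<close>, and its cone is perfect by \<open>F_acyclic_perf\<close>.\<close>

lemma F_perf_reflect:
 assumes C: "cplx R C" "FX C:S.perf"
 shows "C:perf"
proof -
 obtain P q where P: "P:S.PROJ" "chmap S P (FX C) q" "qis P (FX C) q" using C(2) unfolding S.perf_def by auto
 obtain G \<eta> where u: "universal_cplx P G \<eta>" using universal_cplx_ex P(1) S.PROJ_iff by blast
 obtain v where v: "chmap R G C v" "S.cmp_map P (Fm G v) \<eta> = q" using uc_chmap[OF u C(1) P(2)] by blast
 note U = uc[OF u]
 have "qis P (FX G) \<eta>" by (rule S.Kb_iso_qis[OF uc_iso[OF u] U(3)])
 then have "qis (FX G) (FX C) (Fm G v)"
  using S.hinj_comp_left[OF U(3) F_chmap[OF v(1)]] S.hsurj_comp_left[OF U(3) F_chmap[OF v(1)]] P(3) unfolding v(2) qis_def by blast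
 then have "acyc (FX (cone G C v))" unfolding FX_cone[OF v(1)] using S.acyc_cone_iff[OF F_chmap[OF v(1)]] by blast
 then show ?thesis using perf_target[OF v(1) F_acyclic_perf[OF cone_cplx[OF v(1)]] PROJ_perf[OF uc_PROJ[OF u P(1)]]] by blast
qed

theorem corner_singular_equivalence: "induces_singular_equivalence R S F"
proof -
 interpret TS: two_step_functor "Kb R" "acyclic_complexes R" perf PROJ "Kb S" "acyclic_complexes S" S.perf S.PROJ FK by (rule FK_two_step)
 interpret NP: nullsys R perf by (rule nullsys_perf)
 interpret SP: nullsys S S.perf by (rule S.nullsys_perf)
 have "is_triangle_equivalence TS.R.VQ2 TS.S.VQ2 TS.F2 (\<lambda>X. Ident TS.S.VQ2 (Shift TS.S.VQ2 (ob TS.F2 X)))"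
 proof (rule TS.F2_triangle_equivalence)
  fix X Y u assume X: "X:Ob (Kb R)" "Y:Ob (Kb R)" "u:Hom (Kb R) X Y"
   and d: "mor FK X Y u:denominators (Kb S) S.perf (ob FK X) (ob FK Y)"
  obtain f where f: "chmap R X Y f" "u = hcl X Y f" using Kb_HomE[OF X(3)] X by auto
  obtain g where g: "SP.W (FX X) (FX Y) g" "S.hcl (FX X) (FX Y) (Fm X f) = S.hcl (FX X) (FX Y) g"
   using d unfolding f(2) FK_hcl[OF f(1)] FK_ob SP.den_iff by blast
  have gc: "chmap S (FX X) (FX Y) g" using g(1) unfolding SP.W_def by blast
  have "homotopic S (FX X) (FX Y) (Fm X f) g" using g(2) S.hcl_eq_iff[OF F_chmap[OF f(1)] gc] by blast
  then have "SP.W (FX X) (FX Y) (Fm X f)" using SP.W_homotopic F_chmap[OF f(1)] gc g(1) by blast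
  then have "FX (cone X Y f):S.perf" unfolding FX_cone[OF f(1)] SP.W_def by blast
  then have "cone X Y f:perf" by (rule F_perf_reflect[OF cone_cplx[OF f(1)]])
  then show "u:denominators (Kb R) perf X Y" unfolding NP.den_iff NP.W_def f(2) using f(1) by blast
 next
  fix X Y u assume X: "X:Ob (Kb S)" "Y:Ob (Kb S)" and i: "is_iso (Kb S) X Y u"
  then have "u:Hom (Kb S) X Y" unfolding is_iso_def by blast
  then obtain f where f: "chmap S X Y f" "u = S.hcl X Y f" using S.Kb_Hom[of X Y u] X by auto
  have "qis X Y f" by (rule S.Kb_iso_qis[OF i[unfolded f(2)] f(1)])
  then show "u:denominators (Kb S) S.perf X Y" unfolding SP.den_iff using SP.W_qis[OF f(1)] f(2) by blast
 qed (rule F_adjoint, simp)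
 moreover have "\<exists>P'\<in>S.PROJ. \<exists>f. is_iso (Db S) (ob (Db_func S F) P) P' f" if P: "P:PROJ" for P
 proof (intro bexI[of _ "FX P"] exI)
  show "FX P:S.PROJ" by (rule F_PROJ[OF P])
  show "is_iso (Db S) (ob (Db_func S F) P) (FX P) (Ident (Db S) (FX P))"
   unfolding Db_def Db_func_def TS.F0.vf_ob FK_ob using TS.S.V.iso_ident[of "FX P"] F_PROJ[OF P] by (simp add: S.PROJ_iff)
 qed
 ultimately show ?thesis unfolding induces_singular_equivalence_def Dsg_def Db_def Dsg_func_def Db_func_def using F_exact by blast
qed

end

section \<open>Idempotents of quiver algebras\<close>

definition reg :: "('r, 'z) ring_scheme=>('r, 'r) module" where
 "reg R = \<lparr>carrier = el R, mult = mult R, one = one R, zero = zero R, add = add R, smult = mult R\<rparr>"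

lemma reg_simps [simp]: "el (reg R) = el R" "zero (reg R) = zero R" "add (reg R) = add R" "smult (reg R) = mult R"
 unfolding reg_def by simp_all

text \<open>Sums are formed relative to a carrier, so a sum in a left ideal or in \<open>aR\<close>
  is a different term from the sum in the ring, with the same value.\<close>

lemma (in ring) finsum_sub:
 assumes "abelian_group M" "add M = add R" "zero M = zero R" "el M<=el R" "finite I" "!!i. i:I ==> f i:el M"
 shows "finsum M f I = finsum R f I"
proof -
 interpret M: abelian_group M by fact
 show ?thesis using assms(5,6)
 proof (induction I rule: finite_induct)
  case (insert i I)
  then have "f:I \<rightarrow> el M" "f:I \<rightarrow> el R" "f i:el M" "f i:el R" using assms(4) by auto
  then show ?case using insert M.finsum_insert[of I i f] finsum_insert[of I i f] assms(2) by simp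
 qed (simp add: assms(3))
qed

text \<open>\<open>L v\<close> is the set of elements with no component at the trivial path at \<open>v\<close>, a maximal left ideal, and
 \<open>D e x\<close> strips the first arrow \<open>e\<close> from the paths in \<open>x\<close> starting with \<open>e\<close>. The latter is
 well-defined because no relation starts in the tail of \<open>e\<close>.\<close>

locale quiver_corner = idem R a for R :: "'r ring" (structure) and a +
 fixes V V0 :: "'v set" and E :: "'e set" and tl hd :: "'e=>'v" and ep :: "'v=>'r" and al :: "'e=>'r"
  and L :: "'v=>'r set" and D :: "'e=>'r=>'r" and m :: nat
 assumes fin: "finite V" "finite E" and V0: "V0<=V" and tl: "e:E ==> tl e:V" and hd: "e:E ==> hd e:V"
  and ep: "v:V ==> ep v:el R" and ep_sum: "finsum R ep V = \<one>"
  and a_ep: "v:V ==> v\<notin>V0 ==> a\<otimes> ep v = ep v" "v:V ==> v\<notin>V0 ==> ep v\<otimes> a = ep v"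
  and ep_ep: "v:V ==> ep v\<otimes> ep v = ep v"
  and al: "e:E ==> al e:el R" and al_tl: "e:E ==> al e\<otimes> ep (tl e) = al e"
  and nil: "set es<=E ==> length es = m ==> foldr (\<lambda>e y. y\<otimes> al e) es \<one> = \<zero>"
  and L: "v:V ==> submod R (reg R) (L v)"
  and L_max: "v:V ==> x:el R ==> x\<notin>L v ==> \<exists>y\<in>el R. \<one>\<oplus>\<ominus> (y\<otimes> x):L v"
  and L_ep: "v:V ==> x:L v ==> \<exists>r. (\<forall>e\<in>E. r e:el R)&x\<otimes> ep v = finsum R (\<lambda>e. r e\<otimes> al e) {e\<in>E. tl e = v}"
  and ep_L: "v:V0 ==> ep v\<notin>L v" "v:V0 ==> \<one>\<oplus>\<ominus> ep v:L v"
  and a_L: "v:V0 ==> x:el R ==> a\<otimes> x:L v" and al_L: "e:E ==> v:V0 ==> al e:L v"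
  and D: "e:E ==> tl e:V0 ==> linear_form R (reg R\<lparr>carrier := L (tl e)\<rparr>) (D e)"
  and D_al: "e:E ==> tl e:V0 ==> y:el R ==> D e (y\<otimes> al e) = y\<otimes> ep (hd e)"
  and D_hd: "e:E ==> tl e:V0 ==> x:L (tl e) ==> D e x\<otimes> ep (hd e) = D e x"
  and D_sum: "v:V0 ==> x:L v ==> x\<otimes> ep v = finsum R (\<lambda>e. D e x\<otimes> al e) {e\<in>E. tl e = v}"
begin

abbreviation "word es\<equiv>foldr (\<lambda>e y. y\<otimes> al e) es \<one>"

lemma word: "set es<=E ==> word es:el R" by (induction es) (auto simp: al)

lemma reg_lm: "lmod R (reg R)"
 by (rule left_moduleI[OF ring_axioms]) (auto simp: a_ac l_distr r_distr m_assoc intro: bexI[of _ "\<ominus> _"] l_neg)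

interpretation reg: left_module R "reg R" by (rule reg_lm)

lemma Lc: "v:V ==> x:L v ==> x:el R" using submodD(2)[OF L] by simp

text \<open>Write x = x(1 - e) + x e with e the idempotent of \<open>v\<close>. The first summand
  has x itself as coefficient of the vector 1 - e, the second is the sum of the D e x times the
  arrows starting in \<open>v\<close>. Together these form a dual basis of the left ideal.\<close>

lemma L_factors:
 assumes "v:V0"
 shows "factors R (reg R\<lparr>carrier := L v\<rparr>) (reg R\<lparr>carrier := L v\<rparr>) (\<lambda>x. x)"
proof -
 have v: "v:V" using assms V0 by auto
 note LD = submodD[OF L[OF v]]
 let ?L = "reg R\<lparr>carrier := L v\<rparr>"
 interpret L: left_module R ?L by (rule reg.submod_left_module[OF L[OF v]])
 let ?E = "{e\<in>E. tl e = v}"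
 have i: "linear_form R ?L (\<lambda>x. x)" unfolding linear_form_def using Lc[OF v] by simp
 have sc: "D e x\<otimes> al e:L v" if "e:?E" "x:L v" for e x
  using LD(5)[OF _ al_L, of "D e x" e] linear_formD(1)[OF D, of e x] that assms by simp
 have D': "factors R ?L ?L (\<lambda>x. finsum ?L (\<lambda>e. D e x\<otimes> al e) ?E)"
 proof (rule L.factors_finsum)
  fix e assume e: "e:?E"
  then have "linear_form R ?L (D e)" using D[of e] assms by simp
  from L.factors_single[OF this, of "al e"] show "factors R ?L ?L (\<lambda>x. D e x\<otimes> al e)" using e al_L assms by simp
 qed (use fin sc in auto)
 have i': "factors R ?L ?L (\<lambda>x. x\<otimes> (\<one>\<oplus>\<ominus> ep v))"
  using L.factors_single[OF i, of "\<one>\<oplus>\<ominus> ep v"] ep_L(2)[OF assms] by simp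
 have "factors R ?L ?L (\<lambda>x. x\<otimes> (\<one>\<oplus>\<ominus> ep v)\<oplus> finsum ?L (\<lambda>e. D e x\<otimes> al e) ?E)"
  using L.factors_add[OF i' D'] by simp
 then show ?thesis
 proof (rule factors_cong)
  fix x assume "x:el ?L"
  then have x: "x:L v" by simp
  have "finsum ?L (\<lambda>e. D e x\<otimes> al e) ?E = x\<otimes> ep v"
   using finsum_sub[of ?L ?E "\<lambda>e. D e x\<otimes> al e"] L.M.abelian_group_axioms Lc[OF v] fin sc x D_sum[OF assms x] by auto
  then show "x = x\<otimes> (\<one>\<oplus>\<ominus> ep v)\<oplus> finsum ?L (\<lambda>e. D e x\<otimes> al e) ?E"
   using Lc[OF v x] ep[OF v] by (simp add: r_distr r_minus a_assoc l_neg)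
 qed
qed

abbreviation "adjoin Z M x\<equiv>{y\<oplus>\<^sub>Z r\<odot>\<^sub>Z x | y r. y:M&r:el R}"

text \<open>The kernel of the map from the free module to Z/B.\<close>

abbreviation "free_pre Z n x B\<equiv>free_mod R n\<lparr>carrier := {p\<in>el (free_mod R n). lc Z n p x:B}\<rparr>"

text \<open>Filtrations of submodules that start at B and adjoin one generator at a time. Each
  quotient is cyclic and annihilated by the maximal left ideal \<open>L w\<close>, thus simple at a
  vertex \<open>w\<close> of W or zero. With W all vertices this gives noetherianity, with W the
  chosen vertices it gives the resolutions.\<close>

inductive chain :: "'r fgmod=>'v set=>(nat=>'r) set=>(nat=>'r) set=>bool" for Z W B where
 base: "chain Z W B B"
| step: "chain Z W B M ==> x:el Z ==> w:W ==> \<forall>r\<in>L w. r\<odot>\<^sub>Z x:M ==>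
  chain Z W B (adjoin Z M x)"

context
 fixes Z B W
 assumes Z: "Z:MOD" and B: "submod R Z B" and W: "W<=V" "!!v z. v:V ==> v\<notin>W ==> z:el Z ==> ep v\<odot>\<^sub>Z z:B"
begin

interpretation Z: left_module R Z using Z by simp

lemma submod_add: "submod R Z M ==> x:el Z ==>
  submod R Z (adjoin Z M x)"
proof (rule submodI, goal_cases)
 case 1
 then show ?case using submodD(2)[OF 1(1)] by (auto simp: Z.smult_closed)
next
 case 2
 then show ?case using submodD(3)[OF 2(1)] by (intro CollectI exI[of _ "\<zero>\<^sub>Z"] exI[of _ \<zero>]) (simp add: Z.smult_l_null)
next
 case (3 x1 x2)
 then obtain y r y' r' where *: "x1 = y\<oplus>\<^sub>Z r\<odot>\<^sub>Z x" "x2 = y'\<oplus>\<^sub>Z r'\<odot>\<^sub>Z x" "y:M" "y':M" "r:el R" "r':el R" by blast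
 then have "x1\<oplus>\<^sub>Z x2 = (y\<oplus>\<^sub>Z y')\<oplus>\<^sub>Z (r\<oplus> r')\<odot>\<^sub>Z x"
  using submodD(2)[OF 3(1)] 3(2) by (simp add: Z.smult_l_distr Z.smult_closed Z.M.a_ac)
 then show ?case using * submodD(4)[OF 3(1), of y y'] by blast
next
 case (4 s x1)
 then obtain y r where *: "x1 = y\<oplus>\<^sub>Z r\<odot>\<^sub>Z x" "y:M" "r:el R" by blast
 then have "s\<odot>\<^sub>Z x1 = s\<odot>\<^sub>Z y\<oplus>\<^sub>Z (s\<otimes> r)\<odot>\<^sub>Z x"
  using submodD(2)[OF 4(1)] 4(2,3) by (simp add: Z.smult_r_distr Z.smult_assoc1 Z.smult_closed)
 then show ?case using * submodD(5)[OF 4(1), of s y] 4(3) by blast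
qed

lemma chain_sub: "chain Z W B M ==> submod R Z M&B<=M"
proof (induction rule: chain.induct)
 case (step M x w)
 note M = submodD[OF conjunct1[OF step.IH]]
 have "y:adjoin Z M x" if "y:M" for y
  using that M(2)[OF that] step(2) by (intro CollectI exI[of _ y] exI[of _ \<zero>]) (simp add: Z.smult_l_null)
 then show ?case using submod_add step by blast
qed (use B in simp)

lemma chain_finite:
 assumes "finite I" "chain Z W B M" "!!i M'. i:I ==> chain Z W B M' ==> M<=M' ==> \<exists>M''. chain Z W B M''&M'<=M''&x i:M''"
 shows "\<exists>M'. chain Z W B M'&M<=M'&(\<forall>i\<in>I. x i:M')" using assms(1,3)
proof (induction I rule: finite_induct)
 case empty
 then show ?case using assms(2) by blast
next
 case (insert i I)
 then obtain M' where M': "chain Z W B M'" "M<=M'" "\<forall>i\<in>I. x i:M'" by blast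
 then obtain M'' where "chain Z W B M''" "M'<=M''" "x i:M''" using insert.prems[of i M'] by blast
 then show ?case using M' by blast
qed

lemma submod_finsum:
 assumes "submod R Z H" "finite I" "g:el Z" "!!i. i:I ==> c i:el R&c i\<odot>\<^sub>Z g:H"
 shows "finsum R c I\<odot>\<^sub>Z g:H" using assms(2,4)
proof (induction I rule: finite_induct)
 case empty
 then show ?case using submodD(3)[OF assms(1)] by (simp add: Z.smult_l_null assms(3))
next
 case (insert i I)
 have "finsum R c I:el R" using insert by (intro finsum_closed) auto
 then have "finsum R c (insert i I)\<odot>\<^sub>Z g = c i\<odot>\<^sub>Z g\<oplus>\<^sub>Z finsum R c I\<odot>\<^sub>Z g"
  using insert by (subst finsum_insert) (auto simp: Z.smult_l_distr assms(3))
 then show ?case using insert submodD(4)[OF assms(1)] by simp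
qed

text \<open>Induction on the length s after which all words of arrows send \<open>g\<close> into the
  filtration. The elements obtained from \<open>g\<close> by one arrow are reached by hypothesis.
  After that the parts of \<open>g\<close> at the vertices of W can be adjoined, the parts at other
  vertices lie in B, and \<open>g\<close> is the sum of its parts.\<close>

lemma chain_reach:
 "chain Z W B M ==> g:el Z ==> (!!es. set es<=E ==> length es = s ==> word es\<odot>\<^sub>Z g:M) ==>
  \<exists>M'. chain Z W B M'&M<=M'&g:M'"
proof (induction s arbitrary: M g)
 case 0
 from 0(3)[of "[]"] have "g:M" using 0(2) by (simp add: Z.smult_one)
 then show ?case using 0(1) by blast
next
 case (Suc s)
 have "\<exists>M'. chain Z W B M'&M<=M'&(\<forall>e\<in>E. al e\<odot>\<^sub>Z g:M')"
 proof (rule chain_finite[OF fin(2) Suc.prems(1)])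
  fix e M' assume e: "e:E" and M': "chain Z W B M'" "M<=M'"
  have "word es\<odot>\<^sub>Z (al e\<odot>\<^sub>Z g):M'" if "set es<=E" "length es = s" for es
   using Suc.prems(3)[of "e # es"] that e M'(2) Suc.prems(2) al[OF e] word[OF that(1)] by (auto simp: Z.smult_assoc1)
  then show "\<exists>M''. chain Z W B M''&M'<=M''&al e\<odot>\<^sub>Z g:M''"
   using Suc.IH[OF M'(1), of "al e\<odot>\<^sub>Z g"] Z.smult_closed[OF al[OF e] Suc.prems(2)] by blast
 qed
 then obtain M' where M': "chain Z W B M'" "M<=M'" "\<forall>e\<in>E. al e\<odot>\<^sub>Z g:M'" by blast
 have "\<exists>M''. chain Z W B M''&M'<=M''&(\<forall>w\<in>V. ep w\<odot>\<^sub>Z g:M'')"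
 proof (rule chain_finite[OF fin(1) M'(1)])
  fix w N assume w: "w:V" and N: "chain Z W B N" "M'<=N"
  note Ns = chain_sub[OF N(1)]
  have wg: "ep w\<odot>\<^sub>Z g:el Z" using Z.smult_closed[OF ep[OF w] Suc.prems(2)] .
  show "\<exists>M''. chain Z W B M''&N<=M''&ep w\<odot>\<^sub>Z g:M''"
  proof (cases "w:W")
   case False
   then show ?thesis using W(2)[OF w False Suc.prems(2)] Ns N(1) by blast
  next
   case True
   \<comment> \<open>An element of \<open>L w\<close> acts on the part of \<open>g\<close> at
     \<open>w\<close> through arrows starting in \<open>w\<close>, and these send \<open>g\<close>
     into the submodule reached so far.\<close>
   have "r\<odot>\<^sub>Z (ep w\<odot>\<^sub>Z g):N" if r: "r:L w" for r
   proof -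
    obtain c where c: "\<forall>e\<in>E. c e:el R" "r\<otimes> ep w = finsum R (\<lambda>e. c e\<otimes> al e) {e\<in>E. tl e = w}" using L_ep[OF w r] by blast
    have "finsum R (\<lambda>e. c e\<otimes> al e) {e\<in>E. tl e = w}\<odot>\<^sub>Z g:N"
     using c(1) al M'(3) N(2) submodD(5)[OF conjunct1[OF Ns]] Suc.prems(2)
     by (intro submod_finsum[OF conjunct1[OF Ns]]) (auto simp: Z.smult_assoc1 fin)
    then show ?thesis using c(2) Z.smult_assoc1[OF Lc[OF w r] ep[OF w] Suc.prems(2)] by simp
   qed
   then have "chain Z W B (adjoin Z N (ep w\<odot>\<^sub>Z g))" (is "chain Z W B ?N") using N(1) wg True by (intro chain.step) auto
   moreover have "N<=?N"
   proof
    fix y assume "y:N"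
    then show "y:?N" using wg submodD(2)[OF conjunct1[OF Ns]] by (intro CollectI exI[of _ y] exI[of _ \<zero>]) (simp add: Z.smult_l_null)
   qed
   moreover have "ep w\<odot>\<^sub>Z g:?N" using wg submodD(3)[OF conjunct1[OF Ns]]
    by (intro CollectI exI[of _ "\<zero>\<^sub>Z"] exI[of _ \<one>]) (simp add: Z.smult_one)
   ultimately show ?thesis by blast
  qed
 qed
 then obtain M'' where M'': "chain Z W B M''" "M'<=M''" "\<forall>w\<in>V. ep w\<odot>\<^sub>Z g:M''" by blast
 have "finsum R ep V\<odot>\<^sub>Z g:M''" using M''(3) ep Suc.prems(2) fin chain_sub[OF M''(1)] by (intro submod_finsum) auto
 then have "g:M''" using ep_sum Suc.prems(2) by (simp add: Z.smult_one)
 then show ?case using M'' M'(2) by blast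
qed

text \<open>Words of length \<open>m\<close> vanish, so they send every generator of Z into B, and
  \<open>chain_reach\<close> can be started with s = m.\<close>

lemma chain_total: "chain Z W B (el Z)"
proof -
 obtain S where S: "finite S" "S<=el Z" "\<forall>H. submod R Z H-->S<=H-->H = el Z" using fin_genE[OF MOD_fg[OF Z] Z.left_module_axioms] .
 have "\<exists>M'. chain Z W B M'&B<=M'&(\<forall>g\<in>S. g:M')"
 proof (rule chain_finite[OF S(1) chain.base])
  fix g M' assume "g:S" and M: "chain Z W B M'" "B<=M'"
  then have "g:el Z" using S(2) by blast
  then show "\<exists>M''. chain Z W B M''&M'<=M''&g:M''"
   using M submodD(3)[OF B] nil by (intro chain_reach[where s = m]) (auto simp: Z.smult_l_null)
 qed
 then obtain M' where M': "chain Z W B M'" "S<=M'" by blast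
 then have "M' = el Z" using S(3) chain_sub by blast
 then show ?thesis using M'(1) by simp
qed

text \<open>The annihilator of \<open>x\<close> modulo M contains the left ideal \<open>L w\<close>,
  which is maximal by \<open>L_max\<close>.\<close>

lemma chain_annihilator:
 assumes M: "submod R Z M" and x: "x:el Z" "w:W" "\<forall>r\<in>L w. r\<odot>\<^sub>Z x:M"
 shows "{r\<in>el R. r\<odot>\<^sub>Z x:M} = el R\<or>{r\<in>el R. r\<odot>\<^sub>Z x:M} = L w"
proof (cases "\<exists>r\<in>el R. r\<odot>\<^sub>Z x:M&r\<notin>L w")
 case True
 have w: "w:V" using W(1) x(2) by blast
 obtain r where r: "r:el R" "r\<odot>\<^sub>Z x:M" "r\<notin>L w" using True by blast
 obtain y where y: "y:el R" "\<one>\<oplus>\<ominus> (y\<otimes> r):L w" using L_max[OF w r(1,3)] by blast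
 have "(\<one>\<oplus>\<ominus> (y\<otimes> r))\<odot>\<^sub>Z x\<oplus>\<^sub>Z y\<odot>\<^sub>Z (r\<odot>\<^sub>Z x):M" using submodD(4,5)[OF M] x(3) y r(2) by blast
 moreover have "(\<one>\<oplus>\<ominus> (y\<otimes> r))\<odot>\<^sub>Z x\<oplus>\<^sub>Z y\<odot>\<^sub>Z (r\<odot>\<^sub>Z x) = x"
  using x(1) y(1) r(1) by (simp add: Z.smult_assoc1[symmetric] Z.smult_l_distr[symmetric] a_assoc l_neg Z.smult_one)
 ultimately have "x:M" by simp
 then show ?thesis using submodD(5)[OF M] by blast
next
 case False
 then show ?thesis using x Lc W(1) by blast
qed

text \<open>Adjoining a generator \<open>x0\<close> adds one coordinate to the free module. The last
  coordinate maps the new kernel onto the annihilator of \<open>x0\<close> modulo M, with the old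
  kernel as kernel. That annihilator is R or \<open>L w\<close> with w in \<open>V0\<close>, hence
  projective, and so is the extension.\<close>

lemma chain_resolution:
 assumes "W<=V0" "chain Z W B M"
 shows "\<exists>n x. (\<forall>i<n. x i:el Z)&(\<forall>p\<in>el (free_mod R n). lc Z n p x:M)&
  (\<forall>z\<in>M. \<exists>p\<in>el (free_mod R n). \<exists>b\<in>B. z = lc Z n p x\<oplus>\<^sub>Z b)&factors R (free_pre Z n x B) (free_pre Z n x B) (\<lambda>p. p)"
 using assms(2)
proof (induction rule: chain.induct)
 case base
 have "el (free_mod R 0) = {\<zero>\<^bsub>free_mod R 0\<^esub>}" unfolding free_carrier free_ops by auto
 then show ?case using submodD(2,3)[OF B] by (intro exI[of _ 0] exI[of _ undefined]) (auto simp: factors_def intro!: exI[of _ "[]"])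
next
 case (step M x0 w)
 note Ms = chain_sub[OF step.hyps(1)]
 note MD = submodD[OF conjunct1[OF Ms]] and BD = submodD[OF B]
 obtain n x where x: "\<forall>i<n. x i:el Z" "\<forall>p\<in>el (free_mod R n). lc Z n p x:M"
  "\<forall>z\<in>M. \<exists>p\<in>el (free_mod R n). \<exists>b\<in>B. z = lc Z n p x\<oplus>\<^sub>Z b"
  and K: "factors R (free_pre Z n x B) (free_pre Z n x B) (\<lambda>p. p)" using step.IH by blast
 define x' where "x' = x(n := x0)"
 let ?F = "free_mod R (Suc n)"
 have lx: "lc Z k p x' = lc Z k p x" if "k\<le>n" for k p using that by (induction k) (auto simp: x'_def)
 have x'c: "\<forall>i<Suc n. x' i:el Z" using x(1) step.hyps(2) by (auto simp: x'_def less_Suc_eq)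
 have lS: "lc Z (Suc n) p x' = lc Z n p x\<oplus>\<^sub>Z p n\<odot>\<^sub>Z x0" for p using lx by (simp add: x'_def)
 have lcut: "lc Z n (p(n := r)) x = lc Z n p x" for p r
 proof -
  have "lc Z k (p(n := r)) x = lc Z k p x" if "k\<le>n" for k using that by (induction k) auto
  then show ?thesis by simp
 qed
 have cut: "p(n := \<zero>):el (free_mod R n)" "p n:el R" if "p:el ?F" for p using that by (auto simp: free_carrier)
 have sub: "p(n := r):el ?F" if "p:el (free_mod R n)" "r:el R" for p r using that by (auto simp: free_carrier)
 have lM: "lc Z n p x:M" if "p:el ?F" for p using x(2) cut(1)[OF that] lcut[of p \<zero>] by auto
 let ?K = "?F\<lparr>carrier := {p\<in>el ?F. lc Z (Suc n) p x':B}\<rparr>"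
 let ?I = "reg R\<lparr>carrier := {r\<in>el R. r\<odot>\<^sub>Z x0:M}\<rparr>"
 have FL: "lmod R ?F" by (rule free_left_module)
 interpret F: left_module R ?F by (rule FL)
 have e: "(\<lambda>p\<in>el ?F. lc Z (Suc n) p x'):hm ?F Z" using x'c by (intro lc_hm[OF Z.left_module_axioms]) blast
 have "submod R ?F {p\<in>el ?F. lc Z (Suc n) p x':B}" using submod_vimage[OF e FL Z.left_module_axioms B] by (simp cong: conj_cong)
 then have KL: "lmod R ?K" by (rule F.submod_left_module)
 have wV0: "w:V0" "w:V" using assms(1) step.hyps(3) W(1) by auto
 have "{r\<in>el R. r\<odot>\<^sub>Z x0:M} = el R\<or>{r\<in>el R. r\<odot>\<^sub>Z x0:M} = L w"
  using chain_annihilator[OF conjunct1[OF Ms] step.hyps(2,3,4)] .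
 then have I: "lmod R ?I&factors R ?I ?I (\<lambda>x. x)"
 proof
  assume "{r\<in>el R. r\<odot>\<^sub>Z x0:M} = el R"
  then have eq: "?I = reg R" unfolding reg_def by simp
  have "linear_form R (reg R) (\<lambda>x. x)" unfolding linear_form_def by simp
  from reg.factors_single[OF this, of \<one>] have "factors R (reg R) (reg R) (\<lambda>x. x)" by (rule factors_cong) simp_all
  then show ?thesis unfolding eq using reg_lm by blast
 next
  assume "{r\<in>el R. r\<odot>\<^sub>Z x0:M} = L w"
  then show ?thesis using L_factors[OF wV0(1)] reg.submod_left_module[OF L[OF wV0(2)]] by simp
 qed
 \<comment> \<open>The extension is taken along the last coordinate \<open>p n\<close>, from the new
   kernel \<open>?K\<close> to the left ideal \<open>?I\<close>.\<close>
 have "factors R ?K ?K (\<lambda>x. x)"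
 proof (rule factors_extension[OF KL conjunct1[OF I], where p = "\<lambda>p. p n"])
  show "factors R ?I ?I (\<lambda>x. x)" using I by blast
  show "p n:el ?I" if "p:el ?K" for p
  proof -
   have p: "p:el ?F" "lc Z n p x\<oplus>\<^sub>Z p n\<odot>\<^sub>Z x0:B" using that lS by auto
   have c: "lc Z n p x:el Z" "p n\<odot>\<^sub>Z x0:el Z" using lM[OF p(1)] MD(2) Z.smult_closed[OF cut(2)[OF p(1)] step.hyps(2)] by auto
   have "\<ominus>\<^sub>Z lc Z n p x\<oplus>\<^sub>Z (lc Z n p x\<oplus>\<^sub>Z p n\<odot>\<^sub>Z x0):M"
    using MD(4)[OF Z.submod_minus[OF conjunct1[OF Ms] lM[OF p(1)]]] p(2) Ms by blast
   then show ?thesis using c cut(2)[OF p(1)] by (simp add: Z.M.r_neg1)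
  qed
  show "\<exists>p\<in>el ?K. p n = r" if "r:el ?I" for r
  proof -
   have r: "r:el R" "r\<odot>\<^sub>Z x0:M" using that by auto
   obtain p b where p: "p:el (free_mod R n)" "b:B" "r\<odot>\<^sub>Z x0 = lc Z n p x\<oplus>\<^sub>Z b" using x(3) r(2) by blast
   \<comment> \<open>The relation expresses r x0 as a combination of the old generators plus
     \<open>b\<close> in B. Negating the combination and putting r in the last coordinate gives a
     vector that evaluates to \<open>b\<close>.\<close>
   let ?q = "\<lambda>i.\<ominus> \<one>\<otimes> p i"
   have q: "?q:el (free_mod R n)" using p(1) by (auto simp: free_carrier)
   have "lc Z n ?q x =\<ominus>\<^sub>Z lc Z n p x"
    using Z.lc_smult[of n p x "\<ominus> \<one>"] x(1) free_mem[OF p(1)] Z.minus_smult Z.lc_closed[of n p x] by simp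
   then have "lc Z (Suc n) (?q(n := r)) x' = b" unfolding lS lcut using p(2,3) x(2) p(1) BD(2) MD(2) by (simp add: Z.M.r_neg1)
   then show ?thesis using sub[OF q r(1)] p(2) by (intro bexI[of _ "?q(n := r)"]) simp_all
  qed
  have fz: "p:el ?F&p n = \<zero>\<longleftrightarrow>p:el (free_mod R n)" for p unfolding free_carrier by (auto, metis Suc_leI le_less)
  have lz: "lc Z (Suc n) p x' = lc Z n p x" if "p:el ?F" "p n = \<zero>" for p
   unfolding lS using that lM[OF that(1)] MD(2) step.hyps(2) by (simp add: Z.smult_l_null)
  have "{p\<in>el ?K. p n = \<zero>} = {p\<in>el (free_mod R n). lc Z n p x:B}"
  proof (rule Set.set_eqI)
   fix p
   show "p:{p\<in>el ?K. p n = \<zero>}\<longleftrightarrow>p:{p\<in>el (free_mod R n). lc Z n p x:B}"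
    using fz[of p] lz[of p] by (auto simp del: lc.simps)
  qed
  note eq' = this
  then have eq: "?K\<lparr>carrier := {p\<in>el ?K. p n = \<zero>\<^sub>?I}\<rparr> = free_pre Z n x B" by (simp add: free_mod_def)
  have K0: "lmod R (free_pre Z n x B)"
  proof -
   have "(\<lambda>p\<in>el (free_mod R n). lc Z n p x):hm (free_mod R n) Z" using x(1) by (intro lc_hm[OF Z.left_module_axioms]) blast
   from submod_vimage[OF this free_left_module Z.left_module_axioms B] show ?thesis
    by (intro left_module.submod_left_module[OF free_left_module]) (simp cong: conj_cong)
  qed
  show "factors R (?K\<lparr>carrier := {p\<in>el ?K. p n = \<zero>\<^sub>?I}\<rparr>) ?K (\<lambda>x. x)" unfolding eq
  proof (rule factors_post[OF K0 K, where h = "\<lambda>x. x"])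
   fix p assume "p:el (free_pre Z n x B)"
   then show "p:el ?K" using fz[of p] lz[of p] by (simp del: lc.simps)
  qed (simp_all add: free_ops)
 qed (auto simp: free_ops)
 moreover have "\<forall>p\<in>el ?F. lc Z (Suc n) p x':adjoin Z M x0" unfolding lS using lM cut(2) by blast
 moreover have "\<exists>p\<in>el ?F. \<exists>b\<in>B. z = lc Z (Suc n) p x'\<oplus>\<^sub>Z b" if z: "z:adjoin Z M x0" for z
 proof -
  obtain y r where y: "z = y\<oplus>\<^sub>Z r\<odot>\<^sub>Z x0" "y:M" "r:el R" using z by blast
  obtain p b where p: "p:el (free_mod R n)" "b:B" "y = lc Z n p x\<oplus>\<^sub>Z b" using x(3) y(2) by blast
  have "z = lc Z (Suc n) (p(n := r)) x'\<oplus>\<^sub>Z b"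
   unfolding lS lcut using p x(2) y BD(2) MD(2) Z.smult_closed[OF y(3) step.hyps(2)] by (simp add: Z.M.a_ac)
  then show ?thesis using sub[OF p(1) y(3)] p(2) by blast
 qed
 ultimately show ?case using x'c by (intro exI[of _ "Suc n"] exI[of _ x'] conjI) blast+
qed

text \<open>Only one generator \<open>h\<close> outside M has to be added to those of the
  intersection of H with M: the quotient by M is simple, so every element of H agrees with a
  multiple of \<open>h\<close> modulo M.\<close>

lemma chain_noetherian:
 assumes "chain Z W B M" "B = {\<zero>\<^sub>Z}"
 shows "submod R Z H ==> H<=M ==> \<exists>S. finite S&S<=H&(\<forall>H'. submod R Z H'-->S<=H'-->H<=H')" using assms(1)
proof (induction arbitrary: H rule: chain.induct)
 case base
 then show ?case using assms(2) submodD(3) by (intro exI[of _ "{}"]) blast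
next
 case (step M x0 w)
 note Ms = conjunct1[OF chain_sub[OF step.hyps(1)]]
 note MD = submodD[OF Ms] and HD = submodD[OF step.prems(1)]
 have w: "w:V" using step.hyps(3) W(1) by blast
 have "submod R Z (H\<inter>M)" using HD MD by (intro submodI) auto
 from step.IH[OF this Int_lower2] obtain S
  where S: "finite S" "S<=H\<inter>M" "\<forall>H'. submod R Z H'-->S<=H'-->H\<inter>M<=H'" by (elim exE conjE)
 show ?case
 proof (cases "H<=M")
  case True
  then show ?thesis using S by (intro exI[of _ S]) blast
 next
  case False
  then obtain h where h: "h:H" "h\<notin>M" by blast
  then obtain y r where y: "h = y\<oplus>\<^sub>Z r\<odot>\<^sub>Z x0" "y:M" "r:el R" using step.prems(2) by blast
  have "r\<notin>L w" using h y step.hyps(4) MD(4) by blast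
  \<comment> \<open>The element \<open>c\<close> inverts \<open>r\<close> modulo \<open>L w\<close>.
    Subtracting r' c h therefore cancels the multiple of \<open>x0\<close> in \<open>g\<close> up to
    an element of M.\<close>
  then obtain c where c: "c:el R" "\<one>\<oplus>\<ominus> (c\<otimes> r):L w" using L_max[OF w y(3)] by blast
  have "g:H'" if H': "submod R Z H'" "insert h S<=H'" and g: "g:H" for H' g
  proof -
   obtain y' r' where y': "g = y'\<oplus>\<^sub>Z r'\<odot>\<^sub>Z x0" "y':M" "r':el R" using g step.prems(2) by blast
   let ?s = "\<ominus> (r'\<otimes> c)"
   have s: "?s:el R" using c y' by simp
   have "r'\<oplus> ?s\<otimes> r = r'\<otimes> (\<one>\<oplus>\<ominus> (c\<otimes> r))" using c(1) y'(3) y(3) by (simp add: r_distr r_minus l_minus m_assoc)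
   then have "(r'\<oplus> ?s\<otimes> r)\<odot>\<^sub>Z x0:M"
    using Z.smult_assoc1[OF y'(3) Lc[OF w c(2)] step.hyps(2)] MD(5)[OF y'(3)] step.hyps(4) c(2) by simp
   moreover have "y'\<oplus>\<^sub>Z ?s\<odot>\<^sub>Z y:M" using MD(4,5) y'(2) y(2) s by blast
   moreover have "g\<oplus>\<^sub>Z ?s\<odot>\<^sub>Z h = (y'\<oplus>\<^sub>Z ?s\<odot>\<^sub>Z y)\<oplus>\<^sub>Z (r'\<oplus> ?s\<otimes> r)\<odot>\<^sub>Z x0"
    unfolding y'(1) y(1) using s y(3) y'(3) MD(2)[OF y(2)] MD(2)[OF y'(2)] step.hyps(2)
    by (simp add: Z.smult_r_distr Z.smult_l_distr Z.smult_assoc1 Z.smult_closed Z.M.a_ac)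
   ultimately have "g\<oplus>\<^sub>Z ?s\<odot>\<^sub>Z h:H\<inter>M" using MD(4) HD(4)[OF g HD(5)[OF s h(1)]] by simp
   then have "g\<oplus>\<^sub>Z ?s\<odot>\<^sub>Z h:H'" using S(3) H' by blast
   then have "(g\<oplus>\<^sub>Z ?s\<odot>\<^sub>Z h)\<oplus>\<^sub>Z\<ominus>\<^sub>Z (?s\<odot>\<^sub>Z h):H'"
    using submodD(4)[OF H'(1)] Z.submod_minus[OF H'(1)] submodD(5)[OF H'(1) s] H'(2) by blast
   then show ?thesis using HD(2)[OF g] HD(2)[OF h(1)] Z.smult_closed[OF s] by (simp add: Z.M.a_assoc Z.M.r_neg)
  qed
  then show ?thesis using S(1,2) h(1) by (intro exI[of _ "insert h S"]) blast
 qed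
qed

end

section \<open>The dual basis of a\<Lambda> over the corner ring\<close>

primrec walk :: "nat=>'v=>bool" where
 "walk 0 v\<longleftrightarrow>v:V0"
| "walk (Suc n) v\<longleftrightarrow>v:V0&(\<exists>e\<in>E. tl e = v&walk n (hd e))"

text \<open>\<open>walk n v\<close> means n arrows through n + 1 vertices of \<open>V0\<close>.
  Stripping its first arrow by \<open>D\<close> is well defined and leaves a shorter nonzero word,
  so the whole word is nonzero. As words of length \<open>m\<close> vanish, walks are shorter than
  \<open>m\<close>.\<close>

lemma walk_word: "walk n v ==> \<exists>es. set es<=E&length es = n&word es\<otimes> ep v~=\<zero>"
proof (induction n arbitrary: v)
 case 0
 then have "ep v~=\<zero>" using ep_L(1)[of v] submodD(3)[OF L, of v] V0 by auto
 then show ?case using ep V0 0 by (intro exI[of _ "[]"]) auto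
next
 case (Suc n)
 then obtain e where e: "e:E" "tl e = v" "walk n (hd e)" "v:V0" by auto
 then obtain es where es: "set es<=E" "length es = n" "word es\<otimes> ep (hd e)~=\<zero>" using Suc.IH by blast
 have v: "v:V" using e V0 by blast
 have "D e \<zero> = \<zero>"
  using linear_formD(3)[OF D, of e \<zero> \<zero>] linear_formD(1)[OF D, of e \<zero>] submodD(3)[OF L[OF v]] e by simp
 then have "word es\<otimes> al e~=\<zero>" using D_al[OF e(1) _ word[OF es(1)]] e es(3) by force
 then show ?case using es e al_tl[OF e(1)] word[OF es(1)] al[OF e(1)] ep[OF v] by (intro exI[of _ "e # es"]) (auto simp: m_assoc)
qed

text \<open>Outside \<open>V0\<close> the form x -> x e, with e the idempotent of \<open>v\<close>,
  takes values in the corner ring, with e as its vector. At a vertex of \<open>V0\<close> elements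
  of a\<Lambda> have no trivial path, so the first arrow is stripped and the induction continues at
  its head; n bounds the remaining walk inside \<open>V0\<close>.\<close>

lemma aR_part: "v:V ==> \<not> walk n v ==> factors S aR aR (\<lambda>x. x\<otimes> ep v)"
proof (induction n arbitrary: v)
 note aR = aR_def
 interpret aR: left_module S aR by (rule aR_lm)
 have base: "factors S aR aR (\<lambda>x. x\<otimes> ep v)" if v: "v:V" "v\<notin>V0" for v
 proof -
  have "linear_form S aR (\<lambda>x. x\<otimes> ep v)"
   unfolding linear_form_def using v ep[OF v(1)] a_ep(2)[OF v] by (auto simp: aR S_carrier l_distr m_assoc simp flip: m_assoc[of a])
  from aR.factors_single[OF this, of "ep v"] show ?thesis
   by (rule factors_cong) (use v ep[OF v(1)] a_ep(1)[OF v] ep_ep[OF v(1)] in \<open>auto simp: aR m_assoc\<close>)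
 qed
 {
  case 0
  then show ?case using base by simp
 next
  case (Suc n)
  show ?case
  proof (cases "v:V0")
   case False
   then show ?thesis using base Suc by blast
  next
   case True
   let ?E = "{e\<in>E. tl e = v}"
   have aL: "x:L v" if "x:el aR" for x using a_L[OF True, of x] that by (auto simp: aR)
   have Da: "D e x:el aR" "D e (x\<oplus> y) = D e x\<oplus> D e y" "s:el S ==> D e (s\<otimes> x) = s\<otimes> D e x"
    if "e:?E" "x:el aR" "y:el aR" for e x y s
    using linear_formD[OF D, of e] that True aL[OF that(2)] aL[OF that(3)] linear_formD(3)[OF D, of e a x] by (auto simp: aR S_carrier)
   have "factors S aR aR (\<lambda>x. D e x\<otimes> ep (hd e)\<otimes> al e)" if e: "e:?E" for e
   proof -
    have "factors S aR aR (\<lambda>x. x\<otimes> ep (hd e))" using Suc e True hd by (intro Suc.IH) auto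
    then have "factors S aR aR (\<lambda>x. x\<otimes> ep (hd e)\<otimes> al e)"
     by (rule factors_post[OF aR_lm, where h = "\<lambda>y. y\<otimes> al e"])
      (use e al in \<open>auto simp: aR S_carrier l_distr m_assoc simp flip: m_assoc[of a]\<close>)
    then show ?thesis by (rule factors_pre[where h = "D e"]) (use Da[OF e] in \<open>auto simp: aR\<close>)
   qed
   then have "factors S aR aR (\<lambda>x. finsum aR (\<lambda>e. D e x\<otimes> ep (hd e)\<otimes> al e) ?E)"
    using fin Da(1) al ep hd by (intro aR.factors_finsum) (auto simp: aR simp flip: m_assoc)
   then show ?thesis
   proof (rule factors_cong)
    fix x assume x: "x:el aR"
    have c: "D e x\<otimes> ep (hd e)\<otimes> al e = D e x\<otimes> al e" "D e x\<otimes> al e:el aR" if "e:?E" for e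
     using D_hd[of e x] that True aL[OF x] Da(1)[OF that x x] al[of e] by (auto simp: aR simp flip: m_assoc)
    have "finsum aR (\<lambda>e. D e x\<otimes> ep (hd e)\<otimes> al e) ?E = finsum R (\<lambda>e. D e x\<otimes> ep (hd e)\<otimes> al e) ?E"
     using fin c by (intro finsum_sub) (auto simp: aR.M.abelian_group_axioms, auto simp: aR)
    also have "\<dots> = finsum R (\<lambda>e. D e x\<otimes> al e) ?E" using c by (intro finsum_cong') (auto simp: aR)
    finally show "x\<otimes> ep v = finsum aR (\<lambda>e. D e x\<otimes> ep (hd e)\<otimes> al e) ?E" using D_sum[OF True aL[OF x]] by simp
   qed
  qed
 }
qed

lemma aR_dual_basis: "factors S aR aR (\<lambda>x. x)"
proof -
 note aR = aR_def
 interpret aR: left_module S aR by (rule aR_lm)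
 have nw: "\<not> walk m v" if "v:V" for v
 proof
  assume "walk m v"
  then obtain es where es: "set es<=E" "length es = m" "word es\<otimes> ep v~=\<zero>" using walk_word by blast
  then show False using nil[OF es(1,2)] ep[OF that] by simp
 qed
 have c: "x\<otimes> ep v:el aR" if "v:V" "x:el aR" for v x using that ep[OF that(1)] by (auto simp: aR simp flip: m_assoc)
 have "factors S aR aR (\<lambda>x. finsum aR (\<lambda>v. x\<otimes> ep v) V)"
  by (rule aR.factors_finsum[OF fin(1) aR_part[OF _ nw]]) (auto intro: c)
 then show ?thesis
 proof (rule factors_cong)
  fix x assume x: "x:el aR"
  then have xR: "x:el R" by (simp add: aR)
  have "finsum aR (\<lambda>v. x\<otimes> ep v) V = finsum R (\<lambda>v. x\<otimes> ep v) V"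
   using fin c[OF _ x] by (intro finsum_sub) (auto simp: aR.M.abelian_group_axioms, auto simp: aR)
  also have "\<dots> = x\<otimes> finsum R ep V" using finsum_rdistr[OF fin(1) xR, of ep] ep by auto
  finally show "x = finsum aR (\<lambda>v. x\<otimes> ep v) V" using ep_sum xR by simp
 qed
qed

sublocale corner R a by unfold_locales (rule aR_dual_basis)

theorem quiver_corner_equivalence: "induces_singular_equivalence R S F"
proof -
 have "singular_corner R a"
 proof unfold_locales
  fix M H assume M: "M:MOD" and H: "submod R M H"
  have LM: "lmod R M" using M by simp
  interpret M: left_module R M by (rule LM)
  note HL = M.submod_left_module[OF H]
  \<comment> \<open>All vertices are allowed, so that the filtration can start at zero.\<close>
  have "chain M V {\<zero>\<^sub>M} (el M)" by (rule chain_total[OF M submod_zero[OF LM]]) auto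
  then obtain T where T: "finite T" "T<=H" "\<forall>H'. submod R M H'-->T<=H'-->H<=H'"
   using chain_noetherian[OF M submod_zero[OF LM] order_refl _ _ refl H submodD(1)[OF H]] by blast
  have "fin_gen R (M\<lparr>carrier := H\<rparr>)"
  proof (rule fin_genI[OF HL T(1)])
   fix H' assume H': "submod R (M\<lparr>carrier := H\<rparr>) H'" "T<=H'"
   then have "submod R M H'" using submodD(1)[OF H] unfolding submod_def by auto
   then show "el (M\<lparr>carrier := H\<rparr>)<=H'" using T(3) H'(2) by simp
  qed (use T in simp)
  then show "M\<lparr>carrier := H\<rparr>:MOD" using HL by (simp add: MOD_iff)
 next
  fix Z B assume Z: "Z:MOD" and B: "submod R Z B" and aB: "!!x. x:el Z ==> a\<odot>\<^sub>Z x:B"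
  have ZL: "lmod R Z" using Z by simp
  interpret Z: left_module R Z by (rule ZL)
  \<comment> \<open>Idempotents of vertices outside \<open>V0\<close> lie below \<open>a\<close>,
    which sends Z into B.\<close>
  have W: "ep v\<odot>\<^sub>Z z:B" if "v:V" "v\<notin>V0" "z:el Z" for v z
   using aB[OF Z.smult_closed[OF ep[OF that(1)] that(3)]] a_ep(1)[OF that(1,2)] ep[OF that(1)] that(3) by (simp flip: Z.smult_assoc1)
  obtain n x where x: "\<forall>i<n. x i:el Z" "\<forall>z\<in>el Z. \<exists>p\<in>el (free_mod R n). \<exists>b\<in>B. z = lc Z n p x\<oplus>\<^sub>Z b"
   and K: "factors R (free_pre Z n x B) (free_pre Z n x B) (\<lambda>p. p)"
   using chain_resolution[OF Z B V0 W order_refl chain_total[OF Z B V0 W]] by blast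
  let ?p = "\<lambda>p\<in>el (free_mod R n). lc Z n p x"
  note FL = free_left_module[of n]
  interpret FL: left_module R "free_mod R n" by (rule FL)
  have p: "?p:hm (free_mod R n) Z" using x(1) by (intro lc_hm[OF ZL]) blast
  have e: "{q\<in>el (free_mod R n). ?p q:B} = {q\<in>el (free_mod R n). lc Z n q x:B}" by auto
  have "is_projective R (free_mod R n\<lparr>carrier := {q\<in>el (free_mod R n). ?p q:B}\<rparr>)"
   using factors_projective[OF FL.submod_left_module[OF submod_vimage[OF p FL ZL B]]] K unfolding e by blast
  then show "\<exists>P \<pi>. is_projective R P&\<pi>:hm P Z&(\<forall>z\<in>el Z. \<exists>p\<in>el P. \<exists>b\<in>B. z = \<pi> p\<oplus>\<^sub>Z b)&
    is_projective R (P\<lparr>carrier := {p\<in>el P. \<pi> p:B}\<rparr>)"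
   using p free_projective x(2) by (intro exI[of _ "free_mod R n"] exI[of _ ?p]) simp
 qed
 then show ?thesis by (rule singular_corner.corner_singular_equivalence)
qed

end

section \<open>Path algebras\<close>

context fin_digraph
begin

abbreviation A :: "(('a, 'b) qpath=>'k::field) ring" where "A\<equiv>path_algebra G"
abbreviation pm :: "(('a, 'b) qpath=>'k::field)=>(('a, 'b) qpath=>'k)=>('a, 'b) qpath=>'k" where "pm\<equiv>mult A"
abbreviation unit :: "'a set=>('a, 'b) qpath=>'k::field" where "unit W\<equiv>(\<lambda>(u, es). if es = []&u:W then 1 else 0)"
abbreviation arr :: "'b=>('a, 'b) qpath=>'k::field" where "arr e\<equiv>single_path (tail G e, [e])"
abbreviation strip :: "'b=>(('a, 'b) qpath=>'k::field)=>('a, 'b) qpath=>'k" where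
 "strip e x\<equiv>(\<lambda>(u, es). if u = head G e then x (tail G e, e # es) else 0)"

lemma path_end_simps [simp]: "path_end G (u, []) = u" "path_end G (u, e # es) = path_end G (head G e, es)" unfolding path_end_def by auto

lemma paths_simps [simp]: "(u, []):paths G\<longleftrightarrow>u:verts G"
 "(u, e # es):paths G\<longleftrightarrow>e:arcs G&tail G e = u&(head G e, es):paths G"
 unfolding paths_def path_end_def by (auto simp: awalk_Nil_iff awalk_Cons_iff)

lemma path_end_verts: "(u, es):paths G ==> path_end G (u, es):verts G" by (induction es arbitrary: u) auto

lemma paths_append: "(u, es):paths G ==> (path_end G (u, es), fs):paths G ==> (u, es @ fs):paths G" by (induction es arbitrary: u) auto

lemma A_simps [simp]: "zero A = (\<lambda>_. 0)" "add A = (\<lambda>x y p. x p + y p)" "one A = unit (verts G)"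
 unfolding path_algebra_def by (auto simp: fun_eq_iff)

lemma A_carrier: "x:el A\<longleftrightarrow>finite {p. x p~=0}&(\<forall>p. x p~=0-->p:paths G)" unfolding path_algebra_def by auto

lemma pm_Nil [simp]: "pm x y (u, []) = x (u, []) * y (u, [])" unfolding path_algebra_def by simp

text \<open>Recursion on the first arrow in place of the sum over cuts: either y contributes only
  the trivial path, or the first arrow belongs to its part. The start vertex w of the remaining path
  is ignored, as it is determined by the arrow.\<close>

lemma pm_Cons [simp]: "pm x y (u, e # es) = x (u, e # es) * y (u, []) + pm x (\<lambda>(w, fs). y (u, e # fs)) (head G e, es)"
 unfolding path_algebra_def by (simp add: sum.atMost_Suc_shift del: sum.atMost_Suc)

lemma pm_cong: "(!!fs. y (u, fs) = y' (u, fs)) ==> pm x y (u, es) = pm x y' (u, es)" unfolding path_algebra_def by simp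

lemma pm_add_right: "pm x (\<lambda>p. y p + z p) q = pm x y q + pm x z q"
 by (cases q) (simp add: path_algebra_def algebra_simps sum.distrib)

lemma pm_add_left: "pm (\<lambda>p. x p + y p) z q = pm x z q + pm y z q"
 by (cases q) (simp add: path_algebra_def algebra_simps sum.distrib)

lemma pm_scale: "pm x (\<lambda>p. y p * c) q = pm x y q * c" by (cases q) (simp add: path_algebra_def sum_distrib_right mult.assoc)

lemma pm_zero [simp]: "pm x (\<lambda>p. 0) q = 0" "pm x (\<lambda>(w, fs). 0) q = 0" by (cases q, simp add: path_algebra_def)+

text \<open>The induction needs \<open>z\<close> arbitrary, because the recursion replaces it by its
  part behind the first arrow.\<close>

lemma pm_assoc: "pm (pm x y) z (u, es) = pm x (pm y z) (u, es)"
proof (induction es arbitrary: u z)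
 case (Cons e es)
 let ?z = "\<lambda>(w, fs). z (u, e # fs)" and ?y = "\<lambda>(w, fs). y (u, e # fs)"
 have "pm x (\<lambda>(w, fs). pm y z (u, e # fs)) (head G e, es) = pm x (\<lambda>p. ?y p * z (u, []) + pm y ?z p) (head G e, es)"
  by (rule pm_cong) simp
 then show ?case by (simp only: pm_Cons pm_Nil pm_add_right pm_scale Cons.IH) (simp add: algebra_simps)
qed (simp add: mult.assoc)

lemma pm_unit_left: "pm (unit W) y (u, es) = (if path_end G (u, es):W then y (u, es) else 0)" by (induction es arbitrary: u y) auto

lemma pm_unit_right: "pm x (unit W) (u, es) = (if u:W then x (u, es) else 0)" by (cases es) (auto simp: case_prod_beta)

lemma pm_vertex: "pm x (\<lambda>(w, fs). if fs = []&w = v then 1 else 0) (u, es) = (if u = v then x (u, es) else 0)"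
 using pm_unit_right[of x "{v}" u es] by simp

lemma pm_arr: "pm x (arr e) (u, es) = (case es of []=>0 | f # fs=>if f = e&u = tail G e then x (head G e, fs) else 0)"
proof (cases es)
 case (Cons f fs)
 have "pm x (\<lambda>(w, gs). arr e (u, f # gs)) (head G f, fs) = (if f = e&u = tail G e then x (head G e, fs) else 0)"
 proof (cases "f = e&u = tail G e")
  case True
  then have "pm x (\<lambda>(w, gs). arr e (u, f # gs)) (head G f, fs) = pm x (unit UNIV) (head G f, fs)"
   by (intro pm_cong) (simp add: single_path_def)
  then show ?thesis using True pm_unit_right[of x UNIV "head G e" fs] by simp
 next
  case False
  then have "pm x (\<lambda>(w, gs). arr e (u, f # gs)) (head G f, fs) = pm x (\<lambda>p. 0) (head G f, fs)"
   by (intro pm_cong) (auto simp: single_path_def)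
  then show ?thesis by (simp only: pm_zero if_not_P[OF False])
 qed
 then show ?thesis using Cons by (simp add: single_path_def)
qed (simp add: single_path_def)

text \<open>Stripping commutes with left multiplication except for one term, in which the stripped
  arrow belongs to the left factor and the right factor contributes its trivial path. This term
  vanishes on the relation ideal and on the left ideals \<open>Lv\<close>.\<close>

lemma strip_pm: "strip e (pm y x) p = pm y (strip e x) p + strip e y p * x (tail G e, [])"
proof (cases p)
 case (Pair u es)
 have "pm y (\<lambda>(w, fs). x (tail G e, e # fs)) (head G e, es) = pm y (strip e x) (head G e, es)" by (rule pm_cong) simp
 moreover have "pm y (strip e x) (u, es) = pm y (\<lambda>p. 0) (u, es)" if "u~=head G e" using that by (intro pm_cong) simp
 ultimately show ?thesis using Pair by simp
qed

lemma unit_closed: "W<=verts G ==> unit W:el A"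
proof -
 assume W: "W<=verts G"
 have "{p. unit W p~=(0::'c)}<=(\<lambda>v. (v, [])) ` verts G" using W by (auto split: if_splits)
 then show ?thesis unfolding A_carrier using W finite_subset[OF _ finite_imageI[OF finite_verts]] by auto
qed

lemma arr_closed: "e:arcs G ==> arr e:el A" by (auto simp: A_carrier single_path_def)

lemma pm_closed: "x:el A ==> y:el A ==> pm x y:el A"
proof -
 assume x: "x:el A" and y: "y:el A"
 have *: "\<exists>es fs. p = (u, es @ fs)&y (u, es)~=0&x (path_end G (u, es), fs)~=0" if p: "pm x y p~=0" "fst p = u" for p u
 proof -
  obtain es where es: "p = (u, es)" using p(2) by (cases p) auto
  obtain i where "x (path_end G (u, take i es), drop i es) * y (u, take i es)~=0"
   using p(1) unfolding es path_algebra_def by (auto elim!: sum.not_neutral_contains_not_neutral)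
  then show ?thesis using es by (intro exI[of _ "take i es"] exI[of _ "drop i es"]) auto
 qed
 have "{p. pm x y p~=0}<=(\<lambda>(q, r). (fst r, snd r @ snd q)) ` ({p. x p~=0}\<times>{p. y p~=0})"
  using * by (fastforce simp: image_iff)
 then have "finite {p. pm x y p~=0}" using x y unfolding A_carrier by (meson finite_SigmaI finite_imageI finite_subset)
 moreover have "p:paths G" if "pm x y p~=0" for p using *[OF that refl] x y paths_append unfolding A_carrier by metis
 ultimately show ?thesis unfolding A_carrier by blast
qed

lemma strip_closed: "x:el A ==> strip e x:el A"
proof -
 assume x: "x:el A"
 have "{p. strip e x p~=0}<=(\<lambda>(u, es). (head G e, List.tl es)) ` {p. x p~=0}" by (force simp: image_iff split: if_splits)
 moreover have "p:paths G" if pn: "strip e x p~=0" for p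
 proof -
  obtain es where es: "p = (head G e, es)" "x (tail G e, e # es)~=0" using pn by (cases p) (auto split: if_splits)
  then have "(tail G e, e # es):paths G" using x unfolding A_carrier by blast
  then show ?thesis using es by simp
 qed
 ultimately show ?thesis using x finite_subset unfolding A_carrier by blast
qed

lemma A_sum: "finite I ==> (!!i. i:I ==> f i:el A) ==> (\<lambda>p. \<Sum>i\<in>I. f i p):el A"
proof -
 assume I: "finite I" "!!i. i:I ==> f i:el A"
 have *: "\<exists>i\<in>I. f i p~=0" if "(\<Sum>i\<in>I. f i p)~=0" for p using that by (meson sum.not_neutral_contains_not_neutral)
 then have "{p. (\<Sum>i\<in>I. f i p)~=0}<=(\<Union>i\<in>I. {p. f i p~=0})" by blast
 moreover have "finite (\<Union>i\<in>I. {p. f i p~=0})" using I unfolding A_carrier by simp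
 ultimately have "finite {p. (\<Sum>i\<in>I. f i p)~=0}" by (rule finite_subset)
 moreover have "p:paths G" if "(\<Sum>i\<in>I. f i p)~=0" for p using *[OF that] I(2) unfolding A_carrier by blast
 ultimately show ?thesis unfolding A_carrier by simp
qed

lemma scale_closed: "x:el A ==> (\<lambda>p. x p * c):el A" unfolding A_carrier by (auto elim: finite_subset[rotated])

lemma A_ring: "ring A"
proof (rule ringI)
 have neg: "\<exists>y\<in>el A. y\<oplus>\<^sub>A x = \<zero>\<^sub>A" if "x:el A" for x :: "('a, 'b) qpath=>'c"
  using scale_closed[OF that, of "- 1"] by (intro bexI) (auto simp: fun_eq_iff)
 have add: "x\<oplus>\<^sub>A y:el A" if "x:el A" "y:el A" for x y :: "('a, 'b) qpath=>'c"
 proof -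
  have "{p. x p + y p~=0}<={p. x p~=0}\<union>{p. y p~=0}" by auto
  then have "finite {p. x p + y p~=0}" using that finite_subset unfolding A_carrier by blast
  moreover have "x p~=0\<or>y p~=0" if "x p + y p~=0" for p using that by auto
  ultimately show ?thesis using that unfolding A_carrier A_simps by blast
 qed
 show "abelian_group (A :: (('a, 'b) qpath=>'c) ring)"
  by (rule abelian_groupI, rule add, assumption+, simp add: A_carrier, simp add: add.assoc, simp add: add.commute, simp, rule neg)
 show "monoid (A :: (('a, 'b) qpath=>'c) ring)"
 proof (rule monoidI)
  fix x y z :: "('a, 'b) qpath=>'c" assume x: "x:el A"
  have p: "x p = 0" if "p\<notin>paths G" for p using x that unfolding A_carrier by blast
  show "one A\<otimes>\<^sub>A x = x" using p path_end_verts by (auto simp: fun_eq_iff pm_unit_left)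
  have "u:verts G" if "(u, es):paths G" for u es using that by (cases es) auto
  then show "x\<otimes>\<^sub>A one A = x" using p by (auto simp: fun_eq_iff pm_unit_right)
 qed (auto simp: pm_closed pm_assoc fun_eq_iff unit_closed)
qed (auto simp: fun_eq_iff pm_add_left pm_add_right)

end

section \<open>The bound quiver algebra as an instance\<close>

locale bound_quiver = fin_digraph G for G :: "('a, 'b) pre_digraph" +
 fixes \<rho> :: "(('a, 'b) qpath=>'k::field) set" and V0 :: "'a set"
 assumes min: "minimal_relations G \<rho>" and adm: "admissible G (genideal (path_algebra G) \<rho>)"
  and V0: "V0<=verts G" and norel: "v:V0 ==> r:\<rho> ==> \<not> starts_at G r v"
begin

abbreviation B :: "(('a, 'b) qpath=>'k) ring" where "B\<equiv>path_algebra G"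
abbreviation I where "I\<equiv>genideal B \<rho>"
abbreviation \<Lambda> where "\<Lambda>\<equiv>B Quot I"
abbreviation \<phi> where "\<phi> x\<equiv>I +>\<^sub>B x"

sublocale B: ring B by (rule A_ring)

sublocale I: ideal I B using adm unfolding admissible_def by blast

sublocale \<Lambda>: ring \<Lambda> by (rule I.quotient_is_ring)

lemma \<phi>_simps: "x:el B ==> \<phi> x:el \<Lambda>"
 "x:el B ==> y:el B ==> \<phi> x\<otimes>\<^sub>\<Lambda> \<phi> y = \<phi> (pm x y)"
 "x:el B ==> y:el B ==> \<phi> x\<oplus>\<^sub>\<Lambda> \<phi> y = \<phi> (\<lambda>p. x p + y p)"
 "\<one>\<^sub>\<Lambda> = \<phi> (unit (verts G))" "\<zero>\<^sub>\<Lambda> = \<phi> (\<lambda>_. 0)"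
proof -
 interpret h: ring_hom_ring B \<Lambda> \<phi> by (rule I.rcos_ring_hom_ring)
 show "x:el B ==> \<phi> x:el \<Lambda>" by (rule h.hom_closed)
 show "x:el B ==> y:el B ==> \<phi> x\<otimes>\<^sub>\<Lambda> \<phi> y = \<phi> (pm x y)" using h.hom_mult by simp
 show "x:el B ==> y:el B ==> \<phi> x\<oplus>\<^sub>\<Lambda> \<phi> y = \<phi> (\<lambda>p. x p + y p)" using h.hom_add by simp
 show "\<one>\<^sub>\<Lambda> = \<phi> (unit (verts G))" using h.hom_one by simp
 show "\<zero>\<^sub>\<Lambda> = \<phi> (\<lambda>_. 0)" using h.hom_zero by simp
qed

lemma minus: "x:el B ==> y:el B ==> x\<ominus>\<^sub>B y = (\<lambda>p. x p - y p)"
proof -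
 assume *: "x:el B" "y:el B"
 have "\<ominus>\<^sub>B y = (\<lambda>p. y p * - 1)"
  using * scale_closed[OF *(2), of "- 1"] by (intro B.minus_equality) (auto simp: fun_eq_iff)
 then show ?thesis by (simp add: B.minus_eq)
qed

lemma \<phi>_eq: "x:el B ==> y:el B ==> \<phi> x = \<phi> y\<longleftrightarrow>(\<lambda>p. x p - y p):I"
 using B.quotient_eq_iff_same_a_r_cos[OF I.is_ideal, of x y] minus by simp

lemma \<phi>_minus: "x:el B ==> y:el B ==> \<phi> x\<oplus>\<^sub>\<Lambda>\<ominus>\<^sub>\<Lambda> \<phi> y = \<phi> (\<lambda>p. x p - y p)"
proof -
 assume *: "x:el B" "y:el B"
 interpret h: ring_hom_ring B \<Lambda> \<phi> by (rule I.rcos_ring_hom_ring)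
 have "\<phi> x\<oplus>\<^sub>\<Lambda>\<ominus>\<^sub>\<Lambda> \<phi> y = \<phi> (x\<ominus>\<^sub>B y)" using * h.hom_add[of x "\<ominus>\<^sub>B y"] h.hom_a_inv[of y] by (simp add: B.minus_eq)
 then show ?thesis using minus[OF *] by simp
qed

lemma \<Lambda>E: "X:el \<Lambda> ==> \<exists>x\<in>el B. X = \<phi> x" unfolding FactRing_def A_RCOSETS_def' by auto

lemma \<phi>_sum: "finite K ==> (!!i. i:K ==> f i:el B) ==> finsum \<Lambda> (\<lambda>i. \<phi> (f i)) K = \<phi> (\<lambda>p. \<Sum>i\<in>K. f i p)"
proof (induction K rule: finite_induct)
 case (insert i K)
 then have "finsum \<Lambda> (\<lambda>i. \<phi> (f i)) (insert i K) = \<phi> (f i)\<oplus>\<^sub>\<Lambda> \<phi> (\<lambda>p. \<Sum>i\<in>K. f i p)"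
  using \<phi>_simps(1) by (subst \<Lambda>.finsum_insert) auto
 then show ?case using insert A_sum[of K f] by (simp add: \<phi>_simps(3))
qed (simp add: \<phi>_simps(5))

abbreviation J where "J\<equiv>arrow_ideal G :: (('a, 'b) qpath=>'k) set"

lemma J: "ideal J B" "e:arcs G ==> arr e:J"
proof -
 have "(\<lambda>e. arr e) ` arcs G<=el B" using arr_closed by auto
 then show "ideal J B" "e:arcs G ==> arr e:J" unfolding arrow_ideal_def using B.genideal_ideal B.genideal_self by blast+
qed

text \<open>Admissibility puts \<open>I\<close> inside the arrow ideal, and the elements without
  trivial paths form an ideal \<open>?K\<close> that contains the arrows.\<close>

lemma I_Nil: "x:I ==> x (v, []) = 0"
proof -
 assume x: "x:I"
 \<comment> \<open>The unit of the monoid of ideals is the whole ring, which is why it appears as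
   innermost factor of the square.\<close>
 have "J [^]\<^bsub>ideals_set B\<^esub> (2::nat) = ideal_prod B (ideal_prod B (el B) J) J"
  by (simp add: numeral_2_eq_2 nat_pow_def ideals_set_def)
 then have "I<=ideal_prod B (ideal_prod B (el B) J) J" using adm unfolding admissible_def by simp
 then have xJ: "x:J" using x B.ideal_prod_inter[OF B.ideal_prod_is_ideal[OF B.oneideal J(1)] J(1)] by blast
 let ?K = "{x\<in>el B. \<forall>v. x (v, []) = 0}"
 have "ideal ?K B"
 proof (rule idealI[OF B.ring_axioms])
  show "subgroup ?K (add_monoid B)"
  proof (rule group.subgroupI[OF B.add.is_group])
   show "inv\<^bsub>add_monoid B\<^esub> y:?K" if "y:?K" for y
    using that minus[of "\<lambda>_. 0" y] B.zero_closed B.a_inv_closed[of y] B.l_zero[of "\<ominus>\<^sub>B y"] by (simp add: a_inv_def B.minus_eq)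
  qed (use B.zero_closed B.a_closed in auto)
 qed (auto simp: pm_closed)
 then have "J<=?K" unfolding arrow_ideal_def by (rule B.genideal_minimal) (use arr_closed in \<open>auto simp: single_path_def\<close>)
 then show ?thesis using xJ by blast
qed

text \<open>The elements \<open>x\<close> of \<open>I\<close> such that \<open>strip e x\<close> is in \<open>I\<close> for all arrows \<open>e\<close> starting in \<open>V0\<close> form an
 ideal, and it contains all relations because these do not involve paths starting in \<open>V0\<close>.\<close>

lemma strip_I: "x:I ==> tail G e:V0 ==> strip e x:I"
proof -
 assume x: "x:I" and e: "tail G e:V0"
 let ?K = "{x\<in>I. strip e x:I}"
 \<comment> \<open>Ideals here are ring ideals; closure under scalars comes from right
   multiplication by scalar multiples of the unit.\<close>
 have sc: "(\<lambda>p. z p * c):I" if "z:I" for z c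
 proof -
  have "pm z (\<lambda>p. unit (verts G) p * c):I" using I.I_r_closed[OF that scale_closed[OF unit_closed]] by blast
  moreover have "pm z (\<lambda>p. unit (verts G) p * c) = (\<lambda>p. z p * c)"
   using B.r_one[OF I.Icarr[OF that]] by (simp add: fun_eq_iff pm_scale)
  ultimately show ?thesis by simp
 qed
 have "ideal ?K B"
 proof (rule idealI[OF B.ring_axioms])
  show "subgroup ?K (add_monoid B)"
  proof (rule group.subgroupI[OF B.add.is_group])
   fix y z assume yz: "y:?K" "z:?K"
   have "strip e (\<lambda>p. y p + z p) = (\<lambda>p. strip e y p + strip e z p)" by (auto simp: fun_eq_iff)
   then show "y\<otimes>\<^bsub>add_monoid B\<^esub> z:?K" using yz I.a_closed[of y z] I.a_closed[of "strip e y" "strip e z"] by simp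
  next
   fix y assume y: "y:?K"
   then have m: "inv\<^bsub>add_monoid B\<^esub> y = (\<lambda>p. y p * - 1)" unfolding a_inv_def[symmetric] using minus[of "\<lambda>_. 0" y] B.zero_closed B.a_inv_closed[of y] B.l_zero[of "\<ominus>\<^sub>B y"] I.Icarr[of y] by (simp add: B.minus_eq)
   have st: "strip e (\<lambda>p. y p * - 1) = (\<lambda>p. strip e y p * - 1)" by (auto simp: fun_eq_iff)
   show "inv\<^bsub>add_monoid B\<^esub> y:?K" unfolding m mem_Collect_eq st using y sc[of y "- 1"] sc[of "strip e y" "- 1"] by blast
  next
   have st: "strip e (\<lambda>_. 0) = (\<lambda>_. 0)" by auto
   have "(\<lambda>_. 0):?K" unfolding mem_Collect_eq st using I.zero_closed by simp
   then show "?K~={}" by blast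
  qed (use I.Icarr in auto)
 next
  fix y z assume y: "y:?K" and z: "z:el B"
  have "strip e (pm z y) = pm z (strip e y)" using I_Nil[of y] y by (auto simp: fun_eq_iff strip_pm)
  then show "z\<otimes>\<^sub>B y:?K" using y z I.I_l_closed by simp
  have "strip e (pm y z) = (\<lambda>p. pm y (strip e z) p + strip e y p * z (tail G e, []))" using strip_pm by (auto simp only: fun_eq_iff)
  moreover have "pm y (strip e z):I" using y z I.I_r_closed strip_closed by blast
  ultimately show "y\<otimes>\<^sub>B z:?K" using y z I.I_r_closed[of y z] I.a_closed[of "pm y (strip e z)", OF _ sc[of "strip e y" "z (tail G e, [])"]] by simp
 qed
 moreover have "\<rho><=?K"
 proof
  fix r assume r: "r:\<rho>"
  have sub: "\<rho><=el B" using min unfolding minimal_relations_def is_relation_def relation_from_to_def by blast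
  obtain u v where uv: "relation_from_to G u v r" using r min unfolding minimal_relations_def is_relation_def by blast
  then have "u~=tail G e" using norel[OF e r] unfolding starts_at_def by blast
  then have "r (tail G e, es) = 0" for es using uv unfolding relation_from_to_def by force
  then have st: "strip e r = (\<lambda>_. 0)" by (auto simp: fun_eq_iff)
  show "r:?K" unfolding mem_Collect_eq st using B.genideal_self[OF sub] r I.zero_closed by auto
 qed
 ultimately have "I<=?K" by (rule B.genideal_minimal)
 then show ?thesis using x by blast
qed

definition rep where "rep X = (SOME x. x:el B&X = \<phi> x)"

lemma rep: "x:el B ==> rep (\<phi> x):el B&\<phi> (rep (\<phi> x)) = \<phi> x" unfolding rep_def by (rule someI2[of _ x]) auto

text \<open>Evaluated on an arbitrary representative of the coset; for arrows starting in
  \<open>V0\<close> the choice does not matter by \<open>strip_I\<close>.\<close>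

definition Dr where "Dr e X = \<phi> (strip e (rep X))"

lemma Dr: "x:el B ==> tail G e:V0 ==> Dr e (\<phi> x) = \<phi> (strip e x)"
proof -
 assume x: "x:el B" and e: "tail G e:V0"
 have "(\<lambda>p. rep (\<phi> x) p - x p):I" using rep[OF x] \<phi>_eq x by blast
 from strip_I[OF this e] have "(\<lambda>p. strip e (rep (\<phi> x)) p - strip e x p):I"
  by (rule back_subst[of "\<lambda>y. y:I"]) (auto simp: fun_eq_iff)
 then show ?thesis unfolding Dr_def using \<phi>_eq strip_closed rep[OF x] x by blast
qed

definition Lv where "Lv v = \<phi> ` {x\<in>el B. x (v, []) = 0}"

lemma Lv: "x:el B ==> \<phi> x:Lv v\<longleftrightarrow>x (v, []) = 0"
proof
 assume x: "x:el B" and "\<phi> x:Lv v"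
 then obtain y where y: "y:el B" "y (v, []) = 0" "\<phi> x = \<phi> y" unfolding Lv_def by auto
 then show "x (v, []) = 0" using I_Nil[of "\<lambda>p. x p - y p" v] \<phi>_eq[OF x y(1)] by simp
qed (auto simp: Lv_def)

text \<open>A nontrivial path from \<open>v\<close> starts with exactly one arrow, so at most one
  summand contributes to each coefficient, and the trivial path at \<open>v\<close> is excluded by
  assumption.\<close>

lemma strip_sum:
 assumes "x:el B" "x (v, []) = 0"
 shows "pm x (unit {v}) p = (\<Sum>e\<in>{e\<in>arcs G. tail G e = v}. pm (strip e x) (arr e) p)"
proof (cases p)
 case (Pair u es)
 show ?thesis
 proof (cases es)
  case Nil
  then show ?thesis using Pair assms(2) by (simp add: pm_vertex single_path_def)
 next
  case (Cons f fs)
  have "(\<Sum>e\<in>{e\<in>arcs G. tail G e = v}. pm (strip e x) (arr e) p) =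
    (\<Sum>e\<in>{e\<in>arcs G. tail G e = v}. if e = f then if u = v then x (u, f # fs) else 0 else 0)"
   unfolding Pair Cons by (rule sum.cong) (auto simp: pm_arr simp del: pm_Cons)
  also have "\<dots> = (if f:arcs G&tail G f = v&u = v then x (u, f # fs) else 0)" by (simp add: sum.delta)
  also have "\<dots> = (if u = v then x (u, f # fs) else 0)"
  proof -
   have "x (u, f # fs) = 0" if "\<not> (f:arcs G&tail G f = u)" using assms(1) that paths_simps(2)[of u f fs] unfolding A_carrier by blast
   then show ?thesis by auto
  qed
  finally show ?thesis unfolding Pair Cons by (simp add: pm_vertex del: pm_Cons)
 qed
qed

lemma \<phi>_strip_sum:
 assumes "x:el B" "x (v, []) = 0" "v:verts G"
 shows "\<phi> x\<otimes>\<^sub>\<Lambda> \<phi> (unit {v}) = finsum \<Lambda> (\<lambda>e. \<phi> (strip e x)\<otimes>\<^sub>\<Lambda> \<phi> (arr e)) {e\<in>arcs G. tail G e = v}"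
proof -
 let ?E = "{e\<in>arcs G. tail G e = v}"
 have "pm x (unit {v}) = (\<lambda>p. \<Sum>e\<in>?E. pm (strip e x) (arr e) p)" by (rule ext) (rule strip_sum[OF assms(1,2)])
 then have "\<phi> x\<otimes>\<^sub>\<Lambda> \<phi> (unit {v}) = \<phi> (\<lambda>p. \<Sum>e\<in>?E. pm (strip e x) (arr e) p)"
  using \<phi>_simps(2)[OF assms(1) unit_closed, of "{v}"] assms(3) by simp
 also have "\<dots> = finsum \<Lambda> (\<lambda>e. \<phi> (pm (strip e x) (arr e))) ?E"
  using assms(1) by (intro \<phi>_sum[symmetric]) (auto intro: pm_closed strip_closed arr_closed)
 also have "\<dots> = finsum \<Lambda> (\<lambda>e. \<phi> (strip e x)\<otimes>\<^sub>\<Lambda> \<phi> (arr e)) ?E"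
  using assms(1) by (intro \<Lambda>.finsum_cong') (auto simp: \<phi>_simps strip_closed arr_closed pm_closed)
 finally show ?thesis .
qed

abbreviation aa where "aa\<equiv>\<phi> (unit (verts G - V0))"

lemma unit_sum: "W<=verts G ==> finsum \<Lambda> (\<lambda>v. \<phi> (unit {v})) W = \<phi> (unit W)"
proof -
 assume W: "W<=verts G"
 then have f: "finite W" by (rule finite_subset) simp
 have "(\<Sum>v\<in>W. unit {v} (u, es)) = (unit W (u, es) :: 'k)" for u and es :: "'b list"
  using f by (cases es) (simp_all add: sum.delta')
 then have *: "(\<lambda>p. \<Sum>v\<in>W. unit {v} p) = (unit W :: ('a, 'b) qpath=>'k)" by (auto simp only: fun_eq_iff split_paired_all)
 have "finsum \<Lambda> (\<lambda>v. \<phi> (unit {v})) W = \<phi> (\<lambda>p. \<Sum>v\<in>W. unit {v} p)"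
  by (rule \<phi>_sum[OF f], rule unit_closed) (use W in blast)
 then show ?thesis unfolding * .
qed

lemma unit_unit: "W<=verts G ==> W'<=verts G ==> \<phi> (unit W)\<otimes>\<^sub>\<Lambda> \<phi> (unit W') = \<phi> (unit (W\<inter>W'))"
proof -
 assume "W<=verts G" "W'<=verts G"
 moreover have "pm (unit W) (unit W') = (unit (W\<inter>W') :: ('a, 'b) qpath=>'k)" by (auto simp: fun_eq_iff pm_unit_left)
 ultimately show ?thesis by (simp add: \<phi>_simps unit_closed)
qed

text \<open>Serves to translate nilpotency: with length m, where the m-th power of the arrow ideal
  lies in \<open>I\<close>, the representative lies in \<open>I\<close> and the word is zero in the
  quotient.\<close>

lemma word_power: "set es<=arcs G ==>
 \<exists>x\<in>J [^]\<^bsub>ideals_set B\<^esub> (length es). x:el B&foldr (\<lambda>e y. y\<otimes>\<^sub>\<Lambda> \<phi> (arr e)) es \<one>\<^sub>\<Lambda> = \<phi> x"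
proof (induction es)
 case Nil
 then show ?case using unit_closed[of "verts G"] by (intro bexI[of _ "unit (verts G)"]) (simp_all add: \<phi>_simps nat_pow_def ideals_set_def)
next
 case (Cons e es)
 then obtain x where x: "x:J [^]\<^bsub>ideals_set B\<^esub> (length es)" "x:el B"
  "foldr (\<lambda>e y. y\<otimes>\<^sub>\<Lambda> \<phi> (arr e)) es \<one>\<^sub>\<Lambda> = \<phi> x" by auto
 have "pm x (arr e):J [^]\<^bsub>ideals_set B\<^esub> (length (e # es))"
  using ideal_prod.prod[OF x(1) J(2), of e B] Cons.prems by (simp add: nat_pow_def ideals_set_def)
 then show ?case using x Cons.prems by (intro bexI[of _ "pm x (arr e)"]) (auto simp: \<phi>_simps arr_closed pm_closed)
qed

lemma quiver_corner:
 obtains m where "quiver_corner \<Lambda> aa (verts G) V0 (arcs G) (tail G) (head G) (\<lambda>v. \<phi> (unit {v})) (\<lambda>e. \<phi> (arr e)) Lv Dr m"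
proof -
 obtain m where m: "J [^]\<^bsub>ideals_set B\<^esub> (m::nat)<=I" using adm unfolding admissible_def by blast
 have u: "unit {v}:el B" if "v:verts G" for v using that by (intro unit_closed) simp
 have u': "(\<lambda>(w, fs). if fs = []&w = v then 1 else 0):el B" if "v:verts G" for v using u[OF that] by simp
 have au: "unit (verts G - V0):el B" by (rule unit_closed) auto
 have LvE: "\<exists>x\<in>el B. X = \<phi> x&x (v, []) = 0" if "X:Lv v" for X v using that unfolding Lv_def by auto
 have "quiver_corner \<Lambda> aa (verts G) V0 (arcs G) (tail G) (head G) (\<lambda>v. \<phi> (unit {v})) (\<lambda>e. \<phi> (arr e)) Lv Dr m"
 proof (unfold_locales, goal_cases)
  case 1 show ?case by (rule \<phi>_simps(1)[OF au])
 next
  case 2 show ?case by (subst unit_unit) auto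
 next
  case 3 show ?case by simp
 next
  case 4 show ?case by simp
 next
  case 5 show ?case by (rule V0)
 next
  case 6 then show ?case by simp
 next
  case 7 then show ?case by simp
 next
  case 8 then show ?case using \<phi>_simps(1) u by blast
 next
  case 9 show ?case using unit_sum \<phi>_simps(4) by simp
 next
  case (10 v) then show ?case by (subst unit_unit) (auto simp: Int_absorb1)
 next
  case (11 v) then show ?case by (subst unit_unit) (auto simp: Int_absorb2)
 next
  case (12 v) then show ?case by (subst unit_unit) auto
 next
  case 13 then show ?case using \<phi>_simps(1) arr_closed by blast
 next
  case (14 e)
  then have "pm (arr e) (unit {tail G e}) = (arr e :: ('a, 'b) qpath=>'k)" by (auto simp: fun_eq_iff pm_vertex single_path_def simp del: pm_Cons)
  then show ?case using 14 by (simp add: \<phi>_simps u' arr_closed)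
 next
  case (15 es)
  then obtain x where x: "x:I" "x:el B" "foldr (\<lambda>e y. y\<otimes>\<^sub>\<Lambda> \<phi> (arr e)) es \<one>\<^sub>\<Lambda> = \<phi> x" using word_power[of es] m by blast
  then show ?case using \<phi>_eq[OF x(2) B.zero_closed] x(1) by (simp add: \<phi>_simps)
 next
  case (16 v)
  show ?case
  proof (rule submodI)
   show "Lv v<=el (reg \<Lambda>)" unfolding Lv_def using \<phi>_simps(1) by auto
   show "\<zero>\<^bsub>reg \<Lambda>\<^esub>:Lv v" using Lv[OF B.zero_closed] by (simp add: \<phi>_simps)
   show "X\<oplus>\<^bsub>reg \<Lambda>\<^esub> Y:Lv v" if XY: "X:Lv v" "Y:Lv v" for X Y
   proof -
    obtain x y where *: "x:el B" "X = \<phi> x" "x (v, []) = 0" "y:el B" "Y = \<phi> y" "y (v, []) = 0" using LvE[OF XY(1)] LvE[OF XY(2)] by blast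
    then show ?thesis using Lv[OF B.a_closed[OF *(1,4)], of v] by (simp add: \<phi>_simps)
   qed
   show "X\<odot>\<^bsub>reg \<Lambda>\<^esub> Y:Lv v" if XY: "X:el \<Lambda>" "Y:Lv v" for X Y
   proof -
    obtain x y where *: "x:el B" "X = \<phi> x" "y:el B" "Y = \<phi> y" "y (v, []) = 0" using \<Lambda>E[OF XY(1)] LvE[OF XY(2)] by blast
    then show ?thesis using Lv[OF pm_closed[OF *(1,3)], of v] by (simp add: \<phi>_simps)
   qed
  qed
 next
  case (17 v X)
  then obtain x where x: "x:el B" "X = \<phi> x" using \<Lambda>E by blast
  then have c: "x (v, [])~=0" using 17 Lv by blast
  \<comment> \<open>The inverse of the coefficient at the trivial path times the unit. Then 1 - y x
    has coefficient zero at the trivial path of \<open>v\<close>.\<close>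
  let ?y = "\<lambda>p. unit (verts G) p * inverse (x (v, []))"
  have y: "?y:el B" by (rule scale_closed[OF unit_closed]) simp
  have d: "(\<lambda>p. unit (verts G) p - pm ?y x p):el B"
   using B.minus_closed[OF B.one_closed pm_closed[OF y x(1)]] minus[OF B.one_closed pm_closed[OF y x(1)]] by simp
  have "\<one>\<^sub>\<Lambda>\<oplus>\<^sub>\<Lambda>\<ominus>\<^sub>\<Lambda> (\<phi> ?y\<otimes>\<^sub>\<Lambda> X) = \<phi> (\<lambda>p. unit (verts G) p - pm ?y x p)"
   using \<phi>_minus[OF B.one_closed pm_closed[OF y x(1)]] \<phi>_simps(2)[OF y x(1)] x(2) \<phi>_simps(4) by simp
  also have "\<dots>:Lv v" using Lv[OF d] 17(1) c by simp
  finally show ?case using \<phi>_simps(1)[OF y] by blast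
 next
  case (18 v X)
  then obtain x where x: "x:el B" "X = \<phi> x" "x (v, []) = 0" using LvE by blast
  then show ?case using \<phi>_strip_sum[OF x(1,3) 18(1)] \<phi>_simps(1) strip_closed by (intro exI[of _ "\<lambda>e. \<phi> (strip e x)"]) auto
 next
  case (19 v)
  then show ?case using Lv[OF u] V0 by auto
 next
  case (20 v)
  then have v: "v:verts G" using V0 by blast
  have d: "(\<lambda>p. unit (verts G) p - unit {v} p):el B"
   using B.minus_closed[OF B.one_closed u[OF v]] minus[OF B.one_closed u[OF v]] by simp
  show ?case using \<phi>_minus[OF B.one_closed u[OF v]] \<phi>_simps(4) Lv[OF d] v by simp
 next
  case (21 v X)
  then obtain x where x: "x:el B" "X = \<phi> x" using \<Lambda>E by blast
  then show ?case using \<phi>_simps(2)[OF au x(1)] Lv[OF pm_closed[OF au x(1)]] 21(1) by simp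
 next
  case (22 e v)
  then show ?case using Lv[OF arr_closed] by (simp add: single_path_def)
 next
  case (23 e)
  have s: "strip e (\<lambda>p. x p + y p) = (\<lambda>p. strip e x p + strip e y p)" for x y :: "('a, 'b) qpath=>'k" by (auto simp: fun_eq_iff)
  \<comment> \<open>On elements without the trivial path at the tail the correction term of
    \<open>strip_pm\<close> vanishes, which makes the form linear.\<close>
  have t: "strip e (pm y x) = pm y (strip e x)" if "x (tail G e, []) = 0" for x y :: "('a, 'b) qpath=>'k"
   by (rule ext) (use strip_pm[of e y x] that in simp)
  show ?case unfolding linear_form_def
  proof (intro conjI ballI; simp)
   fix X assume "X:Lv (tail G e)"
   then obtain x where x: "x:el B" "X = \<phi> x" "x (tail G e, []) = 0" using LvE by blast
   show "Dr e X:el \<Lambda>" using Dr[OF x(1) 23(2)] x(2) \<phi>_simps(1)[OF strip_closed[OF x(1)]] by simp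
   { fix Y assume "Y:Lv (tail G e)"
    then obtain y where y: "y:el B" "Y = \<phi> y" using LvE by blast
    show "Dr e (X\<oplus>\<^sub>\<Lambda> Y) = Dr e X\<oplus>\<^sub>\<Lambda> Dr e Y"
     using x y B.a_closed[OF x(1) y(1)] 23(2) by (simp add: \<phi>_simps Dr s strip_closed) }
   fix Y assume "Y:el \<Lambda>"
   then obtain y where y: "y:el B" "Y = \<phi> y" using \<Lambda>E by blast
   show "Dr e (Y\<otimes>\<^sub>\<Lambda> X) = Y\<otimes>\<^sub>\<Lambda> Dr e X"
    using x y pm_closed[OF y(1) x(1)] 23(2) by (simp add: \<phi>_simps Dr t strip_closed)
  qed
 next
  case (24 e Y)
  then obtain y where y: "y:el B" "Y = \<phi> y" using \<Lambda>E by blast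
  have "strip e (pm y (arr e)) = pm y (unit {head G e})" by (auto simp: fun_eq_iff pm_arr pm_vertex simp del: pm_Cons)
  then show ?case using 24 y by (simp add: \<phi>_simps arr_closed u' Dr pm_closed del: pm_Cons)
 next
  case (25 e X)
  then obtain x where x: "x:el B" "X = \<phi> x" using LvE by blast
  have "pm (strip e x) (unit {head G e}) = strip e x" by (auto simp: fun_eq_iff pm_vertex simp del: pm_Cons)
  then show ?case using 25 x by (simp add: \<phi>_simps u' Dr strip_closed)
 next
  case (26 v X)
  then obtain x where x: "x:el B" "X = \<phi> x" "x (v, []) = 0" using LvE by blast
  have v: "v:verts G" using 26(1) V0 by blast
  have "finsum \<Lambda> (\<lambda>e. Dr e X\<otimes>\<^sub>\<Lambda> \<phi> (arr e)) {e\<in>arcs G. tail G e = v} =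
    finsum \<Lambda> (\<lambda>e. \<phi> (strip e x)\<otimes>\<^sub>\<Lambda> \<phi> (arr e)) {e\<in>arcs G. tail G e = v}"
   using x 26(1) by (intro \<Lambda>.finsum_cong') (auto simp: Dr \<phi>_simps strip_closed arr_closed pm_closed)
  then show ?case using \<phi>_strip_sum[OF x(1,3) v] x(2) by simp
 qed
 then show ?thesis by (rule that)
qed

lemma vertex_sum: "vertex_sum G \<rho> (verts G - V0) = aa"
proof -
 have "single_path (v, []) = (unit {v} :: ('a, 'b) qpath=>'k)" for v by (auto simp: fun_eq_iff single_path_def)
 then show ?thesis unfolding vertex_sum_def bound_quiver_algebra_def using unit_sum[of "verts G - V0"] by simp
qed

end

theorem corollary8p16:
  fixes Q :: "('v, 'e) pre_digraph"
    and \<rho> :: "(('v, 'e) qpath \<Rightarrow> 'k::field) set"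
    and V\<^sub>0 :: "'v set"
  assumes "fin_digraph Q"
    and "minimal_relations Q \<rho>"
    and "admissible Q (genideal (path_algebra Q) \<rho>)"
    and "V\<^sub>0 \<subseteq> verts Q"
    and "\<forall>v\<in>V\<^sub>0. \<forall>r\<in>\<rho>. \<not> starts_at Q r v"
  defines "\<Lambda> \<equiv> bound_quiver_algebra Q \<rho>"
    and "a \<equiv> vertex_sum Q \<rho> (verts Q - V\<^sub>0)"
  shows "induces_singular_equivalence \<Lambda> (corner_ring \<Lambda> a) (corner_functor a)"
proof -
 interpret bound_quiver Q \<rho> V\<^sub>0 using assms(1-5) by (simp add: bound_quiver_def bound_quiver_axioms_def)
 obtain m where "quiver_corner (path_algebra Q Quot genideal (path_algebra Q) \<rho>) aa (verts Q) V\<^sub>0 (arcs Q) (tail Q) (head Q)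
   (\<lambda>v. genideal (path_algebra Q) \<rho> +>\<^bsub>path_algebra Q\<^esub> unit {v}) (\<lambda>e. genideal (path_algebra Q) \<rho> +>\<^bsub>path_algebra Q\<^esub> arr e) Lv Dr m"
  by (rule quiver_corner)
 from quiver_corner.quiver_corner_equivalence[OF this] show ?thesis unfolding \<Lambda>_def a_def vertex_sum bound_quiver_algebra_def .
qed

end
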